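(* Let $k$ be a field and $\overline{k}$ an algebraic closure of $k$, and let $m,n\ge 0$ be integers. (1) Let $G=GL_{m+n}$, let $K=GL_m\times GL_n\subset G$ (block diagonal), let $B\subset G$ be a Borel subgroup (defined over $k$), and let $X=G/K$. Then there is a bijection between the set of $B(k)$-orbits in $X(k)$ and the set of $m$-matchings in the corona graph $C_{m+n}$. (2) Assume $\operatorname{char}(k)\neq 2$. Let $G=Sp_{2m+2n}$, $K=Sp_{2m}\times Sp_{2n}\subset G$, $B\subset G$ a Borel subgroup, and $X=G/K$. Then there is a bijection between the set of $B(\overline{k})$-orbits in $X(\overline{k})$ and the set of $m$-matchings in the double corona graph $C^{(2)}_{m+n}$.
   Context: For $N\ge 1$, the corona graph $C_N$ has vertices $v_1,\dots,v_N,w_1,\dots,w_N$, with one edge between $v_i$ and $v_j$ for every $i\neq j$ and one edge between $v_i$ and $w_i$ for every $i$ (no other edges). The double corona graph $C^{(2)}_N$ has the same vertices, with exactly two (distinct, parallel) edges between $v_i$ and $v_j$ for each $i\ne j$, and one edge between $v_i$ and $w_i$ for each $i$. An $m$-matching of a (multi)graph is a set of $m$ edges, no two of which share a vertex (parallel edges count as different edges). *)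

theory Defs
  imports
    "HOL-Algebra.Left_Coset"
    "HOL-Algebra.Group_Action"
    "HOL-Algebra.Solvable_Groups"
    "HOL-Analysis.Abstract_Topology"
    "Jordan_Normal_Form.Determinant"
begin

text \<open>
  Algebraic groups over a field \<open>k\<close> (the type \<open>'a\<close>) are treated in the classical language of
  varieties: an algebraic closure \<open>\<iota>\<close> from \<open>k\<close> to \<open>'b\<close> is fixed, a group is given by
  its points over \<open>'b\<close>, and \<open>k\<close>-structures are described by functions defined over the subfield
  \<open>range \<iota>\<close>.
\<close>

definition alg_closure_of :: "('a::field \<Rightarrow> 'b::alg_closed_field) \<Rightarrow> bool" where
  "alg_closure_of \<iota> \<longleftrightarrow>
     field_hom \<iota> \<and> (\<forall>x. \<exists>p. p \<noteq> 0 \<and> poly (map_poly \<iota> p) x = 0)"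

section \<open>Matrix groups\<close>

definition GL :: "nat \<Rightarrow> 'a::field mat monoid" where
  "GL N = \<lparr>carrier = {A \<in> carrier_mat N N. det A \<noteq> 0}, monoid.mult = (*), one = 1\<^sub>m N\<rparr>"

text \<open>
  The alternating form is the orthogonal sum of \<open>N\<close> hyperbolic planes, spanned by the basis vectors
  number \<open>2i\<close> and \<open>2i+1\<close>. With this choice \<open>Sp\<^sub>2\<^sub>m \<times> Sp\<^sub>2\<^sub>n\<close> is embedded in
  \<open>Sp\<^sub>2\<^sub>m\<^sub>+\<^sub>2\<^sub>n\<close> by block diagonal matrices.
\<close>

definition symp_form :: "nat \<Rightarrow> 'a::field mat" where
  "symp_form N = mat (2 * N) (2 * N) (\<lambda>(i, j).
     if even i \<and> j = Suc i then 1 else if even j \<and> i = Suc j then -1 else 0)"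

text \<open>The argument \<open>N\<close> is half the size of the matrices.\<close>

definition Sp :: "nat \<Rightarrow> 'a::field mat monoid" where
  "Sp N = (GL (2 * N))
     \<lparr>carrier := {A \<in> carrier (GL (2 * N)). transpose_mat A * symp_form N * A = symp_form N}\<rparr>"

definition block_diag :: "'a::field mat \<Rightarrow> 'a mat \<Rightarrow> 'a mat" where
  "block_diag A B =
     four_block_mat A (0\<^sub>m (dim_row A) (dim_col B)) (0\<^sub>m (dim_row B) (dim_col A)) B"

definition GL_GL :: "nat \<Rightarrow> nat \<Rightarrow> 'a::field mat set" where
  "GL_GL m n = {block_diag A B | A B. A \<in> carrier (GL m) \<and> B \<in> carrier (GL n)}"

definition Sp_Sp :: "nat \<Rightarrow> nat \<Rightarrow> 'a::field mat set" where
  "Sp_Sp m n = {block_diag A B | A B. A \<in> carrier (Sp m) \<and> B \<in> carrier (Sp n)}"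

section \<open>Regular functions and the Zariski topology\<close>

text \<open>
  \<open>regular_funs R N\<close> is \<open>R[x\<^sub>i\<^sub>j, 1/det]\<close> for a subring \<open>R\<close>, as functions on \<open>GL\<^sub>N\<close>; only the values on
  \<open>carrier (GL N)\<close> are meaningful.
\<close>

inductive_set regular_funs :: "'b::field set \<Rightarrow> nat \<Rightarrow> ('b mat \<Rightarrow> 'b) set"
  for R :: "'b set" and N :: nat where
  const: "c \<in> R \<Longrightarrow> (\<lambda>_. c) \<in> regular_funs R N"
| entry: "i < N \<Longrightarrow> j < N \<Longrightarrow> (\<lambda>A. A $$ (i, j)) \<in> regular_funs R N"
| inv_det: "(\<lambda>A. inverse (det A)) \<in> regular_funs R N"
| add: "f \<in> regular_funs R N \<Longrightarrow> g \<in> regular_funs R N \<Longrightarrow> (\<lambda>A. f A + g A) \<in> regular_funs R N"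
| mult: "f \<in> regular_funs R N \<Longrightarrow> g \<in> regular_funs R N \<Longrightarrow> (\<lambda>A. f A * g A) \<in> regular_funs R N"

definition zariski :: "nat \<Rightarrow> 'b::field mat topology" where
  "zariski N = topology_generated_by
     {{A \<in> carrier (GL N). f A \<noteq> 0} | f. f \<in> regular_funs UNIV N}"

section \<open>Borel subgroups\<close>

text \<open>Here \<open>G\<close> stands for a closed subgroup of \<open>GL\<^sub>N\<close> over an algebraically closed field.\<close>

definition closed_connected_solvable ::
    "nat \<Rightarrow> 'b::alg_closed_field mat monoid \<Rightarrow> 'b mat set \<Rightarrow> bool" where
  "closed_connected_solvable N G H \<longleftrightarrow>
     subgroup H G \<and> closedin (subtopology (zariski N) (carrier G)) H \<and>
     connectedin (zariski N) H \<and> solvable (G\<lparr>carrier := H\<rparr>)"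

definition borel_subgroup ::
    "nat \<Rightarrow> 'b::alg_closed_field mat monoid \<Rightarrow> 'b mat set \<Rightarrow> bool" where
  "borel_subgroup N G B \<longleftrightarrow> closed_connected_solvable N G B \<and>
     (\<forall>H. closed_connected_solvable N G H \<and> B \<subseteq> H \<longrightarrow> H = B)"

text \<open>
  A closed subset \<open>Z\<close> of \<open>GL\<^sub>N\<close> is defined over \<open>k\<close> if its full vanishing ideal is generated by
  functions with coefficients in \<open>k\<close>. Over an imperfect field this is stronger than \<open>Z\<close> being the
  zero set of such functions.
\<close>

definition defined_over ::
    "('a::field \<Rightarrow> 'b::alg_closed_field) \<Rightarrow> nat \<Rightarrow> 'b mat set \<Rightarrow> bool" where
  "defined_over \<iota> N Z \<longleftrightarrow>
     (\<forall>f \<in> regular_funs UNIV N. (\<forall>A\<in>Z. f A = 0) \<longrightarrow>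
       (\<exists>(r::nat) c h.
          (\<forall>i<r. c i \<in> regular_funs UNIV N \<and>
                 h i \<in> regular_funs (range \<iota>) N \<and> (\<forall>A\<in>Z. h i A = 0)) \<and>
          (\<forall>A\<in>carrier (GL N). f A = (\<Sum>i<r. c i A * h i A))))"

definition rational_subgroup ::
    "('a::field \<Rightarrow> 'b::field) \<Rightarrow> nat \<Rightarrow> 'b mat set \<Rightarrow> 'b mat set" where
  "rational_subgroup \<iota> N B = B \<inter> map_mat \<iota> ` carrier (GL N)"

section \<open>Points of homogeneous spaces\<close>

text \<open>
  Over the algebraically closed field the points of \<open>G/K\<close> are the left cosets of \<open>K\<close>. For reductive
  \<open>K\<close>, the variety \<open>GL\<^sub>N/K\<close> is affine with coordinate ring \<open>k[GL\<^sub>N]\<^sup>K\<close>, the functions invariant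
  under right translation by \<open>K\<close>. A \<open>k\<close>-point is a point at which all these functions take values in
  \<open>k\<close>; the definition does not ask that it be the coset of an element of \<open>GL\<^sub>N(k)\<close>.
\<close>

definition GL_quotient_points ::
    "('a::field \<Rightarrow> 'b::alg_closed_field) \<Rightarrow> nat \<Rightarrow> 'b mat set \<Rightarrow> 'b mat set set" where
  "GL_quotient_points \<iota> N K =
     {x \<in> lcosets\<^bsub>GL N\<^esub> K.
        \<forall>f \<in> regular_funs (range \<iota>) N.
          (\<forall>g\<in>carrier (GL N). \<forall>h\<in>K. f (g * h) = f g) \<longrightarrow> (\<forall>g\<in>x. f g \<in> range \<iota>)}"

definition coset_orbits :: "'b mat monoid \<Rightarrow> 'b mat set \<Rightarrow> 'b mat set set \<Rightarrow> 'b mat set set set"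
  where "coset_orbits G B X = orbits (G\<lparr>carrier := B\<rparr>) X (\<lambda>b x. b <#\<^bsub>G\<^esub> x)"

section \<open>Multigraphs, matchings and corona graphs\<close>

text \<open>A loopless multigraph: a set of edges, each with a set of two end points.\<close>

record ('v, 'e) multigraph =
  verts :: "'v set"
  edges :: "'e set"
  ends :: "'e \<Rightarrow> 'v set"

definition matchings :: "('v, 'e) multigraph \<Rightarrow> nat \<Rightarrow> 'e set set" where
  "matchings \<Gamma> m = {M. M \<subseteq> edges \<Gamma> \<and> finite M \<and> card M = m \<and>
     (\<forall>e\<in>M. \<forall>e'\<in>M. e \<noteq> e' \<longrightarrow> ends \<Gamma> e \<inter> ends \<Gamma> e' = {})}"

datatype corona_vertex = V nat | W nat

text \<open>\<open>Core i j c\<close> is the copy number \<open>c\<close> of the edge between \<open>V i\<close> and \<open>V j\<close>.\<close>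

datatype corona_edge = Core nat nat nat | Pendant nat

fun corona_ends :: "corona_edge \<Rightarrow> corona_vertex set" where
  "corona_ends (Core i j c) = {V i, V j}"
| "corona_ends (Pendant i) = {V i, W i}"

definition multi_corona :: "nat \<Rightarrow> nat \<Rightarrow> (corona_vertex, corona_edge) multigraph" where
  "multi_corona r N =
     \<lparr>verts = V ` {1..N} \<union> W ` {1..N},
      edges = {Core i j c | i j c. 1 \<le> i \<and> i < j \<and> j \<le> N \<and> c < r} \<union> Pendant ` {1..N},
      ends = corona_ends\<rparr>"

definition corona_graph :: "nat \<Rightarrow> (corona_vertex, corona_edge) multigraph" where
  "corona_graph N = multi_corona 1 N"

definition double_corona_graph :: "nat \<Rightarrow> (corona_vertex, corona_edge) multigraph" where
  "double_corona_graph N = multi_corona 2 N"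

end

(* Cosets of K correspond to idempotents P = h E h^-1, where E is the projection to the first block; in
   the symplectic case P is moreover self-adjoint for the alternating form. By the theorem of Lie and
   Kolchin a Borel subgroup is the stabiliser of a full flag (isotropic in the symplectic case), so
   orbits are classes of idempotents up to conjugation by triangular matrices. Tracking the leading
   indices of vectors, of their images under P and of the vectors fixed or killed by P, one finds a basis
   adapted to the flag in which P permutes basis vectors up to correction terms; the combinatorial
   datum obtained (pairs of indices and signs of the remaining ones) is an invariant of the orbit, and
   is the same thing as an m-matching: pairs are core edges, indices with sign + are pendant edges.
   Over k, a Borel subgroup defined over k stabilises a flag of k-rational subspaces: for the trace form,
   the orthogonal complement of the triangular matrices consists of the strictly triangular
   ones, and the ideal being generated over k makes this complement stable under taking coordinates with
   respect to a k-basis of the algebraic closure. A k-point of G/K is the same as an idempotent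
   with entries in k, and so the classification over k takes place entirely over k. *)

theory Submission
  imports Defs "Jordan_Normal_Form.Char_Poly"
begin

section \<open>General linear groups\<close>

text \<open>Quotient spaces and dimensions are avoided throughout: Lie-Kolchin is proved for a
  vector of \<open>Y\<close> that is an eigenvector modulo \<open>U\<close>, and the set of leading
  indices of a subspace stands in for its dimension. The relative form allows the next flag vector
  to be chosen inside the orthogonal of the earlier ones, which is what makes the flag isotropic in
  the symplectic case. Coordinates with respect to a basis of the closure over k replace it; linear
  disjointness shows that the components of a linear form vanishing on the group vanish on it again.
  The two parallel edges come from the reflection x -> 2N - 1 - x of the 2N indices, with which the
  symplectic involution commutes. No index is paired with its own reflection, since the form
  vanishes on (P v, v). Two positions a < b below N can therefore be joined in two ways: a with b,
  or a with the reflection of b. The number of edges is the rank of P, or half of it in the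
  symplectic case.\<close>

definition minv :: "'a::field mat \<Rightarrow> 'a mat" where
  "minv A = inverse (det A) \<cdot>\<^sub>m adj_mat A"

lemma carrier_GL: "A \<in> carrier (GL N) \<longleftrightarrow> A \<in> carrier_mat N N \<and> det A \<noteq> 0"
  by (simp add: GL_def)

lemma GL_carrier_mat: "A \<in> carrier (GL N) \<Longrightarrow> A \<in> carrier_mat N N"
  by (simp add: GL_def)

lemma GL_mult [simp]: "A \<otimes>\<^bsub>GL N\<^esub> B = A * B"
  and GL_one [simp]: "\<one>\<^bsub>GL N\<^esub> = 1\<^sub>m N"
  by (simp_all add: GL_def)

lemma minv_carrier_mat: "A \<in> carrier_mat N N \<Longrightarrow> minv A \<in> carrier_mat N N"
  by (simp add: minv_def adj_mat)

lemma minv_right: "A \<in> carrier (GL N) \<Longrightarrow> A * minv A = 1\<^sub>m N"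
  and minv_left: "A \<in> carrier (GL N) \<Longrightarrow> minv A * A = 1\<^sub>m N"
proof -
  assume "A \<in> carrier (GL N)"
  then have A: "A \<in> carrier_mat N N" and d: "det A \<noteq> 0"
    by (auto simp: carrier_GL)
  show "A * minv A = 1\<^sub>m N"
    unfolding minv_def mult_smult_distrib[OF A adj_mat(1)[OF A]] adj_mat(2)[OF A]
    using d by (intro eq_matI) auto
  show "minv A * A = 1\<^sub>m N"
    unfolding minv_def mult_smult_assoc_mat[OF adj_mat(1)[OF A] A] adj_mat(3)[OF A]
    using d by (intro eq_matI) auto
qed

lemma one_GL: "1\<^sub>m N \<in> carrier (GL N)"
  by (simp add: carrier_GL)

lemma mult_GL: "A \<in> carrier (GL N) \<Longrightarrow> B \<in> carrier (GL N) \<Longrightarrow> A * B \<in> carrier (GL N)"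
  by (auto simp: carrier_GL det_mult)

lemma left_inverse_GL:
  assumes "A \<in> carrier_mat N N" "B \<in> carrier_mat N N" "A * B = 1\<^sub>m N"
  shows "A \<in> carrier (GL N)" "B \<in> carrier (GL N)"
proof -
  have "det A * det B = 1" using assms det_mult[OF assms(1,2)] by simp
  then show "A \<in> carrier (GL N)" "B \<in> carrier (GL N)"
    using assms by (auto simp: carrier_GL)
qed

lemma minv_GL: "A \<in> carrier (GL N) \<Longrightarrow> minv A \<in> carrier (GL N)"
  using left_inverse_GL(2)[OF _ _ minv_right] minv_carrier_mat GL_carrier_mat by blast

lemma minv_unique:
  assumes A: "A \<in> carrier_mat N N" and B: "B \<in> carrier_mat N N" and "A * B = 1\<^sub>m N"
  shows "minv A = B"
proof -
  have G: "A \<in> carrier (GL N)" by (rule left_inverse_GL(1)[OF assms])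
  have "minv A = minv A * (A * B)" using assms minv_carrier_mat[OF A] by simp
  also have "\<dots> = (minv A * A) * B" using A B minv_carrier_mat[OF A] by simp
  also have "\<dots> = B" using B minv_left[OF G] by simp
  finally show ?thesis .
qed

lemma minv_cancel:
  assumes "A \<in> carrier (GL N)" "X \<in> carrier_mat N k"
  shows "minv A * (A * X) = X" "A * (minv A * X) = X"
proof -
  have A: "A \<in> carrier_mat N N" "minv A \<in> carrier_mat N N"
    using assms GL_carrier_mat minv_carrier_mat by blast+
  show "minv A * (A * X) = X"
    using assoc_mult_mat[OF A(2) A(1) assms(2)] minv_left[OF assms(1)] assms(2) by simp
  show "A * (minv A * X) = X"
    using assoc_mult_mat[OF A assms(2)] minv_right[OF assms(1)] assms(2) by simp
qed

lemma minv_cancel_right: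
  assumes "A \<in> carrier (GL N)" "X \<in> carrier_mat k N"
  shows "X * minv A * A = X" "X * A * minv A = X"
proof -
  have A: "A \<in> carrier_mat N N" "minv A \<in> carrier_mat N N"
    using assms GL_carrier_mat minv_carrier_mat by blast+
  show "X * minv A * A = X"
    using assoc_mult_mat[OF assms(2) A(2,1)] minv_left[OF assms(1)] assms(2) by simp
  show "X * A * minv A = X"
    using assoc_mult_mat[OF assms(2) A(1,2)] minv_right[OF assms(1)] assms(2) by simp
qed

lemma minv_cancel_vec:
  assumes "A \<in> carrier (GL N)" "v \<in> carrier_vec N"
  shows "minv A *\<^sub>v (A *\<^sub>v v) = v" "A *\<^sub>v (minv A *\<^sub>v v) = v"
proof -
  have A: "A \<in> carrier_mat N N" "minv A \<in> carrier_mat N N"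
    using assms GL_carrier_mat minv_carrier_mat by blast+
  show "minv A *\<^sub>v (A *\<^sub>v v) = v"
    using assoc_mult_mat_vec[OF A(2) A(1) assms(2)] minv_left[OF assms(1)] assms(2) by simp
  show "A *\<^sub>v (minv A *\<^sub>v v) = v"
    using assoc_mult_mat_vec[OF A assms(2)] minv_right[OF assms(1)] assms(2) by simp
qed

lemma minv_mult:
  assumes "A \<in> carrier (GL N)" "B \<in> carrier (GL N)"
  shows "minv (A * B) = minv B * minv A"
proof (rule minv_unique)
  have A: "A \<in> carrier_mat N N" "minv A \<in> carrier_mat N N" "B \<in> carrier_mat N N" "minv B \<in> carrier_mat N N"
    using assms GL_carrier_mat minv_carrier_mat by blast+
  show "A * B \<in> carrier_mat N N" "minv B * minv A \<in> carrier_mat N N" using A by auto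
  have "A * B * (minv B * minv A) = A * (B * (minv B * minv A))"
    using A by (intro assoc_mult_mat) auto
  also have "\<dots> = A * minv A" using minv_cancel(2)[OF assms(2) A(2)] by simp
  finally show "A * B * (minv B * minv A) = 1\<^sub>m N" using minv_right[OF assms(1)] by simp
qed

lemma minv_minv: "A \<in> carrier (GL N) \<Longrightarrow> minv (minv A) = A"
  by (rule minv_unique[of _ N]) (auto simp: minv_left GL_carrier_mat minv_carrier_mat)

lemma minv_one [simp]: "minv (1\<^sub>m N) = 1\<^sub>m N"
  by (rule minv_unique[of _ N]) auto

lemma group_GL: "group (GL N)"
proof (rule groupI)
  fix x y z assume "x \<in> carrier (GL N :: 'a mat monoid)" "y \<in> carrier (GL N :: 'a mat monoid)"
    "z \<in> carrier (GL N :: 'a mat monoid)"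
  then show "x \<otimes>\<^bsub>GL N\<^esub> y \<otimes>\<^bsub>GL N\<^esub> z = x \<otimes>\<^bsub>GL N\<^esub> (y \<otimes>\<^bsub>GL N\<^esub> z)"
    by (auto dest!: GL_carrier_mat)
next
  fix x assume "x \<in> carrier (GL N :: 'a mat monoid)"
  then show "\<exists>y\<in>carrier (GL N). y \<otimes>\<^bsub>GL N\<^esub> x = \<one>\<^bsub>GL N\<^esub>"
    using minv_GL minv_left by fastforce
qed (auto simp: mult_GL one_GL dest: GL_carrier_mat)

lemma inv_GL: "A \<in> carrier (GL N) \<Longrightarrow> inv\<^bsub>GL N\<^esub> A = minv A"
  by (rule group.inv_equality[OF group_GL]) (auto simp: minv_left minv_GL)

section \<open>Functions on matrices, curves, and the topology they define\<close>

section \<open>Rings of functions\<close>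

text \<open>Four rings are treated alike: regular functions over the big field, regular functions
  over the subfield, rational functions of one parameter, and polynomial functions of the matrix
  entries over the subfield. By \<open>cong\<close>, membership depends only on the values on
  \<open>X\<close>.\<close>

locale function_ring =
  fixes X :: "'x set" and F :: "('x \<Rightarrow> 'b::field) set"
  assumes zero: "(\<lambda>_. 0) \<in> F" and one: "(\<lambda>_. 1) \<in> F" and minus_one: "(\<lambda>_. - 1) \<in> F"
    and add: "f \<in> F \<Longrightarrow> g \<in> F \<Longrightarrow> (\<lambda>x. f x + g x) \<in> F"
    and mult: "f \<in> F \<Longrightarrow> g \<in> F \<Longrightarrow> (\<lambda>x. f x * g x) \<in> F"
    and cong: "f \<in> F \<Longrightarrow> (\<And>x. x \<in> X \<Longrightarrow> g x = f x) \<Longrightarrow> g \<in> F"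
begin

lemma sum: "(\<And>s. s \<in> S \<Longrightarrow> f s \<in> F) \<Longrightarrow> (\<lambda>x. \<Sum>s\<in>S. f s x) \<in> F"
  by (induction S rule: infinite_finite_induct) (auto intro: add zero)

lemma prod: "(\<And>s. s \<in> S \<Longrightarrow> f s \<in> F) \<Longrightarrow> (\<lambda>x. \<Prod>s\<in>S. f s x) \<in> F"
  by (induction S rule: infinite_finite_induct) (auto intro: mult one)

definition mats :: "nat \<Rightarrow> nat \<Rightarrow> ('x \<Rightarrow> 'b mat) set" where
  "mats n k = {M. (\<forall>x\<in>X. M x \<in> carrier_mat n k) \<and> (\<forall>i<n. \<forall>j<k. (\<lambda>x. M x $$ (i, j)) \<in> F)}"

lemma matsI:
  "(\<And>x. x \<in> X \<Longrightarrow> M x \<in> carrier_mat n k) \<Longrightarrow>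
   (\<And>i j. i < n \<Longrightarrow> j < k \<Longrightarrow> (\<lambda>x. M x $$ (i, j)) \<in> F) \<Longrightarrow> M \<in> mats n k"
  by (simp add: mats_def)

lemma matsD:
  assumes "M \<in> mats n k"
  shows "x \<in> X \<Longrightarrow> M x \<in> carrier_mat n k" "i < n \<Longrightarrow> j < k \<Longrightarrow> (\<lambda>x. M x $$ (i, j)) \<in> F"
  using assms by (auto simp: mats_def)

lemma mats_mult:
  assumes "M \<in> mats n k" "M' \<in> mats k l"
  shows "(\<lambda>x. M x * M' x) \<in> mats n l"
proof (rule matsI)
  fix i j assume ij: "i < n" "j < l"
  have "(\<lambda>x. \<Sum>r\<in>{0..<k}. M x $$ (i, r) * M' x $$ (r, j)) \<in> F"
    using assms ij by (intro sum mult matsD) auto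
  then show "(\<lambda>x. (M x * M' x) $$ (i, j)) \<in> F"
  proof (rule cong)
    fix x assume "x \<in> X"
    then have "M x \<in> carrier_mat n k" "M' x \<in> carrier_mat k l" using assms matsD(1) by blast+
    then show "(M x * M' x) $$ (i, j) = (\<Sum>r\<in>{0..<k}. M x $$ (i, r) * M' x $$ (r, j))"
      using ij by (auto simp: scalar_prod_def)
  qed
next
  fix x assume "x \<in> X"
  then show "M x * M' x \<in> carrier_mat n l"
    using assms[THEN matsD(1)] mult_carrier_mat by blast
qed

lemma det:
  assumes "M \<in> mats n n"
  shows "(\<lambda>x. det (M x)) \<in> F"
proof -
  have "(\<lambda>x. \<Sum>p\<in>{p. p permutes {0..<n}}. of_int (sign p) * (\<Prod>i\<in>{0..<n}. M x $$ (i, p i))) \<in> F"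
  proof (intro sum mult prod matsD[OF assms])
    fix p show "(\<lambda>x. of_int (sign p)) \<in> F"
      using one minus_one by (cases "evenperm p") (auto simp: sign_def)
  qed (auto dest: permutes_in_image)
  then show ?thesis
    by (rule cong) (use assms[THEN matsD(1)] in \<open>auto simp: det_def\<close>)
qed

text \<open>Cramer's rule: the adjugate in the definition of \<open>minv\<close> makes its entries
  polynomials in those of \<open>M x\<close>, times the inverse determinant.\<close>

lemma mats_minv:
  assumes M: "M \<in> mats n n" and d: "(\<lambda>x. inverse (det (M x))) \<in> F"
  shows "(\<lambda>x. minv (M x)) \<in> mats n n"
proof (rule matsI)
  fix i j assume ij: "i < n" "j < n"
  have pow: "(\<lambda>x. (- 1) ^ k) \<in> F" for k :: nat
    using prod[of "{0..<k}" "\<lambda>_ _. - 1"] minus_one by simp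
  have D: "(\<lambda>x. mat_delete (M x) j i) \<in> mats (n - 1) (n - 1)"
  proof (rule matsI)
    fix x assume "x \<in> X"
    then show "mat_delete (M x) j i \<in> carrier_mat (n - 1) (n - 1)"
      using matsD(1)[OF M] by (metis mat_delete_carrier)
  next
    fix a b assume ab: "a < n - 1" "b < n - 1"
    have "(\<lambda>x. M x $$ (insert_index j a, insert_index i b)) \<in> F"
      using ab by (intro matsD[OF M]) (auto simp: insert_index_def)
    then show "(\<lambda>x. mat_delete (M x) j i $$ (a, b)) \<in> F"
    proof (rule cong)
      fix x assume "x \<in> X"
      then show "mat_delete (M x) j i $$ (a, b) = M x $$ (insert_index j a, insert_index i b)"
        using matsD(1)[OF M] ab by (force simp: mat_delete_def insert_index_def)
    qed
  qed
  have "(\<lambda>x. inverse (det (M x)) * ((- 1) ^ (j + i) * det (mat_delete (M x) j i))) \<in> F"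
    by (intro mult d det[OF D] pow)
  then show "(\<lambda>x. minv (M x) $$ (i, j)) \<in> F"
  proof (rule cong)
    fix x assume "x \<in> X"
    then have "M x \<in> carrier_mat n n" using M matsD(1) by blast
    then show "minv (M x) $$ (i, j) = inverse (det (M x)) * ((- 1) ^ (j + i) * det (mat_delete (M x) j i))"
      using ij by (simp add: minv_def adj_mat_def cofactor_def)
  qed
qed (use M matsD(1) minv_carrier_mat in blast)

end

text \<open>Closing \<open>regular_funs\<close> under equality on the group makes it a
  \<open>function_ring\<close>; values at singular matrices or matrices of another size then play no
  part in membership.\<close>

definition regular_on :: "'b::field set \<Rightarrow> nat \<Rightarrow> ('b mat \<Rightarrow> 'b) set" where
  "regular_on R N = {f. \<exists>g\<in>regular_funs R N. \<forall>A\<in>carrier (GL N). f A = g A}"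

lemma regular_onI: "f \<in> regular_funs R N \<Longrightarrow> f \<in> regular_on R N"
  by (auto simp: regular_on_def)

lemma function_ring_regular:
  assumes "0 \<in> R" "1 \<in> R" "- 1 \<in> R"
  shows "function_ring (carrier (GL N)) (regular_on R N)"
proof
  fix f g assume "f \<in> regular_on R N" "g \<in> regular_on R N"
  then obtain f' g' where fg: "f' \<in> regular_funs R N" "\<forall>A\<in>carrier (GL N). f A = f' A"
      "g' \<in> regular_funs R N" "\<forall>A\<in>carrier (GL N). g A = g' A"
    by (auto simp: regular_on_def)
  show "(\<lambda>x. f x + g x) \<in> regular_on R N"
    using fg regular_funs.add[OF fg(1,3)] by (auto simp: regular_on_def)
  show "(\<lambda>x. f x * g x) \<in> regular_on R N"
    using fg regular_funs.mult[OF fg(1,3)] by (auto simp: regular_on_def)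
next
  show "f \<in> regular_on R N \<Longrightarrow> (\<And>x. x \<in> carrier (GL N) \<Longrightarrow> g x = f x) \<Longrightarrow> g \<in> regular_on R N" for f g
    unfolding regular_on_def by auto
qed (use assms in \<open>auto intro!: regular_onI regular_funs.const\<close>)

interpretation reg: function_ring "carrier (GL N)" "regular_on UNIV N" for N
  by (rule function_ring_regular) auto

lemma regular_on_const: "c \<in> R \<Longrightarrow> (\<lambda>_. c) \<in> regular_on R N"
  by (auto intro!: regular_onI regular_funs.const)

lemma regular_on_inv_det: "(\<lambda>A. inverse (det A)) \<in> regular_on R N"
  by (auto intro!: regular_onI regular_funs.inv_det)

lemma mats_id:
  assumes "0 \<in> R" "1 \<in> R" "- 1 \<in> R"
  shows "(\<lambda>A. A) \<in> function_ring.mats (carrier (GL N)) (regular_on R N) N N"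
  by (rule function_ring.matsI[OF function_ring_regular[OF assms]])
     (auto simp: carrier_GL intro!: regular_onI regular_funs.entry)

lemma mats_const:
  assumes "0 \<in> R" "1 \<in> R" "- 1 \<in> R" and "C \<in> carrier_mat n k" "\<And>i j. i < n \<Longrightarrow> j < k \<Longrightarrow> C $$ (i, j) \<in> R"
  shows "(\<lambda>A. C) \<in> function_ring.mats (carrier (GL N)) (regular_on R N) n k"
  by (rule function_ring.matsI[OF function_ring_regular[OF assms(1-3)]])
     (use assms in \<open>auto intro!: regular_on_const\<close>)

text \<open>Induction on the way \<open>f\<close> is built. The inverse determinant is the only
  generator that is not a polynomial, hence the separate assumption \<open>d\<close>.\<close>

lemma regular_on_comp:
  assumes f: "f \<in> regular_funs R N"
    and \<Phi>: "\<And>i j. i < N \<Longrightarrow> j < N \<Longrightarrow> (\<lambda>x. \<Phi> x $$ (i, j)) \<in> F"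
    and d: "(\<lambda>x. inverse (det (\<Phi> x))) \<in> F"
    and F: "function_ring X F" and c: "\<And>c. c \<in> R \<Longrightarrow> (\<lambda>_. c) \<in> F"
  shows "(\<lambda>x. f (\<Phi> x)) \<in> F"
proof -
  interpret function_ring X F by (rule F)
  show ?thesis
    using f by induction (auto intro: add mult c \<Phi> d)
qed

section \<open>The Zariski topology\<close>

lemma topspace_zariski: "topspace (zariski N) = carrier (GL N)"
proof -
  have "carrier (GL N) \<in> {{A \<in> carrier (GL N). f A \<noteq> 0} | f. f \<in> regular_funs (UNIV :: 'b::field set) N}"
    by (intro CollectI exI[of _ "\<lambda>_. 1"]) (auto intro: regular_funs.const)
  then show ?thesis
    unfolding zariski_def topology_generated_by_topspace by blast
qed

lemma openin_nonzero:
  assumes "f \<in> regular_on UNIV N"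
  shows "openin (zariski N) {A \<in> carrier (GL N). f A \<noteq> 0}"
proof -
  obtain g where g: "g \<in> regular_funs UNIV N" "\<forall>A\<in>carrier (GL N). f A = g A"
    using assms by (auto simp: regular_on_def)
  then have "{A \<in> carrier (GL N). f A \<noteq> 0} = {A \<in> carrier (GL N). g A \<noteq> 0}" by auto
  then show ?thesis
    unfolding zariski_def openin_topology_generated_by_iff
    using g(1) by (auto intro: generate_topology_on.Basis)
qed

lemma closedin_zero:
  assumes "f \<in> regular_on UNIV N"
  shows "closedin (zariski N) {A \<in> carrier (GL N). f A = 0}"
proof -
  have "carrier (GL N) - {A \<in> carrier (GL N). f A = 0} = {A \<in> carrier (GL N). f A \<noteq> 0}" by auto
  then show ?thesis
    using openin_nonzero[OF assms] by (auto simp: closedin_def topspace_zariski)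
qed

text \<open>The subbasis is already a basis: a product of two functions is nonzero exactly where
  both factors are, which settles intersections.\<close>

lemma zariski_basis:
  assumes "openin (zariski N) E" "x \<in> E"
  shows "\<exists>f\<in>regular_funs UNIV N. f x \<noteq> 0 \<and> {A \<in> carrier (GL N). f A \<noteq> 0} \<subseteq> E"
proof -
  let ?S = "{{A \<in> carrier (GL N). f A \<noteq> 0} | f. f \<in> regular_funs (UNIV :: 'a set) N}"
  have "generate_topology_on ?S E"
    using assms(1) by (simp add: zariski_def openin_topology_generated_by_iff)
  then show ?thesis using assms(2)
  proof (induction arbitrary: x rule: generate_topology_on.induct)
    case (Int a b)
    obtain f where f: "f \<in> regular_funs UNIV N" "f x \<noteq> 0" "{A \<in> carrier (GL N). f A \<noteq> 0} \<subseteq> a"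
      using Int.IH(1)[of x] Int.prems by auto
    obtain g where g: "g \<in> regular_funs UNIV N" "g x \<noteq> 0" "{A \<in> carrier (GL N). g A \<noteq> 0} \<subseteq> b"
      using Int.IH(2)[of x] Int.prems by auto
    show ?case
      using f g by (intro bexI[of _ "\<lambda>A. f A * g A"] regular_funs.mult) auto
  next
    case (UN K)
    then obtain k where k: "k \<in> K" "x \<in> k" by blast
    then show ?case using UN.IH[OF k] by blast
  qed auto
qed

lemma continuous_map_regular:
  assumes \<Phi>: "\<Phi> \<in> reg.mats N N N" "\<And>A. A \<in> carrier (GL N) \<Longrightarrow> \<Phi> A \<in> carrier (GL N)"
    and d: "(\<lambda>A. inverse (det (\<Phi> A))) \<in> regular_on UNIV N"
  shows "continuous_map (zariski N) (zariski N) \<Phi>"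
proof -
  let ?S = "{{A \<in> carrier (GL N). f A \<noteq> 0} | f. f \<in> regular_funs (UNIV :: 'a set) N}"
  have "continuous_map (zariski N) (topology_generated_by ?S) \<Phi>"
  proof (rule continuous_on_generated_topo)
  fix U assume "U \<in> {{A \<in> carrier (GL N). f A \<noteq> 0} | f. f \<in> regular_funs (UNIV :: 'a set) N}"
  then obtain f where f: "f \<in> regular_funs UNIV N" and U: "U = {A \<in> carrier (GL N). f A \<noteq> 0}" by auto
  have "(\<lambda>A. f (\<Phi> A)) \<in> regular_on UNIV N"
    by (rule regular_on_comp[OF f _ d reg.function_ring_axioms])
       (auto intro: reg.matsD[OF \<Phi>(1)] regular_on_const)
  moreover have "\<Phi> -` U \<inter> topspace (zariski N) = {A \<in> carrier (GL N). f (\<Phi> A) \<noteq> 0}"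
    using \<Phi>(2) by (auto simp: U topspace_zariski)
  ultimately show "openin (zariski N) (\<Phi> -` U \<inter> topspace (zariski N))"
    using openin_nonzero by metis
next
  have "\<Union> {{A \<in> carrier (GL N). f A \<noteq> 0} | f. f \<in> regular_funs (UNIV :: 'a set) N} = carrier (GL N)"
    using topspace_zariski[of N] unfolding zariski_def topology_generated_by_topspace .
  then show "\<Phi> ` topspace (zariski N) \<subseteq> \<Union> {{A \<in> carrier (GL N). f A \<noteq> 0} | f. f \<in> regular_funs (UNIV :: 'a set) N}"
    using \<Phi>(2) by (auto simp: topspace_zariski)
qed
  then show ?thesis by (simp only: zariski_def[symmetric])
qed

text \<open>As there are finitely many classes, the union of all but one of them is closed too, so
  each class is both open and closed in \<open>H\<close>.\<close>

lemma connectedin_finite_closed_partition: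
  assumes H: "connectedin X H" and C: "finite C" "\<And>c. c \<in> C \<Longrightarrow> closedin X (Z c)"
    and cov: "\<And>h. h \<in> H \<Longrightarrow> \<exists>c\<in>C. h \<in> Z c"
    and disj: "\<And>h c c'. h \<in> H \<Longrightarrow> h \<in> Z c \<Longrightarrow> h \<in> Z c' \<Longrightarrow> c = c'"
    and h0: "h0 \<in> H" "h0 \<in> Z c0" and h: "h \<in> H"
  shows "h \<in> Z c0"
proof (rule ccontr)
  assume n: "h \<notin> Z c0"
  have c0: "c0 \<in> C" using cov disj h0 by blast
  have "closedin X (Z c0)" "closedin X (\<Union>c\<in>C - {c0}. Z c)"
    using C c0 by (auto intro!: closedin_Union)
  moreover have "H \<subseteq> Z c0 \<union> (\<Union>c\<in>C - {c0}. Z c)" using cov by blast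
  moreover have "Z c0 \<inter> (\<Union>c\<in>C - {c0}. Z c) \<inter> H = {}" using disj by blast
  moreover have "Z c0 \<inter> H \<noteq> {}" using h0 by blast
  moreover have "(\<Union>c\<in>C - {c0}. Z c) \<inter> H \<noteq> {}" using cov[OF h] n h by blast
  ultimately show False using H unfolding connectedin_closedin by blast
qed

text \<open>The denominator has no zero on \<open>D\<close>, so a curve may have inverses of
  polynomials among its entries. In the applications \<open>D\<close> omits only finitely many
  parameters.\<close>

definition rational_on :: "'b::field set \<Rightarrow> ('b \<Rightarrow> 'b) set" where
  "rational_on D = {f. \<exists>p q. \<forall>s\<in>D. poly q s \<noteq> 0 \<and> f s = poly p s / poly q s}"

lemma rational_onI: "(\<And>s. s \<in> D \<Longrightarrow> poly q s \<noteq> 0 \<and> f s = poly p s / poly q s) \<Longrightarrow> f \<in> rational_on D"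
  by (auto simp: rational_on_def)

lemma rational_on_poly: "poly p \<in> rational_on D"
  by (rule rational_onI[of _ 1 _ p]) auto

lemma rational_on_const: "(\<lambda>_. c) \<in> rational_on D"
  by (rule rational_onI[of _ 1 _ "[:c:]"]) auto

interpretation rat: function_ring D "rational_on D" for D
proof
  show "(\<lambda>_. 0) \<in> rational_on D" "(\<lambda>_. 1) \<in> rational_on D" "(\<lambda>_. - 1) \<in> rational_on D"
    by (rule rational_on_const)+
  fix f g assume "f \<in> rational_on D" "g \<in> rational_on D"
  then obtain p q p' q' where *: "\<forall>s\<in>D. poly q s \<noteq> 0 \<and> f s = poly p s / poly q s"
     "\<forall>s\<in>D. poly q' s \<noteq> 0 \<and> g s = poly p' s / poly q' s"
    by (auto simp: rational_on_def)
  show "(\<lambda>s. f s + g s) \<in> rational_on D"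
    by (rule rational_onI[of _ "q * q'" _ "p * q' + p' * q"]) (use * in \<open>auto simp: add_frac_eq\<close>)
  show "(\<lambda>s. f s * g s) \<in> rational_on D"
    by (rule rational_onI[of _ "q * q'" _ "p * p'"]) (use * in auto)
next
  fix f g assume "f \<in> rational_on D" "\<And>x. x \<in> D \<Longrightarrow> g x = f x"
  then show "g \<in> rational_on D" by (auto simp: rational_on_def)
qed

lemma rational_on_inverse:
  assumes "f \<in> rational_on D" "\<And>s. s \<in> D \<Longrightarrow> f s \<noteq> 0"
  shows "(\<lambda>s. inverse (f s)) \<in> rational_on D"
proof -
  obtain p q where *: "\<forall>s\<in>D. poly q s \<noteq> 0 \<and> f s = poly p s / poly q s"
    using assms by (auto simp: rational_on_def)
  show ?thesis
    by (rule rational_onI[of _ p _ q]) (use * assms(2) in auto)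
qed

text \<open>If the field were finite, the product of all X - a, increased by 1, would be a
  nonconstant polynomial without a root.\<close>

lemma infinite_alg_closed: "infinite (UNIV :: 'b::alg_closed_field set)"
proof
  assume fin: "finite (UNIV :: 'b set)"
  define p :: "'b poly" where "p = (\<Prod>a\<in>UNIV. [:- a, 1:]) + 1"
  have d: "degree (\<Prod>a\<in>(UNIV :: 'b set). [:- a, 1:]) = card (UNIV :: 'b set)"
    by (subst degree_prod_eq_sum_degree) auto
  have "card (UNIV :: 'b set) > 0" using fin by (simp add: card_gt_0_iff)
  then have "degree p = card (UNIV :: 'b set)"
    unfolding p_def by (subst degree_add_eq_left) (use d in auto)
  then obtain x where x: "poly p x = 0"
    using alg_closed_imp_poly_has_root[of p] \<open>card (UNIV :: 'b set) > 0\<close> by auto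
  have "poly (\<Prod>a\<in>UNIV. [:- a, 1:]) x = 0"
    unfolding poly_prod using fin by (intro prod_zero) auto
  then show False using x by (simp add: p_def)
qed

text \<open>The image is irreducible: two nonempty open subsets correspond to cofinite subsets of the line.\<close>

lemma connectedin_rational_curve:
  fixes \<gamma> :: "'b::alg_closed_field \<Rightarrow> 'b mat"
  assumes D: "finite (- D)" and \<gamma>: "\<gamma> \<in> rat.mats D N N" "\<And>s. s \<in> D \<Longrightarrow> det (\<gamma> s) \<noteq> 0"
  shows "connectedin (zariski N) (\<gamma> ` D)"
  unfolding connectedin
proof (intro conjI notI)
  show "\<gamma> ` D \<subseteq> topspace (zariski N)"
    using \<gamma> rat.matsD(1) by (auto simp: topspace_zariski carrier_GL)
  assume "\<exists>E1 E2. openin (zariski N) E1 \<and> openin (zariski N) E2 \<and> \<gamma> ` D \<subseteq> E1 \<union> E2 \<and>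
    E1 \<inter> E2 \<inter> \<gamma> ` D = {} \<and> E1 \<inter> \<gamma> ` D \<noteq> {} \<and> E2 \<inter> \<gamma> ` D \<noteq> {}"
  then obtain E1 E2 s1 s2 where E: "openin (zariski N) E1" "openin (zariski N) E2"
      "E1 \<inter> E2 \<inter> \<gamma> ` D = {}" and s: "s1 \<in> D" "\<gamma> s1 \<in> E1" "s2 \<in> D" "\<gamma> s2 \<in> E2" by auto
  \<comment> \<open>A principal open set inside \<open>E\<close> pulls back to the nonvanishing of a
    numerator \<open>p\<close>, so it misses only finitely many parameters.\<close>
  have *: "\<exists>p. p \<noteq> 0 \<and> (\<forall>s\<in>D. poly p s \<noteq> 0 \<longrightarrow> \<gamma> s \<in> E)"
    if E: "openin (zariski N) E" and s1: "s1 \<in> D" "\<gamma> s1 \<in> E" for E s1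
  proof -
    obtain f where f: "f \<in> regular_funs UNIV N" "f (\<gamma> s1) \<noteq> 0" "{A \<in> carrier (GL N). f A \<noteq> 0} \<subseteq> E"
      using zariski_basis[OF E s1(2)] by auto
    have d: "(\<lambda>s. inverse (det (\<gamma> s))) \<in> rational_on D"
      by (rule rational_on_inverse[OF rat.det[OF \<gamma>(1)] \<gamma>(2)])
    have "(\<lambda>s. f (\<gamma> s)) \<in> rational_on D"
      by (rule regular_on_comp[OF f(1) _ d rat.function_ring_axioms])
         (auto intro: rat.matsD[OF \<gamma>(1)] rational_on_const)
    then obtain p q where pq: "\<forall>s\<in>D. poly q s \<noteq> 0 \<and> f (\<gamma> s) = poly p s / poly q s"
      by (auto simp: rational_on_def)
    have "p \<noteq> 0" using pq f(2) s1 by auto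
    moreover have "\<gamma> s \<in> E" if "s \<in> D" "poly p s \<noteq> 0" for s
      using that pq f(3) \<gamma> rat.matsD(1)[OF \<gamma>(1)] by (auto simp: carrier_GL subset_iff)
    ultimately show ?thesis by blast
  qed
  obtain p1 p2 where p: "p1 \<noteq> 0" "\<forall>s\<in>D. poly p1 s \<noteq> 0 \<longrightarrow> \<gamma> s \<in> E1"
      "p2 \<noteq> 0" "\<forall>s\<in>D. poly p2 s \<noteq> 0 \<longrightarrow> \<gamma> s \<in> E2"
    using *[OF E(1) s(1,2)] *[OF E(2) s(3,4)] by blast
  have "finite (- D \<union> {s. poly (p1 * p2) s = 0})"
    using D p by (intro finite_UnI poly_roots_finite) auto
  then obtain s where "s \<notin> - D \<union> {s. poly (p1 * p2) s = 0}"
    using ex_new_if_finite[OF infinite_alg_closed] by blast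
  then show False using p E(3) by auto
qed

section \<open>Linear algebra by leading indices, up to common relative eigenvectors\<close>

section \<open>The standard flag\<close>

definition flag :: "nat \<Rightarrow> nat \<Rightarrow> 'a::field vec set" where
  "flag N i = {v \<in> carrier_vec N. \<forall>l. i \<le> l \<and> l < N \<longrightarrow> v $ l = 0}"

text \<open>The last nonzero coordinate marks the step at which \<open>v\<close> enters the flag
  (\<open>leads_flag_Suc\<close>). It is therefore unchanged by invertible upper triangular matrices
  and can serve as an invariant.\<close>

definition leads :: "nat \<Rightarrow> 'a::field vec \<Rightarrow> nat \<Rightarrow> bool" where
  "leads N v i \<longleftrightarrow> v \<in> carrier_vec N \<and> i < N \<and> v $ i \<noteq> 0 \<and> (\<forall>l. i < l \<and> l < N \<longrightarrow> v $ l = 0)"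

lemma leads_exists:
  assumes "v \<in> carrier_vec N" "v \<noteq> 0\<^sub>v N"
  shows "\<exists>i. leads N v i"
proof -
  let ?S = "{i. i < N \<and> v $ i \<noteq> 0}"
  have "?S \<noteq> {}" using assms by (auto intro!: eq_vecI)
  then have "Max ?S \<in> ?S" by (intro Max_in) auto
  moreover have "v $ l = 0" if "Max ?S < l" "l < N" for l
  proof (rule ccontr)
    assume "v $ l \<noteq> 0"
    then have "l \<le> Max ?S" using that by (intro Max_ge) auto
    then show False using that by simp
  qed
  ultimately show ?thesis using assms(1) unfolding leads_def by blast
qed

lemma leads_unique: "leads N v i \<Longrightarrow> leads N v j \<Longrightarrow> i = j"
  unfolding leads_def by (metis linorder_neqE_nat)

lemma leads_flag: "leads N v i \<Longrightarrow> v \<in> flag N j \<longleftrightarrow> i < j"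
  unfolding leads_def flag_def by (auto simp: not_less)

lemma leads_flag_Suc: "leads N v i \<longleftrightarrow> i < N \<and> v \<in> flag N (Suc i) \<and> v \<notin> flag N i"
proof
  assume "i < N \<and> v \<in> flag N (Suc i) \<and> v \<notin> flag N i"
  then show "leads N v i"
    unfolding leads_def flag_def by (auto simp: Suc_le_eq) (metis le_neq_implies_less)
qed (auto simp: leads_flag leads_def)

lemma flag_leads: "v \<in> flag N j \<Longrightarrow> v \<noteq> 0\<^sub>v N \<Longrightarrow> \<exists>i<j. leads N v i"
  using leads_exists[of v N] leads_flag[of N v _ j] by (auto simp: flag_def)

lemma flag_mono: "i \<le> j \<Longrightarrow> flag N i \<subseteq> flag N j"
  by (auto simp: flag_def)

lemma flag_full: "N \<le> i \<Longrightarrow> flag N i = carrier_vec N"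
  by (auto simp: flag_def)

lemma flag_0: "v \<in> flag N 0 \<longleftrightarrow> v = 0\<^sub>v N"
  by (auto simp: flag_def)

definition subsp :: "nat \<Rightarrow> 'a::field vec set \<Rightarrow> bool" where
  "subsp N U \<longleftrightarrow> U \<subseteq> carrier_vec N \<and> 0\<^sub>v N \<in> U \<and> (\<forall>u\<in>U. \<forall>v\<in>U. u + v \<in> U) \<and> (\<forall>c. \<forall>u\<in>U. c \<cdot>\<^sub>v u \<in> U)"

lemma subsp_carrier: "subsp N U \<Longrightarrow> u \<in> U \<Longrightarrow> u \<in> carrier_vec N"
  and subsp_zero: "subsp N U \<Longrightarrow> 0\<^sub>v N \<in> U"
  and subsp_add: "subsp N U \<Longrightarrow> u \<in> U \<Longrightarrow> v \<in> U \<Longrightarrow> u + v \<in> U"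
  and subsp_smult: "subsp N U \<Longrightarrow> u \<in> U \<Longrightarrow> c \<cdot>\<^sub>v u \<in> U"
  by (auto simp: subsp_def)

lemma subsp_minus:
  assumes "subsp N U" "u \<in> U" "v \<in> U"
  shows "u - v \<in> U"
proof -
  have c: "u \<in> carrier_vec N" "v \<in> carrier_vec N" using assms subsp_carrier by blast+
  have "u - v = u + (- 1) \<cdot>\<^sub>v v" using c by (intro eq_vecI) auto
  then show ?thesis using assms subsp_add subsp_smult by metis
qed

lemma subsp_smult_iff:
  assumes "subsp N U" "c \<noteq> 0" "c \<cdot>\<^sub>v u \<in> U"
  shows "u \<in> U"
  using subsp_smult[OF assms(1,3), of "inverse c"] assms(2) by (simp add: smult_smult_assoc)

lemma subsp_minus_iff:
  assumes "subsp N U" "u \<in> U" "v \<in> carrier_vec N"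
  shows "v - u \<in> U \<longleftrightarrow> v \<in> U"
proof
  assume "v - u \<in> U"
  then have "(v - u) + u \<in> U" using assms subsp_add by blast
  moreover have "(v - u) + u = v"
    using assms(3) subsp_carrier[OF assms(1,2)] by (intro eq_vecI) auto
  ultimately show "v \<in> U" by simp
qed (use assms subsp_minus in blast)

lemma subsp_flag: "subsp N (flag N i)"
  by (auto simp: subsp_def flag_def)

lemma subsp_lincomb:
  assumes "subsp N U" "\<And>k. k \<in> K \<Longrightarrow> u k \<in> U"
  shows "vec N (\<lambda>i. \<Sum>k\<in>K. c k * u k $ i) \<in> U"
  using assms(2)
proof (induction K rule: infinite_finite_induct)
  case (insert x F)
  have "u x \<in> carrier_vec N" using insert.prems[of x] assms(1) subsp_carrier by blast
  then have "vec N (\<lambda>i. \<Sum>k\<in>insert x F. c k * u k $ i) = c x \<cdot>\<^sub>v u x + vec N (\<lambda>i. \<Sum>k\<in>F. c k * u k $ i)"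
    using insert.hyps by (intro eq_vecI) auto
  then show ?case
    using insert subsp_add[OF assms(1)] subsp_smult[OF assms(1)] by auto
qed (use subsp_zero[OF assms(1)] in \<open>auto simp: zero_vec_def\<close>)

text \<open>The cardinality of this set is the dimension of \<open>U\<close>.\<close>

definition leadset :: "nat \<Rightarrow> 'a::field vec set \<Rightarrow> nat set" where
  "leadset N U = {i. \<exists>v\<in>U. leads N v i}"

lemma finite_leadset: "finite (leadset N U)"
  by (rule finite_subset[of _ "{..<N}"]) (auto simp: leadset_def leads_def)

lemma leadset_mono: "U \<subseteq> Y \<Longrightarrow> leadset N U \<subseteq> leadset N Y"
  by (auto simp: leadset_def)

lemma leads_cancel:
  assumes "leads N v i" "leads N w i"
  obtains c where "c \<noteq> 0" "v - c \<cdot>\<^sub>v w \<in> flag N i"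
proof
  show "v $ i / w $ i \<noteq> 0" using assms by (auto simp: leads_def)
  show "v - (v $ i / w $ i) \<cdot>\<^sub>v w \<in> flag N i"
    unfolding flag_def
  proof (intro CollectI conjI allI impI)
    fix l assume "i \<le> l \<and> l < N"
    then show "(v - (v $ i / w $ i) \<cdot>\<^sub>v w) $ l = 0"
      using assms by (cases "l = i") (auto simp: leads_def)
  qed (use assms in \<open>auto simp: leads_def\<close>)
qed

lemma leads_diff_flag:
  assumes "leads N v i" "w \<in> flag N i"
  shows "leads N (v - w) i" "leads N (v + w) i"
  using assms by (auto simp: leads_def flag_def)

lemma leads_smult: "c \<noteq> 0 \<Longrightarrow> leads N (c \<cdot>\<^sub>v v) i \<longleftrightarrow> leads N v i"
  unfolding leads_def by (intro iffI) auto

text \<open>Elimination from the top: a vector of \<open>Y\<close> led by \<open>i\<close> is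
  reduced by a multiple of a vector of \<open>U\<close> led by \<open>i\<close>, and the remainder
  lies lower in the flag. Used with a comparison of cardinalities, this replaces dimension
  counting.\<close>

lemma subsp_eqI_leadset:
  assumes U: "subsp N U" and Y: "subsp N Y" and "U \<subseteq> Y" "leadset N Y \<subseteq> leadset N U"
  shows "U = Y"
proof -
  have "v \<in> U" if "v \<in> Y" "v \<in> flag N i" for v i
    using that
  proof (induction i arbitrary: v)
    case 0
    then show ?case using subsp_zero[OF U] by (simp add: flag_0)
  next
    case (Suc i)
    show ?case
    proof (cases "v \<in> flag N i")
      case True then show ?thesis using Suc by blast
    next
      case False
      then have "i < N" using Suc.prems(2) flag_full[of N i] by (auto simp: flag_def not_less)
      then have l: "leads N v i" using False Suc.prems(2) by (simp add: leads_flag_Suc)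
      then have "i \<in> leadset N U" using Suc.prems(1) assms(4) by (auto simp: leadset_def)
      then obtain e where e: "e \<in> U" "leads N e i" by (auto simp: leadset_def)
      obtain c where c: "v - c \<cdot>\<^sub>v e \<in> flag N i" using leads_cancel[OF l e(2)] by metis
      have "c \<cdot>\<^sub>v e \<in> U" using subsp_smult[OF U e(1)] .
      moreover from this have "v - c \<cdot>\<^sub>v e \<in> U"
        using c Suc.IH subsp_minus[OF Y Suc.prems(1)] \<open>U \<subseteq> Y\<close> by blast
      ultimately show ?thesis
        using subsp_minus_iff[OF U] Suc.prems(1) subsp_carrier[OF Y] by metis
    qed
  qed
  from this[of _ N] show ?thesis using \<open>U \<subseteq> Y\<close> subsp_carrier[OF Y] by (auto simp: flag_full)
qed

section \<open>Eigenvectors modulo a subspace\<close>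

text \<open>For a subspace \<open>U\<close>, the condition
  \<open>shift A c *\<^sub>v v \<in> U\<close> says that \<open>v\<close> is an eigenvector modulo
  \<open>U\<close>, without mention of the quotient.\<close>

definition shift :: "'a::field mat \<Rightarrow> 'a \<Rightarrow> 'a mat" where
  "shift A c = A - c \<cdot>\<^sub>m 1\<^sub>m (dim_row A)"

lemma shift_carrier: "A \<in> carrier_mat N N \<Longrightarrow> shift A c \<in> carrier_mat N N"
  by (auto simp: shift_def)

lemma shift_vec:
  assumes "A \<in> carrier_mat N N" "v \<in> carrier_vec N"
  shows "shift A c *\<^sub>v v = A *\<^sub>v v - c \<cdot>\<^sub>v v"
proof -
  have "(c \<cdot>\<^sub>m 1\<^sub>m N) *\<^sub>v v = c \<cdot>\<^sub>v v"
    using assms(2) by (intro eq_vecI) auto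
  then show ?thesis
    using assms unfolding shift_def by (subst minus_mult_distrib_mat_vec[of _ N N]) auto
qed

lemma shift_stable:
  assumes "A \<in> carrier_mat N N" "subsp N U" "\<forall>u\<in>U. A *\<^sub>v u \<in> U" "u \<in> U"
  shows "shift A c *\<^sub>v u \<in> U"
  unfolding shift_vec[OF assms(1) subsp_carrier[OF assms(2,4)]]
  using assms(3,4) by (intro subsp_minus[OF assms(2)] subsp_smult[OF assms(2)]) auto

lemma shift_diff:
  assumes "A \<in> carrier_mat N N" "subsp N U" "v \<in> carrier_vec N"
    and "shift A c *\<^sub>v v \<in> U" "shift A c' *\<^sub>v v \<in> U" "v \<notin> U"
  shows "c = c'"
proof (rule ccontr)
  assume "c \<noteq> c'"
  have "shift A c *\<^sub>v v - shift A c' *\<^sub>v v = (c' - c) \<cdot>\<^sub>v v"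
    using assms(1,3) by (intro eq_vecI) (auto simp: shift_vec algebra_simps)
  then have "(c' - c) \<cdot>\<^sub>v v \<in> U" using subsp_minus[OF assms(2,4,5)] by simp
  then show False using subsp_smult_iff[OF assms(2), of "c' - c" v] \<open>c \<noteq> c'\<close> assms(6) by simp
qed

lemma subsp_image:
  assumes "A \<in> carrier_mat N N" "subsp N U"
  shows "subsp N ((*\<^sub>v) A ` U)"
  unfolding subsp_def
proof (intro conjI ballI allI)
  show "(*\<^sub>v) A ` U \<subseteq> carrier_vec N" using assms by (auto dest: subsp_carrier)
  have "A *\<^sub>v 0\<^sub>v N = 0\<^sub>v N" using assms by (intro eq_vecI) auto
  then show "0\<^sub>v N \<in> (*\<^sub>v) A ` U" using subsp_zero[OF assms(2)] by (metis image_eqI)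
next
  fix x y assume "x \<in> (*\<^sub>v) A ` U" "y \<in> (*\<^sub>v) A ` U"
  then obtain u v where uv: "u \<in> U" "v \<in> U" "x = A *\<^sub>v u" "y = A *\<^sub>v v" by blast
  then have "x + y = A *\<^sub>v (u + v)"
    using assms mult_add_distrib_mat_vec[OF assms(1)] subsp_carrier[OF assms(2)] by simp
  then show "x + y \<in> (*\<^sub>v) A ` U" using subsp_add[OF assms(2) uv(1,2)] by blast
next
  fix c x assume "x \<in> (*\<^sub>v) A ` U"
  then obtain u where u: "u \<in> U" "x = A *\<^sub>v u" by blast
  then have "c \<cdot>\<^sub>v x = A *\<^sub>v (c \<cdot>\<^sub>v u)"
    using mult_mat_vec[OF assms(1) subsp_carrier[OF assms(2)]] by simp
  then show "c \<cdot>\<^sub>v x \<in> (*\<^sub>v) A ` U" using subsp_smult[OF assms(2) u(1)] by blast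
qed

text \<open>The decreasing sequence of images of \<open>U\<close> becomes stationary.\<close>

lemma injective_stable_imp_surj:
  assumes A: "A \<in> carrier_mat N N" and U: "subsp N U" and st: "\<forall>u\<in>U. A *\<^sub>v u \<in> U"
    and inj: "inj_on ((*\<^sub>v) A) (carrier_vec N)"
  shows "(*\<^sub>v) A ` U = U"
proof -
  define f where "f = (*\<^sub>v) A"
  have sub: "subsp N ((f ^^ k) ` U)" for k
  proof (induction k)
    case (Suc k)
    have "(f ^^ Suc k) ` U = (*\<^sub>v) A ` (f ^^ k) ` U" by (auto simp: f_def)
    then show ?case using subsp_image[OF A Suc] by simp
  qed (use U in simp)
  have dec: "(f ^^ Suc k) ` U \<subseteq> (f ^^ k) ` U" for k
    using st by (auto simp: f_def funpow_Suc_right simp del: funpow.simps)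
  \<comment> \<open>An image with the fewest leading indices, that is, of least dimension.\<close>
  obtain k where k: "\<forall>l. card (leadset N ((f ^^ k) ` U)) \<le> card (leadset N ((f ^^ l) ` U))"
    using ex_has_least_nat[of "\<lambda>_. True" 0 "\<lambda>l. card (leadset N ((f ^^ l) ` U))"] by blast
  have eq: "(f ^^ Suc k) ` U = (f ^^ k) ` U"
  proof (rule subsp_eqI_leadset[OF sub sub dec])
    show "leadset N ((f ^^ k) ` U) \<subseteq> leadset N ((f ^^ Suc k) ` U)"
      using card_seteq[OF finite_leadset leadset_mono[OF dec]] k by blast
  qed
  have injk: "inj_on (f ^^ k) (carrier_vec N)" for k
  proof (induction k)
    case (Suc k)
    have "(f ^^ k) ` carrier_vec N \<subseteq> carrier_vec N"
      by (induction k) (use A in \<open>auto simp: f_def\<close>)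
    then have "inj_on (f \<circ> (f ^^ k)) (carrier_vec N)"
      using Suc inj unfolding f_def by (intro comp_inj_on) (auto intro: inj_on_subset)
    then show ?case by (simp add: o_def)
  qed auto
  \<comment> \<open>Injectivity of the \<open>k\<close>-th power cancels it, which moves the
    stationary step back to the beginning.\<close>
  have "(f ^^ k) ` (f ` U) = (f ^^ k) ` U"
    using eq by (simp add: image_comp funpow_Suc_right del: funpow.simps)
  then have "f ` U = U"
    using inj_on_image_eq_iff[OF injk, of "f ` U" U k] U st
    by (auto simp: f_def subsp_def subset_iff)
  then show ?thesis by (simp add: f_def)
qed

text \<open>If \<open>c\<close> were not an eigenvalue of \<open>A\<close>, then
  \<open>shift A c\<close> would be injective and hence map the stable subspace \<open>U\<close>
  onto itself. A preimage in \<open>U\<close> of the image of \<open>v\<close> would have to be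
  \<open>v\<close>. So the eigenvalues modulo any stable subspace are among the finitely many
  eigenvalues of \<open>A\<close>.\<close>

lemma relative_eigenvalue:
  assumes A: "A \<in> carrier_mat N N" and U: "subsp N U" and st: "\<forall>u\<in>U. A *\<^sub>v u \<in> U"
    and v: "v \<in> carrier_vec N" "v \<notin> U" "shift A c *\<^sub>v v \<in> U"
  shows "eigenvalue A c"
proof (rule ccontr)
  assume n: "\<not> eigenvalue A c"
  have S: "shift A c \<in> carrier_mat N N" by (rule shift_carrier[OF A])
  have inj: "inj_on ((*\<^sub>v) (shift A c)) (carrier_vec N)"
  proof (rule inj_onI)
    fix x y assume xy: "x \<in> carrier_vec N" "y \<in> carrier_vec N" "shift A c *\<^sub>v x = shift A c *\<^sub>v y"
    then have "shift A c *\<^sub>v (x - y) = 0\<^sub>v N"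
      using S by (simp add: mult_minus_distrib_mat_vec[OF S xy(1,2)])
    then have e: "A *\<^sub>v (x - y) - c \<cdot>\<^sub>v (x - y) = 0\<^sub>v N"
      using shift_vec[OF A, of "x - y"] xy by simp
    have "A *\<^sub>v (x - y) = c \<cdot>\<^sub>v (x - y)"
    proof (rule eq_vecI)
      fix i assume "i < dim_vec (c \<cdot>\<^sub>v (x - y))"
      then have "i < N" using xy by simp
      then have "(A *\<^sub>v (x - y) - c \<cdot>\<^sub>v (x - y)) $ i = 0" using e by simp
      then show "(A *\<^sub>v (x - y)) $ i = (c \<cdot>\<^sub>v (x - y)) $ i"
        using xy A \<open>i < N\<close> by simp
    qed (use A xy in simp)
    moreover have "x - y \<in> carrier_vec N" using xy by simp
    ultimately have "x - y = 0\<^sub>v N"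
      using n A unfolding eigenvalue_def eigenvector_def by auto
    then have "(x - y) $ i = 0" if "i < N" for i using that by simp
    then show "x = y" using xy by (intro eq_vecI) auto
  qed
  have "(*\<^sub>v) (shift A c) ` U = U"
    by (rule injective_stable_imp_surj[OF S U _ inj]) (use shift_stable[OF A U st] in blast)
  then obtain u where "u \<in> U" "shift A c *\<^sub>v v = shift A c *\<^sub>v u" using v(3) by blast
  then have "v = u" using inj v(1) U by (meson inj_onD subsp_carrier)
  then show False using v \<open>u \<in> U\<close> by simp
qed

lemma finite_eigenvalues:
  fixes A :: "'a::field mat"
  assumes "A \<in> carrier_mat N N"
  shows "finite {c. eigenvalue A c}"
proof -
  have "char_poly A \<noteq> 0" using degree_monic_char_poly[OF assms] by auto
  then show ?thesis
    using poly_roots_finite eigenvalue_root_char_poly[OF assms] by auto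
qed

lemma linear_dependence:
  fixes u :: "nat \<Rightarrow> 'a::field vec"
  shows "\<exists>c. (\<exists>k\<le>N. c k \<noteq> 0) \<and> (\<forall>i<N. (\<Sum>k\<le>N. c k * u k $ i) = 0)"
proof -
  \<comment> \<open>The \<open>N + 1\<close> vectors become columns and a row of zeros is appended,
    giving a square singular matrix.\<close>
  define A where "A = mat (Suc N) (Suc N) (\<lambda>(i, k). if i < N then u k $ i else 0)"
  have A: "A \<in> carrier_mat (Suc N) (Suc N)" by (simp add: A_def)
  have "transpose_mat A *\<^sub>v unit_vec (Suc N) N = 0\<^sub>v (Suc N)"
    by (intro eq_vecI) (auto simp: A_def)
  then have "det (transpose_mat A) = 0"
    using det_0_iff_vec_prod_zero[of "transpose_mat A" "Suc N"] A
    by (metis lessI transpose_carrier_mat unit_vec_carrier unit_vec_nonzero)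
  then have "det A = 0" using det_transpose[OF A] by simp
  then obtain c where c: "c \<in> carrier_vec (Suc N)" "c \<noteq> 0\<^sub>v (Suc N)" "A *\<^sub>v c = 0\<^sub>v (Suc N)"
    using det_0_iff_vec_prod_zero[OF A] by blast
  have "\<exists>k\<le>N. c $ k \<noteq> 0"
    using c(1,2) by (metis carrier_vecD eq_vecI index_zero_vec less_Suc_eq_le)
  moreover have "(\<Sum>k\<le>N. c $ k * u k $ i) = 0" if i: "i < N" for i
  proof -
    have "(A *\<^sub>v c) $ i = 0" using c(3) i by simp
    moreover have "(A *\<^sub>v c) $ i = (\<Sum>k\<in>{0..<Suc N}. u k $ i * c $ k)"
      using i c(1) by (simp add: A_def scalar_prod_def)
    moreover have "{0..<Suc N} = {..N}" by auto
    ultimately show ?thesis by (simp add: mult.commute)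
  qed
  ultimately show ?thesis by blast
qed

text \<open>Take a polynomial p of least degree with p(T) v in \<open>U\<close>. It has a root
  \<open>\<mu>\<close>, and the cofactor q of X - \<open>\<mu>\<close> gives q(T) v, which is
  outside \<open>U\<close> by minimality and is mapped into \<open>U\<close> by T -
  \<open>\<mu>\<close>.\<close>

lemma relative_eigenvector_exists:
  fixes T :: "'a::alg_closed_field mat"
  assumes T: "T \<in> carrier_mat N N" and U: "subsp N U" and Y: "subsp N Y"
    and UY: "U \<subset> Y" and st: "\<forall>w\<in>Y. T *\<^sub>v w \<in> Y"
  shows "\<exists>v\<in>Y - U. \<exists>c. shift T c *\<^sub>v v \<in> U"
proof -
  obtain v where v: "v \<in> Y" "v \<notin> U" using UY by blast
  define u where "u = (\<lambda>k. ((*\<^sub>v) T ^^ k) v)"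
  have uY: "u k \<in> Y" for k
    unfolding u_def by (induction k) (use v st in auto)
  have uc: "u k \<in> carrier_vec N" for k using uY Y subsp_carrier by blast
  \<comment> \<open>This is p(T) v. The sum stops at \<open>N\<close>, which is harmless because
    only polynomials of degree at most \<open>N\<close> are used.\<close>
  define pv where "pv p = vec N (\<lambda>i. \<Sum>k\<le>N. coeff p k * u k $ i)" for p :: "'a poly"
  have pvY: "pv p \<in> Y" for p
    unfolding pv_def by (rule subsp_lincomb[OF Y]) (rule uY)
  obtain c where c: "\<exists>k\<le>N. c k \<noteq> 0" "\<forall>i<N. (\<Sum>k\<le>N. c k * u k $ i) = 0"
    using linear_dependence by blast
  define p0 where "p0 = (\<Sum>k\<le>N. monom (c k) k)"
  have cp0: "coeff p0 k = (if k \<le> N then c k else 0)" for k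
    by (auto simp: p0_def coeff_sum)
  have "p0 \<noteq> 0" using c(1) cp0 by (metis coeff_0)
  moreover have "degree p0 \<le> N" by (rule degree_le) (auto simp: cp0)
  moreover have "pv p0 = 0\<^sub>v N" using c(2) by (intro eq_vecI) (auto simp: pv_def cp0)
  ultimately have "p0 \<noteq> 0 \<and> degree p0 \<le> N \<and> pv p0 \<in> U" using subsp_zero[OF U] by simp
  then obtain p where p: "p \<noteq> 0" "degree p \<le> N" "pv p \<in> U"
      and min: "\<And>q. q \<noteq> 0 \<Longrightarrow> degree q \<le> N \<Longrightarrow> pv q \<in> U \<Longrightarrow> degree p \<le> degree q"
    using ex_has_least_nat[of "\<lambda>p. p \<noteq> 0 \<and> degree p \<le> N \<and> pv p \<in> U" p0 degree] by blast
  have "degree p > 0"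
  proof (rule ccontr)
    assume "\<not> degree p > 0"
    then obtain a where a: "p = [:a:]" "a \<noteq> 0" using p(1) by (metis degree_0_id gr0I pCons_eq_0_iff degree_eq_zeroE)
    have s: "(\<Sum>k\<le>N. coeff [:a:] k * u k $ i) = a * v $ i" for i
      by (subst sum.remove[of _ 0]) (auto simp: u_def coeff_pCons intro!: sum.neutral split: nat.splits)
    have "pv p = a \<cdot>\<^sub>v v"
      unfolding pv_def a(1) s using subsp_carrier[OF Y v(1)] by (intro eq_vecI) auto
    then show False using p(3) subsp_smult_iff[OF U a(2)] v(2) by simp
  qed
  then obtain \<mu> where "poly p \<mu> = 0" using alg_closed_imp_poly_has_root by blast
  then obtain q where q: "p = [:- \<mu>, 1:] * q" by (auto simp: poly_eq_0_iff_dvd dvd_def)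
  have q0: "q \<noteq> 0" using q p(1) by auto
  have dq: "degree p = Suc (degree q)" unfolding q using q0 by (subst degree_mult_eq) auto
  have "pv q \<notin> U" using min[OF q0] dq p(2) by auto
  moreover have "shift T \<mu> *\<^sub>v pv q = pv p"
  proof (rule eq_vecI)
    fix i assume "i < dim_vec (pv p)"
    then have i: "i < N" by (simp add: pv_def)
    have Tu: "(\<Sum>j\<in>{0..<N}. T $$ (i, j) * u k $ j) = u (Suc k) $ i" for k
      using T uc[of k] i by (simp add: u_def scalar_prod_def)
    have "(T *\<^sub>v pv q) $ i = (\<Sum>j\<in>{0..<N}. T $$ (i, j) * (\<Sum>k\<le>N. coeff q k * u k $ j))"
      using T i by (simp add: pv_def scalar_prod_def)
    also have "\<dots> = (\<Sum>k\<le>N. coeff q k * (\<Sum>j\<in>{0..<N}. T $$ (i, j) * u k $ j))"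
      unfolding sum_distrib_left by (subst sum.swap) (simp add: ac_simps)
    also have "\<dots> = (\<Sum>k\<le>N. coeff q k * u (Suc k) $ i)" by (simp add: Tu)
    also have "\<dots> = (\<Sum>k\<in>{0..<N}. coeff q k * u (Suc k) $ i)"
      \<comment> \<open>The degree of \<open>q\<close> is one less than that of \<open>p\<close>,
        hence below \<open>N\<close>; dropping the last term leaves room for the shift of indices by
        one.\<close>
      by (rule sum.mono_neutral_right) (use dq p(2) in \<open>auto intro: coeff_eq_0\<close>)
    also have "\<dots> = (\<Sum>k\<in>{1..<Suc N}. coeff q (k - 1) * u k $ i)"
      using sum.shift_bounds_nat_ivl[of "\<lambda>k. coeff q (k - 1) * u k $ i" 0 1 N] by simp
    also have "\<dots> = (\<Sum>k\<le>N. (case k of 0 \<Rightarrow> 0 | Suc k \<Rightarrow> coeff q k) * u k $ i)"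
      by (rule sum.mono_neutral_cong_left) (auto split: nat.splits)
    finally have 1: "(T *\<^sub>v pv q) $ i = (\<Sum>k\<le>N. (case k of 0 \<Rightarrow> 0 | Suc k \<Rightarrow> coeff q k) * u k $ i)" .
    have "coeff p k = (case k of 0 \<Rightarrow> 0 | Suc k \<Rightarrow> coeff q k) - \<mu> * coeff q k" for k
      unfolding q by (auto simp: coeff_pCons split: nat.splits)
    then have "pv p $ i = (\<Sum>k\<le>N. (case k of 0 \<Rightarrow> 0 | Suc k \<Rightarrow> coeff q k) * u k $ i) - \<mu> * pv q $ i"
      using i by (simp add: pv_def left_diff_distrib sum_subtractf sum_distrib_left mult.assoc)
    then show "(shift T \<mu> *\<^sub>v pv q) $ i = pv p $ i"
      using shift_vec[OF T, of "pv q"] 1 i T by (simp add: pv_def)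
  qed (use T in \<open>simp add: pv_def shift_def\<close>)
  ultimately show ?thesis using pvY[of q] p(3) by (metis DiffI)
qed

section \<open>The theorem of Lie and Kolchin\<close>

interpretation GL: group "GL N" for N
  by (rule group_GL)

lemma sq_mult: "A \<in> carrier_mat N N \<Longrightarrow> B \<in> carrier_mat N N \<Longrightarrow> A * B \<in> carrier_mat N N"
  and sq_assoc: "A \<in> carrier_mat N N \<Longrightarrow> B \<in> carrier_mat N N \<Longrightarrow> C \<in> carrier_mat N N \<Longrightarrow>
    A * B * C = A * (B * C)" for C :: "'a::field mat"
  by auto

lemma connectedin_joined:
  assumes "a \<in> H" "\<And>x. x \<in> H \<Longrightarrow> \<exists>S. connectedin X S \<and> a \<in> S \<and> x \<in> S \<and> S \<subseteq> H"
  shows "connectedin X H"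
proof -
  let ?U = "{S. connectedin X S \<and> a \<in> S \<and> S \<subseteq> H}"
  have "connectedin X (\<Union> ?U)" by (rule connectedin_Union) auto
  moreover have "\<Union> ?U = H" using assms(2) by blast
  ultimately show ?thesis by simp
qed

lemma det_minv:
  assumes "A \<in> carrier (GL N)"
  shows "det (minv A) = inverse (det A)"
proof -
  have "det A * det (minv A) = 1"
    using det_mult[OF GL_carrier_mat[OF assms] GL_carrier_mat[OF minv_GL[OF assms]]] minv_right[OF assms]
    by simp
  then show ?thesis by (metis inverse_unique)
qed

lemma continuous_map_mult_left:
  assumes x: "x \<in> carrier (GL N)"
  shows "continuous_map (zariski N) (zariski N) ((*) x)"
proof (rule continuous_map_regular)
  show "(*) x \<in> reg.mats N N N"
    by (rule reg.mats_mult[OF mats_const mats_id]) (use x GL_carrier_mat in auto)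
  have "(\<lambda>A. inverse (det x) * inverse (det A)) \<in> regular_on UNIV N"
    by (intro reg.mult regular_on_const regular_on_inv_det) auto
  then show "(\<lambda>A. inverse (det (x * A))) \<in> regular_on UNIV N"
    by (rule reg.cong) (use x in \<open>auto simp: det_mult carrier_GL\<close>)
qed (use x mult_GL in auto)

text \<open>Commutators have determinant 1, so the inverse determinant of the image is constant and
  causes no trouble.\<close>

lemma continuous_map_commutator:
  assumes x: "x \<in> carrier (GL N)"
  shows "continuous_map (zariski N) (zariski N) (\<lambda>k. x * k * minv x * minv k)"
proof (rule continuous_map_regular)
  have minv: "minv \<in> reg.mats N N N"
    using reg.mats_minv[OF mats_id regular_on_inv_det] by simp
  show "(\<lambda>k. x * k * minv x * minv k) \<in> reg.mats N N N"
    by (rule reg.mats_mult[OF reg.mats_mult[OF reg.mats_mult[OF mats_const mats_id] mats_const] minv])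
       (use x GL_carrier_mat minv_GL in auto)
  have "det (x * A * minv x * minv A) = 1" if A: "A \<in> carrier (GL N)" for A
  proof -
    have "x \<in> carrier_mat N N" "A \<in> carrier_mat N N" "minv x \<in> carrier_mat N N" "minv A \<in> carrier_mat N N"
      using x A minv_GL GL_carrier_mat by blast+
    then have "det (x * A * minv x * minv A) = det x * det A * det (minv x) * det (minv A)"
      using det_mult by (metis mult_carrier_mat)
    then show ?thesis using x A det_minv[OF x] det_minv[OF A] by (simp add: carrier_GL field_simps)
  qed
  then show "(\<lambda>A. inverse (det (x * A * minv x * minv A))) \<in> regular_on UNIV N"
    by (intro reg.cong[OF regular_on_const[of 1]]) auto
qed (use x in \<open>auto intro!: mult_GL minv_GL\<close>)

text \<open>For fixed \<open>a\<close>, the commutators of \<open>a\<close> with elements of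
  \<open>H\<close> form a connected set through 1. The inverse of a commutator is a commutator, and
  a product \<open>h1 * h2\<close> is reached by a set joining 1 to \<open>h1\<close> followed by
  the translate by \<open>h1\<close> of one joining 1 to \<open>h2\<close>.\<close>

lemma connectedin_derived:
  assumes H: "subgroup H (GL N)" and conn: "connectedin (zariski N) H"
  shows "connectedin (zariski N) (derived (GL N) H)"
proof (rule connectedin_joined)
  have HG: "h \<in> H \<Longrightarrow> h \<in> carrier (GL N)" for h using H by (meson subgroup.mem_carrier)
  have gen1: "\<one>\<^bsub>GL N\<^esub> \<in> derived (GL N) H" by (simp only: derived_def generate.one)
  then show "1\<^sub>m N \<in> derived (GL N) H" by simp
  have comm: "\<exists>S. connectedin (zariski N) S \<and> 1\<^sub>m N \<in> S \<and> a * b * minv a * minv b \<in> S \<and> S \<subseteq> derived (GL N) H"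
    if ab: "a \<in> H" "b \<in> H" for a b
  proof (intro exI conjI)
    let ?S = "(\<lambda>k. a * k * minv a * minv k) ` H"
    show "connectedin (zariski N) ?S"
      by (rule connectedin_continuous_map_image[OF continuous_map_commutator conn]) (use ab HG in auto)
    show "a * b * minv a * minv b \<in> ?S" using ab by blast
    have "1\<^sub>m N \<in> H" using subgroup.one_closed[OF H] by simp
    moreover have "a * 1\<^sub>m N * minv a * minv (1\<^sub>m N) = 1\<^sub>m N"
    proof -
      have "a * 1\<^sub>m N = a" using GL_carrier_mat[OF HG[OF ab(1)]] by simp
      then show ?thesis using minv_right[OF HG[OF ab(1)]] by simp
    qed
    ultimately show "1\<^sub>m N \<in> ?S" by (intro image_eqI[of _ _ "1\<^sub>m N"]) auto
    show "?S \<subseteq> derived (GL N) H"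
    proof
      fix y assume "y \<in> ?S"
      then obtain k where k: "k \<in> H" "y = a * k * minv a * minv k" by blast
      then have "y = a \<otimes>\<^bsub>GL N\<^esub> k \<otimes>\<^bsub>GL N\<^esub> inv\<^bsub>GL N\<^esub> a \<otimes>\<^bsub>GL N\<^esub> inv\<^bsub>GL N\<^esub> k"
        using ab HG by (simp add: inv_GL)
      then show "y \<in> derived (GL N) H"
        unfolding derived_def using ab(1) k(1) by (intro generate.incl) blast
    qed
  qed
  have comm': "\<exists>a\<in>H. \<exists>b\<in>H. h = a * b * minv a * minv b" if "h \<in> derived_set (GL N) H" for h
    using that HG by (auto simp: inv_GL)
  fix x assume "x \<in> derived (GL N) H"
  then show "\<exists>S. connectedin (zariski N) S \<and> 1\<^sub>m N \<in> S \<and> x \<in> S \<and> S \<subseteq> derived (GL N) H"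
    unfolding derived_def
  proof (induction rule: generate.induct)
    case one
    show ?case
      by (rule exI[of _ "{1\<^sub>m N}"]) (use gen1 in \<open>auto simp: topspace_zariski one_GL derived_def\<close>)
  next
    case (incl h)
    obtain a b where ab: "a \<in> H" "b \<in> H" "h = a * b * minv a * minv b" using comm'[OF incl] by blast
    show ?case using comm[OF ab(1,2)] unfolding ab(3) derived_def .
  next
    case (inv h)
    obtain a b where ab: "a \<in> H" "b \<in> H" "h = a * b * minv a * minv b" using comm'[OF inv] by blast
    have "h = a \<otimes>\<^bsub>GL N\<^esub> b \<otimes>\<^bsub>GL N\<^esub> inv\<^bsub>GL N\<^esub> a \<otimes>\<^bsub>GL N\<^esub> inv\<^bsub>GL N\<^esub> b"
      using ab HG by (simp add: inv_GL)
    then have "inv\<^bsub>GL N\<^esub> h = b \<otimes>\<^bsub>GL N\<^esub> a \<otimes>\<^bsub>GL N\<^esub> inv\<^bsub>GL N\<^esub> b \<otimes>\<^bsub>GL N\<^esub> inv\<^bsub>GL N\<^esub> a"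
      using HG[OF ab(1)] HG[OF ab(2)] by (simp only: GL.inv_mult_group GL.m_assoc GL.m_closed GL.inv_closed GL.inv_inv)
    then have "inv\<^bsub>GL N\<^esub> h = b * a * minv b * minv a"
      using HG[OF ab(1)] HG[OF ab(2)] by (simp add: inv_GL)
    then show ?case using comm[OF ab(2,1)] unfolding derived_def by (simp only:)
  next
    case (eng h1 h2)
    obtain S where S: "connectedin (zariski N) S" "1\<^sub>m N \<in> S" "h1 \<in> S" "S \<subseteq> generate (GL N) (derived_set (GL N) H)"
      using eng.IH(1) by blast
    obtain S' where S': "connectedin (zariski N) S'" "1\<^sub>m N \<in> S'" "h2 \<in> S'" "S' \<subseteq> generate (GL N) (derived_set (GL N) H)"
      using eng.IH(2) by blast
    have h1: "h1 \<in> carrier (GL N)"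
      using S(1,3) by (auto simp: connectedin_def topspace_zariski)
    show ?case
    proof (intro exI conjI)
      have "connectedin (zariski N) ((*) h1 ` S')"
        by (rule connectedin_continuous_map_image[OF continuous_map_mult_left[OF h1] S'(1)])
      moreover have "h1 \<in> S \<inter> (*) h1 ` S'"
      proof -
        have "h1 = h1 * 1\<^sub>m N" using GL_carrier_mat[OF h1] by simp
        then show ?thesis using S(3) S'(2) by blast
      qed
      ultimately show "connectedin (zariski N) (S \<union> (*) h1 ` S')"
        by (intro connectedin_Un[OF S(1)]) auto
      show "1\<^sub>m N \<in> S \<union> (*) h1 ` S'" "h1 \<otimes>\<^bsub>GL N\<^esub> h2 \<in> S \<union> (*) h1 ` S'"
        using S(2) S'(3) by auto
      show "S \<union> (*) h1 ` S' \<subseteq> generate (GL N) (derived_set (GL N) H)"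
      proof -
        have "h1 * s \<in> generate (GL N) (derived_set (GL N) H)" if "s \<in> S'" for s
          using generate.eng[OF eng.hyps(1), of s] S'(4) that by auto
        then show ?thesis using S(4) by blast
      qed
    qed
  qed
qed

text \<open>The derived series of \<open>H\<close> is the same whether it is taken in
  \<open>H\<close> or in the ambient group, where the topological statements live.\<close>

lemma solvable_GL_iff:
  assumes H: "subgroup H (GL N)"
  shows "solvable ((GL N)\<lparr>carrier := H\<rparr>) \<longleftrightarrow> (\<exists>n. (derived (GL N) ^^ n) H = {1\<^sub>m N})"
proof -
  have grp: "group ((GL N)\<lparr>carrier := H\<rparr>)" using GL.subgroup_imp_group[OF H] .
  have "(derived (GL N) ^^ n) H \<subseteq> H \<and>
      (derived ((GL N)\<lparr>carrier := H\<rparr>) ^^ n) H = (derived (GL N) ^^ n) H" for n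
    by (induction n) (auto simp: GL.derived_consistent[OF _ H] dest: GL.derived_incl[OF _ H])
  then show ?thesis
    using group.solvable_iff_trivial_derived_seq[OF grp] by simp
qed

text \<open>Subspaces are given by linear equations, so that stability conditions such as
  \<open>M *\<^sub>v (h *\<^sub>v v) \<in> U\<close> are visibly closed conditions on
  \<open>h\<close>.\<close>

definition closed_subsp :: "nat \<Rightarrow> 'a::field vec set \<Rightarrow> bool" where
  "closed_subsp N U \<longleftrightarrow> (\<exists>\<Phi>\<subseteq>carrier_vec N. U = {v \<in> carrier_vec N. \<forall>\<phi>\<in>\<Phi>. \<phi> \<bullet> v = 0})"

lemma closed_subsp_subsp: "closed_subsp N U \<Longrightarrow> subsp N U"
  unfolding closed_subsp_def subsp_def
  by (auto simp: subset_iff scalar_prod_add_distrib[of _ N])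

text \<open>The equations of \<open>U\<close> are pulled back along each \<open>M d\<close> by the
  transposed matrix and added to those of \<open>Y\<close>.\<close>

lemma closed_subsp_stabilizer:
  assumes Y: "closed_subsp N Y" and U: "closed_subsp N U" and M: "\<And>d. d \<in> D \<Longrightarrow> M d \<in> carrier_mat N N"
  shows "closed_subsp N {v \<in> Y. \<forall>d\<in>D. M d *\<^sub>v v \<in> U}"
proof -
  obtain \<Phi> where \<Phi>: "\<Phi> \<subseteq> carrier_vec N" "Y = {v \<in> carrier_vec N. \<forall>\<phi>\<in>\<Phi>. \<phi> \<bullet> v = 0}"
    using Y by (auto simp: closed_subsp_def)
  obtain \<Psi> where \<Psi>: "\<Psi> \<subseteq> carrier_vec N" "U = {v \<in> carrier_vec N. \<forall>\<phi>\<in>\<Psi>. \<phi> \<bullet> v = 0}"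
    using U by (auto simp: closed_subsp_def)
  have "((M d)\<^sup>T *\<^sub>v \<phi>) \<bullet> v = \<phi> \<bullet> (M d *\<^sub>v v)" if "d \<in> D" "\<phi> \<in> \<Psi>" "v \<in> carrier_vec N" for d \<phi> v
    by (rule transpose_vec_mult_scalar[OF M[OF that(1)] that(3)]) (use that \<Psi>(1) in blast)
  note eq = this
  have "(\<forall>d\<in>D. M d *\<^sub>v v \<in> U) \<longleftrightarrow> (\<forall>d\<in>D. \<forall>\<phi>\<in>\<Psi>. ((M d)\<^sup>T *\<^sub>v \<phi>) \<bullet> v = 0)"
    if v: "v \<in> carrier_vec N" for v
  proof -
    have "M d *\<^sub>v v \<in> carrier_vec N" if "d \<in> D" for d
      using mult_mat_vec_carrier[OF M[OF that] v] .
    then show ?thesis using eq[OF _ _ v] unfolding \<Psi>(2) by auto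
  qed
  then have "{v \<in> Y. \<forall>d\<in>D. M d *\<^sub>v v \<in> U} =
      {v \<in> carrier_vec N. \<forall>\<phi>\<in>\<Phi> \<union> (\<Union>d\<in>D. (\<lambda>\<phi>. (M d)\<^sup>T *\<^sub>v \<phi>) ` \<Psi>). \<phi> \<bullet> v = 0}"
    unfolding \<Phi>(2) by auto
  moreover have "\<Phi> \<union> (\<Union>d\<in>D. (\<lambda>\<phi>. (M d)\<^sup>T *\<^sub>v \<phi>) ` \<Psi>) \<subseteq> carrier_vec N"
    using \<Phi>(1) \<Psi>(1) M by (force intro!: mult_mat_vec_carrier[of _ N N])
  ultimately show ?thesis unfolding closed_subsp_def by blast
qed

lemma closedin_mult_vec:
  assumes U: "closed_subsp N U" and M: "M \<in> carrier_mat N N" and v: "v \<in> carrier_vec N"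
  shows "closedin (zariski N) {h \<in> carrier (GL N). M *\<^sub>v (h *\<^sub>v v) \<in> U}"
proof -
  obtain \<Phi> where \<Phi>: "\<Phi> \<subseteq> carrier_vec N" "U = {v \<in> carrier_vec N. \<forall>\<phi>\<in>\<Phi>. \<phi> \<bullet> v = 0}"
    using U by (auto simp: closed_subsp_def)
  have 1: "closedin (zariski N) {h \<in> carrier (GL N). \<phi> \<bullet> (M *\<^sub>v (h *\<^sub>v v)) = 0}" if "\<phi> \<in> \<Phi>" for \<phi>
  proof (rule closedin_zero)
    have "(\<lambda>h. \<Sum>i\<in>{0..<N}. \<phi> $ i * (\<Sum>j\<in>{0..<N}. M $$ (i, j) * (\<Sum>l\<in>{0..<N}. h $$ (j, l) * v $ l)))
       \<in> regular_on UNIV N"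
      by (intro reg.sum reg.mult regular_on_const regular_onI regular_funs.entry) auto
    then show "(\<lambda>h. \<phi> \<bullet> (M *\<^sub>v (h *\<^sub>v v))) \<in> regular_on UNIV N"
    proof (rule reg.cong)
      fix h :: "'a mat" assume "h \<in> carrier (GL N)"
      then have "h \<in> carrier_mat N N" by (rule GL_carrier_mat)
      then show "\<phi> \<bullet> (M *\<^sub>v (h *\<^sub>v v)) =
         (\<Sum>i\<in>{0..<N}. \<phi> $ i * (\<Sum>j\<in>{0..<N}. M $$ (i, j) * (\<Sum>l\<in>{0..<N}. h $$ (j, l) * v $ l)))"
        using M v by (auto simp: scalar_prod_def intro!: sum.cong)
    qed
  qed
  let ?Z = "\<lambda>\<phi>. {h \<in> carrier (GL N). \<phi> \<bullet> (M *\<^sub>v (h *\<^sub>v v)) = 0}"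
  have c: "M *\<^sub>v (h *\<^sub>v v) \<in> carrier_vec N" if "h \<in> carrier (GL N)" for h
    using M v GL_carrier_mat[OF that] by (intro mult_mat_vec_carrier[of _ N N])
  have "closedin (zariski N) (carrier (GL N))"
    using closedin_topspace[of "zariski N"] by (simp add: topspace_zariski)
  then have "closedin (zariski N) (\<Inter> (insert (carrier (GL N)) (?Z ` \<Phi>)))"
    using 1 by (intro closedin_Inter) blast+
  moreover have "\<Inter> (insert (carrier (GL N)) (?Z ` \<Phi>)) = {h \<in> carrier (GL N). M *\<^sub>v (h *\<^sub>v v) \<in> U}"
    using c by (auto simp: \<Phi>(2))
  ultimately show ?thesis by simp
qed

text \<open>The translates of an eigenvector of \<open>A\<close> under a connected group have the same eigenvalue as
  soon as they are eigenvectors, because \<open>A\<close> has only finitely many eigenvalues.\<close>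

lemma eigenvalue_propagates:
  assumes H: "subgroup H (GL N)" and conn: "connectedin (zariski N) H"
    and U: "closed_subsp N U" and HU: "\<And>h u. h \<in> H \<Longrightarrow> u \<in> U \<Longrightarrow> h *\<^sub>v u \<in> U"
    and A: "A \<in> carrier_mat N N" "\<forall>u\<in>U. A *\<^sub>v u \<in> U"
    and v: "v \<in> carrier_vec N" "v \<notin> U" "shift A c0 *\<^sub>v v \<in> U"
    and ex: "\<And>h. h \<in> H \<Longrightarrow> \<exists>c. shift A c *\<^sub>v (h *\<^sub>v v) \<in> U"
    and h: "h \<in> H"
  shows "shift A c0 *\<^sub>v (h *\<^sub>v v) \<in> U"
proof -
  have sU: "subsp N U" using closed_subsp_subsp[OF U] .
  have HG: "h \<in> H \<Longrightarrow> h \<in> carrier (GL N)" for h using H by (meson subgroup.mem_carrier)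
  have hv: "h *\<^sub>v v \<in> carrier_vec N" if "h \<in> H" for h
    using GL_carrier_mat[OF HG[OF that]] v(1) by simp
  \<comment> \<open>Otherwise translating back by the inverse of \<open>h\<close> would put
    \<open>v\<close> into \<open>U\<close>.\<close>
  have nU: "h *\<^sub>v v \<notin> U" if "h \<in> H" for h
  proof
    assume "h *\<^sub>v v \<in> U"
    moreover have "minv h \<in> H" using subgroup.m_inv_closed[OF H that] inv_GL[OF HG[OF that]] by simp
    ultimately have "minv h *\<^sub>v (h *\<^sub>v v) \<in> U" using HU by blast
    then show False using v(1,2) minv_cancel_vec(1)[OF HG[OF that]] by simp
  qed
  have "h \<in> {h \<in> carrier (GL N). shift A c0 *\<^sub>v (h *\<^sub>v v) \<in> U}"
  proof (rule connectedin_finite_closed_partition[OF conn finite_eigenvalues[OF A(1)], where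
        Z = "\<lambda>c. {h \<in> carrier (GL N). shift A c *\<^sub>v (h *\<^sub>v v) \<in> U}"])
    show "closedin (zariski N) {h \<in> carrier (GL N). shift A c *\<^sub>v (h *\<^sub>v v) \<in> U}" for c
      by (rule closedin_mult_vec[OF U shift_carrier[OF A(1)] v(1)])
    fix k assume k: "k \<in> H"
    then obtain c where c: "shift A c *\<^sub>v (k *\<^sub>v v) \<in> U" using ex by blast
    have "eigenvalue A c" by (rule relative_eigenvalue[OF A(1) sU A(2) hv[OF k] nU[OF k] c])
    then show "\<exists>c\<in>{c. eigenvalue A c}. k \<in> {h \<in> carrier (GL N). shift A c *\<^sub>v (h *\<^sub>v v) \<in> U}"
      using c HG[OF k] by blast
    fix c c' assume "k \<in> {h \<in> carrier (GL N). shift A c *\<^sub>v (h *\<^sub>v v) \<in> U}"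
      "k \<in> {h \<in> carrier (GL N). shift A c' *\<^sub>v (h *\<^sub>v v) \<in> U}"
    then show "c = c'" using shift_diff[OF A(1) sU hv[OF k] _ _ nU[OF k]] by blast
  next
    show "1\<^sub>m N \<in> H" using subgroup.one_closed[OF H] by simp
    show "1\<^sub>m N \<in> {h \<in> carrier (GL N). shift A c0 *\<^sub>v (h *\<^sub>v v) \<in> U}"
      using v one_GL by simp
  qed (rule h)
  then show ?thesis by blast
qed

text \<open>Induction on the derived length. The derived group \<open>D\<close> has a common
  eigenvector modulo \<open>U\<close>; its weight space \<open>E\<close> is stable under
  \<open>H\<close>, because \<open>H\<close> can only permute the weights of \<open>D\<close> and a
  connected group cannot move among finitely many eigenvalues. On a minimal \<open>H\<close>-stable
  \<open>E'\<close> between \<open>U\<close> and \<open>E\<close> every element of \<open>H\<close>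
  acts as a scalar modulo \<open>U\<close>, and any vector of \<open>E'\<close> outside
  \<open>U\<close> will do.\<close>

theorem lie_kolchin:
  fixes H :: "'a::alg_closed_field mat set"
  assumes "subgroup H (GL N)" "connectedin (zariski N) H" "(derived (GL N) ^^ n) H = {1\<^sub>m N}"
    and U: "closed_subsp N U" and Y: "closed_subsp N Y" and UY: "U \<subset> Y"
    and "\<And>h u. h \<in> H \<Longrightarrow> u \<in> U \<Longrightarrow> h *\<^sub>v u \<in> U" "\<And>h u. h \<in> H \<Longrightarrow> u \<in> Y \<Longrightarrow> h *\<^sub>v u \<in> Y"
  shows "\<exists>v\<in>Y - U. \<forall>h\<in>H. \<exists>c. shift h c *\<^sub>v v \<in> U"
  using assms(1-3,7,8)
proof (induction n arbitrary: H)
  case 0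
  then have H: "H = {1\<^sub>m N}" by simp
  obtain v where v: "v \<in> Y" "v \<notin> U" using UY by blast
  have vc: "v \<in> carrier_vec N" using v(1) Y closed_subsp_subsp subsp_carrier by blast
  have "shift (1\<^sub>m N) 1 *\<^sub>v v = 0\<^sub>v N" using vc by (simp add: shift_vec[of _ N])
  then have "shift (1\<^sub>m N) 1 *\<^sub>v v \<in> U" using subsp_zero[OF closed_subsp_subsp[OF U]] by simp
  then show ?case using v H by blast
next
  case (Suc n)
  note sU = closed_subsp_subsp[OF U] and sY = closed_subsp_subsp[OF Y]
  note Hsub = Suc.prems(1) and HU = Suc.prems(4) and HY = Suc.prems(5)
  define D where "D = derived (GL N) H"
  have HG: "h \<in> H \<Longrightarrow> h \<in> carrier (GL N)" for h using Hsub by (meson subgroup.mem_carrier)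
  have Hm: "h \<in> H \<Longrightarrow> h \<in> carrier_mat N N" for h using HG GL_carrier_mat by blast
  have DH: "D \<subseteq> H" unfolding D_def using GL.derived_incl[OF _ Hsub] by blast
  have "\<exists>v\<in>Y - U. \<forall>h\<in>D. \<exists>c. shift h c *\<^sub>v v \<in> U"
  proof (rule Suc.IH)
    show "subgroup D (GL N)" unfolding D_def using GL.derived_is_subgroup[OF subgroup.subset[OF Hsub]] .
    show "connectedin (zariski N) D" unfolding D_def by (rule connectedin_derived[OF Hsub Suc.prems(2)])
    show "(derived (GL N) ^^ n) D = {1\<^sub>m N}" using Suc.prems(3) by (simp add: D_def funpow_swap1)
  qed (use DH HU HY in blast)+
  then obtain v0 \<chi> where v0: "v0 \<in> Y" "v0 \<notin> U" "\<And>d. d \<in> D \<Longrightarrow> shift d (\<chi> d) *\<^sub>v v0 \<in> U"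
    by (metis Diff_iff)
  \<comment> \<open>The weight space, modulo \<open>U\<close>, of the derived group for the weight
    \<open>\<chi>\<close> of \<open>v0\<close>.\<close>
  define E where "E = {v \<in> Y. \<forall>d\<in>D. shift d (\<chi> d) *\<^sub>v v \<in> U}"
  have Ec: "closed_subsp N E" unfolding E_def
    by (rule closed_subsp_stabilizer[OF Y U]) (use DH Hm shift_carrier in blast)
  have UE: "U \<subset> E"
  proof -
    have "U \<subseteq> E" unfolding E_def using UY DH Hm HU shift_stable[OF _ sU] by blast
    moreover have "v0 \<in> E" using v0 by (simp add: E_def)
    ultimately show ?thesis using v0 by blast
  qed
  have EH: "h *\<^sub>v v \<in> E" if h: "h \<in> H" and v: "v \<in> E" for h v
  proof (cases "v \<in> U")
    case True
    then show ?thesis using HU[OF h] UE by blast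
  next
    case False
    have vY: "v \<in> Y" using v by (simp add: E_def)
    have vc: "v \<in> carrier_vec N" using vY sY subsp_carrier by blast
    have "shift d (\<chi> d) *\<^sub>v (h *\<^sub>v v) \<in> U" if d: "d \<in> D" for d
    proof (rule eigenvalue_propagates[OF Hsub Suc.prems(2) U HU _ _ vc False _ _ h])
      show "d \<in> carrier_mat N N" "\<forall>u\<in>U. d *\<^sub>v u \<in> U" using d DH Hm HU by blast+
      show "shift d (\<chi> d) *\<^sub>v v \<in> U" using v d by (simp add: E_def)
      fix k assume k: "k \<in> H"
      note km = Hm[OF k] and dm = Hm[OF subsetD[OF DH d]] and kim = minv_carrier_mat[OF Hm[OF k]]
      \<comment> \<open>Normality of \<open>D\<close> puts this conjugate into \<open>D\<close>.
        Hence the translate of \<open>v\<close> by \<open>k\<close> is again an eigenvector of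
        \<open>d\<close> modulo \<open>U\<close>, with the eigenvalue that \<open>d'\<close> has on
        \<open>v\<close>.\<close>
      define d' where "d' = minv k * d * k"
      have "D \<lhd> (GL N)\<lparr>carrier := H\<rparr>" unfolding D_def by (rule GL.derived_subgroup_is_normal[OF Hsub])
      then have "inv\<^bsub>(GL N)\<lparr>carrier := H\<rparr>\<^esub> k \<otimes>\<^bsub>GL N\<^esub> d \<otimes>\<^bsub>GL N\<^esub> k \<in> D"
        using normal.inv_op_closed1[of D "(GL N)\<lparr>carrier := H\<rparr>" k d] k d by simp
      then have d': "d' \<in> D"
        using GL.m_inv_consistent[OF Hsub k] inv_GL[OF HG[OF k]] by (simp add: d'_def)
      have dm': "d' \<in> carrier_mat N N" using d' DH Hm by blast
      have "k *\<^sub>v (shift d' (\<chi> d') *\<^sub>v v) \<in> U" using v d' HU[OF k] by (simp add: E_def)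
      moreover have "k *\<^sub>v (d' *\<^sub>v v) = d *\<^sub>v (k *\<^sub>v v)"
      proof -
        have "k * d' = k * (minv k * (d * k))" unfolding d'_def using km dm kim by (simp add: sq_assoc[of _ N] sq_mult del: assoc_mult_mat)
        also have "\<dots> = d * k" by (rule minv_cancel(2)[OF HG[OF k], of _ N]) (use dm km in simp)
        finally have "k * d' = d * k" .
        then show ?thesis
          using assoc_mult_mat_vec[OF km dm' vc] assoc_mult_mat_vec[OF dm km vc] by simp
      qed
      ultimately have "shift d (\<chi> d') *\<^sub>v (k *\<^sub>v v) \<in> U"
        using km dm dm' vc
        by (simp add: shift_vec[of _ N] mult_minus_distrib_mat_vec[OF km] mult_mat_vec[OF km])
      then show "\<exists>c. shift d c *\<^sub>v (k *\<^sub>v v) \<in> U" by blast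
    qed
    then show ?thesis using HY[OF h vY] by (simp add: E_def)
  qed
  \<comment> \<open>A stable subspace strictly above \<open>U\<close> with the fewest leading
    indices plays the role of an irreducible one.\<close>
  define P where "P E' \<longleftrightarrow> closed_subsp N E' \<and> U \<subset> E' \<and> E' \<subseteq> E \<and> (\<forall>h\<in>H. \<forall>e\<in>E'. h *\<^sub>v e \<in> E')" for E'
  have "P E" using Ec UE EH by (simp add: P_def)
  then obtain E' where E': "P E'" and min: "\<And>F. P F \<Longrightarrow> card (leadset N E') \<le> card (leadset N F)"
    using ex_has_least_nat[of P E "\<lambda>F. card (leadset N F)"] by blast
  have cE': "closed_subsp N E'" "U \<subset> E'" "E' \<subseteq> E" "\<And>h e. h \<in> H \<Longrightarrow> e \<in> E' \<Longrightarrow> h *\<^sub>v e \<in> E'"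
    using E' by (auto simp: P_def)
  note sE' = closed_subsp_subsp[OF cE'(1)]
  have scalar: "\<exists>\<mu>. \<forall>v\<in>E'. shift g \<mu> *\<^sub>v v \<in> U" if g: "g \<in> H" for g
  proof -
    note gm = Hm[OF g] and gim = minv_carrier_mat[OF Hm[OF g]]
    obtain v1 \<mu> where v1: "v1 \<in> E'" "v1 \<notin> U" "shift g \<mu> *\<^sub>v v1 \<in> U"
      using relative_eigenvector_exists[OF gm sU sE' cE'(2)] cE'(4)[OF g] by blast
    define F where "F = {v \<in> E'. \<forall>g'\<in>{g}. shift g' \<mu> *\<^sub>v v \<in> U}"
    have "closed_subsp N F" unfolding F_def
      by (rule closed_subsp_stabilizer[OF cE'(1) U]) (use gm shift_carrier in blast)
    moreover have "U \<subset> F"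
    proof -
      have "U \<subseteq> F" unfolding F_def using cE'(2) shift_stable[OF gm sU] HU[OF g] by blast
      then show ?thesis using v1 by (auto simp: F_def)
    qed
    moreover have "h *\<^sub>v v \<in> F" if h: "h \<in> H" and v: "v \<in> F" for h v
    proof (cases "v \<in> U")
      case True
      then show ?thesis using HU[OF h] \<open>U \<subset> F\<close> by blast
    next
      case False
      have vE: "v \<in> E'" and vF: "shift g \<mu> *\<^sub>v v \<in> U" using v by (auto simp: F_def)
      have vc: "v \<in> carrier_vec N" using vE sE' subsp_carrier by blast
      have "shift g \<mu> *\<^sub>v (h *\<^sub>v v) \<in> U"
      proof (rule eigenvalue_propagates[OF Hsub Suc.prems(2) U HU gm _ vc False vF _ h])
        show "\<forall>u\<in>U. g *\<^sub>v u \<in> U" using HU[OF g] by blast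
        fix k assume k: "k \<in> H"
        note km = Hm[OF k] and kim = minv_carrier_mat[OF Hm[OF k]]
        \<comment> \<open>Chosen such that \<open>k * (g * d) = g * k\<close>. As \<open>d\<close>
          acts on \<open>v\<close> by the scalar \<open>\<chi> d\<close> modulo \<open>U\<close>,
          the translate of \<open>v\<close> by \<open>k\<close> is an eigenvector of
          \<open>g\<close> with eigenvalue \<open>\<chi> d * \<mu>\<close>; connectedness then
          forces this eigenvalue to be \<open>\<mu>\<close>.\<close>
        define d where "d = minv g * minv k * g * k"
        have "minv g \<in> H" "minv k \<in> H"
          using subgroup.m_inv_closed[OF Hsub] inv_GL HG g k by metis+
        moreover have "d = minv g \<otimes>\<^bsub>GL N\<^esub> minv k \<otimes>\<^bsub>GL N\<^esub> inv\<^bsub>GL N\<^esub> (minv g) \<otimes>\<^bsub>GL N\<^esub> inv\<^bsub>GL N\<^esub> (minv k)"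
          using inv_GL[OF minv_GL[OF HG[OF g]]] minv_minv[OF HG[OF g]]
            inv_GL[OF minv_GL[OF HG[OF k]]] minv_minv[OF HG[OF k]] by (simp add: d_def)
        ultimately have d: "d \<in> D" unfolding D_def derived_def by (intro generate.incl) blast
        have dm: "d \<in> carrier_mat N N" using d DH Hm by blast
        have "k * (g * d) = g * k"
        proof -
          have "d = minv g * (minv k * (g * k))" unfolding d_def using gm km gim kim by (simp add: sq_assoc[of _ N] sq_mult del: assoc_mult_mat)
          then have "g * d = minv k * (g * k)" using minv_cancel(2)[OF HG[OF g] sq_mult[OF kim sq_mult[OF gm km]]] by simp
          then show ?thesis using minv_cancel(2)[OF HG[OF k] mult_carrier_mat[OF gm km]] by simp
        qed
        then have *: "k *\<^sub>v (g *\<^sub>v (d *\<^sub>v v)) = g *\<^sub>v (k *\<^sub>v v)"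
          using assoc_mult_mat_vec[OF km mult_carrier_mat[OF gm dm] vc] assoc_mult_mat_vec[OF gm dm vc]
            assoc_mult_mat_vec[OF gm km vc] by simp
        have "shift d (\<chi> d) *\<^sub>v v \<in> U" using vE cE'(3) d by (auto simp: E_def)
        then have u1: "k *\<^sub>v (g *\<^sub>v (shift d (\<chi> d) *\<^sub>v v)) \<in> U" using HU g k by blast
        have u2: "\<chi> d \<cdot>\<^sub>v (k *\<^sub>v (shift g \<mu> *\<^sub>v v)) \<in> U"
          using vF HU[OF k] subsp_smult[OF sU] by blast
        have "k *\<^sub>v (g *\<^sub>v (shift d (\<chi> d) *\<^sub>v v)) = g *\<^sub>v (k *\<^sub>v v) - \<chi> d \<cdot>\<^sub>v (k *\<^sub>v (g *\<^sub>v v))"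
          using gm km dm vc
          by (simp add: shift_vec[OF dm] mult_minus_distrib_mat_vec[OF gm] mult_minus_distrib_mat_vec[OF km]
             mult_mat_vec[OF gm] mult_mat_vec[OF km] *)
        moreover have "k *\<^sub>v (shift g \<mu> *\<^sub>v v) = k *\<^sub>v (g *\<^sub>v v) - \<mu> \<cdot>\<^sub>v (k *\<^sub>v v)"
          using gm km vc
          by (simp add: shift_vec[OF gm] mult_minus_distrib_mat_vec[OF km] mult_mat_vec[OF km])
        ultimately have "k *\<^sub>v (g *\<^sub>v (shift d (\<chi> d) *\<^sub>v v)) + \<chi> d \<cdot>\<^sub>v (k *\<^sub>v (shift g \<mu> *\<^sub>v v)) =
            shift g (\<chi> d * \<mu>) *\<^sub>v (k *\<^sub>v v)"
          using gm km vc by (intro eq_vecI) (auto simp: shift_vec[OF gm] right_diff_distrib simp del: index_mult_mat_vec)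
        then have "shift g (\<chi> d * \<mu>) *\<^sub>v (k *\<^sub>v v) \<in> U" using subsp_add[OF sU u1 u2] by simp
        then show "\<exists>c. shift g c *\<^sub>v (k *\<^sub>v v) \<in> U" by blast
      qed
      then show ?thesis using cE'(4)[OF h vE] by (simp add: F_def)
    qed
    ultimately have "P F" using cE'(3) by (auto simp: P_def F_def)
    have FE: "F \<subseteq> E'" by (auto simp: F_def)
    \<comment> \<open>Minimality of \<open>E'\<close> applied to the eigenspace \<open>F\<close> of
      \<open>g\<close> in it.\<close>
    have "leadset N F = leadset N E'"
      by (rule card_seteq[OF finite_leadset leadset_mono[OF FE] min[OF \<open>P F\<close>]])
    then have "F = E'"
      using subsp_eqI_leadset[OF closed_subsp_subsp sE' FE] \<open>P F\<close> by (simp add: P_def)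
    then show ?thesis by (auto simp: F_def)
  qed
  obtain v where "v \<in> E'" "v \<notin> U" using cE'(2) by blast
  moreover from this have "v \<in> Y" using cE'(3) by (auto simp: E_def)
  ultimately show ?case using scalar by blast
qed

section \<open>The stabiliser of a flag is closed, connected and solvable\<close>

section \<open>Triangular matrices\<close>

definition tri :: "nat \<Rightarrow> 'a::field mat set" where
  "tri N = {A \<in> carrier (GL N). upper_triangular A}"

lemma tri_GL: "A \<in> tri N \<Longrightarrow> A \<in> carrier (GL N)"
  and tri_carrier_mat: "A \<in> tri N \<Longrightarrow> A \<in> carrier_mat N N"
  by (auto simp: tri_def carrier_GL)

lemma tri_entry: "A \<in> tri N \<Longrightarrow> j < i \<Longrightarrow> i < N \<Longrightarrow> A $$ (i, j) = 0"
  by (auto simp: tri_def carrier_GL)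

lemma det_tri: "A \<in> carrier_mat N N \<Longrightarrow> upper_triangular A \<Longrightarrow> det A = (\<Prod>i\<in>{0..<N}. A $$ (i, i))"
  by (subst det_upper_triangular) (auto simp: prod_list_diag_prod)

lemma tri_diag:
  assumes "A \<in> tri N" "i < N"
  shows "A $$ (i, i) \<noteq> 0"
proof
  assume "A $$ (i, i) = 0"
  then have "(\<Prod>i\<in>{0..<N}. A $$ (i, i)) = 0" using assms(2) by (intro prod_zero) auto
  then show False using assms(1) det_tri[of A N] by (auto simp: tri_def carrier_GL)
qed

lemma triI:
  assumes "A \<in> carrier_mat N N" "\<And>i j. j < i \<Longrightarrow> i < N \<Longrightarrow> A $$ (i, j) = 0" "\<And>i. i < N \<Longrightarrow> A $$ (i, i) \<noteq> 0"
  shows "A \<in> tri N"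
proof -
  have "upper_triangular A" using assms(1,2) by auto
  then show ?thesis using assms det_tri[of A N] by (auto simp: tri_def carrier_GL)
qed

lemma one_tri: "1\<^sub>m N \<in> tri N"
  by (simp add: tri_def one_GL)

lemma tri_mult_vec_index:
  assumes "A \<in> tri N" "i < N" "v \<in> flag N (Suc i)"
  shows "(A *\<^sub>v v) $ i = A $$ (i, i) * v $ i"
proof -
  have "(A *\<^sub>v v) $ i = (\<Sum>j\<in>{0..<N}. A $$ (i, j) * v $ j)"
    using assms tri_carrier_mat[OF assms(1)] by (auto simp: scalar_prod_def flag_def intro!: sum.cong)
  also have "\<dots> = (\<Sum>j\<in>{i}. A $$ (i, j) * v $ j)"
  proof (rule sum.mono_neutral_right)
    show "\<forall>j\<in>{0..<N} - {i}. A $$ (i, j) * v $ j = 0"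
    proof
      fix j assume "j \<in> {0..<N} - {i}"
      then have "j < i \<or> Suc i \<le> j \<and> j < N" by auto
      then show "A $$ (i, j) * v $ j = 0"
        using tri_entry[OF assms(1) _ assms(2)] assms(3) by (auto simp: flag_def)
    qed
  qed (use assms in auto)
  finally show ?thesis by simp
qed

lemma tri_flag:
  assumes "A \<in> tri N" "v \<in> flag N i"
  shows "A *\<^sub>v v \<in> flag N i"
  unfolding flag_def
proof (intro CollectI conjI allI impI)
  show "A *\<^sub>v v \<in> carrier_vec N" using assms tri_carrier_mat[OF assms(1)] by (auto simp: flag_def)
  fix l assume "i \<le> l \<and> l < N"
  then have "v \<in> flag N (Suc l)" "v $ l = 0" "l < N" using assms(2) flag_mono[of i "Suc l"] by (auto simp: flag_def)
  then show "(A *\<^sub>v v) $ l = 0" using tri_mult_vec_index[OF assms(1)] by simp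
qed

lemma tri_leads:
  assumes "A \<in> tri N" "leads N v i"
  shows "leads N (A *\<^sub>v v) i"
proof -
  have v: "v \<in> flag N (Suc i)" "i < N" using assms(2) by (simp_all add: leads_flag_Suc)
  have vi: "v $ i \<noteq> 0" using assms(2) by (simp add: leads_def)
  have "(A *\<^sub>v v) $ i \<noteq> 0" using tri_mult_vec_index[OF assms(1) v(2,1)] v vi tri_diag[OF assms(1)] by simp
  then have "A *\<^sub>v v \<notin> flag N i" using v(2) by (auto simp: flag_def)
  then show ?thesis using tri_flag[OF assms(1) v(1)] v(2) by (simp add: leads_flag_Suc)
qed

lemma leads_unit_vec: "i < N \<Longrightarrow> leads N (unit_vec N i) i"
  by (auto simp: leads_def)

lemma col_eq_mult_unit: "(A :: 'a::field mat) \<in> carrier_mat n N \<Longrightarrow> j < N \<Longrightarrow> col A j = A *\<^sub>v unit_vec N j"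
  by (intro eq_vecI) auto

text \<open>The matrix \<open>A\<close> preserves leading indices, so the preimage of the unit
  vector \<open>j\<close>, which is column \<open>j\<close> of the inverse, is led by
  \<open>j\<close>.\<close>

lemma tri_minv:
  assumes "A \<in> tri N"
  shows "minv A \<in> tri N"
proof -
  have G: "A \<in> carrier (GL N)" and M: "minv A \<in> carrier (GL N)" and m: "minv A \<in> carrier_mat N N"
    using assms tri_GL minv_GL GL_carrier_mat by blast+
  have "minv A $$ (i, j) = 0" if ij: "j < i" "i < N" for i j
  proof -
    let ?v = "minv A *\<^sub>v unit_vec N j"
    have v: "?v \<in> carrier_vec N" using m by simp
    have Av: "A *\<^sub>v ?v = unit_vec N j" by (rule minv_cancel_vec(2)[OF G]) simp
    have "?v \<noteq> 0\<^sub>v N"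
    proof
      assume "?v = 0\<^sub>v N"
      then have "A *\<^sub>v 0\<^sub>v N = unit_vec N j" using Av by simp
      moreover have "A *\<^sub>v 0\<^sub>v N = 0\<^sub>v N" using GL_carrier_mat[OF G] by (intro eq_vecI) auto
      ultimately have "unit_vec N j $ j = (0\<^sub>v N :: 'a vec) $ j" by simp
      then show False using ij by simp
    qed
    then obtain l where l: "leads N ?v l" using leads_exists[OF v] by blast
    then have "leads N (unit_vec N j :: 'a vec) l" using tri_leads[OF assms l] Av by simp
    then have "l = j" using leads_unique leads_unit_vec ij by (metis order.strict_trans)
    then have "?v $ i = 0" using l ij by (auto simp: leads_def)
    then show ?thesis using m ij col_eq_mult_unit[OF m, of j] by (metis carrier_matD(1,2) index_col order.strict_trans)
  qed
  then show ?thesis using M m by (auto simp: tri_def)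
qed

lemma tri_mult:
  assumes "A \<in> tri N" "B \<in> tri N"
  shows "A * B \<in> tri N"
proof -
  have c: "A \<in> carrier_mat N N" "B \<in> carrier_mat N N" using assms tri_carrier_mat by blast+
  have "(A * B) $$ (i, j) = 0" if ij: "j < i" "i < N" for i j
  proof -
    have "(A * B) $$ (i, j) = (\<Sum>k\<in>{0..<N}. A $$ (i, k) * B $$ (k, j))"
      using c ij by (simp add: scalar_prod_def)
    also have "\<dots> = 0"
    proof (rule sum.neutral, rule ballI)
      fix k assume "k \<in> {0..<N}"
      then show "A $$ (i, k) * B $$ (k, j) = 0"
        using tri_entry[OF assms(1), of k i] tri_entry[OF assms(2), of j k] ij by (cases "k < i") auto
    qed
    finally show ?thesis .
  qed
  then show ?thesis using mult_GL[OF tri_GL tri_GL, OF assms] c by (auto simp: tri_def)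
qed

text \<open>The matrix of \<open>h\<close> in the basis formed by the columns of \<open>g\<close>.
  For invertible \<open>h\<close>, \<open>cj g h \<in> tri N\<close> says that \<open>h\<close>
  stabilises the flag spanned by these columns.\<close>

definition cj :: "'a::field mat \<Rightarrow> 'a mat \<Rightarrow> 'a mat" where
  "cj g h = minv g * h * g"

lemma cj_carrier: "g \<in> carrier (GL N) \<Longrightarrow> h \<in> carrier_mat N N \<Longrightarrow> cj g h \<in> carrier_mat N N"
  using minv_GL GL_carrier_mat unfolding cj_def by (metis mult_carrier_mat)

lemma cj_GL: "g \<in> carrier (GL N) \<Longrightarrow> h \<in> carrier (GL N) \<Longrightarrow> cj g h \<in> carrier (GL N)"
  by (auto simp: cj_def intro!: mult_GL minv_GL)

lemma cj_mult:
  assumes "g \<in> carrier (GL N)" "h \<in> carrier_mat N N" "k \<in> carrier_mat N N"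
  shows "cj g (h * k) = cj g h * cj g k"
proof -
  have m: "g \<in> carrier_mat N N" "minv g \<in> carrier_mat N N" using assms minv_GL GL_carrier_mat by blast+
  have "cj g h * cj g k = minv g * h * (g * (minv g * (k * g)))"
    unfolding cj_def using m assms(2,3) by (simp add: sq_assoc[of _ N] sq_mult del: assoc_mult_mat)
  also have "\<dots> = minv g * h * (k * g)"
    using minv_cancel(2)[OF assms(1) mult_carrier_mat[OF assms(3) m(1)]] by simp
  also have "\<dots> = cj g (h * k)"
    unfolding cj_def using m assms(2,3) by (simp add: sq_assoc[of _ N] sq_mult del: assoc_mult_mat)
  finally show ?thesis by simp
qed

lemma cj_one: "g \<in> carrier (GL N) \<Longrightarrow> cj g (1\<^sub>m N) = 1\<^sub>m N"
  using minv_left minv_GL GL_carrier_mat unfolding cj_def by (metis right_mult_one_mat)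

lemma cj_minv:
  assumes "g \<in> carrier (GL N)" "h \<in> carrier (GL N)"
  shows "cj g (minv h) = minv (cj g h)"
proof -
  have m: "h \<in> carrier_mat N N" "minv h \<in> carrier_mat N N" using assms minv_GL GL_carrier_mat by blast+
  have "cj g h * cj g (minv h) = 1\<^sub>m N"
    using cj_mult[OF assms(1) m] minv_right[OF assms(2)] cj_one[OF assms(1)] by simp
  then show ?thesis using minv_unique[OF cj_carrier cj_carrier] assms(1) m by metis
qed

lemma cj_cj_minv:
  assumes "g \<in> carrier (GL N)" "h \<in> carrier_mat N N"
  shows "cj g (g * h * minv g) = h" "g * cj g h * minv g = h"
proof -
  have m: "g \<in> carrier_mat N N" "minv g \<in> carrier_mat N N" using assms minv_GL GL_carrier_mat by blast+
  have "cj g (g * h * minv g) = minv g * (g * h * minv g * g)"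
    unfolding cj_def using m assms(2) by (intro assoc_mult_mat) auto
  also have "g * h * minv g * g = g * h"
    by (rule minv_cancel_right(1)[OF assms(1)]) (use m assms(2) in auto)
  also have "minv g * (g * h) = h" by (rule minv_cancel(1)[OF assms])
  finally show "cj g (g * h * minv g) = h" .
  have "g * cj g h = g * (minv g * (h * g))"
    unfolding cj_def using m assms(2) by (simp add: sq_assoc[of _ N] sq_mult del: assoc_mult_mat)
  also have "\<dots> = h * g"
    using minv_cancel(2)[OF assms(1) mult_carrier_mat[OF assms(2) m(1)]] .
  finally show "g * cj g h * minv g = h" using minv_cancel_right(2)[OF assms] by simp
qed

section \<open>Solvability\<close>

text \<open>The filtration by superdiagonals: step 0 consists of the upper triangular matrices, step
  1 of the strictly upper triangular ones, and products add the steps.\<close>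

definition nil :: "nat \<Rightarrow> nat \<Rightarrow> 'a::field mat set" where
  "nil N r = {X \<in> carrier_mat N N. \<forall>i<N. \<forall>j<N. j < i + r \<longrightarrow> X $$ (i, j) = 0}"

lemma nil_mult:
  assumes "X \<in> nil N r" "Y \<in> nil N s"
  shows "X * Y \<in> nil N (r + s)"
proof -
  have "(X * Y) $$ (i, j) = 0" if ij: "i < N" "j < N" "j < i + (r + s)" for i j
  proof -
    have "(X * Y) $$ (i, j) = (\<Sum>k\<in>{0..<N}. X $$ (i, k) * Y $$ (k, j))"
      using assms ij by (auto simp: scalar_prod_def nil_def)
    also have "\<dots> = 0"
    proof (rule sum.neutral, rule ballI)
      fix k assume "k \<in> {0..<N}"
      then show "X $$ (i, k) * Y $$ (k, j) = 0"
        using assms ij by (cases "k < i + r") (auto simp: nil_def)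
    qed
    finally show ?thesis .
  qed
  then show ?thesis using assms by (auto simp: nil_def)
qed

lemma nil_add: "X \<in> nil N r \<Longrightarrow> Y \<in> nil N r \<Longrightarrow> X + Y \<in> nil N r"
  and nil_minus: "X \<in> nil N r \<Longrightarrow> Y \<in> nil N r \<Longrightarrow> X - Y \<in> nil N r"
  by (auto simp: nil_def)

lemma nil_mono: "r \<le> s \<Longrightarrow> nil N s \<subseteq> nil N r"
  by (auto simp: nil_def)

lemma tri_nil: "A \<in> tri N \<Longrightarrow> A \<in> nil N 0"
  by (auto simp: nil_def tri_def carrier_GL)

text \<open>A descending chain of groups from the triangular to the unipotent matrices and on
  towards the trivial group. Step 0 is separate because it imposes nothing on the diagonal.\<close>

definition uni :: "nat \<Rightarrow> nat \<Rightarrow> 'a::field mat set" where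
  "uni N r = {A \<in> tri N. r = 0 \<or> A - 1\<^sub>m N \<in> nil N r}"

lemma uni_tri: "A \<in> uni N r \<Longrightarrow> A \<in> tri N"
  by (simp add: uni_def)

lemma uni_mult:
  assumes "A \<in> uni N r" "B \<in> uni N r"
  shows "A * B \<in> uni N r"
proof -
  have t: "A \<in> tri N" "B \<in> tri N" using assms uni_tri by blast+
  have c: "A \<in> carrier_mat N N" "B \<in> carrier_mat N N" using t tri_carrier_mat by blast+
  have "A * B - 1\<^sub>m N = (A - 1\<^sub>m N) * B + (B - 1\<^sub>m N)"
    unfolding minus_mult_distrib_mat[OF c(1) one_carrier_mat c(2)] using c
    by (intro eq_matI) (auto simp del: index_mult_mat(1))
  then have "A * B - 1\<^sub>m N \<in> nil N r" if "r \<noteq> 0"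
    using assms that nil_mult[OF _ tri_nil[OF t(2)], of "A - 1\<^sub>m N" r] nil_add by (auto simp: uni_def)
  then show ?thesis using tri_mult[OF t] by (auto simp: uni_def)
qed

lemma uni_minv:
  assumes "A \<in> uni N r"
  shows "minv A \<in> uni N r"
proof -
  have t: "A \<in> tri N" using assms uni_tri by blast
  have t': "minv A \<in> tri N" using tri_minv[OF t] .
  have c: "A \<in> carrier_mat N N" "minv A \<in> carrier_mat N N" using t t' tri_carrier_mat by blast+
  have "(A - 1\<^sub>m N) * minv A = 1\<^sub>m N - minv A"
    unfolding minus_mult_distrib_mat[OF c(1) one_carrier_mat c(2)]
    using c minv_right[OF tri_GL[OF t]] by simp
  then have "minv A - 1\<^sub>m N = 0\<^sub>m N N - (A - 1\<^sub>m N) * minv A"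
    using c by (intro eq_matI) (auto simp del: index_mult_mat(1))
  moreover have "0\<^sub>m N N \<in> nil N r" by (auto simp: nil_def)
  ultimately have "minv A - 1\<^sub>m N \<in> nil N r" if "r \<noteq> 0"
    using assms that nil_mult[OF _ tri_nil[OF t'], of "A - 1\<^sub>m N" r] nil_minus by (auto simp: uni_def)
  then show ?thesis using t' by (auto simp: uni_def)
qed

text \<open>The commutator minus 1 is \<open>A * B - B * A\<close> times an upper triangular matrix.
  This difference gains one superdiagonal: for \<open>r = 0\<close> because the diagonals commute,
  otherwise because it is the additive commutator of \<open>A - 1\<close> and \<open>B - 1\<close>,
  which even lies in step \<open>r + r\<close>.\<close>

lemma uni_commutator:
  assumes "A \<in> uni N r" "B \<in> uni N r"
  shows "A * B * minv A * minv B \<in> uni N (Suc r)"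
proof -
  have t: "A \<in> tri N" "B \<in> tri N" "minv A \<in> tri N" "minv B \<in> tri N"
    using assms uni_tri tri_minv by blast+
  have c: "A \<in> carrier_mat N N" "B \<in> carrier_mat N N" "minv A \<in> carrier_mat N N" "minv B \<in> carrier_mat N N"
    using t tri_carrier_mat by blast+
  have comm: "A * B - B * A \<in> nil N (Suc r)"
  proof (cases "r = 0")
    case True
    have "(A * B - B * A) $$ (i, j) = 0" if ij: "i < N" "j < N" "j < i + 1" for i j
    proof (cases "j = i")
      case True
      have "(X * Y) $$ (i, i) = X $$ (i, i) * Y $$ (i, i)" if XY: "X \<in> tri N" "Y \<in> tri N" for X Y :: "'a mat"
      proof -
        note XYc = XY[THEN tri_carrier_mat]
        have "Y *\<^sub>v unit_vec N i \<in> flag N (Suc i)"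
          using tri_flag[OF XY(2)] leads_unit_vec[OF ij(1)] by (auto simp: leads_flag_Suc)
        moreover have "col Y i = Y *\<^sub>v unit_vec N i" by (rule col_eq_mult_unit[OF XYc(2) ij(1)])
        ultimately have "(X *\<^sub>v col Y i) $ i = X $$ (i, i) * col Y i $ i"
          using tri_mult_vec_index[OF XY(1) ij(1)] by simp
        then show ?thesis using XYc ij(1) by simp
      qed
      then show ?thesis using True t(1,2) c ij by (simp del: index_mult_mat(1))
    next
      case False
      then show ?thesis
        using ij c tri_entry[OF tri_mult[OF t(1,2)], of j i] tri_entry[OF tri_mult[OF t(2,1)], of j i]
        by (simp del: index_mult_mat(1))
    qed
    then show ?thesis using True c by (auto simp: nil_def simp del: index_mult_mat(1))
  next
    case False
    have x: "A - 1\<^sub>m N \<in> nil N r" "B - 1\<^sub>m N \<in> nil N r" using assms False by (auto simp: uni_def)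
    have e: "(X - 1\<^sub>m N) * (Y - 1\<^sub>m N) = X * Y - X - (Y - 1\<^sub>m N)" if "X \<in> carrier_mat N N" "Y \<in> carrier_mat N N" for X Y :: "'a mat"
      using that by (subst minus_mult_distrib_mat[of _ N N]) (auto simp: mult_minus_distrib_mat[of _ N N])
    have "A * B - B * A = (A - 1\<^sub>m N) * (B - 1\<^sub>m N) - (B - 1\<^sub>m N) * (A - 1\<^sub>m N)"
      unfolding e[OF c(1,2)] e[OF c(2,1)] using c by (intro eq_matI) (auto simp del: index_mult_mat(1))
    then have "A * B - B * A \<in> nil N (r + r)"
      using nil_minus[OF nil_mult[OF x] nil_mult[OF x(2,1)]] by simp
    then show ?thesis using nil_mono[of "Suc r" "r + r" N] False by auto
  qed
  have ab: "A * B \<in> carrier_mat N N" "B * A \<in> carrier_mat N N" using c by auto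
  have m: "minv A * minv B \<in> carrier_mat N N" using c by simp
  have ba: "B * A \<in> carrier (GL N)" using mult_GL tri_GL t by blast
  have "B * A * (minv A * minv B) = 1\<^sub>m N"
    using minv_right[OF ba] minv_mult[OF tri_GL[OF t(2)] tri_GL[OF t(1)]] by simp
  then have "(A * B - B * A) * (minv A * minv B) = A * B * minv A * minv B - 1\<^sub>m N"
    using minus_mult_distrib_mat[OF ab m] assoc_mult_mat[OF ab(1) c(3,4)] by simp
  then have "A * B * minv A * minv B - 1\<^sub>m N \<in> nil N (Suc r)"
    using nil_mult[OF comm tri_nil[OF tri_mult[OF t(3,4)]]] by simp
  then show ?thesis using tri_mult[OF tri_mult[OF tri_mult[OF t(1,2)] t(3)] t(4)] by (auto simp: uni_def)
qed

lemma subgroup_cj_uni: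
  assumes g: "g \<in> carrier (GL N)"
  shows "subgroup {h \<in> carrier (GL N). cj g h \<in> uni N r} (GL N)"
proof (rule GL.subgroupI)
  have "1\<^sub>m N \<in> uni N r" by (auto simp: uni_def one_tri nil_def)
  then show "{h \<in> carrier (GL N). cj g h \<in> uni N r} \<noteq> {}" using cj_one[OF g] one_GL by force
  show "inv\<^bsub>GL N\<^esub> a \<in> {h \<in> carrier (GL N). cj g h \<in> uni N r}"
    if "a \<in> {h \<in> carrier (GL N). cj g h \<in> uni N r}" for a
    using that by (auto simp: inv_GL minv_GL cj_minv[OF g] uni_minv)
  show "a \<otimes>\<^bsub>GL N\<^esub> b \<in> {h \<in> carrier (GL N). cj g h \<in> uni N r}"
    if "a \<in> {h \<in> carrier (GL N). cj g h \<in> uni N r}" "b \<in> {h \<in> carrier (GL N). cj g h \<in> uni N r}" for a b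
    using that by (auto simp: mult_GL cj_mult[OF g] GL_carrier_mat uni_mult)
qed auto

lemma solvable_triangularizable:
  assumes H: "subgroup H (GL N)" and g: "g \<in> carrier (GL N)" and tr: "\<And>h. h \<in> H \<Longrightarrow> cj g h \<in> tri N"
  shows "solvable ((GL N)\<lparr>carrier := H\<rparr>)"
proof -
  let ?C = "\<lambda>r. {h \<in> carrier (GL N). cj g h \<in> uni N r}"
  have "(derived (GL N) ^^ r) H \<subseteq> ?C r" for r
  proof (induction r)
    case 0
    then show ?case using tr H by (auto simp: uni_def subgroup.mem_carrier)
  next
    case (Suc r)
    have "derived (GL N) (?C r) \<subseteq> ?C (Suc r)"
      unfolding derived_def
    proof (rule GL.generate_subgroup_incl[OF _ subgroup_cj_uni[OF g]])
      show "derived_set (GL N) (?C r) \<subseteq> ?C (Suc r)"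
        using g by (auto simp: inv_GL minv_GL mult_GL cj_mult cj_minv GL_carrier_mat uni_commutator)
    qed
    then show ?case using GL.mono_derived[OF Suc] by auto
  qed
  \<comment> \<open>With \<open>Suc N\<close> instead of \<open>N\<close> the exceptional case
    \<open>r = 0\<close> of \<open>uni\<close> does not arise, even for
    \<open>N = 0\<close>.\<close>
  moreover have "?C (Suc N) \<subseteq> {1\<^sub>m N}"
  proof
    fix h assume h: "h \<in> ?C (Suc N)"
    then have hm: "h \<in> carrier_mat N N" and "cj g h - 1\<^sub>m N \<in> nil N (Suc N)" and c: "cj g h \<in> carrier_mat N N"
      using cj_carrier[OF g] by (auto simp: uni_def GL_carrier_mat)
    then have "(cj g h - 1\<^sub>m N) $$ (i, j) = 0" if "i < N" "j < N" for i j using that by (auto simp: nil_def)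
    then have "cj g h = 1\<^sub>m N" using c by (intro eq_matI) auto
    then have "h = g * 1\<^sub>m N * minv g" using cj_cj_minv(2)[OF g hm] by simp
    then show "h \<in> {1\<^sub>m N}" using minv_right[OF g] GL_carrier_mat[OF g] by simp
  qed
  ultimately have "(derived (GL N) ^^ Suc N) H \<subseteq> {1\<^sub>m N}" by blast
  moreover have "1\<^sub>m N \<in> (derived (GL N) ^^ Suc N) H"
    using subgroup.one_closed[OF GL.exp_of_derived_is_subgroup[OF H]] by (metis GL_one)
  ultimately have "(derived (GL N) ^^ Suc N) H = {1\<^sub>m N}" by blast
  then show ?thesis using solvable_GL_iff[OF H] by blast
qed

lemma closedin_triangularizable:
  assumes g: "g \<in> carrier (GL N)"
  shows "closedin (zariski N) {h \<in> carrier (GL N). cj g h \<in> tri N}"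
proof -
  let ?Z = "\<lambda>(i, j). {h \<in> carrier (GL N). cj g h $$ (i, j) = 0}"
  let ?I = "{(i, j). j < i \<and> i < N}"
  have "(\<lambda>h. minv g * h * g) \<in> reg.mats N N N"
    by (rule reg.mats_mult[OF reg.mats_mult[OF mats_const mats_id] mats_const])
       (use g minv_GL GL_carrier_mat in auto)
  then have "(\<lambda>h. cj g h $$ (i, j)) \<in> regular_on UNIV N" if "i < N" "j < N" for i j
    using reg.matsD(2) that unfolding cj_def by blast
  then have "closedin (zariski N) (?Z x)" if "x \<in> ?I" for x
    using that by (auto intro!: closedin_zero)
  moreover have "closedin (zariski N) (carrier (GL N))"
    using closedin_topspace[of "zariski N"] by (simp add: topspace_zariski)
  ultimately have "closedin (zariski N) (\<Inter> (insert (carrier (GL N)) (?Z ` ?I)))"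
    by (intro closedin_Inter) blast+
  moreover have "\<Inter> (insert (carrier (GL N)) (?Z ` ?I)) = {h \<in> carrier (GL N). cj g h \<in> tri N}"
  proof -
    have "cj g h \<in> tri N \<longleftrightarrow> (\<forall>i j. j < i \<and> i < N \<longrightarrow> cj g h $$ (i, j) = 0)" if "h \<in> carrier (GL N)" for h
      using cj_GL[OF g that] cj_carrier[OF g GL_carrier_mat[OF that]] by (auto simp: tri_def)
    then show ?thesis by auto
  qed
  ultimately show ?thesis by simp
qed

section \<open>Connectedness\<close>

text \<open>For \<open>s \<noteq> 0\<close> this is conjugation by a diagonal matrix with entries \<open>s\<^sup>-\<^sup>i\<close>; it contracts \<open>A\<close> to its
  diagonal as \<open>s\<close> tends to \<open>0\<close>.\<close>

definition contr :: "'a::field \<Rightarrow> 'a mat \<Rightarrow> 'a mat" where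
  "contr s A = mat (dim_row A) (dim_col A) (\<lambda>(i, j). if i \<le> j then s ^ (j - i) * A $$ (i, j) else 0)"

lemma contr_tri:
  assumes "A \<in> tri N"
  shows "contr s A \<in> tri N"
  by (rule triI) (use tri_carrier_mat[OF assms] tri_diag[OF assms] in \<open>auto simp: contr_def\<close>)

text \<open>The curve \<open>contr s A\<close> runs from \<open>A\<close> at \<open>s = 1\<close> to
  its diagonal part at \<open>s = 0\<close>, so only diagonal matrices remain to be joined with 1.
  The statement for subsets covers the triangular group as well as its isometries.\<close>

lemma connectedin_tri_subset:
  fixes H :: "'a::alg_closed_field mat set"
  assumes H: "H \<subseteq> tri N" "1\<^sub>m N \<in> H" and contr: "\<And>A s. A \<in> H \<Longrightarrow> contr s A \<in> H"
    and diag: "\<And>A. A \<in> H \<Longrightarrow> (\<And>i j. i < N \<Longrightarrow> j < N \<Longrightarrow> i \<noteq> j \<Longrightarrow> A $$ (i, j) = 0) \<Longrightarrow>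
       \<exists>S. connectedin (zariski N) S \<and> 1\<^sub>m N \<in> S \<and> A \<in> S \<and> S \<subseteq> H"
  shows "connectedin (zariski N) H"
proof (rule connectedin_joined[OF H(2)])
  fix A assume A: "A \<in> H"
  have t: "A \<in> tri N" and c: "A \<in> carrier_mat N N" using A H tri_carrier_mat by blast+
  let ?S = "(\<lambda>s. contr s A) ` UNIV"
  have "connectedin (zariski N) ?S"
  proof (rule connectedin_rational_curve)
    show "(\<lambda>s. contr s A) \<in> rat.mats UNIV N N"
    proof (rule rat.matsI)
      fix i j assume ij: "i < N" "j < N"
      have "poly (if i \<le> j then monom (A $$ (i, j)) (j - i) else 0) \<in> rational_on UNIV"
        by (rule rational_on_poly)
      then show "(\<lambda>s. contr s A $$ (i, j)) \<in> rational_on UNIV"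
        by (rule rat.cong) (use ij c in \<open>auto simp: contr_def poly_monom mult.commute\<close>)
    qed (use c in \<open>auto simp: contr_def\<close>)
    show "det (contr s A) \<noteq> 0" for s using tri_GL[OF contr_tri[OF t]] by (simp add: carrier_GL)
  qed simp
  moreover have "contr 0 A $$ (i, j) = 0" if "i < N" "j < N" "i \<noteq> j" for i j
    using that c by (auto simp: contr_def power_0_left)
  then obtain S' where S': "connectedin (zariski N) S'" "1\<^sub>m N \<in> S'" "contr 0 A \<in> S'" "S' \<subseteq> H"
    using diag[OF contr[OF A, of 0]] by blast
  ultimately have "connectedin (zariski N) (?S \<union> S')" by (intro connectedin_Un) auto
  moreover have "A = contr 1 A" using c tri_entry[OF t] by (intro eq_matI) (auto simp: contr_def not_le)
  then have "A \<in> ?S" by blast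
  ultimately show "\<exists>S. connectedin (zariski N) S \<and> 1\<^sub>m N \<in> S \<and> A \<in> S \<and> S \<subseteq> H"
    using S' contr[OF A] by (intro exI[of _ "?S \<union> S'"]) auto
qed

text \<open>The indices selected by \<open>r\<close> carry inverses, as the torus of the symplectic
  group requires; the zeros of the polynomials are taken out of the line.\<close>

lemma connectedin_diag_curve:
  fixes p :: "nat \<Rightarrow> 'a::alg_closed_field poly"
  assumes p: "\<And>i. i < N \<Longrightarrow> p i \<noteq> 0"
  defines "D \<equiv> {s. \<forall>i<N. poly (p i) s \<noteq> 0}"
  shows "connectedin (zariski N) ((\<lambda>s. mat_diag N (\<lambda>i. if r i then inverse (poly (p i) s) else poly (p i) s)) ` D)"
    (is "connectedin _ (?\<gamma> ` D)")
proof (rule connectedin_rational_curve)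
  have "- D = (\<Union>i\<in>{..<N}. {s. poly (p i) s = 0})" by (auto simp: D_def)
  then show "finite (- D)" using p by (auto intro!: poly_roots_finite)
  show "?\<gamma> \<in> rat.mats D N N"
  proof (rule rat.matsI)
    fix i j assume ij: "i < N" "j < N"
    have "(\<lambda>s. inverse (poly (p j) s)) \<in> rational_on D"
      by (rule rational_on_inverse[OF rational_on_poly]) (use ij in \<open>auto simp: D_def\<close>)
    then have "(\<lambda>s. if i = j then (if r j then inverse (poly (p j) s) else poly (p j) s) else 0) \<in> rational_on D"
      using rational_on_poly[of "p j" D] rational_on_const[of 0 D]
      by (cases "i = j"; cases "r j") simp_all
    then show "(\<lambda>s. ?\<gamma> s $$ (i, j)) \<in> rational_on D"
      by (rule rat.cong) (use ij in \<open>auto simp: mat_diag_def\<close>)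
  qed auto
  fix s assume "s \<in> D"
  then have "?\<gamma> s \<in> tri N" by (intro triI) (auto simp: mat_diag_def D_def)
  then show "det (?\<gamma> s) \<noteq> 0" using tri_GL by (auto simp: carrier_GL)
qed

lemma connectedin_tri: "connectedin (zariski N) (tri N :: 'a::alg_closed_field mat set)"
proof (rule connectedin_tri_subset[OF _ one_tri contr_tri])
  fix A :: "'a mat" assume A: "A \<in> tri N" and d: "\<And>i j. i < N \<Longrightarrow> j < N \<Longrightarrow> i \<noteq> j \<Longrightarrow> A $$ (i, j) = 0"
  have c: "A \<in> carrier_mat N N" using A tri_carrier_mat by blast
  \<comment> \<open>The line with value 1 at \<open>s = 0\<close> and the diagonal entry at
    \<open>s = 1\<close>.\<close>
  define p where "p i = [:1, A $$ (i, i) - 1:]" for i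
  define D where "D = {s. \<forall>i<N. poly (p i) s \<noteq> 0}"
  let ?\<gamma> = "\<lambda>s. mat_diag N (\<lambda>i. if False then inverse (poly (p i) s) else poly (p i) s)"
  have "connectedin (zariski N) (?\<gamma> ` D)"
    unfolding D_def by (rule connectedin_diag_curve) (auto simp: p_def)
  moreover have "?\<gamma> 0 = 1\<^sub>m N" "?\<gamma> 1 = A"
    using c d by (auto intro!: eq_matI simp: mat_diag_def p_def)
  moreover have "0 \<in> D" "1 \<in> D" using tri_diag[OF A] by (auto simp: D_def p_def)
  moreover have "?\<gamma> ` D \<subseteq> tri N" by (auto intro!: triI simp: mat_diag_def D_def)
  ultimately show "\<exists>S. connectedin (zariski N) S \<and> 1\<^sub>m N \<in> S \<and> A \<in> S \<and> S \<subseteq> tri N"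
    by (metis image_eqI)
qed auto

lemma connectedin_cj:
  assumes g: "g \<in> carrier (GL N)" and H: "connectedin (zariski N) H"
  shows "connectedin (zariski N) {h \<in> carrier (GL N). cj g h \<in> H}"
proof -
  have HG: "H \<subseteq> carrier (GL N)" using H by (simp add: connectedin_def topspace_zariski)
  have "continuous_map (zariski N) (zariski N) (\<lambda>A. g * A * minv g)"
  proof (rule continuous_map_regular)
    show "(\<lambda>A. g * A * minv g) \<in> reg.mats N N N"
      by (rule reg.mats_mult[OF reg.mats_mult[OF mats_const mats_id] mats_const])
         (use g minv_GL GL_carrier_mat in auto)
    have "det (g * A * minv g) = det A" if "A \<in> carrier (GL N)" for A
      using det_mult[OF sq_mult, of g N A "minv g"] det_mult[of g N A] g that det_minv[OF g]
        minv_carrier_mat[of g N] by (simp add: carrier_GL)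
    then show "(\<lambda>A. inverse (det (g * A * minv g))) \<in> regular_on UNIV N"
      by (intro reg.cong[OF regular_on_inv_det]) auto
  qed (use g in \<open>auto intro!: mult_GL minv_GL\<close>)
  then have "connectedin (zariski N) ((\<lambda>A. g * A * minv g) ` H)"
    using connectedin_continuous_map_image H by blast
  moreover have "(\<lambda>A. g * A * minv g) ` H = {h \<in> carrier (GL N). cj g h \<in> H}"
  proof (intro equalityI subsetI)
    fix y assume "y \<in> (\<lambda>A. g * A * minv g) ` H"
    then obtain A where A: "A \<in> H" "y = g * A * minv g" by blast
    have "A \<in> carrier (GL N)" using A HG by blast
    then show "y \<in> {h \<in> carrier (GL N). cj g h \<in> H}"
      using A g cj_cj_minv(1)[OF g GL_carrier_mat] by (auto intro!: mult_GL minv_GL)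
  next
    fix h assume "h \<in> {h \<in> carrier (GL N). cj g h \<in> H}"
    then have h: "h \<in> carrier (GL N)" "cj g h \<in> H" by auto
    show "h \<in> (\<lambda>A. g * A * minv g) ` H"
      using cj_cj_minv(2)[OF g GL_carrier_mat[OF h(1)]] h(2) by (intro image_eqI[of _ _ "cj g h"]) auto
  qed
  ultimately show ?thesis by simp
qed

section \<open>Borel subgroups of the general linear group as flag stabilisers\<close>

section \<open>Invariant flags\<close>

text \<open>Flag vectors are carried together with dual functionals. These provide an explicit
  projection onto the span, hence complements and, at the end, the inverse of the basis
  matrix.\<close>

definition biorth :: "nat \<Rightarrow> (nat \<Rightarrow> 'a::field vec) \<Rightarrow> (nat \<Rightarrow> 'a vec) \<Rightarrow> nat \<Rightarrow> bool" where
  "biorth N f \<phi> i \<longleftrightarrow> (\<forall>a<i. f a \<in> carrier_vec N \<and> \<phi> a \<in> carrier_vec N \<and>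
     (\<forall>b<i. \<phi> a \<bullet> f b = (if a = b then 1 else 0)))"

definition proj :: "nat \<Rightarrow> (nat \<Rightarrow> 'a::field vec) \<Rightarrow> (nat \<Rightarrow> 'a vec) \<Rightarrow> nat \<Rightarrow> 'a vec \<Rightarrow> 'a vec" where
  "proj N f \<phi> i v = vec N (\<lambda>l. \<Sum>a<i. (\<phi> a \<bullet> v) * f a $ l)"

text \<open>The span of the first \<open>i\<close> vectors, described as the fixed points of the
  projection; this gives it equations at once (\<open>closed_subsp_spn\<close>).\<close>

definition spn :: "nat \<Rightarrow> (nat \<Rightarrow> 'a::field vec) \<Rightarrow> (nat \<Rightarrow> 'a vec) \<Rightarrow> nat \<Rightarrow> 'a vec set" where
  "spn N f \<phi> i = {v \<in> carrier_vec N. proj N f \<phi> i v = v}"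

lemma proj_carrier [simp]: "proj N f \<phi> i v \<in> carrier_vec N"
  by (simp add: proj_def)

lemma scalar_prod_lincomb:
  fixes \<phi> :: "'a::field vec"
  assumes "\<phi> \<in> carrier_vec N" "\<And>a. a \<in> K \<Longrightarrow> u a \<in> carrier_vec N"
  shows "\<phi> \<bullet> vec N (\<lambda>l. \<Sum>a\<in>K. c a * u a $ l) = (\<Sum>a\<in>K. c a * (\<phi> \<bullet> u a))"
proof -
  have "\<phi> \<bullet> vec N (\<lambda>l. \<Sum>a\<in>K. c a * u a $ l) = (\<Sum>l\<in>{0..<N}. \<Sum>a\<in>K. c a * (\<phi> $ l * u a $ l))"
    unfolding scalar_prod_def by (intro sum.cong) (auto simp: sum_distrib_left ac_simps)
  also have "\<dots> = (\<Sum>a\<in>K. c a * (\<Sum>l\<in>{0..<N}. \<phi> $ l * u a $ l))"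
    by (subst sum.swap) (simp add: sum_distrib_left)
  also have "\<dots> = (\<Sum>a\<in>K. c a * (\<phi> \<bullet> u a))"
    using assms(2)[THEN carrier_vecD] by (intro sum.cong) (auto simp: scalar_prod_def)
  finally show ?thesis .
qed

lemma mult_mat_vec_lincomb:
  fixes A :: "'a::field mat"
  assumes "A \<in> carrier_mat n N" "\<And>a. a \<in> K \<Longrightarrow> u a \<in> carrier_vec N"
  shows "A *\<^sub>v vec N (\<lambda>l. \<Sum>a\<in>K. c a * u a $ l) = vec n (\<lambda>l. \<Sum>a\<in>K. c a * (A *\<^sub>v u a) $ l)"
  using assms by (intro eq_vecI) (auto simp: scalar_prod_lincomb[of _ N])

lemma biorth_proj:
  assumes "biorth N f \<phi> i" "j \<le> i" "a < i"
  shows "\<phi> a \<bullet> proj N f \<phi> j v = (if a < j then \<phi> a \<bullet> v else 0)"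
proof -
  have "\<phi> a \<bullet> proj N f \<phi> j v = (\<Sum>b<j. (\<phi> b \<bullet> v) * (\<phi> a \<bullet> f b))"
    unfolding proj_def using assms by (intro scalar_prod_lincomb) (auto simp: biorth_def)
  also have "\<dots> = (\<Sum>b<j. if a = b then \<phi> b \<bullet> v else 0)"
    using assms by (intro sum.cong) (auto simp: biorth_def)
  finally show ?thesis by auto
qed

lemma biorth_spn_zero:
  assumes "biorth N f \<phi> i" "v \<in> spn N f \<phi> j" "j \<le> a" "a < i"
  shows "\<phi> a \<bullet> v = 0"
  using biorth_proj[OF assms(1) _ assms(4), of j v] assms by (auto simp: spn_def)

lemma proj_spn: "biorth N f \<phi> i \<Longrightarrow> proj N f \<phi> i v \<in> spn N f \<phi> i"
  by (auto simp: spn_def proj_def[of N f \<phi> i "proj N f \<phi> i v"] biorth_proj) (simp add: proj_def)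

lemma basis_spn:
  assumes "biorth N f \<phi> i" "b < i"
  shows "f b \<in> spn N f \<phi> i"
proof -
  have "(\<Sum>a<i. (\<phi> a \<bullet> f b) * f a $ l) = (\<Sum>a<i. if a = b then f a $ l else 0)" for l
    using assms by (intro sum.cong) (auto simp: biorth_def)
  then show ?thesis using assms by (auto simp: spn_def proj_def biorth_def intro!: eq_vecI)
qed

lemma spn_mono:
  assumes "biorth N f \<phi> i" "j \<le> i"
  shows "spn N f \<phi> j \<subseteq> spn N f \<phi> i"
proof
  fix v assume v: "v \<in> spn N f \<phi> j"
  have "(\<Sum>a<i. (\<phi> a \<bullet> v) * f a $ l) = (\<Sum>a<j. (\<phi> a \<bullet> v) * f a $ l)" for l
    using biorth_spn_zero[OF assms(1) v] assms(2) by (intro sum.mono_neutral_right) auto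
  then have "proj N f \<phi> i v = proj N f \<phi> j v" by (simp add: proj_def)
  then show "v \<in> spn N f \<phi> i" using v by (simp add: spn_def)
qed

lemma closed_subsp_carrier: "closed_subsp N (carrier_vec N)"
  unfolding closed_subsp_def by (rule exI[of _ "{}"]) auto

lemma closed_subsp_zero: "closed_subsp N {0\<^sub>v N :: 'a::field vec}"
proof -
  have "{0\<^sub>v N :: 'a vec} = {v \<in> carrier_vec N. \<forall>\<phi>\<in>unit_vec N ` {..<N}. \<phi> \<bullet> v = 0}"
  proof (intro equalityI subsetI)
    fix v :: "'a vec" assume v: "v \<in> {v \<in> carrier_vec N. \<forall>\<phi>\<in>unit_vec N ` {..<N}. \<phi> \<bullet> v = 0}"
    have "v $ i = 0" if "i < N" for i
      using v that scalar_prod_left_unit[of v N i] by auto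
    then show "v \<in> {0\<^sub>v N}" using v by (auto intro!: eq_vecI)
  qed auto
  then show ?thesis unfolding closed_subsp_def by (intro exI[of _ "unit_vec N ` {..<N}"]) auto
qed

lemma closed_subsp_spn:
  assumes "\<forall>a<i. \<phi> a \<in> carrier_vec N"
  shows "closed_subsp N (spn N f \<phi> i)"
proof -
  define M where "M = mat N N (\<lambda>(l, j). (if l = j then 1 else 0) - (\<Sum>a<i. f a $ l * \<phi> a $ j))"
  have M: "M \<in> carrier_mat N N" by (simp add: M_def)
  have Mv: "(M *\<^sub>v v) $ l = v $ l - proj N f \<phi> i v $ l" if "v \<in> carrier_vec N" "l < N" for v l
  proof -
    have "(M *\<^sub>v v) $ l = (\<Sum>j\<in>{0..<N}. ((if l = j then 1 else 0) - (\<Sum>a<i. f a $ l * \<phi> a $ j)) * v $ j)"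
      using that by (simp add: M_def scalar_prod_def)
    also have "\<dots> = (\<Sum>j\<in>{0..<N}. if l = j then v $ j else 0) - (\<Sum>j\<in>{0..<N}. \<Sum>a<i. f a $ l * \<phi> a $ j * v $ j)"
      unfolding sum_subtractf[symmetric] by (intro sum.cong) (auto simp: left_diff_distrib sum_distrib_right)
    also have "(\<Sum>j\<in>{0..<N}. \<Sum>a<i. f a $ l * \<phi> a $ j * v $ j) = proj N f \<phi> i v $ l"
      using that by (subst sum.swap) (simp add: proj_def scalar_prod_def sum_distrib_left sum_distrib_right ac_simps)
    finally show ?thesis using that by simp
  qed
  have "spn N f \<phi> i = {v \<in> carrier_vec N. \<forall>d\<in>{()}. M *\<^sub>v v \<in> {0\<^sub>v N}}"
  proof (intro equalityI subsetI)
    fix v assume "v \<in> spn N f \<phi> i"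
    then show "v \<in> {v \<in> carrier_vec N. \<forall>d\<in>{()}. M *\<^sub>v v \<in> {0\<^sub>v N}}"
      using M by (auto simp: spn_def Mv simp del: index_mult_mat_vec intro!: eq_vecI)
  next
    fix v assume "v \<in> {v \<in> carrier_vec N. \<forall>d\<in>{()}. M *\<^sub>v v \<in> {0\<^sub>v N}}"
    then have v: "v \<in> carrier_vec N" "M *\<^sub>v v = 0\<^sub>v N" by auto
    have "proj N f \<phi> i v $ l = v $ l" if "l < N" for l
      using Mv[OF v(1) that] v(2) that by simp
    then show "v \<in> spn N f \<phi> i" using v(1) by (auto simp: spn_def intro!: eq_vecI)
  qed
  then show ?thesis using closed_subsp_stabilizer[OF closed_subsp_carrier closed_subsp_zero, of "{()}" "\<lambda>_. M"] M by simp
qed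

lemma spn_stable:
  assumes b: "biorth N f \<phi> i" and A: "A \<in> carrier_mat N N" "\<And>b. b < i \<Longrightarrow> A *\<^sub>v f b \<in> spn N f \<phi> i"
    and v: "v \<in> spn N f \<phi> i"
  shows "A *\<^sub>v v \<in> spn N f \<phi> i"
proof -
  have s: "subsp N (spn N f \<phi> i)"
    by (rule closed_subsp_subsp[OF closed_subsp_spn]) (use b in \<open>auto simp: biorth_def\<close>)
  have "v = vec N (\<lambda>l. \<Sum>a<i. (\<phi> a \<bullet> v) * f a $ l)" using v by (simp add: spn_def proj_def)
  then have "A *\<^sub>v v = A *\<^sub>v vec N (\<lambda>l. \<Sum>a<i. (\<phi> a \<bullet> v) * f a $ l)" by simp
  also have "\<dots> = vec N (\<lambda>l. \<Sum>a<i. (\<phi> a \<bullet> v) * (A *\<^sub>v f a) $ l)"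
    by (rule mult_mat_vec_lincomb[OF A(1)]) (use b in \<open>auto simp: biorth_def\<close>)
  also have "\<dots> \<in> spn N f \<phi> i" by (rule subsp_lincomb[OF s]) (use A(2) in auto)
  finally show ?thesis .
qed

lemma annihilated_vector_exists:
  fixes \<phi> :: "nat \<Rightarrow> 'a::field vec"
  assumes "i < N"
  shows "\<exists>v\<in>carrier_vec N. v \<noteq> 0\<^sub>v N \<and> (\<forall>a<i. \<phi> a \<in> carrier_vec N \<longrightarrow> \<phi> a \<bullet> v = 0)"
proof -
  obtain M where M: "N = Suc M" using assms by (cases N) auto
  \<comment> \<open>Slot \<open>k\<close> of all functionals gives one vector in dimension
    \<open>M\<close>, and there are \<open>M + 1\<close> slots; the functionals missing up to
    \<open>M\<close> are replaced by zero.\<close>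
  obtain c where c: "\<exists>k\<le>M. c k \<noteq> 0" "\<forall>a<M. (\<Sum>k\<le>M. c k * vec M (\<lambda>a. if a < i then \<phi> a $ k else 0) $ a) = 0"
    using linear_dependence[of M "\<lambda>k. vec M (\<lambda>a. if a < i then \<phi> a $ k else 0)"] by blast
  have r: "{0..<N} = {..M}" using M by auto
  have "\<phi> a \<bullet> vec N c = 0" if "a < i" "\<phi> a \<in> carrier_vec N" for a
  proof -
    have "a < M" using that assms M by simp
    then have "(\<Sum>k\<le>M. c k * (\<phi> a $ k)) = 0" using c(2) that by auto
    moreover have "\<phi> a \<bullet> vec N c = (\<Sum>k\<in>{0..<N}. \<phi> a $ k * c k)" by (simp add: scalar_prod_def)
    ultimately show ?thesis by (simp add: r mult.commute)
  qed
  moreover have "vec N c \<noteq> 0\<^sub>v N" using c(1) M by (metis index_vec index_zero_vec(1) le_imp_less_Suc)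
  ultimately show ?thesis by (intro bexI[of _ "vec N c"]) auto
qed

text \<open>Lie-Kolchin modulo the present span yields a vector; subtracting its projection makes
  the dual functionals vanish on it and changes it only within the span. \<open>Y\<close> is the
  whole space or, for an isotropic flag, the orthogonal of the span.\<close>

lemma flag_step:
  fixes H :: "'a::alg_closed_field mat set"
  assumes H: "subgroup H (GL N)" "connectedin (zariski N) H" "solvable ((GL N)\<lparr>carrier := H\<rparr>)"
    and b: "biorth N f \<phi> i" and st: "\<And>h b. h \<in> H \<Longrightarrow> b < i \<Longrightarrow> h *\<^sub>v f b \<in> spn N f \<phi> i"
    and Y: "closed_subsp N Y" "\<And>h u. h \<in> H \<Longrightarrow> u \<in> Y \<Longrightarrow> h *\<^sub>v u \<in> Y" "spn N f \<phi> i \<subset> Y"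
  shows "\<exists>w\<in>Y. w \<noteq> 0\<^sub>v N \<and> (\<forall>a<i. \<phi> a \<bullet> w = 0) \<and> (\<forall>h\<in>H. \<exists>c. shift h c *\<^sub>v w \<in> spn N f \<phi> i)"
proof -
  let ?S = "spn N f \<phi> i"
  have cS: "closed_subsp N ?S" by (rule closed_subsp_spn) (use b in \<open>auto simp: biorth_def\<close>)
  note sS = closed_subsp_subsp[OF cS] and sY = closed_subsp_subsp[OF Y(1)]
  have Hm: "h \<in> H \<Longrightarrow> h \<in> carrier_mat N N" for h using H(1) by (meson subgroup.mem_carrier GL_carrier_mat)
  have stS: "h *\<^sub>v u \<in> ?S" if "h \<in> H" "u \<in> ?S" for h u
    by (rule spn_stable[OF b Hm[OF that(1)] st[OF that(1)] that(2)])
  obtain n where n: "(derived (GL N) ^^ n) H = {1\<^sub>m N}" using H(3) solvable_GL_iff[OF H(1)] by blast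
  obtain v where v: "v \<in> Y" "v \<notin> ?S" "\<forall>h\<in>H. \<exists>c. shift h c *\<^sub>v v \<in> ?S"
    using lie_kolchin[OF H(1,2) n cS Y(1,3) stS Y(2)] by blast
  have vc: "v \<in> carrier_vec N" using v(1) sY subsp_carrier by blast
  define p where "p = proj N f \<phi> i v"
  have p: "p \<in> ?S" "p \<in> carrier_vec N" using proj_spn[OF b] by (simp_all add: p_def)
  define w where "w = v - p"
  have w: "w \<in> Y" unfolding w_def using subsp_minus[OF sY v(1)] p(1) Y(3) by blast
  have w0: "w \<noteq> 0\<^sub>v N"
  proof
    assume "w = 0\<^sub>v N"
    then have "v - p \<in> ?S" using subsp_zero[OF sS] by (simp add: w_def)
    then show False using subsp_minus_iff[OF sS p(1) vc] v(2) by blast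
  qed
  have "\<phi> a \<bullet> w = 0" if "a < i" for a
  proof -
    have "\<phi> a \<in> carrier_vec N" using b that by (auto simp: biorth_def)
    then show ?thesis
      using biorth_proj[OF b _ that, of i v] that vc p(2)
      by (simp add: w_def scalar_prod_minus_distrib[of _ N] p_def)
  qed
  moreover have "\<exists>c. shift h c *\<^sub>v w \<in> ?S" if h: "h \<in> H" for h
  proof -
    obtain c where c: "shift h c *\<^sub>v v \<in> ?S" using v(3) h by blast
    have "shift h c *\<^sub>v w = shift h c *\<^sub>v v - shift h c *\<^sub>v p"
      unfolding w_def by (rule mult_minus_distrib_mat_vec[OF shift_carrier[OF Hm[OF h]] vc p(2)])
    moreover have "shift h c *\<^sub>v p \<in> ?S"
      by (rule shift_stable[OF Hm[OF h] sS _ p(1)]) (use stS h in blast)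
    ultimately show ?thesis using subsp_minus[OF sS c] by metis
  qed
  ultimately show ?thesis using w w0 by blast
qed

lemma spn_cong:
  assumes "\<And>a. a < i \<Longrightarrow> f' a = f a" "\<And>a. a < i \<Longrightarrow> \<phi>' a = \<phi> a"
  shows "spn N f' \<phi>' i = spn N f \<phi> i"
  using assms by (simp add: spn_def proj_def)

lemma flag_extend:
  assumes b: "biorth N f \<phi> (Suc i)" and h: "h \<in> carrier_mat N N" "shift h c *\<^sub>v f i \<in> spn N f \<phi> i"
  shows "h *\<^sub>v f i \<in> spn N f \<phi> (Suc i)"
proof -
  let ?S = "spn N f \<phi> (Suc i)"
  have s: "subsp N ?S" by (rule closed_subsp_subsp[OF closed_subsp_spn]) (use b in \<open>auto simp: biorth_def\<close>)
  have fi: "f i \<in> carrier_vec N" using b by (auto simp: biorth_def)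
  have "shift h c *\<^sub>v f i \<in> ?S" using h(2) spn_mono[OF b, of i] by auto
  moreover have "c \<cdot>\<^sub>v f i \<in> ?S" using subsp_smult[OF s basis_spn[OF b]] by simp
  ultimately have "shift h c *\<^sub>v f i + c \<cdot>\<^sub>v f i \<in> ?S" by (rule subsp_add[OF s])
  moreover have "shift h c *\<^sub>v f i + c \<cdot>\<^sub>v f i = h *\<^sub>v f i"
    using h(1) fi by (intro eq_vecI) (auto simp: shift_vec)
  ultimately show ?thesis by simp
qed

lemma invariant_flag_GL:
  fixes H :: "'a::alg_closed_field mat set"
  assumes H: "subgroup H (GL N)" "connectedin (zariski N) H" "solvable ((GL N)\<lparr>carrier := H\<rparr>)"
  shows "\<exists>g\<in>carrier (GL N). \<forall>h\<in>H. cj g h \<in> tri N"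
proof -
  have HG: "h \<in> H \<Longrightarrow> h \<in> carrier (GL N)" for h using H(1) by (meson subgroup.mem_carrier)
  have "i \<le> N \<Longrightarrow> \<exists>f \<phi>. biorth N f \<phi> i \<and> (\<forall>h\<in>H. \<forall>b<i. h *\<^sub>v f b \<in> spn N f \<phi> (Suc b))" for i
  proof (induction i)
    case 0
    then show ?case by (auto simp: biorth_def)
  next
    case (Suc i)
    then obtain f \<phi> where b: "biorth N f \<phi> i" and st: "\<And>h b. h \<in> H \<Longrightarrow> b < i \<Longrightarrow> h *\<^sub>v f b \<in> spn N f \<phi> (Suc b)"
      by auto
    have st': "h *\<^sub>v f b \<in> spn N f \<phi> i" if "h \<in> H" "b < i" for h b
      using st[OF that] spn_mono[OF b, of "Suc b"] that(2) by auto
    have "spn N f \<phi> i \<subset> carrier_vec N"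
    proof -
      obtain v where v: "v \<in> carrier_vec N" "v \<noteq> 0\<^sub>v N" "\<forall>a<i. \<phi> a \<in> carrier_vec N \<longrightarrow> \<phi> a \<bullet> v = 0"
        using annihilated_vector_exists[of i N \<phi>] Suc.prems by auto
      then have "proj N f \<phi> i v = 0\<^sub>v N" using b by (auto simp: proj_def biorth_def intro!: eq_vecI)
      then have "v \<notin> spn N f \<phi> i" using v by (auto simp: spn_def)
      then show ?thesis using v(1) by (auto simp: spn_def)
    qed
    then obtain w where w: "w \<in> carrier_vec N" "w \<noteq> 0\<^sub>v N" "\<forall>a<i. \<phi> a \<bullet> w = 0"
        "\<forall>h\<in>H. \<exists>c. shift h c *\<^sub>v w \<in> spn N f \<phi> i"
      using flag_step[OF H b st' closed_subsp_carrier] mult_mat_vec_carrier HG GL_carrier_mat by metis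
    obtain l where l: "leads N w l" using leads_exists[OF w(1,2)] by blast
    define \<psi> where "\<psi> = inverse (w $ l) \<cdot>\<^sub>v unit_vec N l"
    have \<psi>: "\<psi> \<in> carrier_vec N" "\<psi> \<bullet> w = 1" using l w(1) by (auto simp: \<psi>_def leads_def)
    \<comment> \<open>Gram-Schmidt on the dual side: the correction makes the functional vanish on
      the earlier vectors and keeps its value 1 on \<open>w\<close>.\<close>
    define \<psi>' where "\<psi>' = \<psi> - vec N (\<lambda>j. \<Sum>a<i. (\<psi> \<bullet> f a) * \<phi> a $ j)"
    have \<psi>'v: "\<psi>' \<bullet> v = \<psi> \<bullet> v - (\<Sum>a<i. (\<psi> \<bullet> f a) * (\<phi> a \<bullet> v))" if v: "v \<in> carrier_vec N" for v
    proof -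
      have "vec N (\<lambda>j. \<Sum>a<i. (\<psi> \<bullet> f a) * \<phi> a $ j) \<bullet> v = v \<bullet> vec N (\<lambda>j. \<Sum>a<i. (\<psi> \<bullet> f a) * \<phi> a $ j)"
        using v by (intro comm_scalar_prod) auto
      also have "\<dots> = (\<Sum>a<i. (\<psi> \<bullet> f a) * (v \<bullet> \<phi> a))"
        by (rule scalar_prod_lincomb[OF v]) (use b in \<open>auto simp: biorth_def\<close>)
      also have "\<dots> = (\<Sum>a<i. (\<psi> \<bullet> f a) * (\<phi> a \<bullet> v))"
        using b v by (intro sum.cong) (auto simp: biorth_def comm_scalar_prod[of v N])
      finally show ?thesis unfolding \<psi>'_def using v \<psi>(1) by (simp add: minus_scalar_prod_distrib[of _ N])
    qed
    have \<psi>'w: "\<psi>' \<bullet> w = 1" using \<psi>'v[OF w(1)] w(3) \<psi>(2) by simp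
    have \<psi>'f: "\<psi>' \<bullet> f c = 0" if c: "c < i" for c
    proof -
      have "(\<Sum>a<i. (\<psi> \<bullet> f a) * (\<phi> a \<bullet> f c)) = (\<Sum>a<i. if a = c then \<psi> \<bullet> f a else 0)"
        using b c by (intro sum.cong) (auto simp: biorth_def)
      then show ?thesis using \<psi>'v[of "f c"] b c by (auto simp: biorth_def)
    qed
    define f' \<phi>' where "f' = f(i := w)" and "\<phi>' = \<phi>(i := \<psi>')"
    have eq: "spn N f' \<phi>' j = spn N f \<phi> j" if "j \<le> i" for j
      by (rule spn_cong) (use that in \<open>auto simp: f'_def \<phi>'_def\<close>)
    have b': "biorth N f' \<phi>' (Suc i)"
      unfolding biorth_def
    proof (intro allI impI conjI)
      fix a assume a: "a < Suc i"
      show "f' a \<in> carrier_vec N" using a b w by (auto simp: f'_def biorth_def less_Suc_eq)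
      show "\<phi>' a \<in> carrier_vec N" using a b \<psi> by (auto simp: \<phi>'_def \<psi>'_def biorth_def less_Suc_eq)
      fix c assume c: "c < Suc i"
      show "\<phi>' a \<bullet> f' c = (if a = c then 1 else 0)"
        using a c b w(3) \<psi>'w \<psi>'f by (auto simp: f'_def \<phi>'_def biorth_def less_Suc_eq)
    qed
    have "h *\<^sub>v f' c \<in> spn N f' \<phi>' (Suc c)" if h: "h \<in> H" and c: "c < Suc i" for h c
    proof (cases "c = i")
      case True
      obtain d where "shift h d *\<^sub>v w \<in> spn N f \<phi> i" using w(4) h by blast
      moreover have "f' i = w" by (simp add: f'_def)
      ultimately have "shift h d *\<^sub>v f' i \<in> spn N f' \<phi>' i" by (simp only: eq[OF order_refl])
      then show ?thesis using flag_extend[OF b' GL_carrier_mat[OF HG[OF h]]] True by blast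
    next
      case False
      then show ?thesis using st[OF h, of c] c by (simp add: eq) (simp add: f'_def)
    qed
    then show ?case using b' by blast
  qed
  then obtain f \<phi> where b: "biorth N f \<phi> N" and st: "\<And>h b. h \<in> H \<Longrightarrow> b < N \<Longrightarrow> h *\<^sub>v f b \<in> spn N f \<phi> (Suc b)"
    by blast
  define g where "g = mat N N (\<lambda>(l, a). f a $ l)"
  \<comment> \<open>The dual functionals are the rows of the inverse, so an entry of
    \<open>cj g h\<close> below the diagonal is a functional evaluated on a vector of an earlier
    span.\<close>
  define g' where "g' = mat N N (\<lambda>(a, l). \<phi> a $ l)"
  have c: "g \<in> carrier_mat N N" "g' \<in> carrier_mat N N" by (auto simp: g_def g'_def)
  have row: "row g' a = \<phi> a" and col: "col g a = f a" if "a < N" for a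
    using b that by (auto simp: g_def g'_def biorth_def intro!: eq_vecI)
  have "g' * g = 1\<^sub>m N"
    using c b by (intro eq_matI) (auto simp: row col biorth_def)
  then have g: "g \<in> carrier (GL N)" and gm: "minv g = g'"
    using left_inverse_GL[OF c(2,1)] minv_unique[OF c(1,2)] mat_mult_left_right_inverse[OF c(2,1)] by auto
  have "cj g h \<in> tri N" if h: "h \<in> H" for h
  proof -
    have hm: "h \<in> carrier_mat N N" using HG[OF h] GL_carrier_mat by blast
    have "cj g h $$ (a, k) = 0" if ak: "k < a" "a < N" for a k
    proof -
      have "cj g h = g' * (h * g)" unfolding cj_def gm using c hm by (simp add: sq_assoc[of _ N] del: assoc_mult_mat)
      then have "cj g h $$ (a, k) = \<phi> a \<bullet> col (h * g) k" using c hm ak row by simp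
      also have "col (h * g) k = h *\<^sub>v f k" using ak by (subst col_mult2[OF hm c(1)]) (auto simp: col)
      also have "\<phi> a \<bullet> \<dots> = 0" by (rule biorth_spn_zero[OF b st[OF h]]) (use ak in auto)
      finally show ?thesis .
    qed
    then show ?thesis using cj_GL[OF g HG[OF h]] by (auto simp: tri_def carrier_GL)
  qed
  then show ?thesis using g by blast
qed

text \<open>A Borel subgroup lies in the stabiliser of an invariant flag. That stabiliser is itself
  closed, connected and solvable, so maximality gives equality.\<close>

lemma borel_subgroup_GL:
  assumes "borel_subgroup N (GL N) (B :: 'a::alg_closed_field mat set)"
  obtains g where "g \<in> carrier (GL N)" "B = {h \<in> carrier (GL N). cj g h \<in> tri N}"
proof -
  have B: "subgroup B (GL N)" "connectedin (zariski N) B" "solvable ((GL N)\<lparr>carrier := B\<rparr>)"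
    using assms by (auto simp: borel_subgroup_def closed_connected_solvable_def)
  obtain g where g: "g \<in> carrier (GL N)" "\<forall>h\<in>B. cj g h \<in> tri N" using invariant_flag_GL[OF B] by blast
  let ?H = "{h \<in> carrier (GL N). cj g h \<in> tri N}"
  have sub: "subgroup ?H (GL N)" using subgroup_cj_uni[OF g(1), of 0] by (simp add: uni_def)
  have "closed_connected_solvable N (GL N) ?H"
    unfolding closed_connected_solvable_def
  proof (intro conjI sub)
    show "closedin (subtopology (zariski N) (carrier (GL N))) ?H"
      using closedin_triangularizable[OF g(1)] by (auto simp: closedin_subtopology)
    show "connectedin (zariski N) ?H" by (rule connectedin_cj[OF g(1) connectedin_tri])
    show "solvable ((GL N)\<lparr>carrier := ?H\<rparr>)" by (rule solvable_triangularizable[OF sub g(1)]) auto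
  qed
  moreover have "B \<subseteq> ?H" using g(2) subgroup.mem_carrier[OF B(1)] by auto
  ultimately show ?thesis using assms that[OF g(1)] by (auto simp: borel_subgroup_def)
qed

section \<open>Isotropic flags and Borel subgroups of the symplectic group\<close>

section \<open>Alternating forms\<close>

definition bil :: "'a::field mat \<Rightarrow> 'a vec \<Rightarrow> 'a vec \<Rightarrow> 'a" where
  "bil J v w = v \<bullet> (J *\<^sub>v w)"

lemma bil_congruence:
  assumes J: "J \<in> carrier_mat n n" and g: "g \<in> carrier_mat n n" and v: "v \<in> carrier_vec n" "w \<in> carrier_vec n"
  shows "bil (g\<^sup>T * J * g) v w = bil J (g *\<^sub>v v) (g *\<^sub>v w)"
proof -
  have c: "J *\<^sub>v (g *\<^sub>v w) \<in> carrier_vec n" using J g v by simp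
  have "g\<^sup>T * J * g *\<^sub>v w = g\<^sup>T *\<^sub>v (J *\<^sub>v (g *\<^sub>v w))"
    using assms by (simp add: sq_assoc[of _ n] sq_mult assoc_mult_mat_vec[of _ n n _ n] del: assoc_mult_mat)
  then have "bil (g\<^sup>T * J * g) v w = (g\<^sup>T *\<^sub>v (J *\<^sub>v (g *\<^sub>v w))) \<bullet> v"
    unfolding bil_def using comm_scalar_prod[OF v(1), of "g\<^sup>T *\<^sub>v (J *\<^sub>v (g *\<^sub>v w))"] c g by simp
  also have "\<dots> = (J *\<^sub>v (g *\<^sub>v w)) \<bullet> (g *\<^sub>v v)" by (rule transpose_vec_mult_scalar[OF g v(1) c])
  also have "\<dots> = bil J (g *\<^sub>v v) (g *\<^sub>v w)"
    unfolding bil_def using comm_scalar_prod[OF c, of "g *\<^sub>v v"] g v by simp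
  finally show ?thesis .
qed

lemma bil_unit:
  assumes "J \<in> carrier_mat n n" "k < n" "l < n"
  shows "bil J (unit_vec n k) (unit_vec n l) = J $$ (k, l)"
  using assms col_eq_mult_unit[OF assms(1,3)] by (simp add: bil_def index_col)

lemma bil_eqI:
  assumes "J \<in> carrier_mat n n" "J' \<in> carrier_mat n n"
    and "\<And>v w. v \<in> carrier_vec n \<Longrightarrow> w \<in> carrier_vec n \<Longrightarrow> bil J v w = bil J' v w"
  shows "J = J'"
proof (rule eq_matI)
  fix i j assume "i < dim_row J'" "j < dim_col J'"
  then have "i < n" "j < n" using assms(2) by auto
  then show "J $$ (i, j) = J' $$ (i, j)"
    using assms(3)[of "unit_vec n i" "unit_vec n j"] bil_unit[OF assms(1)] bil_unit[OF assms(2)] by simp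
qed (use assms in auto)

lemma bil_lincomb_left:
  assumes "J \<in> carrier_mat n n" "\<And>a. a \<in> K \<Longrightarrow> u a \<in> carrier_vec n" "w \<in> carrier_vec n"
  shows "bil J (vec n (\<lambda>l. \<Sum>a\<in>K. c a * u a $ l)) w = (\<Sum>a\<in>K. c a * bil J (u a) w)"
proof -
  have Jw: "J *\<^sub>v w \<in> carrier_vec n" using assms by simp
  have "bil J (vec n (\<lambda>l. \<Sum>a\<in>K. c a * u a $ l)) w = (J *\<^sub>v w) \<bullet> vec n (\<lambda>l. \<Sum>a\<in>K. c a * u a $ l)"
    unfolding bil_def using Jw by (intro comm_scalar_prod) auto
  also have "\<dots> = (\<Sum>a\<in>K. c a * ((J *\<^sub>v w) \<bullet> u a))" by (rule scalar_prod_lincomb[OF Jw assms(2)])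
  also have "\<dots> = (\<Sum>a\<in>K. c a * bil J (u a) w)"
    unfolding bil_def using comm_scalar_prod[OF Jw] assms(2) by (intro sum.cong) auto
  finally show ?thesis .
qed

text \<open>Alternation is assumed as \<open>bil J v v = 0\<close>, the stronger condition in
  characteristic 2; skew symmetry is derived from it in \<open>skew\<close>.\<close>

locale alt_form =
  fixes n :: nat and J :: "'a::field mat"
  assumes J: "J \<in> carrier_mat n n"
    and alt: "v \<in> carrier_vec n \<Longrightarrow> bil J v v = 0"
    and nondeg: "v \<in> carrier_vec n \<Longrightarrow> v \<noteq> 0\<^sub>v n \<Longrightarrow> \<exists>y\<in>carrier_vec n. bil J v y \<noteq> 0"
begin

lemma bil_add_left:
  "u \<in> carrier_vec n \<Longrightarrow> v \<in> carrier_vec n \<Longrightarrow> w \<in> carrier_vec n \<Longrightarrow> bil J (u + v) w = bil J u w + bil J v w"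
  unfolding bil_def using J by (intro add_scalar_prod_distrib[of _ n]) auto

lemma bil_add_right:
  "u \<in> carrier_vec n \<Longrightarrow> v \<in> carrier_vec n \<Longrightarrow> w \<in> carrier_vec n \<Longrightarrow> bil J u (v + w) = bil J u v + bil J u w"
  unfolding bil_def using J by (simp add: mult_add_distrib_mat_vec[OF J] scalar_prod_add_distrib[of _ n])

lemma bil_minus_left:
  "u \<in> carrier_vec n \<Longrightarrow> v \<in> carrier_vec n \<Longrightarrow> w \<in> carrier_vec n \<Longrightarrow> bil J (u - v) w = bil J u w - bil J v w"
  unfolding bil_def using J by (intro minus_scalar_prod_distrib[of _ n]) auto

lemma bil_minus_right:
  "u \<in> carrier_vec n \<Longrightarrow> v \<in> carrier_vec n \<Longrightarrow> w \<in> carrier_vec n \<Longrightarrow> bil J u (v - w) = bil J u v - bil J u w"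
  unfolding bil_def using J by (simp add: mult_minus_distrib_mat_vec[OF J] scalar_prod_minus_distrib[of _ n])

lemma bil_smult_left:
  "u \<in> carrier_vec n \<Longrightarrow> w \<in> carrier_vec n \<Longrightarrow> bil J (c \<cdot>\<^sub>v u) w = c * bil J u w"
  unfolding bil_def using J by simp

lemma bil_smult_right:
  "u \<in> carrier_vec n \<Longrightarrow> w \<in> carrier_vec n \<Longrightarrow> bil J u (c \<cdot>\<^sub>v w) = c * bil J u w"
  unfolding bil_def using J by (simp add: mult_mat_vec[OF J])

lemma skew:
  assumes "v \<in> carrier_vec n" "w \<in> carrier_vec n"
  shows "bil J v w = - bil J w v"
proof -
  have "bil J (v + w) (v + w) = 0" using assms by (intro alt) auto
  moreover have "bil J (v + w) (v + w) = bil J v w + bil J w v"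
    using assms alt[OF assms(1)] alt[OF assms(2)] by (simp add: bil_add_left bil_add_right)
  ultimately show ?thesis by (simp add: eq_neg_iff_add_eq_0)
qed

lemma bil_lincomb_right:
  assumes "\<And>a. a \<in> K \<Longrightarrow> u a \<in> carrier_vec n" "w \<in> carrier_vec n"
  shows "bil J w (vec n (\<lambda>l. \<Sum>a\<in>K. c a * u a $ l)) = (\<Sum>a\<in>K. c a * bil J w (u a))"
proof -
  have "bil J w (vec n (\<lambda>l. \<Sum>a\<in>K. c a * u a $ l)) = - bil J (vec n (\<lambda>l. \<Sum>a\<in>K. c a * u a $ l)) w"
    by (rule skew[OF assms(2)]) simp
  also have "\<dots> = (\<Sum>a\<in>K. c a * (- bil J (u a) w))"
    using bil_lincomb_left[OF J assms] by (simp add: sum_negf)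
  also have "\<dots> = (\<Sum>a\<in>K. c a * bil J w (u a))"
    by (intro sum.cong refl arg_cong2[of _ _ _ _ "(*)"] skew[symmetric] assms)
  finally show ?thesis .
qed

end

text \<open>Terms with exchanged indices cancel; the diagonal has its own assumption, because in
  characteristic 2 skewness does not make it vanish.\<close>

lemma skew_sum_zero:
  fixes a :: "nat \<Rightarrow> nat \<Rightarrow> 'a::field"
  assumes "\<And>i j. i < n \<Longrightarrow> j < n \<Longrightarrow> a i j = - a j i" "\<And>i. i < n \<Longrightarrow> a i i = 0"
  shows "(\<Sum>i<n. \<Sum>j<n. a i j) = 0"
  using assms
proof (induction n)
  case (Suc n)
  have "(\<Sum>i<n. a i n) = (\<Sum>j<n. - a n j)"
    by (intro sum.cong refl Suc.prems(1)) auto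
  moreover have "(\<Sum>i<n. \<Sum>j<n. a i j) = 0"
  proof (rule Suc.IH)
    show "a i j = - a j i" if "i < n" "j < n" for i j by (rule Suc.prems(1)) (use that in auto)
    show "a i i = 0" if "i < n" for i by (rule Suc.prems(2)) (use that in auto)
  qed
  moreover have "a n n = 0" by (rule Suc.prems(2)) simp
  ultimately show ?case by (simp add: sum.distrib sum_negf)
qed simp

text \<open>Covers both the standard and the antidiagonal form. For nondegeneracy, a vector led by
  \<open>i\<close> is paired with the unit vector \<open>\<sigma> i\<close>, which isolates the
  coordinate \<open>i\<close>.\<close>

lemma alt_form_monomial:
  fixes e :: "nat \<Rightarrow> 'a::field"
  assumes \<sigma>: "\<And>i. i < n \<Longrightarrow> \<sigma> i < n \<and> \<sigma> (\<sigma> i) = i \<and> \<sigma> i \<noteq> i \<and> e (\<sigma> i) = - e i \<and> e i \<noteq> 0"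
    and J: "J \<in> carrier_mat n n" "\<And>i j. i < n \<Longrightarrow> j < n \<Longrightarrow> J $$ (i, j) = (if j = \<sigma> i then e i else 0)"
  shows "alt_form n J"
proof
  show "J \<in> carrier_mat n n" by (rule J)
  have bil: "bil J v w = (\<Sum>i<n. \<Sum>j<n. v $ i * J $$ (i, j) * w $ j)"
    if "v \<in> carrier_vec n" "w \<in> carrier_vec n" for v w
    using that J(1) unfolding bil_def scalar_prod_def
    by (auto simp: scalar_prod_def sum_distrib_left mult.assoc atLeast0LessThan intro!: sum.cong)
  fix v :: "'a vec" assume v: "v \<in> carrier_vec n"
  show "bil J v v = 0"
    unfolding bil[OF v v]
  proof (rule skew_sum_zero)
    fix i j assume ij: "i < n" "j < n"
    show "v $ i * J $$ (i, j) * v $ j = - (v $ j * J $$ (j, i) * v $ i)"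
    proof (cases "j = \<sigma> i")
      case True
      have "e j = - e i" "\<sigma> j = i" using \<sigma>[OF ij(1)] True by auto
      then show ?thesis using True ij by (simp add: J(2))
    next
      case False
      have "i \<noteq> \<sigma> j" using \<sigma>[OF ij(2)] False by auto
      then show ?thesis using False ij by (simp add: J(2))
    qed
  next
    fix i assume i: "i < n"
    have "i \<noteq> \<sigma> i" using \<sigma>[OF i] by auto
    then show "v $ i * J $$ (i, i) * v $ i = 0" using i by (simp add: J(2))
  qed
  assume "v \<noteq> 0\<^sub>v n"
  then obtain i where i: "leads n v i" using leads_exists[OF v] by blast
  then have in': "i < n" "v $ i \<noteq> 0" by (auto simp: leads_def)
  have "(J *\<^sub>v unit_vec n (\<sigma> i)) $ k = (if k = i then e i else 0)" if "k < n" for k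
  proof -
    have s: "\<sigma> i < n" using \<sigma>[OF in'(1)] by (elim conjE)
    have "\<sigma> (\<sigma> i) = i" using \<sigma>[OF in'(1)] by blast
    moreover have "\<sigma> (\<sigma> k) = k" using \<sigma>[OF that] by blast
    ultimately have inj: "\<sigma> i = \<sigma> k \<longleftrightarrow> k = i" by metis
    have "(J *\<^sub>v unit_vec n (\<sigma> i)) $ k = J $$ (k, \<sigma> i)"
      unfolding col_eq_mult_unit[OF J(1) s, symmetric] using J(1) s that by (subst index_col) auto
    also have "\<dots> = (if k = i then e i else 0)" unfolding J(2)[OF that s] inj by simp
    finally show ?thesis .
  qed
  then have "bil J v (unit_vec n (\<sigma> i)) = (\<Sum>k\<in>{0..<n}. v $ k * (if k = i then e i else 0))"
    unfolding bil_def scalar_prod_def using carrier_matD(1)[OF J(1)]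
    by (intro sum.cong) (simp_all del: index_mult_mat_vec)
  also have "\<dots> = (\<Sum>k\<in>{0..<n}. if k = i then v $ i * e i else 0)" by (intro sum.cong) auto
  also have "\<dots> = v $ i * e i" using in'(1) by simp
  finally have "bil J v (unit_vec n (\<sigma> i)) = v $ i * e i" .
  moreover have "e i \<noteq> 0" using \<sigma>[OF in'(1)] by blast
  ultimately show "\<exists>y\<in>carrier_vec n. bil J v y \<noteq> 0"
    using in'(2) by (intro bexI[of _ "unit_vec n (\<sigma> i)"]) simp_all
qed

lemma symp_form_carrier: "symp_form N \<in> carrier_mat (2 * N) (2 * N)"
  by (simp add: symp_form_def)

lemma alt_form_symp: "alt_form (2 * N) (symp_form N :: 'a::field mat)"
proof (rule alt_form_monomial[where \<sigma> = "\<lambda>i. if even i then Suc i else i - 1" and e = "\<lambda>i. if even i then 1 else - 1"])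
  fix i assume "i < 2 * N"
  then show "(if even i then Suc i else i - 1) < 2 * N \<and>
     (if even (if even i then Suc i else i - 1) then Suc (if even i then Suc i else i - 1)
        else (if even i then Suc i else i - 1) - 1) = i \<and>
     (if even i then Suc i else i - 1) \<noteq> i \<and>
     (if even (if even i then Suc i else i - 1) then 1 else - 1) = - (if even i then 1 else - 1 :: 'a) \<and>
     (if even i then 1 else - 1 :: 'a) \<noteq> 0"
    by (cases "even i") (auto elim!: evenE oddE)
  fix j assume "i < 2 * N" "j < 2 * N"
  then show "symp_form N $$ (i, j) = (if j = (if even i then Suc i else i - 1) then if even i then 1 else - 1 else (0 :: 'a))"
    by (cases "even i") (auto simp: symp_form_def elim!: evenE oddE, presburger+)
qed (rule symp_form_carrier)

text \<open>The antidiagonal form, for which the standard flag is isotropic.\<close>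

definition star :: "nat \<Rightarrow> nat \<Rightarrow> nat" where
  "star N x = 2 * N - 1 - x"

definition sg :: "nat \<Rightarrow> nat \<Rightarrow> 'a::field" where
  "sg N x = (if x < N then 1 else - 1)"

definition anti :: "nat \<Rightarrow> 'a::field mat" where
  "anti N = mat (2 * N) (2 * N) (\<lambda>(i, j). if j = star N i then sg N i else 0)"

lemma star_less: "x < 2 * N \<Longrightarrow> star N x < 2 * N"
  and star_star: "x < 2 * N \<Longrightarrow> star N (star N x) = x"
  and star_neq: "x < 2 * N \<Longrightarrow> star N x \<noteq> x"
  and star_less_iff: "x < 2 * N \<Longrightarrow> y < 2 * N \<Longrightarrow> star N x < star N y \<longleftrightarrow> y < x"
  and star_eq_iff: "x < 2 * N \<Longrightarrow> y < 2 * N \<Longrightarrow> star N x = y \<longleftrightarrow> x = star N y"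
  and star_less_N: "x < 2 * N \<Longrightarrow> star N x < N \<longleftrightarrow> \<not> x < N"
  by (auto simp: star_def) presburger

lemma sg_star: "x < 2 * N \<Longrightarrow> sg N (star N x) = - (sg N x :: 'a::field)"
  by (auto simp: sg_def star_less_N)

lemma sg_sg [simp]: "sg N x * sg N x = (1 :: 'a::field)" "sg N x * (sg N x * c) = (c :: 'a)" "sg N x \<noteq> (0 :: 'a)"
  by (auto simp: sg_def)

lemma anti_carrier: "anti N \<in> carrier_mat (2 * N) (2 * N)"
  by (simp add: anti_def)

lemma anti_index: "i < 2 * N \<Longrightarrow> j < 2 * N \<Longrightarrow> anti N $$ (i, j) = (if j = star N i then sg N i else 0)"
  by (simp add: anti_def)

lemma alt_form_anti: "alt_form (2 * N) (anti N :: 'a::field mat)"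
  by (rule alt_form_monomial[where \<sigma> = "star N" and e = "sg N"])
     (auto simp: star_less star_star star_neq sg_star anti_index anti_carrier)

lemma bil_anti:
  fixes v w :: "'a::field vec"
  assumes "v \<in> carrier_vec (2 * N)" "w \<in> carrier_vec (2 * N)"
  shows "bil (anti N) v w = (\<Sum>x<2 * N. v $ x * sg N x * w $ star N x)"
proof -
  have "(anti N *\<^sub>v w) $ x = sg N x * w $ star N x" if x: "x < 2 * N" for x
  proof -
    have "(anti N *\<^sub>v w) $ x = (\<Sum>j\<in>{0..<2 * N}. anti N $$ (x, j) * w $ j)"
      using x assms anti_carrier[of N, where 'a = 'a] by (auto simp: scalar_prod_def intro!: sum.cong)
    also have "\<dots> = (\<Sum>j\<in>{0..<2 * N}. if j = star N x then sg N x * w $ j else 0)"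
      using x by (intro sum.cong) (auto simp: anti_index)
    also have "\<dots> = sg N x * w $ star N x" using star_less[OF x] by simp
    finally show ?thesis .
  qed
  then show ?thesis
    unfolding bil_def scalar_prod_def using anti_carrier[of N, where 'a = 'a]
    by (auto simp: atLeast0LessThan mult.assoc intro!: sum.cong simp del: index_mult_mat_vec)
qed

section \<open>Partial symplectic bases\<close>

locale symplectic = alt_form "2 * N" J for N :: nat and J :: "'a::field mat"
begin

text \<open>The index set is closed under \<open>star\<close>, so the span is nondegenerate and
  splits off orthogonally. It may be any such set, not only an initial segment with its
  reflection.\<close>

definition psb :: "(nat \<Rightarrow> 'a vec) \<Rightarrow> nat set \<Rightarrow> bool" where
  "psb f I \<longleftrightarrow> I \<subseteq> {..<2 * N} \<and> (\<forall>x\<in>I. star N x \<in> I) \<and> (\<forall>x\<in>I. f x \<in> carrier_vec (2 * N)) \<and>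
     (\<forall>x\<in>I. \<forall>y\<in>I. bil J (f x) (f y) = (if y = star N x then sg N x else 0))"

text \<open>The component orthogonal to the partial basis. The coefficient at \<open>f x\<close> is
  read off by pairing with the partner \<open>f (star N x)\<close>, up to the sign
  \<open>sg N x\<close>.\<close>

definition pr :: "(nat \<Rightarrow> 'a vec) \<Rightarrow> nat set \<Rightarrow> 'a vec \<Rightarrow> 'a vec" where
  "pr f I v = v - vec (2 * N) (\<lambda>l. \<Sum>x\<in>I. (sg N x * bil J v (f (star N x))) * f x $ l)"

lemma pr_carrier: "v \<in> carrier_vec (2 * N) \<Longrightarrow> pr f I v \<in> carrier_vec (2 * N)"
  by (simp add: pr_def)

lemma pr_orth:
  assumes p: "psb f I" and v: "v \<in> carrier_vec (2 * N)" and y: "y \<in> I"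
  shows "bil J (pr f I v) (f y) = 0"
proof -
  have I: "I \<subseteq> {..<2 * N}" "finite I" "star N y \<in> I" using p y finite_subset[of I "{..<2 * N}"] by (auto simp: psb_def)
  have y2: "y < 2 * N" using I y by auto
  have c: "f x \<in> carrier_vec (2 * N)" if "x \<in> I" for x using p that by (auto simp: psb_def)
  have "bil J (vec (2 * N) (\<lambda>l. \<Sum>x\<in>I. (sg N x * bil J v (f (star N x))) * f x $ l)) (f y) =
      (\<Sum>x\<in>I. (sg N x * bil J v (f (star N x))) * bil J (f x) (f y))"
    by (rule bil_lincomb_left[OF J c c[OF y]])
  also have "\<dots> = (\<Sum>x\<in>I. if x = star N y then bil J v (f y) else 0)"
  proof (rule sum.cong)
    fix x assume x: "x \<in> I"
    have "x < 2 * N" using x I by auto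
    then show "(sg N x * bil J v (f (star N x))) * bil J (f x) (f y) = (if x = star N y then bil J v (f y) else 0)"
      using p x y star_eq_iff[of x N y] y2 star_star[OF y2] by (auto simp: psb_def ac_simps)
  qed simp
  also have "\<dots> = bil J v (f y)" using I by simp
  finally show ?thesis using v c[OF y] by (simp add: pr_def bil_minus_left)
qed

lemma bil_pr:
  assumes p: "psb f I" and v: "v \<in> carrier_vec (2 * N)" and u: "u \<in> carrier_vec (2 * N)"
    and o: "\<And>x. x \<in> I \<Longrightarrow> bil J u (f x) = 0"
  shows "bil J u (pr f I v) = bil J u v"
proof -
  have "bil J u (vec (2 * N) (\<lambda>l. \<Sum>x\<in>I. (sg N x * bil J v (f (star N x))) * f x $ l)) =
      (\<Sum>x\<in>I. (sg N x * bil J v (f (star N x))) * bil J u (f x))"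
    by (rule bil_lincomb_right[OF _ u]) (use p in \<open>auto simp: psb_def\<close>)
  also have "\<dots> = 0" using o by simp
  finally show ?thesis using v u by (simp add: pr_def bil_minus_right)
qed

lemma psb_extend:
  assumes p: "psb f I" and x: "x < 2 * N" "x \<notin> I" "star N x \<notin> I"
    and u: "u \<in> carrier_vec (2 * N)" "\<And>z. z \<in> I \<Longrightarrow> bil J u (f z) = 0"
    and y: "y \<in> carrier_vec (2 * N)" "\<And>z. z \<in> I \<Longrightarrow> bil J y (f z) = 0"
    and uy: "bil J u y = sg N x"
  shows "psb (f(x := u, star N x := y)) (I \<union> {x, star N x})"
proof -
  let ?f = "f(x := u, star N x := y)"
  have sx: "star N x < 2 * N" "star N (star N x) = x" "star N x \<noteq> x" using x star_less star_star star_neq by blast+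
  have fx: "?f x = u" "?f (star N x) = y" "\<And>z. z \<in> I \<Longrightarrow> ?f z = f z" using x sx by auto
  have I: "\<And>z. z \<in> I \<Longrightarrow> star N z \<in> I \<and> z < 2 * N \<and> f z \<in> carrier_vec (2 * N)" using p by (auto simp: psb_def)
  have nz: "star N z \<noteq> x" "star N z \<noteq> star N x" "z \<noteq> x" "z \<noteq> star N x" if "z \<in> I" for z
    using I[OF that] x that by auto
  have u': "bil J (f z) u = 0" "bil J (f z) y = 0" if "z \<in> I" for z
    using skew[OF _ u(1), of "f z"] skew[OF _ y(1), of "f z"] I[OF that] u(2)[OF that] y(2)[OF that] by simp_all
  have yu: "bil J y u = sg N (star N x)" using skew[OF y(1) u(1)] uy sg_star[OF x(1), where 'a = 'a] by simp
  show ?thesis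
    unfolding psb_def
  proof (intro conjI ballI)
    show "I \<union> {x, star N x} \<subseteq> {..<2 * N}" using I x sx by auto
    fix a assume a: "a \<in> I \<union> {x, star N x}"
    show "star N a \<in> I \<union> {x, star N x}" using a I sx by auto
    show "?f a \<in> carrier_vec (2 * N)" using a I u y by auto
    fix b assume b: "b \<in> I \<union> {x, star N x}"
    consider "a \<in> I" "b \<in> I" | "a \<in> I" "b = x" | "a \<in> I" "b = star N x" | "a = x" "b \<in> I" | "a = x" "b = x"
      | "a = x" "b = star N x" | "a = star N x" "b \<in> I" | "a = star N x" "b = x" | "a = star N x" "b = star N x"
      using a b by blast
    then show "bil J (?f a) (?f b) = (if b = star N a then sg N a else 0)"
    proof cases
      case 1 then show ?thesis using p fx by (auto simp: psb_def)
    next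
      case 2 then show ?thesis using u'(1) fx nz(1)[of a] by auto
    next
      case 3 then show ?thesis using u'(2) fx nz(2)[of a] by auto
    next
      case 4 then show ?thesis using u(2) fx x nz by auto
    next
      case 5 then show ?thesis using alt[OF u(1)] fx sx by auto
    next
      case 6 then show ?thesis using uy fx by auto
    next
      case 7 then show ?thesis using y(2) fx sx nz by auto
    next
      case 8 then show ?thesis using yu fx sx by auto
    next
      case 9 then show ?thesis using alt[OF y(1)] fx sx by auto
    qed
  qed
qed

end

section \<open>Borel subgroups of the symplectic group\<close>

interpretation symp: symplectic N "symp_form N :: 'a::field mat" for N
  by (simp add: symplectic_def alt_form_symp)

interpretation anti: symplectic N "anti N :: 'a::field mat" for N
  by (simp add: symplectic_def alt_form_anti)

definition isom :: "'a::field mat \<Rightarrow> 'a mat set" where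
  "isom J = {A \<in> carrier (GL (dim_row J)). A\<^sup>T * J * A = J}"

lemma isom_iff:
  assumes "J \<in> carrier_mat n n" "J' \<in> carrier_mat n n" "g \<in> carrier_mat n n"
  shows "g\<^sup>T * J * g = J' \<longleftrightarrow>
    (\<forall>v\<in>carrier_vec n. \<forall>w\<in>carrier_vec n. bil J (g *\<^sub>v v) (g *\<^sub>v w) = bil J' v w)"
proof
  assume "g\<^sup>T * J * g = J'"
  then show "\<forall>v\<in>carrier_vec n. \<forall>w\<in>carrier_vec n. bil J (g *\<^sub>v v) (g *\<^sub>v w) = bil J' v w"
    using bil_congruence[OF assms(1,3)] by simp
next
  assume *: "\<forall>v\<in>carrier_vec n. \<forall>w\<in>carrier_vec n. bil J (g *\<^sub>v v) (g *\<^sub>v w) = bil J' v w"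
  show "g\<^sup>T * J * g = J'"
  proof (rule bil_eqI)
    show "g\<^sup>T * J * g \<in> carrier_mat n n" using assms by (intro sq_mult) auto
    fix v w :: "'a vec" assume "v \<in> carrier_vec n" "w \<in> carrier_vec n"
    then show "bil (g\<^sup>T * J * g) v w = bil J' v w" using bil_congruence[OF assms(1,3)] * by simp
  qed (rule assms(2))
qed

lemma carrier_Sp: "carrier (Sp N) = isom (symp_form N)"
  by (simp add: Sp_def isom_def symp_form_def)

lemma Sp_mult [simp]: "A \<otimes>\<^bsub>Sp N\<^esub> B = A * B"
  and Sp_one [simp]: "\<one>\<^bsub>Sp N\<^esub> = 1\<^sub>m (2 * N)"
  by (simp_all add: Sp_def GL_def)

lemma isomD:
  assumes "J \<in> carrier_mat n n" "A \<in> isom J"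
  shows "A \<in> carrier (GL n)" "A \<in> carrier_mat n n"
    "v \<in> carrier_vec n \<Longrightarrow> w \<in> carrier_vec n \<Longrightarrow> bil J (A *\<^sub>v v) (A *\<^sub>v w) = bil J v w"
proof -
  show G: "A \<in> carrier (GL n)" using assms by (auto simp: isom_def)
  then show m: "A \<in> carrier_mat n n" by (rule GL_carrier_mat)
  show "v \<in> carrier_vec n \<Longrightarrow> w \<in> carrier_vec n \<Longrightarrow> bil J (A *\<^sub>v v) (A *\<^sub>v w) = bil J v w"
    using isom_iff[OF assms(1,1) m] assms(2) by (auto simp: isom_def)
qed

lemma isomI:
  assumes "J \<in> carrier_mat n n" "A \<in> carrier (GL n)"
    "\<And>v w. v \<in> carrier_vec n \<Longrightarrow> w \<in> carrier_vec n \<Longrightarrow> bil J (A *\<^sub>v v) (A *\<^sub>v w) = bil J v w"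
  shows "A \<in> isom J"
  using isom_iff[OF assms(1,1) GL_carrier_mat[OF assms(2)]] assms by (auto simp: isom_def)

lemma subgroup_isom:
  assumes J: "J \<in> carrier_mat n n"
  shows "subgroup (isom J) (GL n)"
proof (rule GL.subgroupI)
  show "isom J \<subseteq> carrier (GL n)" using J by (auto simp: isom_def)
  have "1\<^sub>m n \<in> isom J" by (rule isomI[OF J one_GL]) auto
  then show "isom J \<noteq> {}" by blast
next
  fix a assume a: "a \<in> isom J"
  note aD = isomD[OF J a]
  have "minv a \<in> isom J"
  proof (rule isomI[OF J minv_GL[OF aD(1)]])
    fix v w :: "'a vec" assume vw: "v \<in> carrier_vec n" "w \<in> carrier_vec n"
    have "minv a *\<^sub>v v \<in> carrier_vec n" "minv a *\<^sub>v w \<in> carrier_vec n"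
      using vw minv_carrier_mat[OF aD(2)] by auto
    from aD(3)[OF this] show "bil J (minv a *\<^sub>v v) (minv a *\<^sub>v w) = bil J v w"
      using minv_cancel_vec(2)[OF aD(1)] vw by simp
  qed
  then show "inv\<^bsub>GL n\<^esub> a \<in> isom J" by (simp add: inv_GL aD(1))
  fix b assume b: "b \<in> isom J"
  note bD = isomD[OF J b]
  have "a * b \<in> isom J"
  proof (rule isomI[OF J mult_GL[OF aD(1) bD(1)]])
    fix v w :: "'a vec" assume vw: "v \<in> carrier_vec n" "w \<in> carrier_vec n"
    then show "bil J (a * b *\<^sub>v v) (a * b *\<^sub>v w) = bil J v w"
      using aD(2,3) bD(2,3) by (simp add: assoc_mult_mat_vec[of _ n n _ n])
  qed
  then show "a \<otimes>\<^bsub>GL n\<^esub> b \<in> isom J" by simp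
qed

lemma subgroup_Sp: "subgroup (carrier (Sp N)) (GL (2 * N))"
  unfolding carrier_Sp by (rule subgroup_isom[OF symp_form_carrier])

lemma Sp_GL: "A \<in> carrier (Sp N) \<Longrightarrow> A \<in> carrier (GL (2 * N))"
  by (rule subgroup.mem_carrier[OF subgroup_Sp])

lemma Sp_restrict: "(Sp N)\<lparr>carrier := H\<rparr> = (GL (2 * N))\<lparr>carrier := H\<rparr>"
  by (simp add: Sp_def)

lemma Sp_eq: "Sp N = (GL (2 * N))\<lparr>carrier := carrier (Sp N)\<rparr>"
  by (simp add: Sp_def)

text \<open>The matrix \<open>g\<close> carries the form \<open>J'\<close> to \<open>J\<close>, so
  conjugation by it identifies their isometry groups.\<close>

lemma isom_cj:
  assumes J: "J \<in> carrier_mat n n" "J' \<in> carrier_mat n n" and g: "g \<in> carrier (GL n)" "g\<^sup>T * J * g = J'"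
    and h: "h \<in> carrier (GL n)"
  shows "cj g h \<in> isom J' \<longleftrightarrow> h \<in> isom J"
proof -
  have gm: "g \<in> carrier_mat n n" "minv g \<in> carrier_mat n n" and hm: "h \<in> carrier_mat n n"
    using g h minv_GL GL_carrier_mat by blast+
  have gi: "\<And>v w. v \<in> carrier_vec n \<Longrightarrow> w \<in> carrier_vec n \<Longrightarrow> bil J (g *\<^sub>v v) (g *\<^sub>v w) = bil J' v w"
    using isom_iff[OF J gm(1)] g(2) by simp
  have gc: "g *\<^sub>v (cj g h *\<^sub>v v) = h *\<^sub>v (g *\<^sub>v v)" if v: "v \<in> carrier_vec n" for v
  proof -
    have "cj g h *\<^sub>v v = minv g *\<^sub>v (h *\<^sub>v (g *\<^sub>v v))"
      unfolding cj_def using gm hm v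
      by (simp add: assoc_mult_mat_vec[of _ n n _ n] sq_mult del: assoc_mult_mat)
    then show ?thesis using minv_cancel_vec(2)[OF g(1)] gm hm v by simp
  qed
  have cm: "cj g h \<in> carrier_mat n n" by (rule cj_carrier[OF g(1) hm])
  have *: "bil J' (cj g h *\<^sub>v v) (cj g h *\<^sub>v w) = bil J (h *\<^sub>v (g *\<^sub>v v)) (h *\<^sub>v (g *\<^sub>v w))"
    if "v \<in> carrier_vec n" "w \<in> carrier_vec n" for v w
    using gi[of "cj g h *\<^sub>v v" "cj g h *\<^sub>v w"] gc[OF that(1)] gc[OF that(2)] that cm by simp
  show ?thesis
  proof
    assume c: "cj g h \<in> isom J'"
    show "h \<in> isom J"
    proof (rule isomI[OF J(1) h])
      fix v w :: "'a vec" assume vw: "v \<in> carrier_vec n" "w \<in> carrier_vec n"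
      have vw': "minv g *\<^sub>v v \<in> carrier_vec n" "minv g *\<^sub>v w \<in> carrier_vec n" using vw gm by auto
      show "bil J (h *\<^sub>v v) (h *\<^sub>v w) = bil J v w"
        using *[OF vw'] isomD(3)[OF J(2) c vw'] gi[OF vw']
          minv_cancel_vec(2)[OF g(1) vw(1)] minv_cancel_vec(2)[OF g(1) vw(2)] by simp
    qed
  next
    assume i: "h \<in> isom J"
    show "cj g h \<in> isom J'"
    proof (rule isomI[OF J(2) cj_GL[OF g(1) h]])
      fix v w :: "'a vec" assume vw: "v \<in> carrier_vec n" "w \<in> carrier_vec n"
      then have "g *\<^sub>v v \<in> carrier_vec n" "g *\<^sub>v w \<in> carrier_vec n" using gm by auto
      then show "bil J' (cj g h *\<^sub>v v) (cj g h *\<^sub>v w) = bil J' v w"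
        using *[OF vw] isomD(3)[OF J(1) i] gi[OF vw] by simp
    qed
  qed
qed

lemma isom_anti_iff:
  assumes "A \<in> carrier (GL (2 * N))"
  shows "A \<in> isom (anti N) \<longleftrightarrow>
    (\<forall>k<2 * N. \<forall>l<2 * N. (\<Sum>x<2 * N. A $$ (x, k) * sg N x * A $$ (star N x, l)) = anti N $$ (k, l))"
proof -
  have Am: "A \<in> carrier_mat (2 * N) (2 * N)" using assms GL_carrier_mat by blast
  have "(A\<^sup>T * anti N * A) $$ (k, l) = (\<Sum>x<2 * N. A $$ (x, k) * sg N x * A $$ (star N x, l))"
    if kl: "k < 2 * N" "l < 2 * N" for k l
  proof -
    have M: "A\<^sup>T * anti N * A \<in> carrier_mat (2 * N) (2 * N)"
      using Am anti_carrier by (intro sq_mult) auto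
    have "(A\<^sup>T * anti N * A) $$ (k, l) = bil (A\<^sup>T * anti N * A) (unit_vec (2 * N) k) (unit_vec (2 * N) l)"
      by (rule bil_unit[OF M kl, symmetric])
    also have "\<dots> = bil (anti N) (col A k) (col A l)"
      using bil_congruence[OF anti_carrier Am] kl col_eq_mult_unit[OF Am] by simp
    also have "\<dots> = (\<Sum>x<2 * N. A $$ (x, k) * sg N x * A $$ (star N x, l))"
      using Am kl star_less[of _ N] by (subst bil_anti) (auto intro!: sum.cong)
    finally show ?thesis .
  qed
  then have "(A\<^sup>T * anti N * A = anti N) \<longleftrightarrow>
     (\<forall>k<2 * N. \<forall>l<2 * N. (\<Sum>x<2 * N. A $$ (x, k) * sg N x * A $$ (star N x, l)) = anti N $$ (k, l))"
    using Am anti_carrier[of N, where 'a = 'a] by (simp add: mat_eq_iff del: index_mult_mat(1))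
  then show ?thesis using assms by (simp add: isom_def anti_def)
qed

lemma isom_diag:
  fixes d :: "nat \<Rightarrow> 'a::field"
  assumes "\<And>x. x < 2 * N \<Longrightarrow> d x * d (star N x) = 1"
  shows "mat_diag (2 * N) d \<in> isom (anti N)"
proof -
  have d: "d x \<noteq> 0" if "x < 2 * N" for x using assms[OF that] by auto
  have "mat_diag (2 * N) d \<in> tri (2 * N)"
    by (rule triI) (auto simp: mat_diag_def d)
  then have G: "mat_diag (2 * N) d \<in> carrier (GL (2 * N))" using tri_GL by blast
  show ?thesis
    unfolding isom_anti_iff[OF G]
  proof (intro allI impI)
    fix k l assume kl: "k < 2 * N" "l < 2 * N"
    have "(\<Sum>x<2 * N. mat_diag (2 * N) d $$ (x, k) * sg N x * mat_diag (2 * N) d $$ (star N x, l)) =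
        (\<Sum>x<2 * N. if x = k then d k * sg N k * (if star N k = l then d l else 0) else 0)"
      using kl star_less[of _ N] by (intro sum.cong) (auto simp: mat_diag_def)
    also have "\<dots> = d k * sg N k * (if star N k = l then d l else 0)" using kl by simp
    also have "\<dots> = anti N $$ (k, l)" using kl assms[OF kl(1)] by (auto simp: anti_index)
    finally show "(\<Sum>x<2 * N. mat_diag (2 * N) d $$ (x, k) * sg N x * mat_diag (2 * N) d $$ (star N x, l)) = anti N $$ (k, l)" .
  qed
qed

text \<open>In each nonzero term the two powers of \<open>s\<close> have exponents
  \<open>k - x\<close> and \<open>l - star N x\<close>, whose sum \<open>k + l + 1 - 2 * N\<close>
  does not depend on \<open>x\<close>. The antidiagonal form has a nonzero entry
  \<open>(k, l)\<close> only when this sum is 0, so no power of \<open>s\<close> remains.\<close>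

lemma contr_isom:
  assumes t: "A \<in> tri (2 * N)" and A: "A \<in> isom (anti N)"
  shows "contr s A \<in> isom (anti N)"
proof -
  note Am = tri_carrier_mat[OF t]
  have ent: "contr s A $$ (x, k) = (if x \<le> k then s ^ (k - x) * A $$ (x, k) else 0)" if "x < 2 * N" "k < 2 * N" for x k
    using that Am by (simp add: contr_def)
  show ?thesis
    unfolding isom_anti_iff[OF tri_GL[OF contr_tri[OF t]]]
  proof (intro allI impI)
    fix k l assume kl: "k < 2 * N" "l < 2 * N"
    have "(\<Sum>x<2 * N. contr s A $$ (x, k) * sg N x * contr s A $$ (star N x, l)) =
        (\<Sum>x<2 * N. s ^ (k + l + 1 - 2 * N) * (A $$ (x, k) * sg N x * A $$ (star N x, l)))"
    proof (rule sum.cong)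
      fix x assume "x \<in> {..<2 * N}"
      then have x: "x < 2 * N" "star N x < 2 * N" using star_less by auto
      show "contr s A $$ (x, k) * sg N x * contr s A $$ (star N x, l) =
          s ^ (k + l + 1 - 2 * N) * (A $$ (x, k) * sg N x * A $$ (star N x, l))"
      proof (cases "x \<le> k \<and> star N x \<le> l")
        case True
        then have "(k - x) + (l - star N x) = k + l + 1 - 2 * N" using x by (auto simp: star_def)
        then have "s ^ (k + l + 1 - 2 * N) = s ^ (k - x) * s ^ (l - star N x)" by (metis power_add)
        then show ?thesis using True x kl by (simp add: ent ac_simps)
      next
        case False
        then have "A $$ (x, k) = 0 \<or> A $$ (star N x, l) = 0"
          using tri_entry[OF t, of k x] tri_entry[OF t, of l "star N x"] x by auto
        then show ?thesis using x kl by (auto simp: ent)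
      qed
    qed simp
    also have "\<dots> = s ^ (k + l + 1 - 2 * N) * anti N $$ (k, l)"
      using A kl unfolding isom_anti_iff[OF tri_GL[OF t]] sum_distrib_left[symmetric] by simp
    also have "\<dots> = anti N $$ (k, l)" using kl by (auto simp: anti_index star_def)
    finally show "(\<Sum>x<2 * N. contr s A $$ (x, k) * sg N x * contr s A $$ (star N x, l)) = anti N $$ (k, l)" .
  qed
qed

lemma connectedin_tri_isom:
  "connectedin (zariski (2 * N)) (tri (2 * N) \<inter> isom (anti N :: 'a::alg_closed_field mat))"
proof (rule connectedin_tri_subset)
  show "1\<^sub>m (2 * N) \<in> tri (2 * N) \<inter> isom (anti N :: 'a mat)"
    using one_tri[of "2 * N", where 'a = 'a] subgroup.one_closed[OF subgroup_isom[OF anti_carrier[of N, where 'a = 'a]]]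
    by simp
next
  fix A :: "'a mat" assume A: "A \<in> tri (2 * N) \<inter> isom (anti N)"
  then have t: "A \<in> tri (2 * N)" and Ai: "A \<in> isom (anti N)" by auto
  note c = tri_carrier_mat[OF t]
  show "contr s A \<in> tri (2 * N) \<inter> isom (anti N)" for s using contr_tri[OF t] contr_isom[OF t Ai] by blast
  assume d: "\<And>i j. i < 2 * N \<Longrightarrow> j < 2 * N \<Longrightarrow> i \<noteq> j \<Longrightarrow> A $$ (i, j) = 0"
  have inv: "A $$ (k, k) * A $$ (star N k, star N k) = 1" if k: "k < 2 * N" for k
  proof -
    have sk: "star N k < 2 * N" using star_less[OF k] .
    have "(\<Sum>x<2 * N. A $$ (x, k) * sg N x * A $$ (star N x, star N k)) =
        (\<Sum>x<2 * N. if x = k then A $$ (k, k) * sg N k * A $$ (star N k, star N k) else 0)"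
      using k sk d by (intro sum.cong) auto
    also have "\<dots> = A $$ (k, k) * sg N k * A $$ (star N k, star N k)" using k by simp
    finally have "A $$ (k, k) * sg N k * A $$ (star N k, star N k) = anti N $$ (k, star N k)"
      using Ai k sk unfolding isom_anti_iff[OF tri_GL[OF t]] by simp
    then have "sg N k * (A $$ (k, k) * A $$ (star N k, star N k)) = sg N k" using k sk by (simp add: anti_index ac_simps)
    then show ?thesis by (metis mult_cancel_left1 sg_sg(3))
  qed
  \<comment> \<open>The indices \<open>i\<close> and \<open>star N i\<close> share a polynomial that
    is 1 at \<open>s = 0\<close>. In the upper half \<open>dd\<close> inverts it, so that the two
    entries have product 1 and the curve stays among the isometries.\<close>
  define p where "p i = (if i < N then [:1, A $$ (i, i) - 1:] else [:1, A $$ (star N i, star N i) - 1:])" for i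
  define D where "D = {s. \<forall>i<2 * N. poly (p i) s \<noteq> 0}"
  define dd where "dd s i = (if \<not> i < N then inverse (poly (p i) s) else poly (p i) s)" for s i
  have "connectedin (zariski (2 * N)) ((\<lambda>s. mat_diag (2 * N) (dd s)) ` D)"
    unfolding D_def dd_def by (rule connectedin_diag_curve) (auto simp: p_def)
  moreover have "mat_diag (2 * N) (dd 0) = 1\<^sub>m (2 * N)"
    by (intro eq_matI) (auto simp: mat_diag_def p_def dd_def)
  moreover have "mat_diag (2 * N) (dd 1) = A"
  proof (rule eq_matI)
    fix i j assume "i < dim_row A" "j < dim_col A"
    then have ij: "i < 2 * N" "j < 2 * N" using c by auto
    have "inverse (A $$ (star N i, star N i)) = A $$ (i, i)"
      using inv[OF ij(1)] by (metis inverse_unique mult.commute)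
    then show "mat_diag (2 * N) (dd 1) $$ (i, j) = A $$ (i, j)"
      using ij d by (auto simp: mat_diag_def p_def dd_def)
  qed (use c in \<open>auto simp: mat_diag_def\<close>)
  moreover have "0 \<in> D" "1 \<in> D" using tri_diag[OF t] star_less[of _ N] by (auto simp: D_def p_def)
  moreover have "mat_diag (2 * N) (dd s) \<in> tri (2 * N) \<inter> isom (anti N)" if s: "s \<in> D" for s
  proof
    have p0: "\<And>i. i < 2 * N \<Longrightarrow> poly (p i) s \<noteq> 0" using s by (simp add: D_def)
    show "mat_diag (2 * N) (dd s) \<in> tri (2 * N)"
      by (rule triI) (use p0 in \<open>auto simp: mat_diag_def dd_def\<close>)
    show "mat_diag (2 * N) (dd s) \<in> isom (anti N)"
    proof (rule isom_diag)
      fix x assume x: "x < 2 * N"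
      have "p (star N x) = p x" using x by (auto simp: p_def star_less_N star_star)
      then show "dd s x * dd s (star N x) = 1"
        using p0[OF x] x by (auto simp: dd_def star_less_N)
    qed
  qed
  ultimately show "\<exists>S. connectedin (zariski (2 * N)) S \<and> 1\<^sub>m (2 * N) \<in> S \<and> A \<in> S \<and> S \<subseteq> tri (2 * N) \<inter> isom (anti N)"
    by (intro exI[of _ "(\<lambda>s. mat_diag (2 * N) (dd s)) ` D"]) (metis image_eqI image_subsetI)
qed auto

text \<open>Isotropic flag vectors fill the first \<open>N\<close> places, and each receives a
  hyperbolic partner at the reflected place, which yields a symplectic basis adapted to the
  antidiagonal form. Stability is checked on the isotropic half only; the isometry condition gives
  the other half.\<close>

lemma invariant_flag_Sp:
  fixes H :: "'a::alg_closed_field mat set"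
  assumes H: "subgroup H (GL (2 * N))" "connectedin (zariski (2 * N)) H" "solvable ((GL (2 * N))\<lparr>carrier := H\<rparr>)"
    and HS: "H \<subseteq> carrier (Sp N)"
  shows "\<exists>g\<in>carrier (GL (2 * N)). g\<^sup>T * symp_form N * g = anti N \<and> (\<forall>h\<in>H. cj g h \<in> tri (2 * N))"
proof -
  let ?n = "2 * N" and ?J = "symp_form N :: 'a mat"
  \<comment> \<open>The form itself supplies the dual functionals: \<open>\<phi> f a\<close> is the
    pairing with the partner of \<open>f a\<close>.\<close>
  define \<phi> where "\<phi> f a = ?J *\<^sub>v f (star N a)" for f a
  define I where "I i = {x. x < ?n \<and> (x < i \<or> star N x < i)}" for i
  note J = symp_form_carrier[of N, where 'a = 'a]
  have Jc: "?J *\<^sub>v v \<in> carrier_vec ?n" for v using J by (intro carrier_vecI) simp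
  have HG: "h \<in> H \<Longrightarrow> h \<in> carrier (GL ?n)" for h using H(1) by (meson subgroup.mem_carrier)
  have Hm: "h \<in> H \<Longrightarrow> h \<in> carrier_mat ?n ?n" for h using HG GL_carrier_mat by blast
  have Hi: "minv h \<in> H" if "h \<in> H" for h
    using subgroup.m_inv_closed[OF H(1) that] inv_GL[OF HG[OF that]] by simp
  have iso: "bil ?J (h *\<^sub>v v) (h *\<^sub>v w) = bil ?J v w"
    if "h \<in> H" "v \<in> carrier_vec ?n" "w \<in> carrier_vec ?n" for h v w
    using isomD(3)[OF J _ that(2,3), of h] HS that(1) by (auto simp: carrier_Sp)
  have \<phi>v: "\<phi> f a \<bullet> v = bil ?J v (f (star N a))" if "v \<in> carrier_vec ?n" for f a v
    unfolding \<phi>_def bil_def by (rule comm_scalar_prod[OF Jc that])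
  have bi: "biorth ?n f (\<phi> f) i" if p: "symp.psb N f (I i)" and i: "i \<le> N" for f i
    unfolding biorth_def
  proof (intro allI impI conjI)
    fix a assume a: "a < i"
    then have aI: "a \<in> I i" "star N a \<in> I i" "a < ?n" using i star_less[of a N] star_star[of a N] by (auto simp: I_def)
    show "f a \<in> carrier_vec ?n" using p aI by (auto simp: symp.psb_def)
    show "\<phi> f a \<in> carrier_vec ?n" unfolding \<phi>_def by (rule Jc)
    fix b assume b: "b < i"
    then have bI: "b \<in> I i" "b < ?n" "b < N" using i by (auto simp: I_def)
    have "\<phi> f a \<bullet> f b = bil ?J (f b) (f (star N a))" by (rule \<phi>v) (use p bI in \<open>auto simp: symp.psb_def\<close>)
    also have "\<dots> = (if star N a = star N b then sg N b else 0)"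
      using p aI bI by (auto simp: symp.psb_def)
    also have "star N a = star N b \<longleftrightarrow> a = b" using aI bI by (metis star_star)
    finally show "\<phi> f a \<bullet> f b = (if a = b then 1 else 0)" using bI by (simp add: sg_def)
  qed
  have "i \<le> N \<Longrightarrow> \<exists>f. symp.psb N f (I i) \<and> (\<forall>h\<in>H. \<forall>b<i. h *\<^sub>v f b \<in> spn ?n f (\<phi> f) (Suc b))" for i
  proof (induction i)
    case 0
    then show ?case by (auto simp: symp.psb_def I_def)
  next
    case (Suc i)
    then obtain f where p: "symp.psb N f (I i)"
        and st: "\<And>h b. h \<in> H \<Longrightarrow> b < i \<Longrightarrow> h *\<^sub>v f b \<in> spn ?n f (\<phi> f) (Suc b)" by auto
    have i: "i < N" "i \<le> N" "i < ?n" "star N i < ?n" using Suc.prems star_less[of i N] by auto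
    note b = bi[OF p i(2)]
    let ?S = "spn ?n f (\<phi> f) i"
    have st': "h *\<^sub>v f c \<in> ?S" if "h \<in> H" "c < i" for h c
      using st[OF that] spn_mono[OF b, of "Suc c"] that(2) by auto
    have fc: "f x \<in> carrier_vec ?n" if "x \<in> I i" for x using p that by (auto simp: symp.psb_def)
    have inI: "a < i \<Longrightarrow> a \<in> I i \<and> star N a \<in> I i" for a
      using i star_less[of a N] star_star[of a N] by (auto simp: I_def)
    \<comment> \<open>The next vector is sought in the orthogonal of the earlier ones, which keeps
      the flag isotropic. This space is stable because \<open>H\<close> consists of isometries that
      preserve the span.\<close>
    define Y where "Y = {v \<in> carrier_vec ?n. \<forall>a<i. bil ?J (f a) v = 0}"
    have JT: "(?J\<^sup>T *\<^sub>v f a) \<bullet> v = bil ?J (f a) v" if "a < i" "v \<in> carrier_vec ?n" for a v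
      unfolding bil_def by (rule transpose_vec_mult_scalar[OF J that(2)]) (use fc inI that in auto)
    have JTc: "?J\<^sup>T *\<^sub>v f a \<in> carrier_vec ?n" for a using J by (intro carrier_vecI) simp
    have Yc: "closed_subsp ?n Y"
      unfolding closed_subsp_def Y_def
      by (rule exI[of _ "(\<lambda>a. ?J\<^sup>T *\<^sub>v f a) ` {..<i}"]) (use JT JTc in auto)
    have SY: "bil ?J u v = 0" if u: "u \<in> ?S" and v: "v \<in> Y" for u v
    proof -
      have "u = vec ?n (\<lambda>l. \<Sum>a<i. (\<phi> f a \<bullet> u) * f a $ l)" using u by (simp add: spn_def proj_def)
      then have "bil ?J u v = bil ?J (vec ?n (\<lambda>l. \<Sum>a<i. (\<phi> f a \<bullet> u) * f a $ l)) v" by simp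
      also have "\<dots> = (\<Sum>a<i. (\<phi> f a \<bullet> u) * bil ?J (f a) v)"
        by (rule bil_lincomb_left[OF J]) (use fc inI v in \<open>auto simp: Y_def\<close>)
      also have "\<dots> = 0" using v by (simp add: Y_def)
      finally show ?thesis .
    qed
    have YH: "h *\<^sub>v v \<in> Y" if h: "h \<in> H" and v: "v \<in> Y" for h v
      unfolding Y_def
    proof (intro CollectI conjI allI impI)
      have vc: "v \<in> carrier_vec ?n" using v by (simp add: Y_def)
      show "h *\<^sub>v v \<in> carrier_vec ?n" using vc Hm[OF h] by simp
      fix a assume a: "a < i"
      have fa: "f a \<in> carrier_vec ?n" using fc inI a by blast
      have m: "minv h *\<^sub>v f a \<in> carrier_vec ?n" using fa Hm[OF Hi[OF h]] by simp
      have "bil ?J (f a) (h *\<^sub>v v) = bil ?J (h *\<^sub>v (minv h *\<^sub>v f a)) (h *\<^sub>v v)"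
        using minv_cancel_vec(2)[OF HG[OF h] fa] by simp
      also have "\<dots> = bil ?J (minv h *\<^sub>v f a) v" by (rule iso[OF h m vc])
      also have "\<dots> = 0" by (rule SY[OF st'[OF Hi[OF h] a] v])
      finally show "bil ?J (f a) (h *\<^sub>v v) = 0" .
    qed
    have "?S \<subseteq> Y"
    proof
      fix u assume u: "u \<in> ?S"
      have "f a \<in> Y" if a: "a < i" for a
      proof -
        have "c < i \<Longrightarrow> a \<noteq> star N c" for c using a i by (auto simp: star_def)
        then show ?thesis using a fc inI p by (auto simp: Y_def symp.psb_def)
      qed
      then have "bil ?J u (f a) = 0" if "a < i" for a using SY[OF u] that by blast
      moreover have "u \<in> carrier_vec ?n" using u by (simp add: spn_def)
      ultimately show "u \<in> Y" using symp.skew[of _ N u] fc inI by (auto simp: Y_def)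
    qed
    moreover have "Y \<noteq> ?S"
    proof -
      \<comment> \<open>The \<open>2 * i\<close> equations express membership in \<open>Y\<close>
        and the vanishing of the dual functionals. As \<open>i < N\<close>, they have a nonzero
        common solution, which cannot lie in \<open>?S\<close>.\<close>
      define \<psi> where "\<psi> k = (if k < i then ?J\<^sup>T *\<^sub>v f k else \<phi> f (k - i))" for k
      obtain v where v: "v \<in> carrier_vec ?n" "v \<noteq> 0\<^sub>v ?n" "\<forall>k<2 * i. \<psi> k \<in> carrier_vec ?n \<longrightarrow> \<psi> k \<bullet> v = 0"
        using annihilated_vector_exists[of "2 * i" ?n \<psi>] i by auto
      have "bil ?J (f a) v = 0" if "a < i" for a
        using v(3)[rule_format, of a] JT[OF that v(1)] JTc[of a] that by (simp add: \<psi>_def)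
      then have vY: "v \<in> Y" using v(1) by (simp add: Y_def)
      have "\<phi> f a \<bullet> v = 0" if "a < i" for a
        using v(3)[rule_format, of "i + a"] Jc[of "f (star N a)"] that by (simp add: \<psi>_def \<phi>_def)
      then have "proj ?n f (\<phi> f) i v = 0\<^sub>v ?n" by (auto simp: proj_def intro!: eq_vecI)
      then have "v \<notin> ?S" using v(2) by (auto simp: spn_def)
      then show ?thesis using vY by blast
    qed
    ultimately have "?S \<subset> Y" by blast
    then obtain w where w: "w \<in> Y" "w \<noteq> 0\<^sub>v ?n" "\<forall>a<i. \<phi> f a \<bullet> w = 0"
        "\<forall>h\<in>H. \<exists>c. shift h c *\<^sub>v w \<in> ?S"
      using flag_step[OF H b st' Yc YH] by blast
    have wc: "w \<in> carrier_vec ?n" using w(1) by (simp add: Y_def)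
    have wf: "bil ?J w (f z) = 0" if z: "z \<in> I i" for z
    proof (cases "z < i")
      case True
      then have "bil ?J (f z) w = 0" using w(1) by (simp add: Y_def)
      then show ?thesis using symp.skew[OF wc fc[OF z]] by simp
    next
      case False
      then have "star N z < i" "star N (star N z) = z" using z star_star[of z N] by (auto simp: I_def)
      then show ?thesis using w(3)[rule_format, of "star N z"] \<phi>v[OF wc, of f "star N z"] by simp
    qed
    obtain y0 where y0: "y0 \<in> carrier_vec ?n" "bil ?J w y0 \<noteq> 0" using symp.nondeg[OF wc w(2)] by blast
    define y1 where "y1 = inverse (bil ?J w y0) \<cdot>\<^sub>v y0"
    have y1: "y1 \<in> carrier_vec ?n" "bil ?J w y1 = 1" using y0 wc by (auto simp: y1_def symp.bil_smult_right)
    \<comment> \<open>The partner of \<open>w\<close>, made orthogonal to the earlier vectors; the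
      correction does not affect its pairing with \<open>w\<close>.\<close>
    define y where "y = symp.pr N f (I i) y1"
    have yc: "y \<in> carrier_vec ?n" unfolding y_def by (rule symp.pr_carrier[OF y1(1)])
    have wy: "bil ?J w y = sg N i" unfolding y_def using symp.bil_pr[OF p y1(1) wc wf] y1(2) i by (simp add: sg_def)
    define f' where "f' = f(i := w, star N i := y)"
    have ni: "i \<notin> I i" "star N i \<notin> I i" using i star_star[OF i(3)] by (auto simp: I_def star_def)
    have "symp.psb N f' (I i \<union> {i, star N i})"
      unfolding f'_def
      by (rule symp.psb_extend[OF p i(3) ni wc wf yc _ wy]) (auto simp: y_def symp.pr_orth[OF p y1(1)])
    moreover have "I i \<union> {i, star N i} = I (Suc i)"
    proof -
      have "star N x < Suc i \<longleftrightarrow> star N x < i \<or> x = star N i" if "x < ?n" for x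
        using that i star_eq_iff[of x N i] by (auto simp: less_Suc_eq)
      then show ?thesis using i by (auto simp: I_def less_Suc_eq star_star)
    qed
    ultimately have p': "symp.psb N f' (I (Suc i))" by simp
    note b' = bi[OF p' Suc.prems]
    have f'f: "f' a = f a" "f' (star N a) = f (star N a)" if "a < i" for a
      using that i by (auto simp: f'_def star_def)
    have eq: "spn ?n f' (\<phi> f') j = spn ?n f (\<phi> f) j" if "j \<le> i" for j
      by (rule spn_cong) (use that f'f in \<open>auto simp: \<phi>_def\<close>)
    have f'i: "f' i = w" using star_neq[OF i(3)] by (simp add: f'_def)
    have "h *\<^sub>v f' c \<in> spn ?n f' (\<phi> f') (Suc c)" if h: "h \<in> H" and c: "c < Suc i" for h c
    proof (cases "c = i")
      case True
      obtain d where "shift h d *\<^sub>v w \<in> ?S" using w(4) h by blast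
      then have "shift h d *\<^sub>v f' i \<in> spn ?n f' (\<phi> f') i" by (simp only: eq[OF order_refl] f'i)
      then show ?thesis using flag_extend[OF b' Hm[OF h]] True by blast
    next
      case False
      then have "c < i" using c by simp
      then show ?thesis using st[OF h, of c] f'f[of c] eq[of "Suc c"] by simp
    qed
    then show ?case using p' by blast
  qed
  from this[of N] obtain f where p: "symp.psb N f (I N)"
      and st: "\<And>h b. h \<in> H \<Longrightarrow> b < N \<Longrightarrow> h *\<^sub>v f b \<in> spn ?n f (\<phi> f) (Suc b)" by auto
  have IN: "I N = {..<?n}" using star_less_N[of _ N] by (auto simp: I_def)
  have fc: "x < ?n \<Longrightarrow> f x \<in> carrier_vec ?n" for x using p IN by (auto simp: symp.psb_def)
  define g where "g = mat ?n ?n (\<lambda>(l, a). f a $ l)"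
  have gm: "g \<in> carrier_mat ?n ?n" by (simp add: g_def)
  have colg: "col g a = f a" if "a < ?n" for a
    using fc[OF that] that by (auto simp: g_def intro!: eq_vecI)
  have gu: "g *\<^sub>v unit_vec ?n a = f a" if "a < ?n" for a using col_eq_mult_unit[OF gm that] colg[OF that] by simp
  have gJ: "g\<^sup>T * ?J * g = anti N"
  proof (rule eq_matI)
    have M: "g\<^sup>T * ?J * g \<in> carrier_mat ?n ?n" using gm J by (intro sq_mult) auto
    fix k l assume "k < dim_row (anti N :: 'a mat)" "l < dim_col (anti N :: 'a mat)"
    then have kl: "k < ?n" "l < ?n" by (auto simp: anti_def)
    have "(g\<^sup>T * ?J * g) $$ (k, l) = bil (g\<^sup>T * ?J * g) (unit_vec ?n k) (unit_vec ?n l)"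
      by (rule bil_unit[OF M kl, symmetric])
    also have "\<dots> = bil ?J (f k) (f l)" using bil_congruence[OF J gm] kl gu by simp
    also have "\<dots> = anti N $$ (k, l)" using p kl IN by (auto simp: symp.psb_def anti_index)
    finally show "(g\<^sup>T * ?J * g) $$ (k, l) = anti N $$ (k, l)" .
  qed (use gm in \<open>auto simp: anti_def\<close>)
  have g: "g \<in> carrier (GL ?n)"
  proof -
    have "det g \<noteq> 0"
    proof
      assume "det g = 0"
      then obtain v where v: "v \<in> carrier_vec ?n" "v \<noteq> 0\<^sub>v ?n" "g *\<^sub>v v = 0\<^sub>v ?n"
        using det_0_iff_vec_prod_zero[OF gm] by blast
      then obtain y where y: "y \<in> carrier_vec ?n" "bil (anti N) v y \<noteq> 0" using anti.nondeg by blast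
      have "bil (anti N) v y = bil ?J (g *\<^sub>v v) (g *\<^sub>v y)"
        using bil_congruence[OF J gm v(1) y(1)] gJ by simp
      also have "\<dots> = 0" using v(3) gm y(1) Jc unfolding bil_def by simp
      finally show False using y(2) by simp
    qed
    then show ?thesis using gm by (simp add: carrier_GL)
  qed
  have low: "cj g h $$ (a, k) = 0" if h: "h \<in> H" and ak: "k < a" "a < ?n" "k < N" for h a k
  proof -
    have mg: "minv g \<in> carrier_mat ?n ?n" using minv_carrier_mat[OF gm] .
    have mgf: "minv g *\<^sub>v f x = unit_vec ?n x" if "x < ?n" for x
      using minv_cancel_vec(1)[OF g, of "unit_vec ?n x"] gu[OF that] by simp
    have "cj g h *\<^sub>v unit_vec ?n k = minv g *\<^sub>v (h *\<^sub>v f k)"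
      unfolding cj_def using mg gm Hm[OF h] gu[of k] fc[of k] ak
      by (simp add: assoc_mult_mat_vec[of _ ?n ?n _ ?n] sq_mult del: assoc_mult_mat)
    also have "h *\<^sub>v f k = vec ?n (\<lambda>l. \<Sum>x<Suc k. (\<phi> f x \<bullet> (h *\<^sub>v f k)) * f x $ l)"
      using st[OF h ak(3)] by (simp only: spn_def proj_def mem_Collect_eq)
    also have "minv g *\<^sub>v \<dots> = vec ?n (\<lambda>l. \<Sum>x<Suc k. (\<phi> f x \<bullet> (h *\<^sub>v f k)) * (minv g *\<^sub>v f x) $ l)"
      by (rule mult_mat_vec_lincomb[OF mg]) (use fc ak in auto)
    also have "\<dots> $ a = (\<Sum>x<Suc k. (\<phi> f x \<bullet> (h *\<^sub>v f k)) * (minv g *\<^sub>v f x) $ a)" using ak by simp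
    also have "\<dots> = 0" by (rule sum.neutral) (use ak mgf in auto)
    finally have "(cj g h *\<^sub>v unit_vec ?n k) $ a = 0" .
    then show ?thesis
      using col_eq_mult_unit[OF cj_carrier[OF g Hm[OF h]], of k] cj_carrier[OF g Hm[OF h]] ak
      by (metis carrier_matD(1,2) index_col order.strict_trans)
  qed
  have "cj g h \<in> tri ?n" if h: "h \<in> H" for h
  proof -
    let ?A = "cj g h" and ?X = "cj g (minv h)"
    have AG: "?A \<in> carrier (GL ?n)" and Am: "?A \<in> carrier_mat ?n ?n" using cj_GL[OF g HG[OF h]] GL_carrier_mat by blast+
    have XA: "?X = minv ?A" by (rule cj_minv[OF g HG[OF h]])
    have Xm: "?X \<in> carrier_mat ?n ?n" using XA minv_carrier_mat[OF Am] by simp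
    have "h \<in> isom ?J" using HS h by (auto simp: carrier_Sp)
    then have Ai: "?A \<in> isom (anti N)" using isom_cj[OF J anti_carrier g gJ HG[OF h]] by simp
    have "?A $$ (a, k) = 0" if ak: "k < a" "a < ?n" for a k
    proof (cases "k < N")
      case True
      then show ?thesis using low[OF h ak] by simp
    next
      case False
      have k: "k < ?n" using ak by simp
      let ?e = "unit_vec ?n :: nat \<Rightarrow> 'a vec"
      have s: "star N a < star N k" "star N a < N" "star N k < ?n" "star N a < ?n"
        using False ak k star_less_iff[OF ak(2) k] star_less_N[OF ak(2)] star_less[of _ N] by auto
      \<comment> \<open>The isometry identity equates, up to sign, the entry \<open>(a, k)\<close>
        of \<open>?A\<close> with the entry \<open>(star N k, star N a)\<close> of its inverse.
        There the column index is below \<open>N\<close>, so \<open>low\<close> applies to the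
        inverse of \<open>h\<close>.\<close>
      have "bil (anti N) (?A *\<^sub>v ?e k) (?e (star N a)) = bil (anti N) (?A *\<^sub>v ?e k) (?A *\<^sub>v (?X *\<^sub>v ?e (star N a)))"
        using minv_cancel_vec(2)[OF AG] XA by simp
      also have "\<dots> = bil (anti N) (?e k) (?X *\<^sub>v ?e (star N a))"
        by (rule isomD(3)[OF anti_carrier Ai]) (use Xm in auto)
      also have "\<dots> = (\<Sum>x<?n. ?e k $ x * sg N x * (?X *\<^sub>v ?e (star N a)) $ star N x)"
        by (rule bil_anti) (use Xm in auto)
      also have "\<dots> = (\<Sum>x<?n. if x = k then sg N k * (?X *\<^sub>v ?e (star N a)) $ star N k else 0)"
        by (intro sum.cong) (use k in auto)
      also have "\<dots> = sg N k * (?X *\<^sub>v ?e (star N a)) $ star N k" using k by simp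
      also have "(?X *\<^sub>v ?e (star N a)) $ star N k = ?X $$ (star N k, star N a)"
        using col_eq_mult_unit[OF Xm s(4)] Xm s by (metis carrier_matD(1,2) index_col)
      also have "\<dots> = 0" by (rule low[OF Hi[OF h] s(1,3,2)])
      finally have "bil (anti N) (?A *\<^sub>v ?e k) (?e (star N a)) = 0" by simp
      moreover have "bil (anti N) (?A *\<^sub>v ?e k) (?e (star N a)) = (\<Sum>x<?n. (?A *\<^sub>v ?e k) $ x * sg N x * ?e (star N a) $ star N x)"
        by (rule bil_anti) (use Am in auto)
      moreover have "\<dots> = (\<Sum>x<?n. if x = a then (?A *\<^sub>v ?e k) $ a * sg N a else 0)"
      proof (rule sum.cong)
        fix x assume "x \<in> {..<?n}"
        then have "star N x < ?n" "star N x = star N a \<longleftrightarrow> x = a" using ak star_less[of _ N] by (auto, metis star_star)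
        then show "(?A *\<^sub>v ?e k) $ x * sg N x * ?e (star N a) $ star N x = (if x = a then (?A *\<^sub>v ?e k) $ a * sg N a else 0)"
          using s by (auto simp del: index_mult_mat_vec)
      qed simp
      ultimately have "(?A *\<^sub>v ?e k) $ a = 0" using ak by (simp del: index_mult_mat_vec)
      then show ?thesis using col_eq_mult_unit[OF Am k] Am ak k by (metis carrier_matD(1,2) index_col)
    qed
    then show ?thesis using AG Am by (auto simp: tri_def)
  qed
  then show ?thesis using g gJ by blast
qed

text \<open>Maximality again. The flag stabiliser is intersected with the isometries, and its
  connectedness comes from \<open>connectedin_tri_isom\<close>.\<close>

lemma borel_subgroup_Sp:
  assumes "borel_subgroup (2 * N) (Sp N) (B :: 'a::alg_closed_field mat set)"
  obtains g where "g \<in> carrier (GL (2 * N))" "g\<^sup>T * symp_form N * g = anti N"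
    "B = {h \<in> carrier (Sp N). cj g h \<in> tri (2 * N)}"
proof -
  let ?n = "2 * N"
  have B: "subgroup B (Sp N)" "connectedin (zariski ?n) B" "solvable ((Sp N)\<lparr>carrier := B\<rparr>)"
    using assms by (auto simp: borel_subgroup_def closed_connected_solvable_def)
  have BS: "B \<subseteq> carrier (Sp N)" using subgroup.subset[OF B(1)] .
  have B': "subgroup B (GL ?n)"
    using GL.incl_subgroup[OF subgroup_Sp, of B N] B(1) Sp_eq[of N, where 'a = 'a] by simp
  obtain g where g: "g \<in> carrier (GL ?n)" "g\<^sup>T * symp_form N * g = anti N" "\<forall>h\<in>B. cj g h \<in> tri ?n"
    using invariant_flag_Sp[OF B' B(2) _ BS] B(3) by (auto simp: Sp_restrict)
  let ?T = "{h \<in> carrier (GL ?n). cj g h \<in> tri ?n}"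
  let ?H = "{h \<in> carrier (Sp N). cj g h \<in> tri ?n}"
  have HT: "?H = ?T \<inter> carrier (Sp N)" using Sp_GL by auto
  have sub: "subgroup ?H (GL ?n)"
    unfolding HT using GL.subgroups_Inter_pair[OF _ subgroup_Sp] subgroup_cj_uni[OF g(1), of 0] by (simp add: uni_def)
  have "closed_connected_solvable ?n (Sp N) ?H"
    unfolding closed_connected_solvable_def
  proof (intro conjI)
    show "subgroup ?H (Sp N)"
      using GL.subgroup_incl[OF sub subgroup_Sp[of N]] Sp_eq[of N, where 'a = 'a] by auto
    show "closedin (subtopology (zariski ?n) (carrier (Sp N))) ?H"
      using closedin_triangularizable[OF g(1)] HT unfolding closedin_subtopology by blast
    have "?H = {h \<in> carrier (GL ?n). cj g h \<in> tri ?n \<inter> isom (anti N)}"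
      using isom_cj[OF symp_form_carrier anti_carrier g(1,2)] Sp_GL by (auto simp: carrier_Sp)
    then show "connectedin (zariski ?n) ?H"
      using connectedin_cj[OF g(1) connectedin_tri_isom[of N]] by simp
    show "solvable ((Sp N)\<lparr>carrier := ?H\<rparr>)"
      unfolding Sp_restrict by (rule solvable_triangularizable[OF sub g(1)]) auto
  qed
  moreover have "B \<subseteq> ?H" using g(3) BS by auto
  ultimately show ?thesis using assms that[OF g(1,2)] by (auto simp: borel_subgroup_def)
qed

section \<open>Normal forms of idempotents under triangular conjugation\<close>

section \<open>Clans\<close>

definition dg :: "nat \<Rightarrow> nat set \<Rightarrow> 'a::field mat" where
  "dg n R = mat_diag n (\<lambda>i. if i \<in> R then 1 else 0)"

lemma dg_carrier [simp]: "dg n R \<in> carrier_mat n n"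
  by (simp add: dg_def)

lemma dg_dim [simp]: "dim_row (dg n R) = n" "dim_col (dg n R) = n"
  by (simp_all add: dg_def mat_diag_def)

lemma dg_index [simp]: "i < n \<Longrightarrow> j < n \<Longrightarrow> dg n R $$ (i, j) = (if i = j \<and> i \<in> R then 1 else 0)"
  by (auto simp: dg_def mat_diag_def)

lemma dg_idem: "dg n R * dg n R = dg n R"
  unfolding dg_def mat_diag_diag by (intro arg_cong[of _ _ "mat_diag n"]) auto

lemma char_poly_dg:
  fixes R :: "nat set"
  assumes "R \<subseteq> {..<n}"
  shows "order 1 (char_poly (dg n R :: 'a::field mat)) = card R"
proof -
  have "char_poly (dg n R :: 'a mat) = (\<Prod>a\<leftarrow>diag_mat (dg n R). [:- a, 1:])"
    by (rule char_poly_upper_triangular[OF dg_carrier]) auto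
  also have "\<dots> = (\<Prod>i\<in>{0..<n}. [:- (if i \<in> R then 1 else 0), 1:])"
    by (simp add: diag_mat_def prod.distinct_set_conv_list[symmetric] o_def cong: map_cong)
  also have "\<dots> = (\<Prod>i\<in>R. [:- 1, 1:]) * (\<Prod>i\<in>{0..<n} - R. [:0, 1:])"
    using assms by (subst prod.subset_diff[of R]) (auto simp: mult.commute intro!: arg_cong2[of _ _ _ _ "(*)"] prod.cong)
  finally have e: "char_poly (dg n R :: 'a mat) = [:- 1, 1:] ^ card R * [:0, 1:] ^ card ({0..<n} - R)" by simp
  have "order 1 ([:0, 1 :: 'a:] ^ card ({0..<n} - R)) = 0" by (rule order_0I) simp
  moreover have "[:- 1, 1 :: 'a:] ^ card R * [:0, 1:] ^ card ({0..<n} - R) \<noteq> 0" by simp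
  ultimately show ?thesis
    unfolding e by (subst order_mult) (simp_all only: order_power_n_n, simp)
qed

text \<open>The number of ones is the multiplicity of the root 1 of the characteristic polynomial, a
  similarity invariant. The trace would determine it only modulo the characteristic.\<close>

lemma similar_dg:
  assumes R: "R \<subseteq> {..<n}" "R' \<subseteq> {..<n}" and h: "h \<in> carrier (GL n)"
    and e: "(dg n R :: 'a::field mat) * h = h * dg n R'"
  shows "card R = card R'"
proof -
  have hm: "h \<in> carrier_mat n n" "minv h \<in> carrier_mat n n" using h minv_GL GL_carrier_mat by blast+
  have "dg n R = h * dg n R' * minv h"
    using minv_cancel_right(2)[OF h, of "dg n R" n] e by simp
  then have "similar_mat (dg n R) (dg n R' :: 'a mat)"
    using hm minv_left[OF h] minv_right[OF h] by (intro similar_matI[of _ _ _ _ n]) auto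
  then have "char_poly (dg n R) = char_poly (dg n R' :: 'a mat)" by (rule char_poly_similar)
  then show ?thesis using char_poly_dg[OF R(1), where 'a = 'a] char_poly_dg[OF R(2), where 'a = 'a] by simp
qed

text \<open>
  A clan is an involution of \<open>{..<n}\<close>, exchanging \<open>i \<in> Op\<close> and \<open>p i > i\<close>, with a sign on each fixed point.
  The fixed points and the closing elements \<open>p i\<close> carrying \<open>+\<close> make up \<open>R\<close>, the set of indices of the basis vectors
  of the image of the idempotent \<open>cmat\<close>, in the basis formed by the columns of \<open>cbasis\<close>. An opening
  element may belong to \<open>R\<close> instead of the corresponding closing element.
\<close>

locale clan =
  fixes n :: nat and Op :: "nat set" and p :: "nat \<Rightarrow> nat" and R :: "nat set" and \<kappa> :: "nat \<Rightarrow> 'a::field"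
  assumes Op_p: "i \<in> Op \<Longrightarrow> i < p i" "i \<in> Op \<Longrightarrow> p i < n" "i \<in> Op \<Longrightarrow> p i \<notin> Op"
    and inj_p: "inj_on p Op"
    and R: "R \<subseteq> {..<n}" "i \<in> Op \<Longrightarrow> i \<in> R \<longleftrightarrow> p i \<notin> R"
    and \<kappa>: "i \<in> Op \<Longrightarrow> \<kappa> i \<noteq> 0"
begin

text \<open>It is the identity on the columns of \<open>cbasis\<close> indexed by \<open>R\<close>
  and zero on the others (\<open>cmat_cbasis\<close>). For \<open>\<kappa> b = - 1\<close> and an
  opening \<open>b \<notin> R\<close> it sends the unit vector \<open>b\<close> to the unit vector
  \<open>p b\<close>.\<close>

definition cmat :: "'a mat" where
  "cmat = mat n n (\<lambda>(a, b). if a = b then (if b \<in> R then 1 else 0)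
     else if b \<in> Op \<and> a = p b then (if b \<in> R then \<kappa> b else - \<kappa> b) else 0)"

definition cbasis :: "'a mat" where
  "cbasis = mat n n (\<lambda>(a, b). if a = b then 1 else if b \<in> Op \<and> a = p b then \<kappa> b else 0)"

lemma cmat_carrier [simp]: "cmat \<in> carrier_mat n n"
  and cbasis_carrier [simp]: "cbasis \<in> carrier_mat n n"
  by (simp_all add: cmat_def cbasis_def)

lemma cbasis_GL: "cbasis \<in> carrier (GL n)"
proof -
  have "det cbasis = prod_list (diag_mat cbasis)"
    by (rule det_lower_triangular[OF _ cbasis_carrier]) (use Op_p(1) in \<open>force simp: cbasis_def\<close>)
  also have "\<dots> = 1" by (auto simp: prod_list_diag_prod cbasis_def)
  finally show ?thesis by (simp add: carrier_GL)
qed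

lemma mult_cbasis:
  assumes "A \<in> carrier_mat m n" "a < m" "b < n"
  shows "(A * cbasis) $$ (a, b) = A $$ (a, b) + (if b \<in> Op then \<kappa> b * A $$ (a, p b) else 0)"
proof -
  have "(A * cbasis) $$ (a, b) = (\<Sum>c\<in>{0..<n}. A $$ (a, c) * cbasis $$ (c, b))"
    using assms by (simp add: scalar_prod_def cbasis_def)
  also have "\<dots> = (\<Sum>c\<in>{0..<n}. (if c = b then A $$ (a, b) else 0) + (if c = p b then (if b \<in> Op then \<kappa> b * A $$ (a, p b) else 0) else 0))"
    using assms Op_p(1)[of b] by (intro sum.cong) (auto simp: cbasis_def)
  also have "\<dots> = A $$ (a, b) + (if b \<in> Op then \<kappa> b * A $$ (a, p b) else 0)"
    unfolding sum.distrib using assms Op_p(2)[of b] by auto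
  finally show ?thesis .
qed

lemma cmat_cbasis: "cmat * cbasis = cbasis * dg n R"
proof (rule eq_matI)
  fix a b assume "a < dim_row (cbasis * dg n R)" "b < dim_col (cbasis * dg n R)"
  then have ab: "a < n" "b < n" by (auto simp: cbasis_def dg_def mat_diag_def)
  have "(cbasis * dg n R) $$ (a, b) = cbasis $$ (a, b) * (if b \<in> R then 1 else 0)"
    unfolding dg_def using mat_diag_mult_right[OF cbasis_carrier] ab by simp
  note e = this
  show "(cmat * cbasis) $$ (a, b) = (cbasis * dg n R) $$ (a, b)"
  proof (cases "b \<in> Op")
    case True
    note b = Op_p[OF True]
    have r: "p b \<in> R \<longleftrightarrow> b \<notin> R" using R(2)[OF True] by blast
    show ?thesis
      unfolding mult_cbasis[OF cmat_carrier ab] e using ab True b r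
      by (cases "b \<in> R"; cases "a = b"; cases "a = p b") (simp_all add: cmat_def cbasis_def)
  next
    case False
    then show ?thesis
      unfolding mult_cbasis[OF cmat_carrier ab] e using ab by (simp add: cmat_def cbasis_def)
  qed
qed (auto simp: cmat_def cbasis_def)

lemma intertwines_cmat:
  assumes P: "P \<in> carrier_mat n n" and f: "\<And>b. b < n \<Longrightarrow> f b \<in> carrier_vec n"
    and Pf: "\<And>b. b < n \<Longrightarrow> P *\<^sub>v f b = (if b \<in> R then f b else 0\<^sub>v n) +
      (if b \<in> Op then (if b \<in> R then \<kappa> b else - \<kappa> b) \<cdot>\<^sub>v f (p b) else 0\<^sub>v n)"
  defines "t \<equiv> mat n n (\<lambda>(l, i). f i $ l)"
  shows "P * t = t * cmat"
proof (rule eq_matI)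
  have tm: "t \<in> carrier_mat n n" by (simp add: t_def)
  fix a b assume "a < dim_row (t * cmat)" "b < dim_col (t * cmat)"
  then have ab: "a < n" "b < n" by (auto simp: t_def cmat_def)
  have colt: "col t b = f b" using f[OF ab(2)] ab(2) by (auto simp: t_def intro!: eq_vecI)
  let ?c = "if b \<in> Op then (if b \<in> R then \<kappa> b else - \<kappa> b) * f (p b) $ a else 0"
  have "(t * cmat) $$ (a, b) = (\<Sum>c\<in>{0..<n}. t $$ (a, c) * cmat $$ (c, b))"
    using ab by (simp add: t_def scalar_prod_def cmat_def)
  also have "\<dots> = (\<Sum>c\<in>{0..<n}. (if c = b then (if b \<in> R then f b $ a else 0) else 0) + (if c = p b then ?c else 0))"
    using ab Op_p(1)[of b] by (intro sum.cong refl) (auto simp: cmat_def t_def)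
  also have "\<dots> = (if b \<in> R then f b $ a else 0) + ?c"
    unfolding sum.distrib using ab Op_p(2)[of b] by auto
  also have "\<dots> = (P *\<^sub>v f b) $ a"
    unfolding Pf[OF ab(2)] using ab f[OF ab(2)] f[OF Op_p(2)[of b]] by (cases "b \<in> Op"; cases "b \<in> R") auto
  also have "\<dots> = (P * t) $$ (a, b)" using P tm ab colt by simp
  finally show "(P * t) $$ (a, b) = (t * cmat) $$ (a, b)" by simp
qed (use P in \<open>auto simp: t_def cmat_def\<close>)

lemma cmat_vec:
  assumes v: "v \<in> carrier_vec n"
  shows "a < n \<Longrightarrow> a \<notin> p ` Op \<Longrightarrow> (cmat *\<^sub>v v) $ a = (if a \<in> R then v $ a else 0)"
    and "b \<in> Op \<Longrightarrow> (cmat *\<^sub>v v) $ (p b) = (if p b \<in> R then v $ p b else 0) + (if b \<in> R then \<kappa> b else - \<kappa> b) * v $ b"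
proof -
  have s: "(cmat *\<^sub>v v) $ a = (\<Sum>c\<in>{0..<n}. cmat $$ (a, c) * v $ c)" if "a < n" for a
    using v that by (auto simp: scalar_prod_def cmat_def intro!: sum.cong)
  show "(cmat *\<^sub>v v) $ a = (if a \<in> R then v $ a else 0)" if "a < n" "a \<notin> p ` Op"
  proof -
    have "(cmat *\<^sub>v v) $ a = (\<Sum>c\<in>{0..<n}. if c = a then (if a \<in> R then v $ a else 0) else 0)"
      unfolding s[OF that(1)] using that by (intro sum.cong) (auto simp: cmat_def)
    then show ?thesis using that by simp
  qed
  show "(cmat *\<^sub>v v) $ (p b) = (if p b \<in> R then v $ p b else 0) + (if b \<in> R then \<kappa> b else - \<kappa> b) * v $ b" if b: "b \<in> Op"
  proof -
    have "(cmat *\<^sub>v v) $ (p b) = (\<Sum>c\<in>{0..<n}. (if c = p b then (if p b \<in> R then v $ p b else 0) else 0)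
        + (if c = b then (if b \<in> R then \<kappa> b else - \<kappa> b) * v $ b else 0))"
      unfolding s[OF Op_p(2)[OF b]] using b Op_p[OF b] inj_onD[OF inj_p _ b]
      by (intro sum.cong) (auto simp: cmat_def)
    then show ?thesis unfolding sum.distrib using Op_p[OF b] by simp
  qed
qed

lemma cmat_unit:
  assumes "b < n" "b \<notin> Op"
  shows "cmat *\<^sub>v unit_vec n b = (if b \<in> R then unit_vec n b else 0\<^sub>v n)"
  using assms unfolding col_eq_mult_unit[OF cmat_carrier assms(1), symmetric]
  by (intro eq_vecI) (auto simp: cmat_def)

lemma cmat_pair:
  assumes "b \<in> Op"
  shows "leads n (cbasis *\<^sub>v unit_vec n b) (p b)"
    and "cmat *\<^sub>v (cbasis *\<^sub>v unit_vec n b) = (if b \<in> R then cbasis *\<^sub>v unit_vec n b else 0\<^sub>v n)"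
proof -
  note b = Op_p[OF assms]
  have bn: "b < n" using b by simp
  have c: "col cbasis b = cbasis *\<^sub>v unit_vec n b" by (rule col_eq_mult_unit[OF cbasis_carrier bn])
  show "leads n (cbasis *\<^sub>v unit_vec n b) (p b)"
    unfolding c[symmetric] leads_def using b bn assms \<kappa>[OF assms] by (auto simp: cbasis_def)
  have "cmat *\<^sub>v (cbasis *\<^sub>v unit_vec n b) = cbasis *\<^sub>v (dg n R *\<^sub>v unit_vec n b)"
    using cmat_cbasis assoc_mult_mat_vec[OF cmat_carrier cbasis_carrier, of "unit_vec n b"]
      assoc_mult_mat_vec[OF cbasis_carrier dg_carrier, of "unit_vec n b" R] by simp
  also have "dg n R *\<^sub>v unit_vec n b = (if b \<in> R then unit_vec n b else 0\<^sub>v n)"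
    unfolding col_eq_mult_unit[OF dg_carrier bn, symmetric] using bn by (intro eq_vecI) auto
  finally have e: "cmat *\<^sub>v (cbasis *\<^sub>v unit_vec n b) = cbasis *\<^sub>v (if b \<in> R then unit_vec n b else 0\<^sub>v n)" .
  have "cbasis *\<^sub>v 0\<^sub>v n = 0\<^sub>v n" by (intro eq_vecI) (auto simp: cbasis_def)
  then show "cmat *\<^sub>v (cbasis *\<^sub>v unit_vec n b) = (if b \<in> R then cbasis *\<^sub>v unit_vec n b else 0\<^sub>v n)"
    unfolding e by simp
qed

end

text \<open>The leading indices of the vectors fixed by \<open>P\<close>. Like the two notions that
  follow, it refers to the flag only through \<open>leads\<close> and \<open>flag\<close>, so
  triangular conjugation does not change it.\<close>

definition fixed_leads :: "nat \<Rightarrow> 'a::field mat \<Rightarrow> nat set" where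
  "fixed_leads n P = {i. \<exists>v. leads n v i \<and> P *\<^sub>v v = v}"

definition killed_leads :: "nat \<Rightarrow> 'a::field mat \<Rightarrow> nat set" where
  "killed_leads n P = {i. \<exists>v. leads n v i \<and> P *\<^sub>v v = 0\<^sub>v n}"

definition level :: "nat \<Rightarrow> 'a::field mat \<Rightarrow> nat \<Rightarrow> nat \<Rightarrow> bool" where
  "level n P i j \<longleftrightarrow> (\<exists>v. leads n v i \<and> P *\<^sub>v v \<in> flag n (Suc j))"

context clan
begin

text \<open>A vector led by \<open>i\<close> vanishes at the later index \<open>p i\<close>, so only
  the contribution of its coordinate \<open>i\<close> survives there. Hence an opening index leads
  neither a fixed nor a killed vector, and the image cannot lie below \<open>p i\<close>.\<close>

lemma opening_vec:
  assumes "i \<in> Op" "leads n v i"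
  shows "(cmat *\<^sub>v v) $ p i = (if i \<in> R then \<kappa> i else - \<kappa> i) * v $ i" "(cmat *\<^sub>v v) $ p i \<noteq> 0"
proof -
  have "v $ p i = 0" "v $ i \<noteq> 0" using assms Op_p[OF assms(1)] by (auto simp: leads_def)
  moreover have "v \<in> carrier_vec n" using assms(2) by (simp add: leads_def)
  ultimately show "(cmat *\<^sub>v v) $ p i = (if i \<in> R then \<kappa> i else - \<kappa> i) * v $ i" "(cmat *\<^sub>v v) $ p i \<noteq> 0"
    using cmat_vec(2)[OF _ assms(1), of v] \<kappa>[OF assms(1)] by auto
qed

text \<open>A closing index always occurs: through its unit vector if it is in \<open>R\<close>, and
  otherwise through the column of \<open>cbasis\<close> at its opening partner, which is led by the
  closing index.\<close>

lemma fixed_leads_cmat: "fixed_leads n cmat = {i. i < n \<and> i \<notin> Op \<and> (i \<in> R \<or> i \<in> p ` Op)}"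
proof (intro equalityI subsetI)
  fix i assume "i \<in> fixed_leads n cmat"
  then obtain v where v: "leads n v i" "cmat *\<^sub>v v = v" by (auto simp: fixed_leads_def)
  then have vi: "v \<in> carrier_vec n" "i < n" "v $ i \<noteq> 0" by (auto simp: leads_def)
  have "i \<notin> Op"
  proof
    assume i: "i \<in> Op"
    have "v $ p i = 0" using v(1) Op_p[OF i] by (auto simp: leads_def)
    then show False using opening_vec(2)[OF i v(1)] v(2) by simp
  qed
  moreover have "i \<in> R \<or> i \<in> p ` Op"
    using cmat_vec(1)[OF vi(1,2)] v(2) vi(3) by force
  ultimately show "i \<in> {i. i < n \<and> i \<notin> Op \<and> (i \<in> R \<or> i \<in> p ` Op)}" using vi by simp
next
  fix i assume "i \<in> {i. i < n \<and> i \<notin> Op \<and> (i \<in> R \<or> i \<in> p ` Op)}"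
  then have i: "i < n" "i \<notin> Op" "i \<in> R \<or> i \<in> p ` Op" by auto
  show "i \<in> fixed_leads n cmat"
  proof (cases "i \<in> R")
    case True
    then show ?thesis using cmat_unit[OF i(1,2)] leads_unit_vec[OF i(1)] by (auto simp: fixed_leads_def)
  next
    case False
    then obtain b where b: "b \<in> Op" "i = p b" "b \<in> R" using i(3) R(2) by blast
    then show ?thesis using cmat_pair[OF b(1)] by (auto simp: fixed_leads_def)
  qed
qed

lemma killed_leads_cmat: "killed_leads n cmat = {i. i < n \<and> i \<notin> Op \<and> (i \<notin> R \<or> i \<in> p ` Op)}"
proof (intro equalityI subsetI)
  fix i assume "i \<in> killed_leads n cmat"
  then obtain v where v: "leads n v i" "cmat *\<^sub>v v = 0\<^sub>v n" by (auto simp: killed_leads_def)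
  then have vi: "v \<in> carrier_vec n" "i < n" "v $ i \<noteq> 0" by (auto simp: leads_def)
  have "i \<notin> Op"
  proof
    assume i: "i \<in> Op"
    then show False using opening_vec(2)[OF i v(1)] v(2) Op_p[OF i] by simp
  qed
  moreover have "i \<notin> R \<or> i \<in> p ` Op"
    using cmat_vec(1)[OF vi(1,2)] v(2) vi(2,3) by force
  ultimately show "i \<in> {i. i < n \<and> i \<notin> Op \<and> (i \<notin> R \<or> i \<in> p ` Op)}" using vi by simp
next
  fix i assume "i \<in> {i. i < n \<and> i \<notin> Op \<and> (i \<notin> R \<or> i \<in> p ` Op)}"
  then have i: "i < n" "i \<notin> Op" "i \<notin> R \<or> i \<in> p ` Op" by auto
  show "i \<in> killed_leads n cmat"
  proof (cases "i \<in> R")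
    case False
    then show ?thesis using cmat_unit[OF i(1,2)] leads_unit_vec[OF i(1)] by (auto simp: killed_leads_def)
  next
    case True
    then obtain b where b: "b \<in> Op" "i = p b" "b \<notin> R" using i(3) R(2) by blast
    then show ?thesis using cmat_pair[OF b(1)] by (auto simp: killed_leads_def)
  qed
qed

lemma level_cmat:
  assumes i: "i \<in> Op"
  shows "level n cmat i j \<longleftrightarrow> p i \<le> j"
proof
  assume "level n cmat i j"
  then obtain v where v: "leads n v i" "cmat *\<^sub>v v \<in> flag n (Suc j)" by (auto simp: level_def)
  show "p i \<le> j"
  proof (rule ccontr)
    assume "\<not> p i \<le> j"
    then have "(cmat *\<^sub>v v) $ p i = 0" using v(2) Op_p[OF i] by (auto simp: flag_def)
    then show False using opening_vec(2)[OF i v(1)] by simp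
  qed
next
  assume j: "p i \<le> j"
  have i': "i < n" using Op_p[OF i] by simp
  have "cmat *\<^sub>v unit_vec n i \<in> flag n (Suc j)"
    unfolding col_eq_mult_unit[OF cmat_carrier i', symmetric] flag_def
    using j Op_p[OF i] i' by (auto simp: cmat_def intro!: carrier_vecI)
  then show "level n cmat i j" using leads_unit_vec[OF i'] by (auto simp: level_def)
qed

text \<open>Closing indices lead both fixed and killed vectors, so the difference leaves exactly the
  unpaired indices with sign plus.\<close>

lemma plus_cmat: "fixed_leads n cmat - killed_leads n cmat = R - Op - p ` Op"
  unfolding fixed_leads_cmat killed_leads_cmat using R(1) by auto

lemma opening_cmat: "Op = {..<n} - (fixed_leads n cmat \<union> killed_leads n cmat)"
  unfolding fixed_leads_cmat killed_leads_cmat using Op_p(1,2) by fastforce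

lemma Least_level_cmat: "i \<in> Op \<Longrightarrow> (LEAST j. level n cmat i j) = p i"
  by (rule Least_equality) (auto simp: level_cmat)

end

text \<open>Multiplication by \<open>t\<close> turns witnesses for \<open>P\<close> into witnesses
  for \<open>P'\<close> with the same leading index; the inverse of \<open>t\<close> goes
  back.\<close>

lemma leads_invariants:
  assumes t: "t \<in> tri n" and P: "P \<in> carrier_mat n n" "P' \<in> carrier_mat n n" and e: "t * P = P' * t"
  shows "fixed_leads n P = fixed_leads n P'" "killed_leads n P = killed_leads n P'" "level n P i j \<longleftrightarrow> level n P' i j"
proof -
  have *: "fixed_leads n P \<subseteq> fixed_leads n P' \<and> killed_leads n P \<subseteq> killed_leads n P' \<and> (level n P i j \<longrightarrow> level n P' i j)"
    if t: "t \<in> tri n" and P: "P \<in> carrier_mat n n" "P' \<in> carrier_mat n n" and e: "t * P = P' * t" for t P P' :: "'a mat"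
  proof -
    note tm = tri_carrier_mat[OF t]
    have tv: "P' *\<^sub>v (t *\<^sub>v v) = t *\<^sub>v (P *\<^sub>v v)" if "v \<in> carrier_vec n" for v
      using assoc_mult_mat_vec[OF P(2) tm that] assoc_mult_mat_vec[OF tm P(1) that] e by simp
    have t0: "t *\<^sub>v 0\<^sub>v n = 0\<^sub>v n" using tm by (intro eq_vecI) auto
    have tv': "P' *\<^sub>v (t *\<^sub>v v) = t *\<^sub>v (P *\<^sub>v v)" if "leads n v i" for v i
      using tv that by (simp add: leads_def)
    have "\<exists>w. leads n w i \<and> P' *\<^sub>v w = w" if v: "leads n v i" "P *\<^sub>v v = v" for v i
      using tri_leads[OF t v(1)] tv'[OF v(1)] v(2) by (intro exI[of _ "t *\<^sub>v v"]) simp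
    moreover have "\<exists>w. leads n w i \<and> P' *\<^sub>v w = 0\<^sub>v n" if v: "leads n v i" "P *\<^sub>v v = 0\<^sub>v n" for v i
      using tri_leads[OF t v(1)] tv'[OF v(1)] v(2) t0 by (intro exI[of _ "t *\<^sub>v v"]) simp
    moreover have "\<exists>w. leads n w i \<and> P' *\<^sub>v w \<in> flag n (Suc j)" if v: "leads n v i" "P *\<^sub>v v \<in> flag n (Suc j)" for v
      using tri_leads[OF t v(1)] tv'[OF v(1)] tri_flag[OF t v(2)] by (intro exI[of _ "t *\<^sub>v v"]) simp
    ultimately show ?thesis
      unfolding fixed_leads_def killed_leads_def level_def by blast
  qed
  have tG: "t \<in> carrier (GL n)" using tri_GL[OF t] .
  have tm: "t \<in> carrier_mat n n" "minv t \<in> carrier_mat n n" using t tri_minv tri_carrier_mat by blast+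
  have "minv t * P' = minv t * (P' * t) * minv t"
    using minv_cancel_right(2)[OF tG, of "minv t * P'" n] tm P by (simp add: sq_assoc[of _ n] sq_mult del: assoc_mult_mat)
  also have "\<dots> = minv t * (t * P) * minv t" using e by simp
  also have "\<dots> = P * minv t" using minv_cancel(1)[OF tG P(1)] by simp
  finally have e': "minv t * P' = P * minv t" .
  show "fixed_leads n P = fixed_leads n P'" "killed_leads n P = killed_leads n P'" "level n P i j \<longleftrightarrow> level n P' i j"
    using *[OF t P e] *[OF tri_minv[OF t] P(2,1) e'] by blast+
qed

lemma clan_unique:
  assumes c: "clan n Op p R \<kappa>" and c': "clan n Op' p' R' \<kappa>'" and t: "t \<in> tri n"
    and e: "t * clan.cmat n Op p R \<kappa> = clan.cmat n Op' p' R' \<kappa>' * t"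
  shows "Op = Op'" "i \<in> Op \<Longrightarrow> p i = p' i" "R - Op - p ` Op = R' - Op' - p' ` Op'"
proof -
  interpret c: clan n Op p R \<kappa> by (rule c)
  interpret c': clan n Op' p' R' \<kappa>' by (rule c')
  note I = leads_invariants[OF t c.cmat_carrier c'.cmat_carrier e]
  show O: "Op = Op'" using c.opening_cmat c'.opening_cmat I(1,2) by simp
  show "i \<in> Op \<Longrightarrow> p i = p' i"
    using c.Least_level_cmat c'.Least_level_cmat I(3) O by simp
  show "R - Op - p ` Op = R' - Op' - p' ` Op'" using c.plus_cmat c'.plus_cmat I(1,2) by simp
qed

lemma leads_mat:
  assumes "\<And>i. i < n \<Longrightarrow> leads n (f i) i"
  shows "mat n n (\<lambda>(l, i). f i $ l) \<in> tri n"
  by (rule triI) (use assms in \<open>auto simp: leads_def\<close>)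

text \<open>
  An index \<open>i\<close> opens if no vector led by \<open>i\<close> lies in the image or in the kernel of \<open>P\<close>; its partner is the
  least possible leading index of \<open>P v\<close> for \<open>v\<close> led by \<open>i\<close>.
\<close>

lemma clan_exists_GL:
  fixes P :: "'a::field mat"
  assumes P: "P \<in> carrier_mat n n" and idem: "P * P = P"
  shows "\<exists>Op p R t. clan n Op p R (\<lambda>_. - 1 :: 'a) \<and> R \<inter> Op = {} \<and> t \<in> tri n \<and>
     P * t = t * clan.cmat n Op p R (\<lambda>_. - 1)"
proof -
  have PP: "P *\<^sub>v (P *\<^sub>v v) = P *\<^sub>v v" if "v \<in> carrier_vec n" for v
    using assoc_mult_mat_vec[OF P P that] idem by simp
  have Pc: "P *\<^sub>v v \<in> carrier_vec n" for v using P by (intro carrier_vecI) simp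
  have lc: "leads n v i \<Longrightarrow> v \<in> carrier_vec n" "leads n v i \<Longrightarrow> i < n" for v i by (auto simp: leads_def)
  \<comment> \<open>The condition \<open>i \<le> j\<close> forces \<open>p i \<ge> i\<close>, so
    that an index that does not open satisfies \<open>p i = i\<close>.\<close>
  define K where "K i j \<longleftrightarrow> i \<le> j \<and> level n P i j" for i j
  define p where "p i = (LEAST j. K i j)" for i
  have "K i (n - 1)" if "i < n" for i
    using leads_unit_vec[OF that] that Pc by (auto simp: K_def level_def flag_full)
  then have Kp: "K i (p i)" and p_le: "p i \<le> n - 1" if "i < n" for i
    using that unfolding p_def by (auto intro: LeastI Least_le)
  have Kmin: "p i \<le> j" if "K i j" for i j using that unfolding p_def by (rule Least_le)
  have ip: "i \<le> p i" if "i < n" for i using Kp[OF that] by (simp add: K_def)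
  define Op where "Op = {i. i < n \<and> i < p i}"
  define f0 where "f0 i = (SOME v. leads n v i \<and> P *\<^sub>v v \<in> flag n (Suc (p i)))" for i
  have f0: "leads n (f0 i) i" "P *\<^sub>v f0 i \<in> flag n (Suc (p i))" if "i < n" for i
  proof -
    have "\<exists>v. leads n v i \<and> P *\<^sub>v v \<in> flag n (Suc (p i))" using Kp[OF that] by (simp add: K_def level_def)
    then have "leads n (f0 i) i \<and> P *\<^sub>v f0 i \<in> flag n (Suc (p i))" unfolding f0_def by (rule someI_ex)
    then show "leads n (f0 i) i" "P *\<^sub>v f0 i \<in> flag n (Suc (p i))" by auto
  qed
  \<comment> \<open>Minimality of \<open>p i\<close>; passing to \<open>p i - 1\<close> respects
    \<open>i \<le> j\<close> because \<open>i < p i\<close>.\<close>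
  have below: "P *\<^sub>v v \<notin> flag n (p i)" if i: "i \<in> Op" and v: "leads n v i" for i v
  proof
    assume "P *\<^sub>v v \<in> flag n (p i)"
    moreover have "i < p i" using i by (simp add: Op_def)
    ultimately have "K i (p i - 1)" using v by (auto simp: K_def level_def)
    then show False using Kmin[of i "p i - 1"] \<open>i < p i\<close> by simp
  qed
  have lead_p: "leads n (P *\<^sub>v f0 i) (p i)" if i: "i \<in> Op" for i
  proof -
    have "i < n" using i by (simp add: Op_def)
    then show ?thesis using below[OF i f0(1)] f0(2) p_le[of i] by (auto simp: leads_flag_Suc)
  qed
  have noA: "i \<notin> fixed_leads n P" if i: "i \<in> Op" for i
  proof
    assume "i \<in> fixed_leads n P"
    then obtain v where v: "leads n v i" "P *\<^sub>v v = v" by (auto simp: fixed_leads_def)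
    have "v \<in> flag n (p i)" using leads_flag[OF v(1)] i by (simp add: Op_def)
    then show False using below[OF i v(1)] v(2) by simp
  qed
  have noOp: "p i \<notin> Op" if i: "i \<in> Op" for i
  proof -
    have "f0 i \<in> carrier_vec n" using f0(1) lc(1) i by (auto simp: Op_def)
    then have "P *\<^sub>v (P *\<^sub>v f0 i) = P *\<^sub>v f0 i" by (rule PP)
    then have "p i \<in> fixed_leads n P" using lead_p[OF i] by (auto simp: fixed_leads_def)
    then show ?thesis using noA by blast
  qed
  have inj: "inj_on p Op"
  proof (rule linorder_inj_onI)
    fix i i' assume ii: "i < i'" "i \<in> Op" "i' \<in> Op"
    show "p i \<noteq> p i'"
    proof
      assume eq: "p i = p i'"
      have n: "i < n" "i' < n" using ii by (auto simp: Op_def)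
      have l: "leads n (P *\<^sub>v f0 i') (p i')" "leads n (P *\<^sub>v f0 i) (p i')" using lead_p[OF ii(2)] lead_p[OF ii(3)] eq by simp_all
      \<comment> \<open>Cancelling the leading terms of the images changes the vector led by
        \<open>i'\<close> only below \<open>i'\<close>, but moves its image below
        \<open>p i'\<close>, against minimality.\<close>
      obtain c where c: "P *\<^sub>v f0 i' - c \<cdot>\<^sub>v (P *\<^sub>v f0 i) \<in> flag n (p i')" using leads_cancel[OF l] by metis
      have fc: "f0 i \<in> carrier_vec n" "f0 i' \<in> carrier_vec n" using f0(1) lc(1) n by blast+
      have "c \<cdot>\<^sub>v f0 i \<in> flag n i'"
        using f0(1)[OF n(1)] ii(1) leads_flag subsp_smult[OF subsp_flag] by blast
      then have "leads n (f0 i' - c \<cdot>\<^sub>v f0 i) i'" using leads_diff_flag(1)[OF f0(1)[OF n(2)]] by blast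
      moreover have "P *\<^sub>v (f0 i' - c \<cdot>\<^sub>v f0 i) = P *\<^sub>v f0 i' - c \<cdot>\<^sub>v (P *\<^sub>v f0 i)"
        using fc by (simp add: mult_minus_distrib_mat_vec[OF P] mult_mat_vec[OF P])
      ultimately show False using below[OF ii(3)] c by metis
    qed
  qed (rule linear)
  \<comment> \<open>The normalised choice: the closing end of each pair belongs to \<open>R\<close>,
    never the opening one.\<close>
  define R where "R = {i. i < n \<and> i \<notin> Op \<and> i \<in> fixed_leads n P}"
  have RO: "b \<notin> Op" if "b \<in> R" for b using that by (simp add: R_def)
  have pR: "p i \<in> R" if i: "i \<in> Op" for i
  proof -
    have "f0 i \<in> carrier_vec n" "i < n" using f0(1) lc(1) i by (auto simp: Op_def)
    then show ?thesis
      using PP lead_p[OF i] lc(2)[OF lead_p[OF i]] noOp[OF i] by (auto simp: R_def fixed_leads_def)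
  qed
  have clan: "clan n Op p R (\<lambda>_. - 1 :: 'a)"
  proof
    fix i assume i: "i \<in> Op"
    show "i < p i" "p i < n" "p i \<notin> Op" "i \<in> R \<longleftrightarrow> p i \<notin> R"
      using i noOp[OF i] pR[OF i] by (auto simp: Op_def R_def)
  qed (auto simp: inj R_def)
  interpret clan n Op p R "\<lambda>_. - 1 :: 'a" by (rule clan)
  have rest: "\<exists>v. leads n v i \<and> P *\<^sub>v v = (if i \<in> R then v else 0\<^sub>v n)" if i: "i < n" "i \<notin> Op" for i
  proof (cases "i \<in> R")
    case True
    then show ?thesis by (auto simp: R_def fixed_leads_def)
  next
    case False
    \<comment> \<open>The vector \<open>f0 i - u\<close> is killed by \<open>P\<close>. It is still
      led by \<open>i\<close>, since otherwise the fixed vector \<open>u\<close> would be led by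
      \<open>i\<close> and the index would belong to \<open>R\<close>.\<close>
    define u where "u = P *\<^sub>v f0 i"
    have pi: "p i = i" using i ip[OF i(1)] by (auto simp: Op_def)
    have fc: "f0 i \<in> carrier_vec n" using f0(1)[OF i(1)] lc(1) by blast
    have uf: "u \<in> flag n (Suc i)" using f0(2)[OF i(1)] pi by (simp add: u_def)
    have "u \<in> flag n i"
    proof (rule ccontr)
      assume "u \<notin> flag n i"
      then have "leads n u i" using uf i by (simp add: leads_flag_Suc)
      then have "i \<in> R" using i PP[OF fc] by (auto simp: R_def fixed_leads_def u_def)
      then show False using False by simp
    qed
    then have "leads n (f0 i - u) i" using leads_diff_flag(1)[OF f0(1)[OF i(1)]] by blast
    moreover have "P *\<^sub>v (f0 i - u) = 0\<^sub>v n"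
      using PP[OF fc] Pc[of "f0 i"] fc by (simp add: u_def mult_minus_distrib_mat_vec[OF P])
    ultimately show ?thesis using False by auto
  qed
  \<comment> \<open>At a closing index the basis vector is the image of its opening partner, so that
    \<open>P\<close> permutes these vectors exactly as \<open>cmat\<close> does.\<close>
  define f where "f i = (if i \<in> Op then f0 i else if \<exists>b\<in>Op. i = p b then P *\<^sub>v f0 (THE b. b \<in> Op \<and> i = p b)
     else SOME v. leads n v i \<and> P *\<^sub>v v = (if i \<in> R then v else 0\<^sub>v n))" for i
  have fOp: "f i = f0 i" if "i \<in> Op" for i using that by (simp add: f_def)
  have fp: "f (p b) = P *\<^sub>v f0 b" if b: "b \<in> Op" for b
  proof -
    have "(THE b'. b' \<in> Op \<and> p b = p b') = b" using b inj_onD[OF inj] by blast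
    then show ?thesis using noOp[OF b] b by (auto simp: f_def)
  qed
  have frest: "leads n (f i) i \<and> P *\<^sub>v f i = (if i \<in> R then f i else 0\<^sub>v n)"
    if i: "i < n" "i \<notin> Op" "\<not> (\<exists>b\<in>Op. i = p b)" for i
  proof -
    have "f i = (SOME v. leads n v i \<and> P *\<^sub>v v = (if i \<in> R then v else 0\<^sub>v n))"
      unfolding f_def using i by simp
    then show ?thesis using someI_ex[OF rest[OF i(1,2)]] by simp
  qed
  have lead: "leads n (f i) i" if "i < n" for i
    using frest[OF that] fp lead_p fOp f0(1)[OF that] by (cases "i \<in> Op"; cases "\<exists>b\<in>Op. i = p b") auto
  define t where "t = mat n n (\<lambda>(l, i). f i $ l)"
  have t: "t \<in> tri n" unfolding t_def by (rule leads_mat[OF lead])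
  have "P * t = t * cmat"
    unfolding t_def
  proof (rule intertwines_cmat[OF P lc(1)[OF lead]])
    fix b assume b: "b < n"
    show "P *\<^sub>v f b = (if b \<in> R then f b else 0\<^sub>v n) + (if b \<in> Op then (if b \<in> R then - 1 else - (- 1)) \<cdot>\<^sub>v f (p b) else 0\<^sub>v n)"
    proof (cases "b \<in> Op")
      case True
      then show ?thesis using fOp fp RO lc(1)[OF lead[OF Op_p(2)[OF True]]] by (auto simp del: index_mult_mat_vec)
    next
      case nOp: False
      show ?thesis
      proof (cases "\<exists>c\<in>Op. b = p c")
        case True
        then obtain c where c: "c \<in> Op" "b = p c" by blast
        have "f0 c \<in> carrier_vec n" using f0(1) lc(1) c(1) by (auto simp: Op_def)
        then have "P *\<^sub>v f b = f b" using PP fp[OF c(1)] c(2) by simp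
        then show ?thesis using nOp pR[OF c(1)] c(2) lc(1)[OF lead[OF b]] by simp
      next
        case False
        then show ?thesis using frest[OF b nOp] nOp lc(1)[OF lead[OF b]] by auto
      qed
    qed
  qed
  then show ?thesis using clan t by (intro exI[of _ Op] exI[of _ p] exI[of _ R] exI[of _ t]) (auto simp: R_def)
qed

section \<open>Translation of cosets and matchings into idempotents and index data\<close>

section \<open>Cosets and idempotents\<close>

lemma commute_dg_iff:
  assumes A: "A \<in> carrier_mat (m + n) (m + n)"
  shows "A * dg (m + n) {..<m} = dg (m + n) {..<m} * A \<longleftrightarrow>
    (\<forall>i<m + n. \<forall>j<m + n. (i < m \<longleftrightarrow> j < m) \<or> A $$ (i, j) = 0)"
proof -
  have "(A * dg (m + n) {..<m}) $$ (i, j) = (if j < m then A $$ (i, j) else 0)"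
    "(dg (m + n) {..<m} * A) $$ (i, j) = (if i < m then A $$ (i, j) else 0)" if "i < m + n" "j < m + n" for i j
    using that unfolding dg_def by (simp_all add: mat_diag_mult_right[OF A] mat_diag_mult_left[OF A])
  then show ?thesis using A by (auto simp: mat_eq_iff simp del: index_mult_mat(1))
qed

lemma block_diag_carrier:
  "A \<in> carrier_mat m m \<Longrightarrow> B \<in> carrier_mat n n \<Longrightarrow> block_diag A B \<in> carrier_mat (m + n) (m + n)"
  by (simp add: block_diag_def)

lemma block_diag_index:
  assumes "A \<in> carrier_mat m m" "B \<in> carrier_mat n n" "i < m + n" "j < m + n"
  shows "block_diag A B $$ (i, j) =
    (if i < m \<and> j < m then A $$ (i, j) else if \<not> i < m \<and> \<not> j < m then B $$ (i - m, j - m) else 0)"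
  using assms by (auto simp: block_diag_def)

lemma det_block_diag:
  "A \<in> carrier_mat m m \<Longrightarrow> B \<in> carrier_mat n n \<Longrightarrow> det (block_diag A B) = det A * det B"
  unfolding block_diag_def by (rule det_four_block_mat_lower_left_zero) auto

lemma block_diag_mult:
  assumes "A \<in> carrier_mat m m" "B \<in> carrier_mat n n" "C \<in> carrier_mat m m" "D \<in> carrier_mat n n"
  shows "block_diag A B * block_diag C D = block_diag (A * C) (B * D)"
  using assms unfolding block_diag_def by (subst mult_four_block_mat[of _ m m _ n _ n]) auto

lemma block_diag_transpose:
  assumes "A \<in> carrier_mat m m" "B \<in> carrier_mat n n"
  shows "(block_diag A B)\<^sup>T = block_diag A\<^sup>T B\<^sup>T"
  using assms unfolding block_diag_def by (subst transpose_four_block_mat) auto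

lemma block_diag_eq_iff:
  assumes "A \<in> carrier_mat m m" "B \<in> carrier_mat n n" "C \<in> carrier_mat m m" "D \<in> carrier_mat n n"
  shows "block_diag A B = block_diag C D \<longleftrightarrow> A = C \<and> B = D"
proof
  assume e: "block_diag A B = block_diag C D"
  have "A $$ (i, j) = C $$ (i, j)" if "i < m" "j < m" for i j
    using arg_cong[OF e, of "\<lambda>X. X $$ (i, j)"] that assms by (simp add: block_diag_index[of _ m _ n])
  moreover have "B $$ (i, j) = D $$ (i, j)" if "i < n" "j < n" for i j
    using arg_cong[OF e, of "\<lambda>X. X $$ (i + m, j + m)"] that assms by (simp add: block_diag_index[of _ m _ n])
  ultimately show "A = C \<and> B = D" using assms by (auto intro!: eq_matI)
qed simp

lemma block_diag_split:
  assumes A: "A \<in> carrier_mat (m + n) (m + n)" and c: "A * dg (m + n) {..<m} = dg (m + n) {..<m} * A"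
  obtains A1 A2 where "A1 \<in> carrier_mat m m" "A2 \<in> carrier_mat n n" "A = block_diag A1 A2"
proof
  let ?A1 = "mat m m (\<lambda>(i, j). A $$ (i, j))" and ?A2 = "mat n n (\<lambda>(i, j). A $$ (i + m, j + m))"
  show c12: "?A1 \<in> carrier_mat m m" "?A2 \<in> carrier_mat n n" by auto
  show "A = block_diag ?A1 ?A2"
  proof (rule eq_matI)
    fix i j assume "i < dim_row (block_diag ?A1 ?A2)" "j < dim_col (block_diag ?A1 ?A2)"
    then have ij: "i < m + n" "j < m + n" by (auto simp: block_diag_def)
    then have "(i < m \<longleftrightarrow> j < m) \<or> A $$ (i, j) = 0" using c commute_dg_iff[OF A] by blast
    then show "A $$ (i, j) = block_diag ?A1 ?A2 $$ (i, j)"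
      unfolding block_diag_index[OF c12 ij] using ij by auto
  qed (use A in \<open>auto simp: block_diag_def\<close>)
qed

lemma block_diag_commute:
  assumes "A \<in> carrier_mat m m" "B \<in> carrier_mat n n"
  shows "block_diag A B * dg (m + n) {..<m} = dg (m + n) {..<m} * block_diag A B"
  unfolding commute_dg_iff[OF block_diag_carrier[OF assms]] by (simp add: block_diag_index[OF assms])

text \<open>Being the centraliser of the projection to the first block is what turns left cosets of
  this subgroup into conjugates of the projection.\<close>

lemma GL_GL_iff:
  "A \<in> GL_GL m n \<longleftrightarrow> A \<in> carrier (GL (m + n)) \<and> A * dg (m + n) {..<m} = dg (m + n) {..<m} * A"
proof
  assume "A \<in> GL_GL m n"
  then obtain A1 A2 where A12: "A1 \<in> carrier (GL m)" "A2 \<in> carrier (GL n)" "A = block_diag A1 A2"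
    by (auto simp: GL_GL_def)
  note c = GL_carrier_mat[OF A12(1)] GL_carrier_mat[OF A12(2)]
  show "A \<in> carrier (GL (m + n)) \<and> A * dg (m + n) {..<m} = dg (m + n) {..<m} * A"
    using block_diag_carrier[OF c] det_block_diag[OF c] block_diag_commute[OF c] A12 by (auto simp: carrier_GL)
next
  assume A: "A \<in> carrier (GL (m + n)) \<and> A * dg (m + n) {..<m} = dg (m + n) {..<m} * A"
  then obtain A1 A2 where A12: "A1 \<in> carrier_mat m m" "A2 \<in> carrier_mat n n" "A = block_diag A1 A2"
    using block_diag_split GL_carrier_mat by metis
  then have "det A1 \<noteq> 0" "det A2 \<noteq> 0" using A det_block_diag[OF A12(1,2)] by (auto simp: carrier_GL)
  then show "A \<in> GL_GL m n" using A12 unfolding GL_GL_def by (auto simp: carrier_GL)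
qed

text \<open>The second block starts at the even index \<open>2 * m\<close>, so no hyperbolic plane
  is split and parities are the same after the shift.\<close>

lemma symp_form_block: "symp_form (m + n) = block_diag (symp_form m) (symp_form n :: 'a::field mat)"
proof (rule eq_matI)
  fix i j assume "i < dim_row (block_diag (symp_form m) (symp_form n :: 'a mat))"
    "j < dim_col (block_diag (symp_form m) (symp_form n :: 'a mat))"
  then have ij: "i < 2 * m + 2 * n" "j < 2 * m + 2 * n" by (auto simp: block_diag_def symp_form_def)
  have e: "even (i - 2 * m) \<longleftrightarrow> even i" if "\<not> i < 2 * m" for i using that by auto
  show "symp_form (m + n) $$ (i, j) = block_diag (symp_form m) (symp_form n :: 'a mat) $$ (i, j)"
  proof (cases "i < 2 * m \<longleftrightarrow> j < 2 * m")
    case True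
    then show ?thesis
      unfolding block_diag_index[OF symp_form_carrier symp_form_carrier ij]
      using ij e[of i] e[of j] by (auto simp: symp_form_def)
  next
    case False
    have "\<not> (even i \<and> j = Suc i)" using False by presburger
    moreover have "\<not> (even j \<and> i = Suc j)" using False by presburger
    ultimately show ?thesis
      unfolding block_diag_index[OF symp_form_carrier symp_form_carrier ij]
      using ij False by (auto simp: symp_form_def)
  qed
qed (auto simp: block_diag_def symp_form_def)

lemma Sp_Sp_iff:
  "A \<in> Sp_Sp m n \<longleftrightarrow> A \<in> carrier (Sp (m + n)) \<and>
     A * dg (2 * m + 2 * n) {..<2 * m} = dg (2 * m + 2 * n) {..<2 * m} * A"
proof -
  have form: "(block_diag A1 A2)\<^sup>T * symp_form (m + n) * block_diag A1 A2 =
      block_diag (A1\<^sup>T * symp_form m * A1) (A2\<^sup>T * symp_form n * A2)"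
    if "A1 \<in> carrier_mat (2 * m) (2 * m)" "A2 \<in> carrier_mat (2 * n) (2 * n)" for A1 A2 :: "'a mat"
  proof -
    note J = symp_form_carrier[of m, where 'a = 'a] symp_form_carrier[of n, where 'a = 'a]
    have t: "A1\<^sup>T \<in> carrier_mat (2 * m) (2 * m)" "A2\<^sup>T \<in> carrier_mat (2 * n) (2 * n)" using that by auto
    show ?thesis
      unfolding symp_form_block block_diag_transpose[OF that] block_diag_mult[OF t J]
      by (rule block_diag_mult[OF sq_mult[OF t(1) J(1)] sq_mult[OF t(2) J(2)] that])
  qed
  have sc: "A\<^sup>T * symp_form k * A \<in> carrier_mat (2 * k) (2 * k)" if "A \<in> carrier_mat (2 * k) (2 * k)" for A :: "'a mat" and k
    using that symp_form_carrier by (intro sq_mult) auto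
  show ?thesis
  proof
    assume "A \<in> Sp_Sp m n"
    then obtain A1 A2 where A: "A1 \<in> carrier (Sp m)" "A2 \<in> carrier (Sp n)" "A = block_diag A1 A2"
      by (auto simp: Sp_Sp_def)
    have c: "A1 \<in> carrier_mat (2 * m) (2 * m)" "A2 \<in> carrier_mat (2 * n) (2 * n)"
      using A Sp_GL GL_carrier_mat by blast+
    have "A \<in> GL_GL (2 * m) (2 * n)" using A Sp_GL unfolding GL_GL_def by blast
    then have "A \<in> carrier (GL (2 * (m + n)))"
      "A * dg (2 * m + 2 * n) {..<2 * m} = dg (2 * m + 2 * n) {..<2 * m} * A"
      unfolding GL_GL_iff by (simp_all add: distrib_left)
    moreover have "A\<^sup>T * symp_form (m + n) * A = symp_form (m + n)"
      unfolding A(3) form[OF c] using A(1,2) by (simp add: Sp_def symp_form_block)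
    ultimately show "A \<in> carrier (Sp (m + n)) \<and>
     A * dg (2 * m + 2 * n) {..<2 * m} = dg (2 * m + 2 * n) {..<2 * m} * A" by (simp add: Sp_def)
  next
    assume A: "A \<in> carrier (Sp (m + n)) \<and>
     A * dg (2 * m + 2 * n) {..<2 * m} = dg (2 * m + 2 * n) {..<2 * m} * A"
    then have "A \<in> GL_GL (2 * m) (2 * n)"
      unfolding GL_GL_iff using Sp_GL[of A "m + n"] by (simp add: distrib_left)
    then obtain A1 A2 where A12: "A1 \<in> carrier (GL (2 * m))" "A2 \<in> carrier (GL (2 * n))" "A = block_diag A1 A2"
      by (auto simp: GL_GL_def)
    have c: "A1 \<in> carrier_mat (2 * m) (2 * m)" "A2 \<in> carrier_mat (2 * n) (2 * n)"
      using A12 GL_carrier_mat by blast+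
    have "A\<^sup>T * symp_form (m + n) * A = symp_form (m + n)" using A by (simp add: Sp_def)
    then have "block_diag (A1\<^sup>T * symp_form m * A1) (A2\<^sup>T * symp_form n * A2) = block_diag (symp_form m) (symp_form n)"
      unfolding form[OF c, symmetric] symp_form_block[symmetric] A12(3) .
    then have "A1\<^sup>T * symp_form m * A1 = symp_form m \<and> A2\<^sup>T * symp_form n * A2 = symp_form n"
      by (rule iffD1[OF block_diag_eq_iff[OF sc[OF c(1)] sc[OF c(2)] symp_form_carrier symp_form_carrier]])
    then have "A1 \<in> carrier (Sp m)" "A2 \<in> carrier (Sp n)" using A12(1,2) by (simp_all add: Sp_def)
    then show "A \<in> Sp_Sp m n" using A12(3) unfolding Sp_Sp_def by blast
  qed
qed

definition pj :: "nat \<Rightarrow> nat \<Rightarrow> 'a::field mat \<Rightarrow> 'a mat" where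
  "pj N m g = g * dg N {..<m} * minv g"

lemma pj_carrier: "g \<in> carrier (GL N) \<Longrightarrow> pj N m g \<in> carrier_mat N N"
  unfolding pj_def by (intro sq_mult) (auto simp: GL_carrier_mat minv_carrier_mat)

lemma pj_eqI:
  assumes "g \<in> carrier (GL N)" "P \<in> carrier_mat N N" "P * g = g * dg N {..<m}"
  shows "pj N m g = P"
  unfolding pj_def assms(3)[symmetric] by (rule minv_cancel_right(2)[OF assms(1,2)])

lemma pj_mult:
  assumes "g \<in> carrier (GL N)"
  shows "pj N m g * g = g * dg N {..<m}"
  unfolding pj_def by (rule minv_cancel_right(1)[OF assms]) (use assms in \<open>auto simp: GL_carrier_mat\<close>)

lemma pj_idem:
  assumes g: "g \<in> carrier (GL N)"
  shows "pj N m g * pj N m g = pj N m g"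
proof -
  have c: "g \<in> carrier_mat N N" "minv g \<in> carrier_mat N N" "pj N m g \<in> carrier_mat N N"
    using g pj_carrier minv_carrier_mat GL_carrier_mat by blast+
  have "pj N m g * pj N m g = (pj N m g * g) * dg N {..<m} * minv g"
    unfolding pj_def[of N m g] using c by (simp add: sq_assoc[of _ N] sq_mult del: assoc_mult_mat)
  also have "\<dots> = g * (dg N {..<m} * dg N {..<m}) * minv g"
    unfolding pj_mult[OF g] using c by (simp add: sq_assoc[of _ N] sq_mult del: assoc_mult_mat)
  finally show ?thesis by (simp add: dg_idem pj_def)
qed

lemma pj_eq_iff:
  assumes g: "g \<in> carrier (GL N)" "h \<in> carrier (GL N)"
  shows "pj N m g = pj N m h \<longleftrightarrow> minv g * h * dg N {..<m} = dg N {..<m} * (minv g * h)"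
proof -
  let ?E = "dg N {..<m} :: 'a mat"
  have c: "g \<in> carrier_mat N N" "minv g \<in> carrier_mat N N" "h \<in> carrier_mat N N"
    using g minv_GL GL_carrier_mat by blast+
  note assoc = sq_assoc[of _ N] sq_mult
  show ?thesis
  proof
    assume e: "pj N m g = pj N m h"
    have "minv g * h * ?E = minv g * (pj N m g * h)" using e pj_mult[OF g(2)] c by (simp add: assoc del: assoc_mult_mat)
    also have "\<dots> = minv g * (g * (?E * (minv g * h)))"
      unfolding pj_def using c by (simp add: assoc del: assoc_mult_mat)
    also have "\<dots> = ?E * (minv g * h)" by (rule minv_cancel(1)[OF g(1), of _ N]) (use c in \<open>auto simp: sq_mult\<close>)
    finally show "minv g * h * ?E = ?E * (minv g * h)" .
  next
    assume e: "minv g * h * ?E = ?E * (minv g * h)"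
    have "pj N m g * h = g * (?E * (minv g * h))" unfolding pj_def using c by (simp add: assoc del: assoc_mult_mat)
    also have "\<dots> = g * (minv g * (h * ?E))" unfolding e[symmetric] using c by (simp add: assoc del: assoc_mult_mat)
    also have "\<dots> = h * ?E" by (rule minv_cancel(2)[OF g(1), of _ N]) (use c in auto)
    finally show "pj N m g = pj N m h" using pj_eqI[OF g(2) pj_carrier[OF g(1)]] by simp
  qed
qed

lemma pj_translate:
  assumes b: "b \<in> carrier (GL N)" and g: "g \<in> carrier (GL N)"
  shows "pj N m (b * g) = b * pj N m g * minv b"
proof (rule pj_eqI[OF mult_GL[OF b g]])
  have c: "b \<in> carrier_mat N N" "minv b \<in> carrier_mat N N" "g \<in> carrier_mat N N" "pj N m g \<in> carrier_mat N N"
    using b g pj_carrier minv_GL GL_carrier_mat by blast+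
  show "b * pj N m g * minv b \<in> carrier_mat N N" using c by (intro sq_mult)
  have "b * pj N m g * minv b * (b * g) = b * (pj N m g * (minv b * (b * g)))"
    using c by (simp add: sq_assoc[of _ N] sq_mult del: assoc_mult_mat)
  also have "minv b * (b * g) = g" by (rule minv_cancel(1)[OF b c(3)])
  also have "b * (pj N m g * g) = b * g * dg N {..<m}"
    unfolding pj_mult[OF g] using c by (simp add: sq_assoc[of _ N] del: assoc_mult_mat)
  finally show "b * pj N m g * minv b * (b * g) = b * g * dg N {..<m}" .
qed

section \<open>Orbits and representatives\<close>

lemma coset_orbits_bij:
  fixes G (structure)
  assumes G: "group G" and K: "subgroup K G" and B: "subgroup B G" and X: "X \<subseteq> lcosets K"
    and r: "\<And>x. x \<in> D \<Longrightarrow> r x \<in> carrier G \<and> r x <# K \<in> X"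
    and ex: "\<And>y. y \<in> X \<Longrightarrow> \<exists>b\<in>B. \<exists>x\<in>D. y = (b \<otimes> r x) <# K"
    and un: "\<And>b x x'. b \<in> B \<Longrightarrow> x \<in> D \<Longrightarrow> x' \<in> D \<Longrightarrow> (b \<otimes> r x) <# K = r x' <# K \<Longrightarrow> x = x'"
  shows "\<exists>\<psi>. bij_betw \<psi> D (coset_orbits G B X)"
proof -
  interpret group G by (rule G)
  have Kc: "K \<subseteq> carrier G" using subgroup.subset[OF K] .
  have Bc: "b \<in> B \<Longrightarrow> b \<in> carrier G" for b using subgroup.mem_carrier[OF B] .
  define orb where "orb x = {b <# x | b. b \<in> B}" for x
  have co: "coset_orbits G B X = orb ` X"
    by (auto simp: coset_orbits_def orbits_def orbit_def orb_def)
  have act: "b <# (g <# K) = (b \<otimes> g) <# K" if "b \<in> carrier G" "g \<in> carrier G" for b g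
    using lcos_m_assoc[OF Kc that] .
  have orb_mult: "orb ((b \<otimes> g) <# K) = orb (g <# K)" if b: "b \<in> B" and g: "g \<in> carrier G" for b g
  proof (intro equalityI subsetI)
    fix y assume "y \<in> orb ((b \<otimes> g) <# K)"
    then obtain c where c: "c \<in> B" "y = c <# ((b \<otimes> g) <# K)" by (auto simp: orb_def)
    then have "y = (c \<otimes> b) <# (g <# K)" using b g Bc by (simp add: act m_assoc)
    then show "y \<in> orb (g <# K)" using subgroup.m_closed[OF B c(1) b] by (auto simp: orb_def)
  next
    fix y assume "y \<in> orb (g <# K)"
    then obtain c where c: "c \<in> B" "y = c <# (g <# K)" by (auto simp: orb_def)
    have "c \<otimes> inv b \<otimes> (b \<otimes> g) = c \<otimes> g"
      using Bc[OF b] Bc[OF c(1)] g by (simp add: m_assoc) (simp add: m_assoc[symmetric])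
    then have "y = (c \<otimes> inv b) <# ((b \<otimes> g) <# K)"
      using c b g Bc by (simp add: act)
    then show "y \<in> orb ((b \<otimes> g) <# K)"
      using subgroup.m_closed[OF B c(1) subgroup.m_inv_closed[OF B b]] by (auto simp: orb_def)
  qed
  have "bij_betw (\<lambda>x. orb (r x <# K)) D (coset_orbits G B X)"
    unfolding bij_betw_def co
  proof (intro conjI inj_onI equalityI subsetI)
    fix x x' assume x: "x \<in> D" "x' \<in> D" and e: "orb (r x <# K) = orb (r x' <# K)"
    have "r x' <# K = \<one> <# (r x' <# K)" using r[OF x(2)] by (simp add: act)
    then have "r x' <# K \<in> orb (r x' <# K)" using subgroup.one_closed[OF B] by (auto simp: orb_def)
    then have "r x' <# K \<in> orb (r x <# K)" using e by simp
    then obtain b where "b \<in> B" "r x' <# K = b <# (r x <# K)" unfolding orb_def by blast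
    then show "x = x'" using un[OF _ x, of b] r[OF x(1)] Bc by (simp add: act)
  next
    fix y assume "y \<in> (\<lambda>x. orb (r x <# K)) ` D"
    then show "y \<in> orb ` X" using r by blast
  next
    fix y assume "y \<in> orb ` X"
    then obtain z where z: "z \<in> X" "y = orb z" by blast
    obtain b x where bx: "b \<in> B" "x \<in> D" "z = (b \<otimes> r x) <# K" using ex[OF z(1)] by blast
    then show "y \<in> (\<lambda>x. orb (r x <# K)) ` D" using z(2) orb_mult[OF bx(1), of "r x"] r[OF bx(2)] by auto
  qed
  then show ?thesis by blast
qed

section \<open>Matchings\<close>

text \<open>The pairs in \<open>E\<close> stand for the core edges of a matching, through \<open>enc\<close>, the elements of \<open>S\<close> for its
  pendant edges; \<open>pv\<close> gives the end points of a core edge, counted from \<open>0\<close>.\<close>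

definition clan_data :: "nat \<Rightarrow> (nat \<times> nat \<Rightarrow> nat set) \<Rightarrow> (nat \<times> nat) set \<Rightarrow> nat \<Rightarrow> ((nat \<times> nat) set \<times> nat set) set" where
  "clan_data N pv Q m = {(E, S). E \<subseteq> Q \<and> S \<subseteq> {..<N} \<and> card E + card S = m \<and>
     (\<forall>x\<in>E. \<forall>y\<in>E. x \<noteq> y \<longrightarrow> pv x \<inter> pv y = {}) \<and> (\<forall>x\<in>E. pv x \<inter> S = {})}"

text \<open>A set of edges splits uniquely into core and pendant edges. Two edges can only meet in a
  vertex \<open>V i\<close>, so disjointness of edges becomes disjointness of the sets
  \<open>pv x\<close> and \<open>S\<close>. The encoding is left abstract to serve for simple as
  well as doubled core edges.\<close>

lemma clan_data_matchings:
  assumes fin: "finite Q" and enc: "inj_on enc Q" "enc ` Q = {Core i j c | i j c. 1 \<le> i \<and> i < j \<and> j \<le> N \<and> c < k}"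
    and ends: "\<And>x. x \<in> Q \<Longrightarrow> corona_ends (enc x) = V ` Suc ` pv x"
  shows "bij_betw (\<lambda>(E, S). enc ` E \<union> (\<lambda>s. Pendant (Suc s)) ` S) (clan_data N pv Q m) (matchings (multi_corona k N) m)"
proof (rule bij_betwI[where g = "\<lambda>M. ({x \<in> Q. enc x \<in> M}, {s. Pendant (Suc s) \<in> M})"])
  have np: "enc x \<noteq> Pendant s" if "x \<in> Q" for x s
  proof -
    have "enc x \<in> {Core i j c | i j c. 1 \<le> i \<and> i < j \<and> j \<le> N \<and> c < k}" using that enc(2) by blast
    then show ?thesis by auto
  qed
  have VS: "V ` Suc ` A \<inter> V ` Suc ` B = {} \<longleftrightarrow> A \<inter> B = {}" for A B by auto
  let ?f = "\<lambda>(E, S). enc ` E \<union> (\<lambda>s. Pendant (Suc s)) ` S"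
  let ?g = "\<lambda>M. ({x \<in> Q. enc x \<in> M}, {s. Pendant (Suc s) \<in> M})"
  have card: "card (enc ` E \<union> (\<lambda>s. Pendant (Suc s)) ` S) = card E + card S" if "E \<subseteq> Q" "S \<subseteq> {..<N}" for E S
  proof -
    have fin': "finite E" "finite S" using that fin finite_subset by blast+
    have "card (enc ` E \<union> (\<lambda>s. Pendant (Suc s)) ` S) = card (enc ` E) + card ((\<lambda>s. Pendant (Suc s)) ` S)"
      using fin' np that by (intro card_Un_disjoint) auto
    moreover have "card (enc ` E) = card E" by (rule card_image[OF inj_on_subset[OF enc(1) that(1)]])
    moreover have "card ((\<lambda>s. Pendant (Suc s)) ` S) = card S" by (rule card_image) (auto simp: inj_on_def)
    ultimately show ?thesis by simp
  qed
  have pend: "i \<in> {1..N}" if M: "M \<subseteq> enc ` Q \<union> Pendant ` {1..N}" "Pendant i \<in> M" for M i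
  proof -
    have "Pendant i \<notin> enc ` Q"
    proof
      assume "Pendant i \<in> enc ` Q"
      then obtain x where "x \<in> Q" "Pendant i = enc x" by blast
      then show False using np[of x i] by simp
    qed
    then have "Pendant i \<in> Pendant ` {1..N}" using M by blast
    then show ?thesis by auto
  qed
  show "?f \<in> clan_data N pv Q m \<rightarrow> matchings (multi_corona k N) m"
  proof
    fix z assume "z \<in> clan_data N pv Q m"
    then obtain E S where z: "z = (E, S)" and E: "E \<subseteq> Q" "S \<subseteq> {..<N}" "card E + card S = m"
        "\<And>x y. x \<in> E \<Longrightarrow> y \<in> E \<Longrightarrow> x \<noteq> y \<Longrightarrow> pv x \<inter> pv y = {}" "\<And>x. x \<in> E \<Longrightarrow> pv x \<inter> S = {}"
      by (auto simp: clan_data_def)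
    have fES: "finite E" "finite S" using E fin finite_subset by blast+
    have e1: "enc ` E \<subseteq> {Core i j c | i j c. 1 \<le> i \<and> i < j \<and> j \<le> N \<and> c < k}" using E(1) enc(2) by blast
    have e2: "(\<lambda>s. Pendant (Suc s)) ` S \<subseteq> Pendant ` {1..N}" using E(2) by force
    have d1: "corona_ends (enc x) \<inter> corona_ends (enc y) = {}" if "x \<in> E" "y \<in> E" "enc x \<noteq> enc y" for x y
    proof -
      have "x \<noteq> y" using that(3) by blast
      then have "V ` Suc ` pv x \<inter> V ` Suc ` pv y = {}" using VS E(4)[OF that(1,2)] by blast
      then show ?thesis using ends[of x] ends[of y] subsetD[OF E(1) that(1)] subsetD[OF E(1) that(2)] by simp
    qed
    have d2: "corona_ends (enc x) \<inter> corona_ends (Pendant (Suc s)) = {}" if "x \<in> E" "s \<in> S" for x s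
      using ends[OF subsetD[OF E(1) that(1)]] E(5)[OF that(1)] that(2) by auto
    let ?M = "enc ` E \<union> (\<lambda>s. Pendant (Suc s)) ` S"
    have "corona_ends e \<inter> corona_ends e' = {}" if e: "e \<in> ?M" "e' \<in> ?M" "e \<noteq> e'" for e e'
      using e(1)
    proof
      assume "e \<in> enc ` E"
      then obtain x where x: "x \<in> E" "e = enc x" by blast
      from e(2) show ?thesis
      proof
        assume "e' \<in> enc ` E"
        then obtain y where "y \<in> E" "e' = enc y" by blast
        then show ?thesis using d1[OF x(1)] x(2) e(3) by blast
      next
        assume "e' \<in> (\<lambda>s. Pendant (Suc s)) ` S"
        then obtain s where "s \<in> S" "e' = Pendant (Suc s)" by blast
        then show ?thesis using d2[OF x(1)] x(2) by blast
      qed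
    next
      assume "e \<in> (\<lambda>s. Pendant (Suc s)) ` S"
      then obtain s where s: "s \<in> S" "e = Pendant (Suc s)" by blast
      from e(2) show ?thesis
      proof
        assume "e' \<in> enc ` E"
        then obtain y where "y \<in> E" "e' = enc y" by blast
        then show ?thesis using d2[OF _ s(1)] s(2) by blast
      next
        assume "e' \<in> (\<lambda>s. Pendant (Suc s)) ` S"
        then show ?thesis using s(2) e(3) by auto
      qed
    qed
    moreover have "?M \<subseteq> edges (multi_corona k N)"
      unfolding multi_corona_def using e1 e2 by (simp, blast)
    moreover have "finite ?M" "card ?M = m" using fES card[OF E(1,2)] E(3) by auto
    ultimately have "?M \<in> matchings (multi_corona k N) m"
      unfolding matchings_def by (simp add: multi_corona_def)
    then show "?f z \<in> matchings (multi_corona k N) m" by (simp add: z)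
  qed
  have recover: "?f (?g M) = M" if M: "M \<subseteq> enc ` Q \<union> Pendant ` {1..N}" for M
  proof -
    have "Pendant i \<in> M \<Longrightarrow> Pendant i \<in> (\<lambda>s. Pendant (Suc s)) ` {s. Pendant (Suc s) \<in> M}" for i
    proof -
      assume i: "Pendant i \<in> M"
      then have "1 \<le> i" using pend[OF M] by simp
      then show ?thesis using i by (intro image_eqI[of _ _ "i - 1"]) auto
    qed
    then show ?thesis using M by auto
  qed
  show "?g \<in> matchings (multi_corona k N) m \<rightarrow> clan_data N pv Q m"
  proof
    fix M assume "M \<in> matchings (multi_corona k N) m"
    then have M: "M \<subseteq> enc ` Q \<union> Pendant ` {1..N}" "card M = m"
        "\<And>e e'. e \<in> M \<Longrightarrow> e' \<in> M \<Longrightarrow> e \<noteq> e' \<Longrightarrow> corona_ends e \<inter> corona_ends e' = {}"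
      by (auto simp: matchings_def multi_corona_def enc(2))
    let ?E = "{x \<in> Q. enc x \<in> M}" and ?S = "{s. Pendant (Suc s) \<in> M}"
    have S: "?S \<subseteq> {..<N}" using pend[OF M(1)] by fastforce
    have "card ?E + card ?S = m" using card[of ?E ?S] S recover[OF M(1)] M(2) by auto
    moreover have "pv x \<inter> pv y = {}" if "x \<in> ?E" "y \<in> ?E" "x \<noteq> y" for x y
    proof -
      have "enc x \<noteq> enc y" using that enc(1) by (auto dest: inj_onD)
      then show ?thesis using M(3)[of "enc x" "enc y"] ends[of x] ends[of y] that VS by auto
    qed
    moreover have "pv x \<inter> ?S = {}" if x: "x \<in> ?E" for x
    proof (rule ccontr)
      assume "pv x \<inter> ?S \<noteq> {}"
      then obtain s where s: "s \<in> pv x" "Pendant (Suc s) \<in> M" by auto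
      then show False using M(3)[of "enc x" "Pendant (Suc s)"] ends[of x] x np by auto
    qed
    ultimately show "?g M \<in> clan_data N pv Q m" using S by (simp add: clan_data_def)
  qed
  fix M assume "M \<in> matchings (multi_corona k N) m"
  then have "M \<subseteq> enc ` Q \<union> Pendant ` {1..N}" by (auto simp: matchings_def multi_corona_def enc(2))
  then show "?f (?g M) = M" by (rule recover)
next
  have np: "enc x \<noteq> Pendant s" if "x \<in> Q" for x s
  proof -
    have "enc x \<in> {Core i j c | i j c. 1 \<le> i \<and> i < j \<and> j \<le> N \<and> c < k}" using that enc(2) by blast
    then show ?thesis by auto
  qed
  fix z assume "z \<in> clan_data N pv Q m"
  then obtain E S where z: "z = (E, S)" "E \<subseteq> Q" by (auto simp: clan_data_def)
  have "{x \<in> Q. enc x \<in> enc ` E \<union> (\<lambda>s. Pendant (Suc s)) ` S} = E"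
  proof (intro equalityI subsetI)
    fix x assume x: "x \<in> {x \<in> Q. enc x \<in> enc ` E \<union> (\<lambda>s. Pendant (Suc s)) ` S}"
    moreover have "enc x \<noteq> Pendant s" for s using np x by blast
    ultimately have "enc x \<in> enc ` E" by auto
    then show "x \<in> E" using x z(2) enc(1) by (auto simp: inj_on_def)
  qed (use z in auto)
  moreover have "{s. Pendant (Suc s) \<in> enc ` E \<union> (\<lambda>s. Pendant (Suc s)) ` S} = S"
  proof -
    have "Pendant s \<notin> enc ` E" for s
    proof
      assume "Pendant s \<in> enc ` E"
      then obtain x where "x \<in> E" "Pendant s = enc x" by blast
      then show False using np[of x s] z(2) by auto
    qed
    then show ?thesis by auto
  qed
  ultimately show "({x \<in> Q. enc x \<in> (case z of (E, S) \<Rightarrow> enc ` E \<union> (\<lambda>s. Pendant (Suc s)) ` S)},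
       {s. Pendant (Suc s) \<in> (case z of (E, S) \<Rightarrow> enc ` E \<union> (\<lambda>s. Pendant (Suc s)) ` S)}) = z"
    by (simp add: z(1))
qed

section \<open>Permutation matrices\<close>

definition pmat :: "nat \<Rightarrow> (nat \<Rightarrow> nat) \<Rightarrow> 'a::field mat" where
  "pmat n \<tau> = mat n n (\<lambda>(a, b). if a = \<tau> b then 1 else 0)"

lemma pmat_carrier [simp]: "pmat n \<tau> \<in> carrier_mat n n"
  by (simp add: pmat_def)

lemma pmat_GL:
  assumes "bij_betw \<tau> {..<n} {..<n}"
  shows "pmat n \<tau> \<in> carrier (GL n)"
proof (rule left_inverse_GL(2))
  show "(pmat n \<tau>)\<^sup>T * pmat n \<tau> = (1\<^sub>m n :: 'a mat)"
  proof (rule eq_matI)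
    fix a b assume "a < dim_row (1\<^sub>m n :: 'a mat)" "b < dim_col (1\<^sub>m n :: 'a mat)"
    then have ab: "a < n" "b < n" by auto
    then have t: "\<tau> a < n" "\<tau> a = \<tau> b \<longleftrightarrow> a = b" using assms by (auto simp: bij_betw_def inj_on_def)
    have "((pmat n \<tau>)\<^sup>T * pmat n \<tau>) $$ (a, b) = (\<Sum>c\<in>{0..<n}. (if c = \<tau> a then 1 else 0) * (if c = \<tau> b then 1 else (0 :: 'a)))"
      using ab by (simp add: pmat_def scalar_prod_def)
    also have "\<dots> = (\<Sum>c\<in>{0..<n}. if c = \<tau> a then (if \<tau> a = \<tau> b then 1 else 0) else 0)"
      by (intro sum.cong) auto
    finally show "((pmat n \<tau>)\<^sup>T * pmat n \<tau>) $$ (a, b) = (1\<^sub>m n :: 'a mat) $$ (a, b)" using t ab by simp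
  qed (auto simp: pmat_def)
qed auto

lemma dg_pmat:
  assumes "bij_betw \<tau> {..<n} {..<n}" "\<And>b. b < n \<Longrightarrow> \<tau> b \<in> R \<longleftrightarrow> b < m"
  shows "dg n R * pmat n \<tau> = pmat n \<tau> * (dg n {..<m} :: 'a::field mat)"
proof (rule eq_matI)
  fix a b assume "a < dim_row (pmat n \<tau> * (dg n {..<m} :: 'a mat))" "b < dim_col (pmat n \<tau> * (dg n {..<m} :: 'a mat))"
  then have ab: "a < n" "b < n" by (auto simp: pmat_def)
  then show "(dg n R * pmat n \<tau>) $$ (a, b) = (pmat n \<tau> * (dg n {..<m} :: 'a mat)) $$ (a, b)"
    unfolding dg_def mat_diag_mult_left[OF pmat_carrier] mat_diag_mult_right[OF pmat_carrier]
    using assms(2)[of b] by (auto simp: pmat_def)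
qed (auto simp: pmat_def)

text \<open>Lists \<open>R\<close> before its complement; by \<open>dg_pmat\<close> this turns the
  projection onto the coordinates in \<open>R\<close> into the one onto the first
  \<open>m\<close>.\<close>

lemma sorting_bij:
  assumes R: "R \<subseteq> {..<n}" "card R = m"
  obtains \<tau> where "bij_betw \<tau> {..<n} {..<n}" "\<And>b. b < n \<Longrightarrow> \<tau> b \<in> R \<longleftrightarrow> b < m"
proof -
  have mn: "m \<le> n" using card_mono[OF _ R(1)] R(2) by simp
  have fR: "finite R" using R(1) finite_subset by blast
  obtain f where f: "bij_betw f {..<m} R"
    using finite_same_card_bij[of "{..<m}" R] fR R(2) by auto
  have "card ({..<n} - R) = n - m" using card_Diff_subset[OF fR R(1)] R(2) by simp
  then obtain g where g: "bij_betw g {m..<n} ({..<n} - R)"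
    using finite_same_card_bij[of "{m..<n}" "{..<n} - R"] by auto
  define \<tau> where "\<tau> b = (if b \<in> {..<m} then f b else g b)" for b
  have "bij_betw \<tau> ({..<m} \<union> {m..<n}) (R \<union> ({..<n} - R))"
    unfolding \<tau>_def by (rule bij_betw_disjoint_Un[OF f g]) auto
  moreover have "{..<m} \<union> {m..<n} = {..<n}" "R \<union> ({..<n} - R) = {..<n}" using mn R(1) by auto
  ultimately have "bij_betw \<tau> {..<n} {..<n}" by simp
  moreover have "\<tau> b \<in> R \<longleftrightarrow> b < m" if "b < n" for b
    using that bij_betwE[OF f] bij_betwE[OF g] by (cases "b < m") (auto simp: \<tau>_def)
  ultimately show thesis using that by blast
qed

section \<open>Descent of an invariant flag to the subfield\<close>

section \<open>Fields of definition\<close>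

locale field_ext = field_hom \<iota> for \<iota> :: "'a::field \<Rightarrow> 'b::alg_closed_field"
begin

lemma range_ring: "0 \<in> range \<iota>" "1 \<in> range \<iota>" "- 1 \<in> range \<iota>"
proof -
  show "0 \<in> range \<iota>" "1 \<in> range \<iota>" "- 1 \<in> range \<iota>"
    using rangeI[of \<iota> 0] rangeI[of \<iota> 1] rangeI[of \<iota> "- 1"] by (simp_all add: hom_distribs)
qed

interpretation rr: function_ring "carrier (GL N)" "regular_on (range \<iota>) N" for N
  by (rule function_ring_regular) (rule range_ring)+

interpretation vs: vector_space "\<lambda>c x. \<iota> c * x"
  by unfold_locales (auto simp: algebra_simps hom_distribs)

text \<open>A basis of the big field over the subfield. It may be infinite, but every element has
  only finitely many nonzero coordinates \<open>co b x\<close>, so all expansions are finite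
  sums.\<close>

definition bas :: "'b set" where
  "bas = vs.extend_basis {}"

definition co :: "'b \<Rightarrow> 'b \<Rightarrow> 'a" where
  "co b x = vs.representation bas x b"

lemma bas: "vs.independent bas" "vs.span bas = UNIV"
  unfolding bas_def using vs.independent_extend_basis[OF vs.independent_empty]
    vs.span_extend_basis[OF vs.independent_empty] by auto

lemma co_add: "co b (x + y) = co b x + co b y"
  unfolding co_def using vs.representation_add[OF bas(1), of y x] bas(2) by simp

lemma co_scale: "co b (\<iota> c * x) = c * co b x"
  unfolding co_def using vs.representation_scale[OF bas(1), of x c] bas(2) by simp

lemma co_zero: "co b 0 = 0"
  using co_scale[of b 0 0] by simp

lemma co_sum: "co b (\<Sum>s\<in>S. f s) = (\<Sum>s\<in>S. co b (f s))"
  by (induction S rule: infinite_finite_induct) (auto simp: co_add co_zero)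

definition supp :: "'b \<Rightarrow> 'b set" where
  "supp x = {b. co b x \<noteq> 0}"

lemma supp: "finite (supp x)" "supp x \<subseteq> bas"
  unfolding supp_def co_def using vs.finite_representation[of bas x] vs.representation_ne_zero by auto

lemma expand:
  assumes "finite S" "supp x \<subseteq> S"
  shows "x = (\<Sum>b\<in>S. b * \<iota> (co b x))"
proof -
  have "x = (\<Sum>b\<in>supp x. \<iota> (co b x) * b)"
    using vs.sum_nonzero_representation_eq[OF bas(1), of x] bas(2) by (simp add: supp_def co_def)
  also have "\<dots> = (\<Sum>b\<in>S. \<iota> (co b x) * b)"
    using assms by (intro sum.mono_neutral_left) (auto simp: supp_def)
  finally show ?thesis by (simp add: mult.commute)
qed

subsection \<open>Linear disjointness\<close>

text \<open>Polynomial functions of the first \<open>n\<close> coordinates, with coefficients in the subfield.\<close>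

primrec pfun :: "nat \<Rightarrow> ((nat \<Rightarrow> 'b) \<Rightarrow> 'b) set" where
  "pfun 0 = {f. \<exists>c. f = (\<lambda>_. \<iota> c)}"
| "pfun (Suc n) = {f. \<exists>d g. (\<forall>j. g j \<in> pfun n) \<and> (\<forall>j\<ge>d. g j = (\<lambda>_. 0)) \<and> f = (\<lambda>x. \<Sum>j<d. g j x * x n ^ j)}"

lemma pfun_zero: "(\<lambda>_. 0) \<in> pfun n"
proof (induction n)
  case 0
  show ?case using hom_zero by (auto intro!: exI[of _ 0])
next
  case (Suc n)
  then show ?case
    unfolding pfun.simps by - (rule CollectI, rule exI[of _ 0], rule exI[of _ "\<lambda>_ _. 0"], simp)
qed

lemma pfun_monom:
  assumes "h \<in> pfun n"
  shows "(\<lambda>x. h x * x n ^ k) \<in> pfun (Suc n)"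
proof -
  define g where "g j = (if j = k then h else (\<lambda>_. 0))" for j
  have "(\<Sum>j<Suc k. g j x * x n ^ j) = h x * x n ^ k" for x
    by (simp add: g_def)
  then have "(\<lambda>x. h x * x n ^ k) = (\<lambda>x. \<Sum>j<Suc k. g j x * x n ^ j)" by presburger
  moreover have "\<forall>j. g j \<in> pfun n" "\<forall>j\<ge>Suc k. g j = (\<lambda>_. 0)" using assms pfun_zero by (auto simp: g_def)
  ultimately show ?thesis unfolding pfun.simps by blast
qed

lemma pfun_lift: "h \<in> pfun n \<Longrightarrow> h \<in> pfun (Suc n)"
  using pfun_monom[of h n 0] by simp

lemma pfun_const: "(\<lambda>_. \<iota> c) \<in> pfun n"
proof (induction n)
  case (Suc n)
  then show ?case by (rule pfun_lift)
qed auto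

lemma pfun_var: "i < n \<Longrightarrow> (\<lambda>x. x i) \<in> pfun n"
proof (induction n)
  case (Suc n)
  show ?case
  proof (cases "i = n")
    case True
    then show ?thesis using pfun_monom[OF pfun_const[of 1 n], of 1] by simp
  next
    case False
    then show ?thesis using Suc by (intro pfun_lift) auto
  qed
qed simp

lemma pfun_add: "f \<in> pfun n \<Longrightarrow> f' \<in> pfun n \<Longrightarrow> (\<lambda>x. f x + f' x) \<in> pfun n"
proof (induction n arbitrary: f f')
  case 0
  then obtain c c' where "f = (\<lambda>_. \<iota> c)" "f' = (\<lambda>_. \<iota> c')" by auto
  then have "(\<lambda>x. f x + f' x) = (\<lambda>_. \<iota> (c + c'))" by (simp add: hom_distribs)
  then show ?case by auto
next
  case (Suc n)
  obtain d g where g: "\<forall>j. g j \<in> pfun n" "\<forall>j\<ge>d. g j = (\<lambda>_. 0)" "f = (\<lambda>x. \<Sum>j<d. g j x * x n ^ j)"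
    using Suc.prems(1) by auto
  obtain d' g' where g': "\<forall>j. g' j \<in> pfun n" "\<forall>j\<ge>d'. g' j = (\<lambda>_. 0)" "f' = (\<lambda>x. \<Sum>j<d'. g' j x * x n ^ j)"
    using Suc.prems(2) by auto
  define D where "D = max d d'"
  have "f x = (\<Sum>j<D. g j x * x n ^ j)" for x
    unfolding g(3) by (intro sum.mono_neutral_left) (use g(2) in \<open>auto simp: D_def\<close>)
  moreover have "f' x = (\<Sum>j<D. g' j x * x n ^ j)" for x
    unfolding g'(3) by (intro sum.mono_neutral_left) (use g'(2) in \<open>auto simp: D_def\<close>)
  ultimately have "(\<lambda>x. f x + f' x) = (\<lambda>x. \<Sum>j<D. (g j x + g' j x) * x n ^ j)"
    by (simp add: distrib_right sum.distrib)
  moreover have "\<forall>j. (\<lambda>x. g j x + g' j x) \<in> pfun n" using Suc.IH g(1) g'(1) by blast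
  moreover have "\<forall>j\<ge>D. (\<lambda>x. g j x + g' j x) = (\<lambda>_. 0)" using g(2) g'(2) by (auto simp: D_def)
  ultimately show ?case
    unfolding pfun.simps by (intro CollectI exI[of _ D] exI[of _ "\<lambda>j x. g j x + g' j x"]) blast
qed

lemma pfun_sum: "(\<And>s. s \<in> S \<Longrightarrow> f s \<in> pfun n) \<Longrightarrow> (\<lambda>x. \<Sum>s\<in>S. f s x) \<in> pfun n"
  by (induction S rule: infinite_finite_induct) (auto intro: pfun_add pfun_zero)

lemma pfun_mult: "f \<in> pfun n \<Longrightarrow> f' \<in> pfun n \<Longrightarrow> (\<lambda>x. f x * f' x) \<in> pfun n"
proof (induction n arbitrary: f f')
  case 0
  then obtain c c' where "f = (\<lambda>_. \<iota> c)" "f' = (\<lambda>_. \<iota> c')" by auto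
  then have "(\<lambda>x. f x * f' x) = (\<lambda>_. \<iota> (c * c'))" by (simp add: hom_distribs)
  then show ?case by auto
next
  case (Suc n)
  obtain d g where g: "\<forall>j. g j \<in> pfun n" "f = (\<lambda>x. \<Sum>j<d. g j x * x n ^ j)"
    using Suc.prems(1) by auto
  obtain d' g' where g': "\<forall>j. g' j \<in> pfun n" "f' = (\<lambda>x. \<Sum>j<d'. g' j x * x n ^ j)"
    using Suc.prems(2) by auto
  have "(\<lambda>x. \<Sum>j<d. \<Sum>l<d'. (g j x * g' l x) * x n ^ (j + l)) \<in> pfun (Suc n)"
    by (intro pfun_sum pfun_monom Suc.IH) (use g g' in auto)
  moreover have "(\<lambda>x. f x * f' x) = (\<lambda>x. \<Sum>j<d. \<Sum>l<d'. (g j x * g' l x) * x n ^ (j + l))"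
    unfolding g(2) g'(2) sum_product by (intro ext sum.cong refl) (simp add: power_add ac_simps)
  ultimately show ?case by simp
qed

lemma pfun_dep: "f \<in> pfun n \<Longrightarrow> (\<And>i. i < n \<Longrightarrow> x i = y i) \<Longrightarrow> f x = f y"
proof (induction n arbitrary: f)
  case (Suc n)
  obtain d g where g: "\<forall>j. g j \<in> pfun n" "f = (\<lambda>x. \<Sum>j<d. g j x * x n ^ j)"
    using Suc.prems(1) by auto
  have "g j x = g j y" for j using Suc.IH[of "g j"] g(1) Suc.prems(2) by auto
  then show ?case unfolding g(2) using Suc.prems(2)[of n] by simp
qed auto

text \<open>Independence over the subfield passes from constants to polynomial functions. For fixed
  earlier variables the sum is a polynomial in the last variable that vanishes on an infinite field,
  so its coefficients vanish, and induction applies to them.\<close>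

lemma pfun_disjoint:
  assumes "finite S" "S \<subseteq> bas" "\<And>b. b \<in> S \<Longrightarrow> f b \<in> pfun n" "\<And>x. (\<Sum>b\<in>S. b * f b x) = 0" "b \<in> S"
  shows "f b x = 0"
  using assms(3-5)
proof (induction n arbitrary: f b x)
  case 0
  then have "\<forall>b\<in>S. \<exists>c. f b = (\<lambda>_. \<iota> c)" by simp
  then obtain c where c: "\<And>b. b \<in> S \<Longrightarrow> f b = (\<lambda>_. \<iota> (c b))" by metis
  have "(\<Sum>b\<in>S. \<iota> (c b) * b) = 0" using 0(2)[of undefined] c by (simp add: mult.commute)
  then have "c b = 0" using vs.independentD[OF bas(1) assms(1,2)] 0(3) by blast
  then show ?case using c[OF 0(3)] by simp
next
  case (Suc n)
  have "\<forall>b\<in>S. \<exists>d g. (\<forall>j. g j \<in> pfun n) \<and> (\<forall>j\<ge>d. g j = (\<lambda>_. 0)) \<and> f b = (\<lambda>x. \<Sum>j<d. g j x * x n ^ j)"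
    using Suc.prems(1) by simp
  from bchoice[OF this] obtain d where "\<forall>b\<in>S. \<exists>g. (\<forall>j. g j \<in> pfun n) \<and> (\<forall>j\<ge>d b. g j = (\<lambda>_. 0)) \<and>
      f b = (\<lambda>x. \<Sum>j<d b. g j x * x n ^ j)" by blast
  from bchoice[OF this] obtain g where *: "\<forall>b\<in>S. (\<forall>j. g b j \<in> pfun n) \<and> (\<forall>j\<ge>d b. g b j = (\<lambda>_. 0)) \<and>
      f b = (\<lambda>x. \<Sum>j<d b. g b j x * x n ^ j)" by blast
  have g: "\<And>b j. b \<in> S \<Longrightarrow> g b j \<in> pfun n" "\<And>b j. b \<in> S \<Longrightarrow> j \<ge> d b \<Longrightarrow> g b j = (\<lambda>_. 0)"
      "\<And>b. b \<in> S \<Longrightarrow> f b = (\<lambda>x. \<Sum>j<d b. g b j x * x n ^ j)"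
    using * by blast+
  define D where "D = (\<Sum>b\<in>S. d b)"
  have dD: "d b \<le> D" if "b \<in> S" for b unfolding D_def using that assms(1) by (simp add: member_le_sum)
  have fD: "f b x = (\<Sum>j<D. g b j x * x n ^ j)" if "b \<in> S" for b x
    unfolding g(3)[OF that] by (intro sum.mono_neutral_left) (use g(2) dD that in auto)
  have zero: "(\<Sum>b\<in>S. b * g b j x) = 0" for j x
  proof (cases "j < D")
    case True
    \<comment> \<open>The sum as a polynomial in the variable \<open>n\<close>, with the earlier
      variables fixed by \<open>x\<close>.\<close>
    define p where "p = (\<Sum>j<D. monom (\<Sum>b\<in>S. b * g b j x) j)"
    have "poly p t = 0" for t
    proof -
      have gx: "g b j (x(n := t)) = g b j x" if "b \<in> S" for b j
        by (rule pfun_dep[OF g(1)[OF that]]) auto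
      have "poly p t = (\<Sum>j<D. \<Sum>b\<in>S. b * (g b j x * t ^ j))"
        by (simp add: p_def poly_sum poly_monom sum_distrib_right mult.assoc)
      also have "\<dots> = (\<Sum>b\<in>S. b * (\<Sum>j<D. g b j x * t ^ j))"
        by (subst sum.swap) (simp add: sum_distrib_left)
      also have "\<dots> = (\<Sum>b\<in>S. b * f b (x(n := t)))"
        by (intro sum.cong refl) (simp add: fD gx)
      also have "\<dots> = 0" by (rule Suc.prems(2))
      finally show ?thesis .
    qed
    then have "{t. poly p t = 0} = UNIV" by auto
    then have "p = 0" using poly_roots_finite[of p] infinite_alg_closed by auto
    moreover have "coeff p j = (\<Sum>b\<in>S. b * g b j x)"
      using True by (simp add: p_def coeff_sum if_distrib cong: if_cong)
    ultimately show ?thesis by simp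
  next
    case False
    then have "g b j x = 0" if "b \<in> S" for b using g(2)[OF that, of j] dD[OF that] by simp
    then show ?thesis by simp
  qed
  have "g b j x = 0" for j by (rule Suc.IH[of "\<lambda>b. g b j" b x]) (use g(1) zero Suc.prems(3) in auto)
  then show ?case using fD[OF Suc.prems(3)] by simp
qed

definition tomat :: "nat \<Rightarrow> (nat \<Rightarrow> 'b) \<Rightarrow> 'b mat" where
  "tomat N x = mat N N (\<lambda>(i, j). x (i * N + j))"

lemma tomat_surj:
  assumes "A \<in> carrier_mat N N"
  shows "\<exists>x. tomat N x = A"
proof
  show "tomat N (\<lambda>k. A $$ (k div N, k mod N)) = A"
    using assms by (intro eq_matI) (auto simp: tomat_def)
qed

lemma pfun_det: "(\<lambda>x. det (tomat N x)) \<in> pfun (N * N)"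
proof -
  interpret pf: function_ring UNIV "pfun (N * N)"
  proof
    show "(\<lambda>_. 0) \<in> pfun (N * N)" "(\<lambda>_. 1) \<in> pfun (N * N)" "(\<lambda>_. - 1) \<in> pfun (N * N)"
      using pfun_const[of 0 "N * N"] pfun_const[of 1 "N * N"] pfun_const[of "- 1" "N * N"]
      by (simp_all add: hom_distribs)
    show "f \<in> pfun (N * N) \<Longrightarrow> (\<And>x. x \<in> UNIV \<Longrightarrow> g x = f x) \<Longrightarrow> g \<in> pfun (N * N)" for f g
      by (metis UNIV_I ext)
  qed (auto intro: pfun_add pfun_mult)
  have ix: "i * N + j < N * N" if "i < N" "j < N" for i j :: nat
  proof -
    have "i * N + j < Suc i * N" using that by simp
    also have "\<dots> \<le> N * N" using that by (intro mult_right_mono) auto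
    finally show ?thesis .
  qed
  show ?thesis
    by (rule pf.det[of _ N], rule pf.matsI) (auto simp: tomat_def intro!: pfun_var ix)
qed

lemma pfun_power: "f \<in> pfun n \<Longrightarrow> (\<lambda>x. f x ^ k) \<in> pfun n"
proof (induction k)
  case 0
  then show ?case using pfun_const[of 1 n] by simp
next
  case (Suc k)
  then show ?case using pfun_mult[of f n "\<lambda>x. f x ^ k"] by simp
qed

lemma regular_clear_denominator:
  assumes "f \<in> regular_on (range \<iota>) N"
  shows "\<exists>d. \<exists>F\<in>pfun (N * N). \<forall>x. det (tomat N x) \<noteq> 0 \<longrightarrow> f (tomat N x) * det (tomat N x) ^ d = F x"
proof -
  obtain h where h: "h \<in> regular_funs (range \<iota>) N" "\<forall>A\<in>carrier (GL N). f A = h A"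
    using assms by (auto simp: regular_on_def)
  have "\<exists>d. \<exists>F\<in>pfun (N * N). \<forall>x. det (tomat N x) \<noteq> 0 \<longrightarrow> h (tomat N x) * det (tomat N x) ^ d = F x"
    using h(1)
  proof induction
    case (const c)
    then obtain a where "c = \<iota> a" by blast
    then show ?case by (intro exI[of _ 0] bexI[of _ "\<lambda>_. \<iota> a"]) (auto simp: pfun_const)
  next
    case (entry i j)
    have "i * N + j < Suc i * N" using entry by simp
    also have "\<dots> \<le> N * N" using entry by (intro mult_right_mono) auto
    finally have "(\<lambda>x. x (i * N + j)) \<in> pfun (N * N)" by (rule pfun_var)
    then show ?case using entry by (intro exI[of _ 0] bexI[of _ "\<lambda>x. x (i * N + j)"]) (auto simp: tomat_def)
  next
    case inv_det
    have "(\<lambda>_. 1) \<in> pfun (N * N)" using pfun_const[of 1 "N * N"] by simp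
    then show ?case by (intro exI[of _ 1] bexI[of _ "\<lambda>_. 1"]) auto
  next
    case (add f g)
    then obtain d F d' F' where F: "F \<in> pfun (N * N)" "\<forall>x. det (tomat N x) \<noteq> 0 \<longrightarrow> f (tomat N x) * det (tomat N x) ^ d = F x"
        "F' \<in> pfun (N * N)" "\<forall>x. det (tomat N x) \<noteq> 0 \<longrightarrow> g (tomat N x) * det (tomat N x) ^ d' = F' x" by blast
    have "(\<lambda>x. F x * det (tomat N x) ^ d' + F' x * det (tomat N x) ^ d) \<in> pfun (N * N)"
      by (intro pfun_add pfun_mult pfun_power pfun_det F)
    moreover have "(f (tomat N x) + g (tomat N x)) * det (tomat N x) ^ (d + d') =
        F x * det (tomat N x) ^ d' + F' x * det (tomat N x) ^ d" if "det (tomat N x) \<noteq> 0" for x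
      using F(2,4)[rule_format, OF that, symmetric] by (simp add: power_add algebra_simps)
    ultimately show ?case
      by (intro exI[of _ "d + d'"] bexI[of _ "\<lambda>x. F x * det (tomat N x) ^ d' + F' x * det (tomat N x) ^ d"]) auto
  next
    case (mult f g)
    then obtain d F d' F' where F: "F \<in> pfun (N * N)" "\<forall>x. det (tomat N x) \<noteq> 0 \<longrightarrow> f (tomat N x) * det (tomat N x) ^ d = F x"
        "F' \<in> pfun (N * N)" "\<forall>x. det (tomat N x) \<noteq> 0 \<longrightarrow> g (tomat N x) * det (tomat N x) ^ d' = F' x" by blast
    have "(\<lambda>x. F x * F' x) \<in> pfun (N * N)" by (intro pfun_mult F)
    moreover have "f (tomat N x) * g (tomat N x) * det (tomat N x) ^ (d + d') = F x * F' x" if "det (tomat N x) \<noteq> 0" for x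
      using F(2,4)[rule_format, OF that, symmetric] by (simp add: power_add algebra_simps)
    ultimately show ?case by (intro exI[of _ "d + d'"] bexI[of _ "\<lambda>x. F x * F' x"]) auto
  qed
  moreover have "f (tomat N x) = h (tomat N x)" if "det (tomat N x) \<noteq> 0" for x
    using h(2) that by (auto simp: carrier_GL tomat_def)
  ultimately show ?thesis by auto
qed

text \<open>Clearing denominators by a power of the determinant reduces the claim to polynomial
  functions, for which linear disjointness is \<open>pfun_disjoint\<close>.\<close>

lemma regular_disjoint:
  assumes S: "finite S" "S \<subseteq> bas" and q: "\<And>b. b \<in> S \<Longrightarrow> q b \<in> regular_on (range \<iota>) N"
    and zero: "\<And>A. A \<in> carrier (GL N) \<Longrightarrow> (\<Sum>b\<in>S. b * q b A) = 0"
    and b: "b \<in> S" and A: "A \<in> carrier (GL N)"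
  shows "q b A = 0"
proof -
  have "\<forall>b\<in>S. \<exists>d. \<exists>F\<in>pfun (N * N). \<forall>x. det (tomat N x) \<noteq> 0 \<longrightarrow> q b (tomat N x) * det (tomat N x) ^ d = F x"
    using regular_clear_denominator q by blast
  from bchoice[OF this] obtain d where "\<forall>b\<in>S. \<exists>F\<in>pfun (N * N). \<forall>x. det (tomat N x) \<noteq> 0 \<longrightarrow>
      q b (tomat N x) * det (tomat N x) ^ d b = F x" by blast
  then have "\<forall>b\<in>S. \<exists>F. F \<in> pfun (N * N) \<and> (\<forall>x. det (tomat N x) \<noteq> 0 \<longrightarrow>
      q b (tomat N x) * det (tomat N x) ^ d b = F x)" by blast
  from bchoice[OF this] obtain F where *: "\<forall>b\<in>S. F b \<in> pfun (N * N) \<and> (\<forall>x. det (tomat N x) \<noteq> 0 \<longrightarrow>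
      q b (tomat N x) * det (tomat N x) ^ d b = F b x)" by blast
  have F: "\<And>b. b \<in> S \<Longrightarrow> F b \<in> pfun (N * N)"
      "\<And>b x. b \<in> S \<Longrightarrow> det (tomat N x) \<noteq> 0 \<Longrightarrow> q b (tomat N x) * det (tomat N x) ^ d b = F b x"
    using * by blast+
  \<comment> \<open>The exponent exceeds every \<open>d b\<close> strictly, so that
    \<open>F'\<close> keeps a factor \<open>det\<close> and vanishes at singular matrices. The
    relation then holds on all matrices, not only on the group.\<close>
  define D where "D = Suc (\<Sum>b\<in>S. d b)"
  have dD: "d b < D" if "b \<in> S" for b unfolding D_def using that S(1) by (simp add: less_Suc_eq_le member_le_sum)
  define F' where "F' b x = F b x * det (tomat N x) ^ (D - d b)" for b x
  have F': "F' b \<in> pfun (N * N)" if "b \<in> S" for b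
    unfolding F'_def by (intro pfun_mult pfun_power pfun_det F(1) that)
  have F'q: "F' b x = q b (tomat N x) * det (tomat N x) ^ D" if "b \<in> S" "det (tomat N x) \<noteq> 0" for b x
    using F(2)[OF that, symmetric] dD[OF that(1)]
    by (simp add: F'_def mult.assoc power_add[symmetric])
  have "(\<Sum>b\<in>S. b * F' b x) = 0" for x
  proof (cases "det (tomat N x) = 0")
    case True
    then have "F' b x = 0" if "b \<in> S" for b using dD[OF that] by (simp add: F'_def)
    then show ?thesis by simp
  next
    case False
    then have "tomat N x \<in> carrier (GL N)" by (simp add: carrier_GL tomat_def)
    have "(\<Sum>b\<in>S. b * F' b x) = (\<Sum>b\<in>S. b * q b (tomat N x)) * det (tomat N x) ^ D"
      using F'q[OF _ False] by (simp add: sum_distrib_right mult.assoc)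
    then show ?thesis using zero[OF \<open>tomat N x \<in> carrier (GL N)\<close>] by simp
  qed
  note z = pfun_disjoint[OF S F' this b]
  obtain x where x: "tomat N x = A" using tomat_surj[OF GL_carrier_mat[OF A]] by blast
  then have "det (tomat N x) \<noteq> 0" using A by (simp add: carrier_GL)
  then show ?thesis using F'q[OF b] z[of x] x by simp
qed

end

text \<open>The trace of \<open>A * X\<close>, written out entrywise so that it is visibly a linear
  form in the entries of \<open>A\<close> with coefficients from \<open>X\<close>.\<close>

definition tf :: "nat \<Rightarrow> 'a::field mat \<Rightarrow> 'a mat \<Rightarrow> 'a" where
  "tf N X A = (\<Sum>i<N. \<Sum>j<N. A $$ (i, j) * X $$ (j, i))"

lemma tf_trace:
  assumes "A \<in> carrier_mat N N" "X \<in> carrier_mat N N"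
  shows "tf N X A = (\<Sum>i<N. (A * X) $$ (i, i))"
  using assms by (auto simp: tf_def scalar_prod_def atLeast0LessThan intro!: sum.cong)

lemma tf_commute: "tf N X A = tf N A X"
  unfolding tf_def by (subst sum.swap) (simp add: mult.commute)

lemma tf_cj:
  assumes g: "g \<in> carrier (GL N)" and A: "A \<in> carrier_mat N N" and X: "X \<in> carrier_mat N N"
  shows "tf N (cj g X) (cj g A) = tf N X A"
proof -
  have m: "g \<in> carrier_mat N N" "minv g \<in> carrier_mat N N" using g minv_GL GL_carrier_mat by blast+
  have M: "A * X * g \<in> carrier_mat N N" using A X m by (intro sq_mult)
  have "tf N (cj g X) (cj g A) = (\<Sum>i<N. (cj g (A * X)) $$ (i, i))"
    using tf_trace[OF cj_carrier[OF g A] cj_carrier[OF g X]] cj_mult[OF g A X] by simp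
  also have "cj g (A * X) = minv g * (A * X * g)"
    unfolding cj_def using m sq_mult[OF A X] by (simp add: sq_assoc[of _ N] del: assoc_mult_mat)
  also have "(\<Sum>i<N. (minv g * (A * X * g)) $$ (i, i)) = tf N (A * X * g) (minv g)"
    by (rule tf_trace[OF m(2) M, symmetric])
  also have "\<dots> = tf N (minv g) (A * X * g)" by (rule tf_commute)
  also have "\<dots> = (\<Sum>i<N. (A * X * g * minv g) $$ (i, i))" by (rule tf_trace[OF M m(2)])
  also have "A * X * g * minv g = A * X" by (rule minv_cancel_right(2)[OF g sq_mult[OF A X]])
  also have "(\<Sum>i<N. (A * X) $$ (i, i)) = tf N X A" by (rule tf_trace[OF A X, symmetric])
  finally show ?thesis .
qed

lemma nil_mult_vec:
  assumes "X \<in> nil N r" "v \<in> flag N (i + r)"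
  shows "X *\<^sub>v v \<in> flag N i"
  unfolding flag_def
proof (intro CollectI conjI allI impI)
  show "X *\<^sub>v v \<in> carrier_vec N" using assms by (auto simp: nil_def flag_def)
  fix l assume l: "i \<le> l \<and> l < N"
  have "(X *\<^sub>v v) $ l = (\<Sum>j\<in>{0..<N}. X $$ (l, j) * v $ j)"
    using assms l by (auto simp: nil_def flag_def scalar_prod_def intro!: sum.cong)
  also have "\<dots> = 0"
  proof (rule sum.neutral, rule ballI)
    fix j assume "j \<in> {0..<N}"
    then show "X $$ (l, j) * v $ j = 0"
      using assms l by (cases "j < l + r") (auto simp: nil_def flag_def)
  qed
  finally show "(X *\<^sub>v v) $ l = 0" .
qed

text \<open>The strictly upper triangular matrices are the orthogonal complement, with respect to the trace form, of
  the upper triangular ones.\<close>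

lemma orth_borel_iff:
  fixes X :: "'b::alg_closed_field mat"
  assumes g: "g \<in> carrier (GL N)" and X: "X \<in> carrier_mat N N"
  shows "(\<forall>h\<in>{h \<in> carrier (GL N). cj g h \<in> tri N}. tf N X h = 0) \<longleftrightarrow> cj g X \<in> nil N 1"
proof
  have Y: "cj g X \<in> carrier_mat N N" by (rule cj_carrier[OF g X])
  show "cj g X \<in> nil N 1 \<Longrightarrow> \<forall>h\<in>{h \<in> carrier (GL N). cj g h \<in> tri N}. tf N X h = 0"
  proof
    fix h assume n: "cj g X \<in> nil N 1" and h: "h \<in> {h \<in> carrier (GL N). cj g h \<in> tri N}"
    then have "cj g h * cj g X \<in> nil N (0 + 1)" using nil_mult[OF tri_nil n] by blast
    then have "(cj g h * cj g X) $$ (i, i) = 0" if "i < N" for i using that by (auto simp: nil_def)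
    moreover have hm: "h \<in> carrier_mat N N" using h GL_carrier_mat by blast
    ultimately have "tf N (cj g X) (cj g h) = 0"
      using tf_trace[OF cj_carrier[OF g hm] Y] by simp
    then show "tf N X h = 0" using tf_cj[OF g hm X] by simp
  qed
  assume *: "\<forall>h\<in>{h \<in> carrier (GL N). cj g h \<in> tri N}. tf N X h = 0"
  have tz: "tf N (cj g X) t = 0" if t: "t \<in> tri N" for t
  proof -
    have tm: "t \<in> carrier_mat N N" using tri_carrier_mat[OF t] .
    have G: "g * t * minv g \<in> carrier (GL N)" using g t tri_GL by (auto intro!: mult_GL minv_GL)
    have c: "cj g (g * t * minv g) = t" by (rule cj_cj_minv(1)[OF g tm])
    have "tf N X (g * t * minv g) = 0" using * G c t by auto
    then show ?thesis using tf_cj[OF g GL_carrier_mat[OF G] X] c by simp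
  qed
  \<comment> \<open>The test matrix is 1 with \<open>a\<close> added at \<open>(k, l)\<close>.
    Excluding \<open>a = - 1\<close> keeps it invertible when \<open>k = l\<close>, and
    \<open>a \<noteq> 0\<close> allows the entry to be recovered.\<close>
  have "infinite (UNIV - {0, - 1 :: 'b})" using infinite_alg_closed by simp
  then have "UNIV - {0, - 1 :: 'b} \<noteq> {}" by (rule infinite_imp_nonempty)
  then obtain a :: 'b where a: "a \<noteq> 0" "a \<noteq> - 1" by blast
  have a1: "1 + a \<noteq> 0" using a(2) by (simp add: add_eq_0_iff)
  have "cj g X $$ (l, k) = 0" if kl: "k \<le> l" "l < N" for k l
  proof -
    let ?Y = "cj g X"
    define t where "t = mat N N (\<lambda>(i, j). (if i = j then 1 else 0) + (if i = k \<and> j = l then a else 0))"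
    have "t \<in> tri N"
      by (rule triI) (use kl a1 in \<open>auto simp: t_def\<close>)
    then have "tf N ?Y t = 0" by (rule tz)
    moreover have "tf N ?Y t = tf N ?Y (1\<^sub>m N) + a * ?Y $$ (l, k)"
    proof -
      have "tf N ?Y t = (\<Sum>i<N. \<Sum>j<N. 1\<^sub>m N $$ (i, j) * ?Y $$ (j, i) + (if i = k then (if j = l then a * ?Y $$ (l, k) else 0) else 0))"
        unfolding tf_def by (intro sum.cong refl) (auto simp: t_def distrib_right)
      also have "\<dots> = tf N ?Y (1\<^sub>m N) + (\<Sum>i<N. \<Sum>j<N. if i = k then (if j = l then a * ?Y $$ (l, k) else 0) else 0)"
        by (simp add: tf_def sum.distrib)
      also have "(\<Sum>i<N. \<Sum>j<N. if i = k then (if j = l then a * ?Y $$ (l, k) else 0) else 0) =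
          (\<Sum>i<N. if i = k then a * ?Y $$ (l, k) else 0)"
        using kl by (intro sum.cong) auto
      also have "\<dots> = a * ?Y $$ (l, k)" using kl by simp
      finally show ?thesis .
    qed
    moreover have "tf N ?Y (1\<^sub>m N) = 0" by (rule tz[OF one_tri])
    ultimately show ?thesis using a(1) by simp
  qed
  then show "cj g X \<in> nil N 1" using Y by (auto simp: nil_def)
qed

context field_ext
begin

interpretation rr: function_ring "carrier (GL N)" "regular_on (range \<iota>) N" for N
  by (rule function_ring_regular) (rule range_ring)+

text \<open>The span over the big field of the regular functions over the subfield that vanish on
  \<open>Z\<close>, written with coefficients in \<open>bas\<close>. For \<open>Z = {}\<close> there
  is no vanishing condition. Setting \<open>q b\<close> to zero outside \<open>S\<close> allows
  \<open>S\<close> to be enlarged freely.\<close>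

definition comb :: "nat \<Rightarrow> 'b mat set \<Rightarrow> ('b mat \<Rightarrow> 'b) set" where
  "comb N Z = {f. \<exists>S q. finite S \<and> S \<subseteq> bas \<and> (\<forall>b. q b \<in> regular_on (range \<iota>) N \<and> (\<forall>A\<in>Z. q b A = 0)) \<and>
     (\<forall>b. b \<notin> S \<longrightarrow> q b = (\<lambda>_. 0)) \<and> (\<forall>A\<in>carrier (GL N). f A = (\<Sum>b\<in>S. b * q b A))}"

lemma comb_cong: "f \<in> comb N Z \<Longrightarrow> (\<And>A. A \<in> carrier (GL N) \<Longrightarrow> g A = f A) \<Longrightarrow> g \<in> comb N Z"
  unfolding comb_def by auto

lemma comb_add:
  assumes "f \<in> comb N Z" "f' \<in> comb N Z"
  shows "(\<lambda>A. f A + f' A) \<in> comb N Z"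
proof -
  obtain S q where q: "finite S" "S \<subseteq> bas" "\<forall>b. q b \<in> regular_on (range \<iota>) N \<and> (\<forall>A\<in>Z. q b A = 0)"
     "\<forall>b. b \<notin> S \<longrightarrow> q b = (\<lambda>_. 0)" "\<forall>A\<in>carrier (GL N). f A = (\<Sum>b\<in>S. b * q b A)"
    using assms(1) unfolding comb_def by blast
  obtain S' q' where q': "finite S'" "S' \<subseteq> bas" "\<forall>b. q' b \<in> regular_on (range \<iota>) N \<and> (\<forall>A\<in>Z. q' b A = 0)"
     "\<forall>b. b \<notin> S' \<longrightarrow> q' b = (\<lambda>_. 0)" "\<forall>A\<in>carrier (GL N). f' A = (\<Sum>b\<in>S'. b * q' b A)"
    using assms(2) unfolding comb_def by blast
  have "f A = (\<Sum>b\<in>S \<union> S'. b * q b A)" if "A \<in> carrier (GL N)" for A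
    unfolding q(5)[rule_format, OF that] by (rule sum.mono_neutral_left) (use q q' in auto)
  moreover have "f' A = (\<Sum>b\<in>S \<union> S'. b * q' b A)" if "A \<in> carrier (GL N)" for A
    unfolding q'(5)[rule_format, OF that] by (rule sum.mono_neutral_left) (use q q' in auto)
  ultimately have "\<forall>A\<in>carrier (GL N). f A + f' A = (\<Sum>b\<in>S \<union> S'. b * (q b A + q' b A))"
    by (simp add: distrib_left sum.distrib)
  moreover have "\<forall>b. (\<lambda>A. q b A + q' b A) \<in> regular_on (range \<iota>) N \<and> (\<forall>A\<in>Z. q b A + q' b A = 0)"
    using q(3) q'(3) by (auto intro!: rr.add)
  ultimately show ?thesis
    unfolding comb_def using q(1,2,4) q'(1,2,4)
    by (intro CollectI exI[of _ "S \<union> S'"] exI[of _ "\<lambda>b A. q b A + q' b A"]) auto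
qed

lemma comb_smult:
  assumes "q \<in> regular_on (range \<iota>) N" "\<And>A. A \<in> Z \<Longrightarrow> q A = 0"
  shows "(\<lambda>A. \<alpha> * q A) \<in> comb N Z"
proof -
  have "\<alpha> * q A = (\<Sum>b\<in>supp \<alpha>. b * (\<iota> (co b \<alpha>) * q A))" for A
    by (subst expand[OF supp(1) order_refl, of \<alpha>]) (simp add: sum_distrib_right mult.assoc)
  moreover have "(\<lambda>A. \<iota> (co b \<alpha>) * q A) \<in> regular_on (range \<iota>) N" for b
    by (intro rr.mult regular_on_const assms) auto
  moreover have "(\<lambda>A. \<iota> (co b \<alpha>) * q A) = (\<lambda>_. 0)" if "b \<notin> supp \<alpha>" for b
    using that by (simp add: supp_def)
  ultimately show ?thesis
    unfolding comb_def using supp assms(2)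
    by (intro CollectI exI[of _ "supp \<alpha>"] exI[of _ "\<lambda>b A. \<iota> (co b \<alpha>) * q A"]) auto
qed

lemma comb_zero: "(\<lambda>_. 0) \<in> comb N Z"
  using comb_smult[of "\<lambda>_. 0" N Z 0] rr.zero by simp

lemma comb_sum: "(\<And>s. s \<in> K \<Longrightarrow> f s \<in> comb N Z) \<Longrightarrow> (\<lambda>A. \<Sum>s\<in>K. f s A) \<in> comb N Z"
  by (induction K rule: infinite_finite_induct) (auto intro: comb_add comb_zero)

lemma comb_mult:
  assumes "f \<in> comb N Z" "f' \<in> comb N {}"
  shows "(\<lambda>A. f' A * f A) \<in> comb N Z"
proof -
  obtain S q where q: "\<forall>b. q b \<in> regular_on (range \<iota>) N \<and> (\<forall>A\<in>Z. q b A = 0)"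
     "\<forall>A\<in>carrier (GL N). f A = (\<Sum>b\<in>S. b * q b A)"
    using assms(1) unfolding comb_def by blast
  obtain S' q' where q': "\<forall>b. q' b \<in> regular_on (range \<iota>) N"
     "\<forall>A\<in>carrier (GL N). f' A = (\<Sum>b\<in>S'. b * q' b A)"
    using assms(2) unfolding comb_def by blast
  have "(\<lambda>A. \<Sum>b'\<in>S'. \<Sum>b\<in>S. (b' * b) * (q' b' A * q b A)) \<in> comb N Z"
    by (intro comb_sum comb_smult rr.mult) (use q(1) q'(1) in auto)
  then show ?thesis
    by (rule comb_cong) (use q(2) q'(2) in \<open>auto simp: sum_product ac_simps\<close>)
qed

lemma regular_comb:
  assumes "f \<in> regular_funs UNIV N"
  shows "f \<in> comb N {}"
  using assms
proof induction
  case (const c)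
  show ?case using comb_smult[of "\<lambda>_. 1" N "{}" c] rr.one by simp
next
  case (entry i j)
  then have "(\<lambda>A. A $$ (i, j)) \<in> regular_on (range \<iota>) N" by (intro regular_onI regular_funs.entry)
  from comb_smult[OF this, of "{}" 1] show ?case by simp
next
  case inv_det
  show ?case using comb_smult[OF regular_on_inv_det, of "{}" 1] by simp
next
  case (add f g)
  then show ?case by (intro comb_add)
next
  case (mult f g)
  then show ?case using comb_mult by blast
qed

text \<open>Here the field of definition enters: the generators of the ideal have coefficients in
  the subfield, and their cofactors are expanded in the basis by
  \<open>regular_comb\<close>.\<close>

lemma vanishing_comb:
  assumes Z: "defined_over \<iota> N Z" "Z \<subseteq> carrier (GL N)" and f: "f \<in> regular_on UNIV N" "\<And>A. A \<in> Z \<Longrightarrow> f A = 0"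
  shows "f \<in> comb N Z"
proof -
  obtain g where g: "g \<in> regular_funs UNIV N" "\<forall>A\<in>carrier (GL N). f A = g A"
    using f(1) by (auto simp: regular_on_def)
  have "\<forall>A\<in>Z. g A = 0" using g(2) f(2) Z(2) by (metis subsetD)
  then obtain r :: nat and c h where ch: "\<forall>i<r. c i \<in> regular_funs UNIV N \<and> h i \<in> regular_funs (range \<iota>) N \<and> (\<forall>A\<in>Z. h i A = 0)"
      "\<forall>A\<in>carrier (GL N). g A = (\<Sum>i<r. c i A * h i A)"
    using Z(1) g(1) unfolding defined_over_def by blast
  have "(\<lambda>A. \<Sum>i<r. c i A * h i A) \<in> comb N Z"
  proof (rule comb_sum)
    fix i assume "i \<in> {..<r}"
    then have i: "c i \<in> regular_funs UNIV N" "h i \<in> regular_funs (range \<iota>) N" "\<forall>A\<in>Z. h i A = 0"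
      using ch(1) by auto
    have "h i \<in> comb N Z" using comb_smult[OF regular_onI[OF i(2)], of Z 1] i(3) by simp
    then show "(\<lambda>A. c i A * h i A) \<in> comb N Z" by (rule comb_mult[OF _ regular_comb[OF i(1)]])
  qed
  then show ?thesis by (rule comb_cong) (use g(2) ch(2) in auto)
qed

definition cm :: "'b \<Rightarrow> 'b mat \<Rightarrow> 'b mat" where
  "cm b X = map_mat (\<lambda>x. \<iota> (co b x)) X"

definition cv :: "'b \<Rightarrow> 'b vec \<Rightarrow> 'b vec" where
  "cv b v = map_vec (\<lambda>x. \<iota> (co b x)) v"

lemma tf_component_regular:
  assumes "X \<in> carrier_mat N N"
  shows "(\<lambda>A. tf N (cm b X) A) \<in> regular_on (range \<iota>) N"
  unfolding tf_def
  by (intro rr.sum rr.mult regular_on_const regular_onI[OF regular_funs.entry]) (use assms in \<open>auto simp: cm_def\<close>)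

text \<open>The linear form has two expansions in the basis: entry by entry, and through
  \<open>vanishing_comb\<close>. Linear disjointness identifies their coefficients, and those of the
  second expansion vanish on \<open>Z\<close>.\<close>

lemma component_vanishes:
  assumes Z: "defined_over \<iota> N Z" "Z \<subseteq> carrier (GL N)" and X: "X \<in> carrier_mat N N"
    and z: "\<And>A. A \<in> Z \<Longrightarrow> tf N X A = 0" and A: "A \<in> Z"
  shows "tf N (cm b X) A = 0"
proof -
  have "(\<lambda>A. tf N X A) \<in> regular_on UNIV N"
    unfolding tf_def by (intro reg.sum reg.mult regular_on_const regular_onI[OF regular_funs.entry]) auto
  then obtain S q where q: "finite S" "S \<subseteq> bas" "\<forall>b. q b \<in> regular_on (range \<iota>) N \<and> (\<forall>A\<in>Z. q b A = 0)"
     "\<forall>b. b \<notin> S \<longrightarrow> q b = (\<lambda>_. 0)" "\<forall>A\<in>carrier (GL N). tf N X A = (\<Sum>b\<in>S. b * q b A)"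
    using vanishing_comb[OF Z, of "\<lambda>A. tf N X A"] z unfolding comb_def by blast
  define S' where "S' = (\<Union>i\<in>{..<N}. \<Union>j\<in>{..<N}. supp (X $$ (j, i)))"
  have S': "finite S'" "S' \<subseteq> bas" unfolding S'_def using supp by blast+
  let ?U = "S \<union> S'"
  have U: "finite ?U" "?U \<subseteq> bas" using q S' by auto
  have ex: "tf N X A = (\<Sum>b\<in>?U. b * tf N (cm b X) A)" for A
  proof -
    have "tf N X A = (\<Sum>i<N. \<Sum>j<N. \<Sum>b\<in>?U. b * (A $$ (i, j) * cm b X $$ (j, i)))"
      unfolding tf_def
    proof (intro sum.cong refl)
      fix i j assume ij: "i \<in> {..<N}" "j \<in> {..<N}"
      have "supp (X $$ (j, i)) \<subseteq> ?U" unfolding S'_def using ij by blast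
      then have "X $$ (j, i) = (\<Sum>b\<in>?U. b * \<iota> (co b (X $$ (j, i))))" by (rule expand[OF U(1)])
      then have "A $$ (i, j) * X $$ (j, i) = A $$ (i, j) * (\<Sum>b\<in>?U. b * \<iota> (co b (X $$ (j, i))))" by simp
      also have "\<dots> = (\<Sum>b\<in>?U. b * (A $$ (i, j) * cm b X $$ (j, i)))"
        unfolding sum_distrib_left using ij X by (intro sum.cong refl) (auto simp: cm_def ac_simps)
      finally show "A $$ (i, j) * X $$ (j, i) = (\<Sum>b\<in>?U. b * (A $$ (i, j) * cm b X $$ (j, i)))" .
    qed
    also have "\<dots> = (\<Sum>i<N. \<Sum>b\<in>?U. \<Sum>j<N. b * (A $$ (i, j) * cm b X $$ (j, i)))"
      by (intro sum.cong refl sum.swap)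
    also have "\<dots> = (\<Sum>b\<in>?U. \<Sum>i<N. \<Sum>j<N. b * (A $$ (i, j) * cm b X $$ (j, i)))"
      by (rule sum.swap)
    also have "\<dots> = (\<Sum>b\<in>?U. b * tf N (cm b X) A)" by (simp add: tf_def sum_distrib_left)
    finally show ?thesis .
  qed
  show ?thesis
  proof (cases "b \<in> ?U")
    case True
    have "q b A + (- 1) * tf N (cm b X) A = 0"
    proof (rule regular_disjoint[OF U _ _ True])
      show "(\<lambda>A. q b A + (- 1) * tf N (cm b X) A) \<in> regular_on (range \<iota>) N" for b
        by (intro rr.add rr.mult regular_on_const range_ring tf_component_regular[OF X]) (use q(3) in auto)
      fix A :: "'b mat" assume A: "A \<in> carrier (GL N)"
      have "(\<Sum>b\<in>S. b * q b A) = (\<Sum>b\<in>?U. b * q b A)"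
        by (rule sum.mono_neutral_left) (use q(4) U(1) in auto)
      then have "(\<Sum>b\<in>?U. b * q b A) = (\<Sum>b\<in>?U. b * tf N (cm b X) A)" using q(5) A ex by metis
      then show "(\<Sum>b\<in>?U. b * (q b A + (- 1) * tf N (cm b X) A)) = 0"
        by (simp add: right_diff_distrib sum_subtractf)
    qed (use A Z in blast)
    then show ?thesis using q(3) A by simp
  next
    case False
    then have "co b (X $$ (j, i)) = 0" if "i < N" "j < N" for i j
      using that unfolding S'_def supp_def by blast
    then show ?thesis unfolding tf_def cm_def using X by (auto intro!: sum.neutral)
  qed
qed

text \<open>Descending induction on \<open>i\<close>. A vector \<open>v\<close> in step
  \<open>i\<close> is \<open>X *\<^sub>v y\<close>, where \<open>X\<close> is strictly triangular
  for the flag and \<open>y\<close> is its basis vector in step \<open>Suc i\<close>. The components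
  of \<open>X\<close> stay strictly triangular by \<open>component_vanishes\<close>, those of
  \<open>y\<close> stay in step \<open>Suc i\<close> by induction, and the components of
  \<open>v\<close> are combinations of the products.\<close>

lemma component_flag:
  assumes g: "g \<in> carrier (GL N)" and Z: "defined_over \<iota> N {h \<in> carrier (GL N). cj g h \<in> tri N}"
    and "i \<le> N" "v \<in> carrier_vec N" "minv g *\<^sub>v v \<in> flag N i"
  shows "minv g *\<^sub>v cv d v \<in> flag N i"
  using assms(3-5)
proof (induction i arbitrary: v d rule: inc_induct)
  have gm: "g \<in> carrier_mat N N" "minv g \<in> carrier_mat N N" using g minv_GL GL_carrier_mat by blast+
  {
    case base
    have "minv g *\<^sub>v cv d v \<in> carrier_vec N" using gm base by (auto simp: cv_def)
    then show ?case by (simp add: flag_full)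
  next
    case (step i)
    let ?w = "minv g *\<^sub>v v"
    \<comment> \<open>Sends the unit vector \<open>i\<close> to \<open>?w\<close> and the other unit
      vectors to 0. It is strictly upper triangular because \<open>?w\<close> lies in step
      \<open>i\<close> of the flag.\<close>
    define Y where "Y = mat N N (\<lambda>(r, c). if c = i then ?w $ r else 0)"
    define X where "X = g * Y * minv g"
    define y where "y = g *\<^sub>v unit_vec N i"
    have wc: "?w \<in> carrier_vec N" using gm step.prems by auto
    have Yc: "Y \<in> carrier_mat N N" by (simp add: Y_def)
    have Xc: "X \<in> carrier_mat N N" unfolding X_def using gm Yc by (intro sq_mult)
    have yc: "y \<in> carrier_vec N" unfolding y_def using gm by simp
    have cX: "cj g X = Y" unfolding X_def by (rule cj_cj_minv(1)[OF g Yc])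
    have Yn: "Y \<in> nil N 1" using step.prems(2) by (auto simp: nil_def Y_def flag_def)
    have gy: "minv g *\<^sub>v y = unit_vec N i" unfolding y_def by (rule minv_cancel_vec(1)[OF g]) simp
    have "Y *\<^sub>v unit_vec N i = ?w"
      unfolding col_eq_mult_unit[OF Yc step.hyps(2), symmetric]
    proof (rule eq_vecI)
      fix r assume "r < dim_vec ?w"
      then have "r < N" using carrier_vecD[OF wc] by simp
      then show "col Y i $ r = ?w $ r" using step.hyps by (simp add: Y_def del: index_mult_mat_vec)
    qed (use carrier_vecD[OF wc] in \<open>simp add: Y_def\<close>)
    then have Xy: "X *\<^sub>v y = v"
      unfolding X_def using gy minv_cancel_vec(2)[OF g step.prems(1)] gm Yc yc
      by (simp add: assoc_mult_mat_vec[of _ N N _ N] sq_mult del: assoc_mult_mat)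
    have Xb: "cj g (cm b X) \<in> nil N 1" for b
    proof -
      have cb: "cm b X \<in> carrier_mat N N" using Xc by (simp add: cm_def)
      show ?thesis
        unfolding orth_borel_iff[OF g cb, symmetric]
      proof
        fix h assume h: "h \<in> {h \<in> carrier (GL N). cj g h \<in> tri N}"
        show "tf N (cm b X) h = 0"
          by (rule component_vanishes[OF Z _ Xc _ h]) (use orth_borel_iff[OF g Xc] cX Yn in auto)
      qed
    qed
    have yb: "minv g *\<^sub>v cv c y \<in> flag N (Suc i)" for c
      by (rule step.IH[OF yc]) (use gy leads_unit_vec[OF step.hyps(2)] in \<open>auto simp: leads_flag_Suc\<close>)
    have Xyb: "minv g *\<^sub>v (cm b X *\<^sub>v cv c y) \<in> flag N i" for b c
    proof -
      have cb: "cm b X \<in> carrier_mat N N" "cv c y \<in> carrier_vec N" using Xc yc by (auto simp: cm_def cv_def)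
      have "minv g *\<^sub>v (cm b X *\<^sub>v cv c y) = cj g (cm b X) *\<^sub>v (minv g *\<^sub>v cv c y)"
      proof -
        have "cj g (cm b X) *\<^sub>v (minv g *\<^sub>v cv c y) = minv g * cm b X *\<^sub>v (g *\<^sub>v (minv g *\<^sub>v cv c y))"
          unfolding cj_def using gm cb by (intro assoc_mult_mat_vec[of _ N N _ N]) auto
        also have "g *\<^sub>v (minv g *\<^sub>v cv c y) = cv c y" by (rule minv_cancel_vec(2)[OF g cb(2)])
        also have "minv g * cm b X *\<^sub>v cv c y = minv g *\<^sub>v (cm b X *\<^sub>v cv c y)"
          by (rule assoc_mult_mat_vec[OF gm(2) cb])
        finally show ?thesis by simp
      qed
      then show ?thesis using nil_mult_vec[OF Xb, of "minv g *\<^sub>v cv c y" i b] yb by simp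
    qed
    define S where "S = (\<Union>r\<in>{..<N}. \<Union>s\<in>{..<N}. supp (X $$ (r, s))) \<times> (\<Union>s\<in>{..<N}. supp (y $ s))"
    let ?S1 = "\<Union>r\<in>{..<N}. \<Union>s\<in>{..<N}. supp (X $$ (r, s))" and ?S2 = "\<Union>s\<in>{..<N}. supp (y $ s)"
    have fS: "finite ?S1" "finite ?S2" using supp(1) by blast+
    define u where "u = (\<lambda>(b, c). minv g *\<^sub>v (cm b X *\<^sub>v cv c y))"
    have cvd: "cv d v = vec N (\<lambda>r. \<Sum>x\<in>S. \<iota> (co d (fst x * snd x)) * (cm (fst x) X *\<^sub>v cv (snd x) y) $ r)"
    proof (rule eq_vecI)
      fix r assume "r < dim_vec (vec N (\<lambda>r. \<Sum>x\<in>S. \<iota> (co d (fst x * snd x)) * (cm (fst x) X *\<^sub>v cv (snd x) y) $ r))"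
      then have r: "r < N" by simp
      have vr: "v $ r = (\<Sum>s\<in>{0..<N}. X $$ (r, s) * y $ s)"
        using Xy Xc yc r by (auto simp: scalar_prod_def intro!: sum.cong)
      \<comment> \<open>The numbers \<open>co d (fst x * snd x)\<close> are the structure constants
        of the big field as an algebra over the subfield.\<close>
      have prod: "co d (X $$ (r, s) * y $ s) = (\<Sum>x\<in>S. co d (fst x * snd x) * co (fst x) (X $$ (r, s)) * co (snd x) (y $ s))"
        if s: "s < N" for s
      proof -
        have 1: "X $$ (r, s) = (\<Sum>b\<in>?S1. b * \<iota> (co b (X $$ (r, s))))"
          by (rule expand[OF fS(1)]) (use r s in blast)
        have 2: "y $ s = (\<Sum>c\<in>?S2. c * \<iota> (co c (y $ s)))"
          by (rule expand[OF fS(2)]) (use s in blast)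
        have "X $$ (r, s) * y $ s = (\<Sum>b\<in>?S1. b * \<iota> (co b (X $$ (r, s)))) * (\<Sum>c\<in>?S2. c * \<iota> (co c (y $ s)))"
          using 1 2 by simp
        also have "\<dots> = (\<Sum>x\<in>S. (fst x * \<iota> (co (fst x) (X $$ (r, s)))) * (snd x * \<iota> (co (snd x) (y $ s))))"
          unfolding S_def sum_product sum.cartesian_product by (simp add: case_prod_unfold)
        also have "\<dots> = (\<Sum>x\<in>S. \<iota> (co (fst x) (X $$ (r, s)) * co (snd x) (y $ s)) * (fst x * snd x))"
          by (intro sum.cong refl) (simp add: hom_distribs ac_simps)
        finally have "co d (X $$ (r, s) * y $ s) =
            (\<Sum>x\<in>S. co d (\<iota> (co (fst x) (X $$ (r, s)) * co (snd x) (y $ s)) * (fst x * snd x)))"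
          by (simp only: co_sum)
        then show ?thesis by (simp only: co_scale) (simp add: ac_simps)
      qed
      have "cv d v $ r = \<iota> (\<Sum>s\<in>{0..<N}. co d (X $$ (r, s) * y $ s))"
        using r step.prems(1) by (simp add: cv_def vr co_sum)
      also have "\<dots> = \<iota> (\<Sum>s\<in>{0..<N}. \<Sum>x\<in>S. co d (fst x * snd x) * co (fst x) (X $$ (r, s)) * co (snd x) (y $ s))"
        using prod by simp
      also have "\<dots> = (\<Sum>s\<in>{0..<N}. \<Sum>x\<in>S. \<iota> (co d (fst x * snd x)) * (\<iota> (co (fst x) (X $$ (r, s))) * \<iota> (co (snd x) (y $ s))))"
        by (simp add: hom_distribs mult.assoc)
      also have "\<dots> = (\<Sum>x\<in>S. \<iota> (co d (fst x * snd x)) * (\<Sum>s\<in>{0..<N}. \<iota> (co (fst x) (X $$ (r, s))) * \<iota> (co (snd x) (y $ s))))"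
        by (subst sum.swap) (simp add: sum_distrib_left)
      also have "\<dots> = (\<Sum>x\<in>S. \<iota> (co d (fst x * snd x)) * (cm (fst x) X *\<^sub>v cv (snd x) y) $ r)"
      proof (intro sum.cong refl)
        fix x
        have "(cm (fst x) X *\<^sub>v cv (snd x) y) $ r = (\<Sum>s\<in>{0..<N}. \<iota> (co (fst x) (X $$ (r, s))) * \<iota> (co (snd x) (y $ s)))"
          using r Xc yc by (auto simp: cm_def cv_def scalar_prod_def intro!: sum.cong)
        then show "\<iota> (co d (fst x * snd x)) * (\<Sum>s\<in>{0..<N}. \<iota> (co (fst x) (X $$ (r, s))) * \<iota> (co (snd x) (y $ s))) =
          \<iota> (co d (fst x * snd x)) * (cm (fst x) X *\<^sub>v cv (snd x) y) $ r" by simp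
      qed
      finally show "cv d v $ r = vec N (\<lambda>r. \<Sum>x\<in>S. \<iota> (co d (fst x * snd x)) * (cm (fst x) X *\<^sub>v cv (snd x) y) $ r) $ r"
        using r by simp
    qed (use step.prems(1) in \<open>simp add: cv_def\<close>)
    have "minv g *\<^sub>v cv d v = vec N (\<lambda>r. \<Sum>x\<in>S. \<iota> (co d (fst x * snd x)) * (minv g *\<^sub>v (cm (fst x) X *\<^sub>v cv (snd x) y)) $ r)"
      unfolding cvd by (rule mult_mat_vec_lincomb[OF gm(2)]) (use Xc in \<open>auto simp: cm_def intro!: carrier_vecI\<close>)
    also have "\<dots> \<in> flag N i" by (rule subsp_lincomb[OF subsp_flag]) (rule Xyb)
    finally show ?case .
  }
qed

text \<open>By \<open>component_flag\<close> the components of a flag vector remain in its flag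
  step, and at least one of them does not fall into the previous step. These components have
  coordinates in the subfield and form a basis adapted to the same flag.\<close>

lemma rational_borel:
  assumes g: "g \<in> carrier (GL N)" and Z: "defined_over \<iota> N {h \<in> carrier (GL N). cj g h \<in> tri N}"
  shows "\<exists>g0\<in>carrier (GL N). map_mat \<iota> g0 \<in> carrier (GL N) \<and>
    {h \<in> carrier (GL N). cj g h \<in> tri N} = {h \<in> carrier (GL N). cj (map_mat \<iota> g0) h \<in> tri N}"
proof -
  have gm: "g \<in> carrier_mat N N" "minv g \<in> carrier_mat N N" using g minv_GL GL_carrier_mat by blast+
  define y where "y i = g *\<^sub>v unit_vec N i" for i
  have yc: "y i \<in> carrier_vec N" for i unfolding y_def using gm by simp
  have gy: "minv g *\<^sub>v y i = unit_vec N i" for i unfolding y_def by (rule minv_cancel_vec(1)[OF g]) simp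
  \<comment> \<open>The vector \<open>y i\<close> is a combination of its components; if all of them
    lay in step \<open>i\<close>, so would \<open>y i\<close>.\<close>
  have ex: "\<exists>b. minv g *\<^sub>v cv b (y i) \<notin> flag N i" if i: "i < N" for i
  proof (rule ccontr)
    assume n: "\<not> (\<exists>b. minv g *\<^sub>v cv b (y i) \<notin> flag N i)"
    let ?S = "\<Union>s\<in>{..<N}. supp (y i $ s)"
    have "finite ?S" using supp(1) by blast
    then have "y i = vec N (\<lambda>r. \<Sum>b\<in>?S. b * cv b (y i) $ r)"
      using yc[of i] expand[of ?S] by (intro eq_vecI) (auto simp: cv_def)
    then have "minv g *\<^sub>v y i = minv g *\<^sub>v vec N (\<lambda>r. \<Sum>b\<in>?S. b * cv b (y i) $ r)" by simp
    also have "\<dots> = vec N (\<lambda>r. \<Sum>b\<in>?S. b * (minv g *\<^sub>v cv b (y i)) $ r)"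
      by (rule mult_mat_vec_lincomb[OF gm(2)]) (use yc in \<open>auto simp: cv_def\<close>)
    also have "\<dots> \<in> flag N i" by (rule subsp_lincomb[OF subsp_flag]) (use n in blast)
    finally show False using gy leads_unit_vec[OF i, where 'a = 'b] by (simp add: leads_flag_Suc)
  qed
  define \<beta> where "\<beta> i = (SOME b. minv g *\<^sub>v cv b (y i) \<notin> flag N i)" for i
  define g0 where "g0 = mat N N (\<lambda>(l, i). co (\<beta> i) (y i $ l))"
  let ?g = "map_mat \<iota> g0"
  have g0m: "g0 \<in> carrier_mat N N" "?g \<in> carrier_mat N N" by (auto simp: g0_def)
  \<comment> \<open>The change of basis from \<open>g\<close> to the rational basis. It is
    triangular because its columns have the right leading indices, so both bases define the same
    stabiliser.\<close>
  define t where "t = minv g * ?g"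
  have tm: "t \<in> carrier_mat N N" unfolding t_def using gm g0m by (intro sq_mult)
  have lead: "leads N (minv g *\<^sub>v cv (\<beta> i) (y i)) i" if i: "i < N" for i
  proof -
    have "minv g *\<^sub>v cv (\<beta> i) (y i) \<notin> flag N i" unfolding \<beta>_def by (rule someI_ex[OF ex[OF i]])
    moreover have "minv g *\<^sub>v cv (\<beta> i) (y i) \<in> flag N (Suc i)"
      by (rule component_flag[OF g Z _ yc]) (use i gy leads_unit_vec[OF i, where 'a = 'b] in \<open>auto simp: leads_flag_Suc\<close>)
    ultimately show ?thesis using i by (simp add: leads_flag_Suc)
  qed
  have "t = mat N N (\<lambda>(l, i). (minv g *\<^sub>v cv (\<beta> i) (y i)) $ l)"
  proof (rule eq_matI)
    fix l i assume "l < dim_row (mat N N (\<lambda>(l, i). (minv g *\<^sub>v cv (\<beta> i) (y i)) $ l))"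
      "i < dim_col (mat N N (\<lambda>(l, i). (minv g *\<^sub>v cv (\<beta> i) (y i)) $ l))"
    then have li: "l < N" "i < N" by auto
    have "col ?g i = cv (\<beta> i) (y i)" using li yc[of i] by (auto simp: g0_def cv_def intro!: eq_vecI)
    then show "t $$ (l, i) = mat N N (\<lambda>(l, i). (minv g *\<^sub>v cv (\<beta> i) (y i)) $ l) $$ (l, i)"
      using li gm g0m by (simp add: t_def)
  qed (use tm in auto)
  then have t: "t \<in> tri N" using leads_mat[of N "\<lambda>i. minv g *\<^sub>v cv (\<beta> i) (y i)"] lead by simp
  have gt: "?g = g * t" unfolding t_def using minv_cancel(2)[OF g g0m(2)] by simp
  have G: "?g \<in> carrier (GL N)" unfolding gt by (rule mult_GL[OF g tri_GL[OF t]])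
  then have "g0 \<in> carrier (GL N)" using g0m by (auto simp: carrier_GL)
  moreover have "cj ?g h \<in> tri N \<longleftrightarrow> cj g h \<in> tri N" if h: "h \<in> carrier (GL N)" for h
  proof -
    note hm = GL_carrier_mat[OF h]
    have c: "cj g h \<in> carrier_mat N N" by (rule cj_carrier[OF g hm])
    have "cj ?g h = minv t * cj g h * t"
      unfolding gt cj_def minv_mult[OF g tri_GL[OF t]] using gm tm hm minv_carrier_mat[OF tm]
      by (simp add: sq_assoc[of _ N] sq_mult del: assoc_mult_mat)
    then have e: "cj ?g h = cj t (cj g h)" by (simp add: cj_def)
    have e': "cj g h = t * cj ?g h * minv t" unfolding e using cj_cj_minv(2)[OF tri_GL[OF t] c] by simp
    show ?thesis
    proof
      assume "cj ?g h \<in> tri N"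
      then show "cj g h \<in> tri N" unfolding e' by (intro tri_mult t tri_minv)
    next
      assume "cj g h \<in> tri N"
      then show "cj ?g h \<in> tri N" unfolding e cj_def[of t] by (intro tri_mult t tri_minv)
    qed
  qed
  ultimately show ?thesis using G by (intro bexI[of _ g0]) auto
qed

end

section \<open>Classification of the orbits for the general linear group\<close>

section \<open>Orbits and idempotents\<close>

lemma lcoset_eq_iff:
  fixes G (structure)
  assumes "group G" "subgroup K G" "a \<in> carrier G" "b \<in> carrier G"
  shows "a <# K = b <# K \<longleftrightarrow> inv a \<otimes> b \<in> K"
proof -
  interpret group G by (rule assms(1))
  interpret K: subgroup K G by (rule assms(2))
  show ?thesis
  proof
    assume e: "a <# K = b <# K"
    have "b \<otimes> \<one> \<in> b <# K" unfolding l_coset_def by (rule UN_I[OF K.one_closed]) (rule singletonI)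
    then have "b \<in> a <# K" unfolding e using assms(4) by simp
    then obtain k where k: "k \<in> K" "b = a \<otimes> k" unfolding l_coset_def by (elim UN_E singletonE)
    have "inv a \<otimes> a \<otimes> k = inv a \<otimes> b"
      unfolding k(2) by (rule m_assoc) (use assms(3) K.mem_carrier[OF k(1)] in auto)
    then show "inv a \<otimes> b \<in> K" using k(1) assms(3) K.mem_carrier[OF k(1)] by simp
  next
    assume k: "inv a \<otimes> b \<in> K"
    have "a \<otimes> inv a \<otimes> b = a \<otimes> (inv a \<otimes> b)"
      by (rule m_assoc) (use assms(3,4) in auto)
    then have e: "a \<otimes> (inv a \<otimes> b) = b" using assms(3,4) by simp
    have "a \<otimes> (inv a \<otimes> b) \<in> a <# K"
      unfolding l_coset_def by (rule UN_I[OF k]) (rule singletonI)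
    then have "b \<in> a <# K" unfolding e .
    then show "a <# K = b <# K" by (rule l_repr_independence[OF _ assms(3,2)])
  qed
qed

text \<open>The common frame of both parts of the theorem: \<open>H\<close> is the general linear or
  the symplectic group and \<open>X\<close> the set of admissible points. Existence and uniqueness
  of representatives become statements about idempotents intertwined by elements of
  \<open>B\<close>.\<close>

lemma orbits_via_idempotents:
  fixes H :: "'a::field mat set" and N m :: nat
  defines "G \<equiv> (GL N)\<lparr>carrier := H\<rparr>"
    and "K \<equiv> {k \<in> H. k * dg N {..<m} = dg N {..<m} * k}"
  assumes H: "subgroup H (GL N)" and B: "subgroup B G" and X: "X \<subseteq> lcosets\<^bsub>G\<^esub> K"
    and r: "\<And>x. x \<in> D \<Longrightarrow> r x \<in> H" "\<And>x. x \<in> D \<Longrightarrow> r x <#\<^bsub>G\<^esub> K \<in> X"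
    and ex: "\<And>h. h \<in> H \<Longrightarrow> h <#\<^bsub>G\<^esub> K \<in> X \<Longrightarrow> \<exists>b\<in>B. \<exists>x\<in>D. pj N m h * b = b * pj N m (r x)"
    and un: "\<And>b x x'. b \<in> B \<Longrightarrow> x \<in> D \<Longrightarrow> x' \<in> D \<Longrightarrow> b * pj N m (r x) = pj N m (r x') * b \<Longrightarrow> x = x'"
  shows "subgroup K G" "\<exists>\<psi>. bij_betw \<psi> D (coset_orbits G B X)"
proof -
  have HG: "h \<in> carrier (GL N)" if "h \<in> H" for h using subgroup.mem_carrier[OF H that] .
  have G: "group G" unfolding G_def by (rule GL.subgroup_imp_group[OF H])
  have [simp]: "carrier G = H" "x \<otimes>\<^bsub>G\<^esub> y = x * y" "\<one>\<^bsub>G\<^esub> = 1\<^sub>m N" for x y by (simp_all add: G_def)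
  have inv: "inv\<^bsub>G\<^esub> h = minv h" if "h \<in> H" for h
    unfolding G_def using GL.m_inv_consistent[OF H that] inv_GL[OF HG[OF that]] by simp
  have mH: "minv h \<in> H" if "h \<in> H" for h
    using subgroup.m_inv_closed[OF H that] inv_GL[OF HG[OF that]] by simp
  have HH: "h * h' \<in> H" if "h \<in> H" "h' \<in> H" for h h'
    using subgroup.m_closed[OF H that] by simp
  show K: "subgroup K G"
  proof (rule group.subgroupI[OF G])
    show "K \<subseteq> carrier G" by (auto simp: K_def)
    have "1\<^sub>m N \<in> H" using subgroup.one_closed[OF H] by simp
    then have "1\<^sub>m N \<in> K" by (simp add: K_def)
    then show "K \<noteq> {}" by blast
  next
    fix a assume "a \<in> K"
    then have "a \<in> H" "a * dg N {..<m} = dg N {..<m} * a" by (auto simp: K_def)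
    then have a: "a \<in> H" "pj N m (1\<^sub>m N) = pj N m a"
      using pj_eq_iff[OF one_GL HG, of a m] left_mult_one_mat[OF GL_carrier_mat[OF HG, of a]] by simp_all
    note am = GL_carrier_mat[OF HG[OF a(1)]]
    have "minv a * dg N {..<m} = dg N {..<m} * minv a"
      using pj_eq_iff[OF HG[OF a(1)] one_GL, of m] a(2) minv_carrier_mat[OF am] by simp
    then show "inv\<^bsub>G\<^esub> a \<in> K" using a mH by (simp add: inv K_def)
    fix b assume b: "b \<in> K"
    then have bm: "b \<in> carrier_mat N N" using GL_carrier_mat HG by (auto simp: K_def)
    have "a * b * dg N {..<m} = a * (dg N {..<m} * b)"
      using am bm b by (simp add: sq_assoc[of _ N] K_def del: assoc_mult_mat)
    also have "\<dots> = a * dg N {..<m} * b" using am bm by (simp add: sq_assoc[of _ N] del: assoc_mult_mat)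
    also have "\<dots> = dg N {..<m} * (a * b)"
      using \<open>a \<in> K\<close> am bm by (simp add: K_def sq_assoc[of _ N] del: assoc_mult_mat)
    finally show "a \<otimes>\<^bsub>G\<^esub> b \<in> K" using a(1) b HH by (simp add: K_def)
  qed
  have BH: "b \<in> H" if "b \<in> B" for b using subgroup.mem_carrier[OF B that] by simp
  have eq: "a <#\<^bsub>G\<^esub> K = b <#\<^bsub>G\<^esub> K \<longleftrightarrow> pj N m a = pj N m b" if "a \<in> H" "b \<in> H" for a b
    using lcoset_eq_iff[OF G K, of a b] pj_eq_iff[OF HG[OF that(1)] HG[OF that(2)]] that mH HH
    by (simp add: inv K_def)
  have tr: "pj N m (b * h) = b * pj N m h * minv b" if "b \<in> H" "h \<in> H" for b h
    using pj_translate[OF HG HG] that by blast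
  show "\<exists>\<psi>. bij_betw \<psi> D (coset_orbits G B X)"
  proof (rule coset_orbits_bij[OF G K B X])
    show "r x \<in> carrier G \<and> r x <#\<^bsub>G\<^esub> K \<in> X" if "x \<in> D" for x using r[OF that] by simp
    show "\<exists>b\<in>B. \<exists>x\<in>D. y = (b \<otimes>\<^bsub>G\<^esub> r x) <#\<^bsub>G\<^esub> K" if y: "y \<in> X" for y
    proof -
      obtain h where h: "h \<in> H" "y = h <#\<^bsub>G\<^esub> K" using X y by (auto simp: LCOSETS_def)
      then obtain b x where bx: "b \<in> B" "x \<in> D" "pj N m h * b = b * pj N m (r x)" using ex y by blast
      have "pj N m h = pj N m h * b * minv b"
        using minv_cancel_right(2)[OF HG[OF BH[OF bx(1)]] pj_carrier[OF HG[OF h(1)]]] by simp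
      also have "\<dots> = pj N m (b * r x)" using tr[OF BH[OF bx(1)] r(1)[OF bx(2)]] bx(3) by simp
      finally show ?thesis using eq[OF h(1) HH[OF BH[OF bx(1)] r(1)[OF bx(2)]]] h(2) bx by auto
    qed
    show "x = x'" if x: "b \<in> B" "x \<in> D" "x' \<in> D" "(b \<otimes>\<^bsub>G\<^esub> r x) <#\<^bsub>G\<^esub> K = r x' <#\<^bsub>G\<^esub> K" for b x x'
    proof (rule un[OF x(1-3)])
      note c = BH[OF x(1)] r(1)[OF x(2)] r(1)[OF x(3)]
      have "b * pj N m (r x) * minv b = pj N m (r x')" using x(4) eq[OF HH[OF c(1,2)] c(3)] tr[OF c(1,2)] by simp
      then have "pj N m (r x') * b = b * pj N m (r x) * minv b * b" by simp
      also have "\<dots> = b * pj N m (r x)"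
        using minv_cancel_right(1)[OF HG[OF c(1)], of "b * pj N m (r x)" N] pj_carrier[OF HG[OF c(2)]]
          GL_carrier_mat[OF HG[OF c(1)]] sq_mult by blast
      finally show "b * pj N m (r x) = pj N m (r x') * b" by simp
    qed
  qed
qed

text \<open>Both diagonal projections are similar to the same idempotent; this is how the rank fixes
  the number of edges of the matching.\<close>

lemma pj_card:
  assumes s: "s \<in> carrier (GL N)" and u: "u \<in> carrier (GL N)" and e: "pj N m s * u = u * (dg N R :: 'a::field mat)"
    and R: "R \<subseteq> {..<N}" and m: "m \<le> N"
  shows "card R = m"
proof -
  have c: "s \<in> carrier_mat N N" "minv s \<in> carrier_mat N N" "u \<in> carrier_mat N N" using s u minv_GL GL_carrier_mat by blast+
  have "dg N {..<m} * (minv s * u) = minv s * (pj N m s * u)"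
    unfolding pj_def using minv_cancel(1)[OF s, of "dg N {..<m} * (minv s * u)" N] c
    by (simp add: sq_assoc[of _ N] sq_mult del: assoc_mult_mat)
  also have "\<dots> = minv s * u * dg N R"
    unfolding e using c by (simp add: sq_assoc[of _ N] del: assoc_mult_mat)
  finally show ?thesis
    using similar_dg[OF _ R mult_GL[OF minv_GL[OF s] u], of "{..<m}"] m by simp
qed

lemma conjugate_intertwine:
  assumes g: "g \<in> carrier (GL N)" and c: "P \<in> carrier_mat N N" "P1 \<in> carrier_mat N N" "t \<in> carrier_mat N N" "C \<in> carrier_mat N N"
    and e: "P * g = g * P1" "P1 * t = t * C"
  shows "P * (g * t * minv g) = g * t * minv g * (g * C * minv g)"
proof -
  have gm: "g \<in> carrier_mat N N" "minv g \<in> carrier_mat N N" using g minv_GL GL_carrier_mat by blast+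
  have "P * (g * t * minv g) = g * (P1 * t) * minv g"
    using e(1) c gm by (simp add: sq_assoc[of _ N, symmetric] sq_mult del: assoc_mult_mat)
  also have "\<dots> = g * t * (C * minv g)" unfolding e(2) using c gm
    by (simp add: sq_assoc[of _ N] sq_mult del: assoc_mult_mat)
  also have "C * minv g = minv g * (g * (C * minv g))"
    by (rule minv_cancel(1)[OF g, symmetric]) (use c gm in \<open>auto intro: sq_mult\<close>)
  finally show ?thesis using c gm by (simp add: sq_assoc[of _ N] sq_mult del: assoc_mult_mat)
qed

lemma cj_intertwine:
  assumes g: "g \<in> carrier (GL N)" and c: "b \<in> carrier_mat N N" "C \<in> carrier_mat N N" "C' \<in> carrier_mat N N"
    and e: "b * (g * C * minv g) = g * C' * minv g * b"
  shows "cj g b * C = C' * cj g b"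
proof -
  have gm: "g \<in> carrier_mat N N" "minv g \<in> carrier_mat N N" using g minv_GL GL_carrier_mat by blast+
  have Q: "g * C * minv g \<in> carrier_mat N N" "g * C' * minv g \<in> carrier_mat N N"
    using gm c by (auto intro!: sq_mult)
  have "cj g b * cj g (g * C * minv g) = cj g (g * C' * minv g) * cj g b"
    using e cj_mult[OF g c(1) Q(1)] cj_mult[OF g Q(2) c(1)] by simp
  then show ?thesis unfolding cj_cj_minv(1)[OF g c(2)] cj_cj_minv(1)[OF g c(3)] .
qed

text \<open>The columns of \<open>cbasis\<close> diagonalise the model idempotent, and a permutation
  moves those indexed by \<open>R\<close> to the front.\<close>

lemma (in clan) clan_representative:
  assumes "card R = m"
  shows "\<exists>\<tau>. bij_betw \<tau> {..<n} {..<n} \<and> pj n m (cbasis * pmat n \<tau>) = cmat"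
proof -
  obtain \<tau> where t: "bij_betw \<tau> {..<n} {..<n}" "\<And>b. b < n \<Longrightarrow> \<tau> b \<in> R \<longleftrightarrow> b < m"
    using sorting_bij[OF R(1) assms] by metis
  have "cmat * (cbasis * pmat n \<tau>) = cbasis * (dg n R * pmat n \<tau>)"
    using cmat_cbasis by (simp add: sq_assoc[of _ n, symmetric] del: assoc_mult_mat)
  also have "\<dots> = cbasis * pmat n \<tau> * dg n {..<m}"
    by (simp add: dg_pmat[OF t] sq_assoc[of _ n] del: assoc_mult_mat)
  finally show ?thesis using pj_eqI[OF mult_GL[OF cbasis_GL pmat_GL[OF t(1)]] cmat_carrier] t(1) by blast
qed

lemma clan_cmat_cong:
  assumes c: "clan n Op p R \<kappa>" and "\<And>i. i \<in> Op \<Longrightarrow> p' i = p i" "\<And>i. i \<in> Op \<Longrightarrow> \<kappa>' i = \<kappa> i"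
  shows "clan n Op p' R \<kappa>'" "clan.cmat n Op p' R \<kappa>' = clan.cmat n Op p R \<kappa>"
proof -
  interpret c: clan n Op p R \<kappa> by (rule c)
  show "clan n Op p' R \<kappa>'"
    by unfold_locales (use assms c.Op_p c.inj_p c.R c.\<kappa> in \<open>auto simp: inj_on_def\<close>)
  then show "clan.cmat n Op p' R \<kappa>' = clan.cmat n Op p R \<kappa>"
    unfolding clan.cmat_def[OF \<open>clan n Op p' R \<kappa>'\<close>] c.cmat_def using assms(2,3) by (intro eq_matI) auto
qed

definition partner :: "(nat \<times> nat) set \<Rightarrow> nat \<Rightarrow> nat" where
  "partner E i = (THE j. (i, j) \<in> E)"

lemma partner_eq:
  assumes "inj_on fst E" "(i, j) \<in> E"
  shows "partner E i = j"
  unfolding partner_def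
  by (rule the_equality[of "\<lambda>j. (i, j) \<in> E", OF assms(2)]) (use inj_onD[OF assms(1) _ _ assms(2)] in auto)

text \<open>A core edge becomes a pair whose closing end is in \<open>R\<close>, a pendant edge an
  unpaired index in \<open>R\<close>. Each edge thus contributes exactly one element to
  \<open>R\<close>, so the number of edges is the rank of the idempotent.\<close>

lemma matching_clan:
  assumes d: "(E, S) \<in> clan_data N (\<lambda>(i, j). {i, j}) {(i, j). i < j \<and> j < N} m"
  shows "inj_on fst E" "clan N (fst ` E) (partner E) (snd ` E \<union> S) (\<lambda>_. - 1 :: 'a::field)"
    "card (snd ` E \<union> S) = m" "snd ` E \<union> S - fst ` E - partner E ` fst ` E = S"
proof -
  have E: "(i, j) \<in> E \<Longrightarrow> i < j \<and> j < N" "S \<subseteq> {..<N}" "card E + card S = m" for i j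
    using d by (auto simp: clan_data_def)
  have dis: "(i, j) \<in> E \<Longrightarrow> (i', j') \<in> E \<Longrightarrow> (i, j) \<noteq> (i', j') \<Longrightarrow> {i, j} \<inter> {i', j'} = {}" for i j i' j'
    using d by (fastforce simp: clan_data_def)
  have disS: "(i, j) \<in> E \<Longrightarrow> i \<notin> S \<and> j \<notin> S" for i j using d by (fastforce simp: clan_data_def)
  show inj: "inj_on fst E" using dis by (fastforce simp: inj_on_def)
  have inj2: "inj_on snd E" using dis by (fastforce simp: inj_on_def)
  have p: "partner E i = j" if "(i, j) \<in> E" for i j by (rule partner_eq[OF inj that])
  have no: "j \<notin> fst ` E" if ij: "(i, j) \<in> E" for i j
  proof
    assume "j \<in> fst ` E"
    then obtain j' where j': "(j, j') \<in> E" by auto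
    have "(i, j) \<noteq> (j, j')" using E(1)[OF ij] by auto
    then show False using dis[OF ij j'] by blast
  qed
  have no': "i \<notin> snd ` E" if ij: "(i, j) \<in> E" for i j
    using no that by force
  show "clan N (fst ` E) (partner E) (snd ` E \<union> S) (\<lambda>_. - 1 :: 'a)"
  proof
    fix i assume "i \<in> fst ` E"
    then obtain j where ij: "(i, j) \<in> E" by auto
    show "i < partner E i" "partner E i < N" "partner E i \<notin> fst ` E" unfolding p[OF ij] using E(1)[OF ij] no[OF ij] by auto
    show "i \<in> snd ` E \<union> S \<longleftrightarrow> partner E i \<notin> snd ` E \<union> S" unfolding p[OF ij] using ij no'[OF ij] disS[OF ij] by force
  next
    show "inj_on (partner E) (fst ` E)"
    proof (rule inj_onI)
      fix i i' assume i: "i \<in> fst ` E" "i' \<in> fst ` E" and e: "partner E i = partner E i'"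
      obtain j j' where j: "(i, j) \<in> E" "(i', j') \<in> E" using i by auto
      then show "i = i'" using inj_onD[OF inj2 _ j] e p[OF j(1)] p[OF j(2)] by simp
    qed
    show "snd ` E \<union> S \<subseteq> {..<N}" using E by auto
  qed auto
  have "finite ({..<N} \<times> {..<N})" by simp
  moreover have "E \<subseteq> {..<N} \<times> {..<N}" using E(1) by fastforce
  ultimately have fin: "finite E" "finite S" using E(2) finite_subset by blast+
  have "card (snd ` E \<union> S) = card (snd ` E) + card S" using fin disS by (intro card_Un_disjoint) auto
  then show "card (snd ` E \<union> S) = m" using card_image[OF inj2] E(3) by simp
  have "partner E ` fst ` E = snd ` E" using p by force
  moreover have "x \<notin> fst ` E \<and> x \<notin> snd ` E" if "x \<in> S" for x using disS that by force
  ultimately show "snd ` E \<union> S - fst ` E - partner E ` fst ` E = S" by auto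
qed

text \<open>The normalisation \<open>R \<inter> Op = {}\<close> puts all closing ends into
  \<open>R\<close>, so \<open>R\<close> splits into closing ends and pendant indices.\<close>

lemma clan_matching:
  assumes c: "clan N Op p R (\<lambda>_. - 1 :: 'a::field)" and RO: "R \<inter> Op = {}" and m: "card R = m"
  defines "E \<equiv> (\<lambda>i. (i, p i)) ` Op"
  shows "(E, R - p ` Op) \<in> clan_data N (\<lambda>(i, j). {i, j}) {(i, j). i < j \<and> j < N} m"
    "clan.cmat N (fst ` E) (partner E) (snd ` E \<union> (R - p ` Op)) (\<lambda>_. - 1 :: 'a) = clan.cmat N Op p R (\<lambda>_. - 1)"
proof -
  interpret clan N Op p R "\<lambda>_. - 1 :: 'a" by (rule c)
  have O: "fst ` E = Op" "snd ` E = p ` Op" unfolding E_def by force+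
  have pR: "p ` Op \<subseteq> R" using R(2) RO by auto
  have fR: "finite R" using R(1) finite_subset by blast
  have "card E = card Op" unfolding E_def by (rule card_image) (auto simp: inj_on_def)
  also have "\<dots> = card (p ` Op)" using card_image[OF inj_p] by simp
  finally have "card E + card (R - p ` Op) = m"
    using card_Diff_subset[OF finite_subset[OF pR fR] pR] card_mono[OF fR pR] m by simp
  moreover have "{i, p i} \<inter> {j, p j} = {}" if "i \<in> Op" "j \<in> Op" "i \<noteq> j" for i j
    using that Op_p(3)[of i] Op_p(3)[of j] inj_onD[OF inj_p, of i j] by auto
  moreover have "{i, p i} \<inter> (R - p ` Op) = {}" if "i \<in> Op" for i using that RO by auto
  ultimately show "(E, R - p ` Op) \<in> clan_data N (\<lambda>(i, j). {i, j}) {(i, j). i < j \<and> j < N} m"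
    unfolding clan_data_def using Op_p R(1) by (auto simp: E_def)
  have "inj_on fst E" by (auto simp: E_def inj_on_def)
  from partner_eq[OF this] have pe: "partner E i = p i" if "i \<in> Op" for i using that by (simp add: E_def)
  have U: "p ` Op \<union> (R - p ` Op) = R" using pR by blast
  show "clan.cmat N (fst ` E) (partner E) (snd ` E \<union> (R - p ` Op)) (\<lambda>_. - 1 :: 'a) = clan.cmat N Op p R (\<lambda>_. - 1)"
    unfolding O U by (rule clan_cmat_cong(2)[OF c]) (simp_all add: pe)
qed

context field_ext
begin

interpretation rr: function_ring "carrier (GL N)" "regular_on (range \<iota>) N" for N
  by (rule function_ring_regular) (rule range_ring)+

lemma map_GL: "A \<in> carrier_mat N N \<Longrightarrow> map_mat \<iota> A \<in> carrier (GL N) \<longleftrightarrow> A \<in> carrier (GL N)"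
  by (simp add: carrier_GL)

lemma map_mult: "A \<in> carrier_mat N N \<Longrightarrow> B \<in> carrier_mat N N \<Longrightarrow> map_mat \<iota> (A * B) = map_mat \<iota> A * map_mat \<iota> B"
  by (rule mat_hom_mult)

lemma map_minv:
  assumes "A \<in> carrier (GL N)"
  shows "map_mat \<iota> (minv A) = minv (map_mat \<iota> A)"
proof (rule minv_unique[symmetric])
  note c = GL_carrier_mat[OF assms] GL_carrier_mat[OF minv_GL[OF assms]]
  show "map_mat \<iota> A \<in> carrier_mat N N" "map_mat \<iota> (minv A) \<in> carrier_mat N N" using c by auto
  show "map_mat \<iota> A * map_mat \<iota> (minv A) = 1\<^sub>m N"
    using map_mult[OF c] minv_right[OF assms] mat_hom_one by simp
qed

lemma map_cj:
  assumes "g \<in> carrier (GL N)" "h \<in> carrier_mat N N"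
  shows "cj (map_mat \<iota> g) (map_mat \<iota> h) = map_mat \<iota> (cj g h)"
  unfolding cj_def map_minv[OF assms(1), symmetric]
  using assms map_mult[of "minv g" N h] map_mult[OF sq_mult, of "minv g" N h g]
  by (simp add: GL_carrier_mat minv_carrier_mat)

lemma map_tri: "A \<in> carrier_mat N N \<Longrightarrow> map_mat \<iota> A \<in> tri N \<longleftrightarrow> A \<in> tri N"
  by (auto simp: tri_def carrier_GL upper_triangular_def)

lemma map_dg: "map_mat \<iota> (dg N R) = dg N R"
  by (rule eq_matI) auto

lemma regular_fun_rational:
  assumes "f \<in> regular_funs (range \<iota>) N" "A \<in> carrier (GL N)"
  shows "f (map_mat \<iota> A) \<in> range \<iota>"
  using assms(1)
proof induction
  case (entry i j)
  then show ?case using GL_carrier_mat[OF assms(2)] by auto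
next
  case inv_det
  show ?case using rangeI[of \<iota> "inverse (det A)"] by (simp add: hom_distribs)
next
  case (add f g)
  then show ?case by (auto simp: hom_add[symmetric])
next
  case (mult f g)
  then show ?case by (auto simp: hom_mult[symmetric])
qed auto

lemma pj_regular:
  "i < N \<Longrightarrow> j < N \<Longrightarrow> (\<lambda>A. pj N m A $$ (i, j)) \<in> regular_on (range \<iota>) N"
  unfolding pj_def
  by (rule rr.matsD(2)[OF rr.mats_mult[OF rr.mats_mult[OF mats_id mats_const] rr.mats_minv[OF mats_id regular_on_inv_det]]])
     (use range_ring in auto)

lemma GL_orbits:
  fixes g0 :: "'a mat" and m n :: nat
  assumes g0: "g0 \<in> carrier (GL (m + n))"
  defines "N \<equiv> m + n"
  defines "B \<equiv> {h \<in> carrier (GL N). cj (map_mat \<iota> g0) h \<in> tri N}"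
  shows "\<exists>\<psi>. bij_betw \<psi> (clan_data N (\<lambda>(i, j). {i, j}) {(i, j). i < j \<and> j < N} m)
     (coset_orbits (GL N) (rational_subgroup \<iota> N B) (GL_quotient_points \<iota> N (GL_GL m n)))"
proof -
  let ?D = "clan_data N (\<lambda>(i, j). {i, j}) {(i, j). i < j \<and> j < N} m"
  let ?K = "{k \<in> carrier (GL N). k * dg N {..<m} = dg N {..<m} * k} :: 'b mat set"
  let ?B = "rational_subgroup \<iota> N B" and ?X = "GL_quotient_points \<iota> N ?K"
  have K: "GL_GL m n = ?K" using GL_GL_iff[of _ m n] by (auto simp: N_def)
  have g0: "g0 \<in> carrier (GL N)" "g0 \<in> carrier_mat N N" using g0 GL_carrier_mat by (auto simp: N_def)
  have G0: "map_mat \<iota> g0 \<in> carrier (GL N)" using map_GL[OF g0(2)] g0(1) by simp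
  define M where "M x = clan.cmat N (fst ` fst x) (partner (fst x)) (snd ` fst x \<union> snd x) (\<lambda>_. - 1 :: 'a)" for x
  have pair: "(fst x, snd x) \<in> ?D" if "x \<in> ?D" for x using that by simp
  have Mc: "M x \<in> carrier_mat N N" if "x \<in> ?D" for x
    unfolding M_def by (rule clan.cmat_carrier[OF matching_clan(2)[OF pair[OF that]]])
  have "\<exists>r\<in>carrier (GL N). pj N m r = M x" if x: "x \<in> ?D" for x
  proof -
    note d = pair[OF x]
    interpret clan N "fst ` fst x" "partner (fst x)" "snd ` fst x \<union> snd x" "\<lambda>_. - 1 :: 'a"
      by (rule matching_clan(2)[OF d])
    show ?thesis
      using clan_representative[OF matching_clan(3)[OF d]] mult_GL[OF cbasis_GL pmat_GL] by (auto simp: M_def)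
  qed
  then obtain r0 where r0: "\<And>x. x \<in> ?D \<Longrightarrow> r0 x \<in> carrier (GL N)" "\<And>x. x \<in> ?D \<Longrightarrow> pj N m (r0 x) = M x"
    using bchoice[of ?D "\<lambda>x r. r \<in> carrier (GL N) \<and> pj N m r = M x"] by blast
  \<comment> \<open>The representatives have entries in the subfield; \<open>g0\<close> moves the
    standard flag to that of the Borel subgroup.\<close>
  define r where "r x = map_mat \<iota> (g0 * r0 x)" for x
  have r: "r x \<in> carrier (GL N)" "g0 * r0 x \<in> carrier (GL N)" if "x \<in> ?D" for x
  proof -
    show *: "g0 * r0 x \<in> carrier (GL N)" by (rule mult_GL[OF g0(1) r0(1)[OF that]])
    show "r x \<in> carrier (GL N)" unfolding r_def using map_GL[OF GL_carrier_mat[OF *]] * by simp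
  qed
  have map_pj: "pj N m (map_mat \<iota> h) = map_mat \<iota> (pj N m h)" if "h \<in> carrier (GL N)" for h
  proof -
    have c: "h \<in> carrier_mat N N" "minv h \<in> carrier_mat N N" using that minv_GL GL_carrier_mat by blast+
    show ?thesis
      unfolding pj_def map_minv[OF that, symmetric] map_mult[OF sq_mult[OF c(1) dg_carrier] c(2)]
        map_mult[OF c(1) dg_carrier] map_dg ..
  qed
  have pr: "pj N m (r x) = map_mat \<iota> (g0 * M x * minv g0)" if "x \<in> ?D" for x
    unfolding r_def map_pj[OF r(2)[OF that]] pj_translate[OF g0(1) r0(1)[OF that]] r0(2)[OF that] ..
  have GL_eq: "(GL N)\<lparr>carrier := carrier (GL N)\<rparr> = (GL N :: 'b mat monoid)" by simp
  have Bsub: "subgroup B (GL N)" unfolding B_def using subgroup_cj_uni[OF G0, of 0] by (simp add: uni_def)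
  have Bform: "?B = map_mat \<iota> ` {h \<in> carrier (GL N). cj g0 h \<in> tri N}"
  proof -
    have "map_mat \<iota> h \<in> B \<longleftrightarrow> cj g0 h \<in> tri N" if h: "h \<in> carrier (GL N)" for h
      using map_GL[OF GL_carrier_mat[OF h]] map_cj[OF g0(1) GL_carrier_mat[OF h]] h
        map_tri[OF cj_carrier[OF g0(1) GL_carrier_mat[OF h]]] by (simp add: B_def)
    then show ?thesis by (auto simp: rational_subgroup_def)
  qed
  have GLsub: "subgroup (map_mat \<iota> ` carrier (GL N)) (GL N)"
  proof (rule GL.subgroupI)
    show "map_mat \<iota> ` carrier (GL N) \<subseteq> carrier (GL N)" using map_GL GL_carrier_mat by blast
    show "map_mat \<iota> ` carrier (GL N) \<noteq> {}" using one_GL by blast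
    show "inv\<^bsub>GL N\<^esub> a \<in> map_mat \<iota> ` carrier (GL N)" if "a \<in> map_mat \<iota> ` carrier (GL N)" for a
    proof -
      obtain a0 where a0: "a0 \<in> carrier (GL N)" "a = map_mat \<iota> a0" using \<open>a \<in> _\<close> by blast
      have "inv\<^bsub>GL N\<^esub> a = map_mat \<iota> (minv a0)"
        using inv_GL[of a N] map_GL[OF GL_carrier_mat[OF a0(1)]] map_minv[OF a0(1)] a0 by simp
      then show ?thesis using minv_GL[OF a0(1)] by blast
    qed
    show "a \<otimes>\<^bsub>GL N\<^esub> b \<in> map_mat \<iota> ` carrier (GL N)"
      if ab: "a \<in> map_mat \<iota> ` carrier (GL N)" "b \<in> map_mat \<iota> ` carrier (GL N)" for a b
    proof -
      obtain a0 where a0: "a = map_mat \<iota> a0" "a0 \<in> carrier (GL N)" using ab(1) by blast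
      obtain b0 where b0: "b = map_mat \<iota> b0" "b0 \<in> carrier (GL N)" using ab(2) by blast
      have "a \<otimes>\<^bsub>GL N\<^esub> b = map_mat \<iota> (a0 * b0)"
        unfolding a0(1) b0(1) GL_mult by (rule map_mult[OF GL_carrier_mat[OF a0(2)] GL_carrier_mat[OF b0(2)], symmetric])
      then show ?thesis by (rule image_eqI[OF _ mult_GL[OF a0(2) b0(2)]])
    qed
  qed
  have "subgroup ?B (GL N)" unfolding rational_subgroup_def by (rule GL.subgroups_Inter_pair[OF Bsub GLsub])
  then have sub: "subgroup ?B ((GL N)\<lparr>carrier := carrier (GL N)\<rparr>)" by simp
  have invK: "pj N m (h * k) = pj N m h" if "h \<in> carrier (GL N)" "k \<in> ?K" for h k :: "'b mat"
  proof -
    have "minv h * (h * k) = k" using minv_cancel(1)[OF that(1) GL_carrier_mat, of k] that by simp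
    then show ?thesis using pj_eq_iff[OF that(1) mult_GL[OF that(1)], of k m] that by simp
  qed
  have "\<exists>\<psi>. bij_betw \<psi> ?D (coset_orbits ((GL N)\<lparr>carrier := carrier (GL N)\<rparr>) ?B ?X)"
  proof (rule orbits_via_idempotents(2)[OF GL.subgroup_self sub, of _ m ?D r])
    show "?X \<subseteq> lcosets\<^bsub>(GL N)\<lparr>carrier := carrier (GL N)\<rparr>\<^esub> ?K" unfolding GL_eq by (auto simp: GL_quotient_points_def)
    show "r x \<in> carrier (GL N)" if "x \<in> ?D" for x using r(1)[OF that] .
    show "r x <#\<^bsub>(GL N)\<lparr>carrier := carrier (GL N)\<rparr>\<^esub> ?K \<in> ?X" if x: "x \<in> ?D" for x
      unfolding GL_eq GL_quotient_points_def
    proof (intro CollectI conjI ballI impI)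
      show "r x <#\<^bsub>GL N\<^esub> ?K \<in> lcosets\<^bsub>GL N\<^esub> ?K" using r(1)[OF x] unfolding LCOSETS_def by blast
      fix f h assume f: "f \<in> regular_funs (range \<iota>) N" "\<forall>g\<in>carrier (GL N). \<forall>h\<in>?K. f (g * h) = f g"
        and "h \<in> r x <#\<^bsub>GL N\<^esub> ?K"
      then obtain k where k: "k \<in> ?K" "h = r x * k" by (auto simp: l_coset_def)
      \<comment> \<open>An invariant function is constant on the coset, and \<open>r x\<close> has
        entries in the subfield.\<close>
      have "f h = f (r x)" using f(2) r(1)[OF x] k by blast
      also have "\<dots> \<in> range \<iota>" unfolding r_def by (rule regular_fun_rational[OF f(1) r(2)[OF x]])
      finally show "f h \<in> range \<iota>" .
    qed
    show "\<exists>b\<in>?B. \<exists>x\<in>?D. pj N m h * b = b * pj N m (r x)"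
      if h: "h \<in> carrier (GL N)" "h <#\<^bsub>(GL N)\<lparr>carrier := carrier (GL N)\<rparr>\<^esub> ?K \<in> ?X" for h
    proof -
      have one: "1\<^sub>m N \<in> ?K" using one_GL by simp
      have "h * 1\<^sub>m N \<in> h <#\<^bsub>GL N\<^esub> ?K" unfolding l_coset_def using one by force
      then have hh: "h \<in> h <#\<^bsub>GL N\<^esub> ?K" using GL_carrier_mat[OF h(1)] by simp
      \<comment> \<open>The entries of the idempotent are invariant under right translation by
        \<open>?K\<close> and regular over the subfield, hence take values there at a rational
        point.\<close>
      have rat: "pj N m h $$ (i, j) \<in> range \<iota>" if ij: "i < N" "j < N" for i j
      proof -
        obtain f where f: "f \<in> regular_funs (range \<iota>) N" "\<And>A. A \<in> carrier (GL N) \<Longrightarrow> pj N m A $$ (i, j) = f A"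
          using pj_regular[OF ij, of m] by (auto simp: regular_on_def)
        have "f (a * k) = f a" if "a \<in> carrier (GL N)" "k \<in> ?K" for a k
          using f(2)[OF that(1)] f(2)[OF mult_GL[OF that(1)], of k] invK[OF that] that(2) by simp
        then have "f h \<in> range \<iota>" using h(2) hh f(1) unfolding GL_eq GL_quotient_points_def by blast
        then show ?thesis using f(2)[OF h(1)] by simp
      qed
      define P where "P = mat N N (\<lambda>(i, j). inv_into UNIV \<iota> (pj N m h $$ (i, j)))"
      have Pc: "P \<in> carrier_mat N N" by (simp add: P_def)
      have mP: "map_mat \<iota> P = pj N m h"
        using pj_carrier[OF h(1), of m] rat by (intro eq_matI) (auto simp: P_def f_inv_into_f)
      have "map_mat \<iota> (P * P) = map_mat \<iota> P" unfolding map_mult[OF Pc Pc] mP by (rule pj_idem[OF h(1)])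
      then have PP: "P * P = P" by (rule mat_hom_inj)
      define P1 where "P1 = cj g0 P"
      have P1c: "P1 \<in> carrier_mat N N" unfolding P1_def by (rule cj_carrier[OF g0(1) Pc])
      have P1P1: "P1 * P1 = P1" unfolding P1_def using cj_mult[OF g0(1) Pc Pc] PP by simp
      obtain Op p R t where c: "clan N Op p R (\<lambda>_. - 1 :: 'a)" "R \<inter> Op = {}" "t \<in> tri N"
          "P1 * t = t * clan.cmat N Op p R (\<lambda>_. - 1)"
        using clan_exists_GL[OF P1c P1P1] by blast
      interpret clan N Op p R "\<lambda>_. - 1 :: 'a" by (rule c(1))
      have gm: "minv g0 \<in> carrier_mat N N" by (rule minv_carrier_mat[OF g0(2)])
      note tm = tri_carrier_mat[OF c(3)]
      have P0: "P * g0 = g0 * P1"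
        unfolding P1_def cj_def using minv_cancel(2)[OF g0(1), of "P * g0" N] Pc g0 gm
        by (simp add: sq_assoc[of _ N] sq_mult del: assoc_mult_mat)
      \<comment> \<open>The matrix \<open>h\<close> itself need not have entries in the subfield, so
        ranks are compared over the big field.\<close>
      have "card R = m"
      proof -
        define s where "s = g0 * (t * cbasis)"
        have s: "s \<in> carrier (GL N)" unfolding s_def by (intro mult_GL g0 tri_GL c(3) cbasis_GL)
        note sm = GL_carrier_mat[OF s]
        have "P * s = g0 * (P1 * t) * cbasis"
          using P0 Pc P1c g0(2) tm by (simp add: s_def sq_assoc[of _ N, symmetric] sq_mult del: assoc_mult_mat)
        also have "\<dots> = g0 * t * (cmat * cbasis)"
          unfolding c(4) using g0(2) tm by (simp add: sq_assoc[of _ N] sq_mult del: assoc_mult_mat)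
        also have "\<dots> = s * dg N R"
          unfolding cmat_cbasis s_def using g0(2) tm by (simp add: sq_assoc[of _ N] sq_mult del: assoc_mult_mat)
        finally have "map_mat \<iota> P * map_mat \<iota> s = map_mat \<iota> s * dg N R"
          using map_mult[OF Pc sm] map_mult[OF sm dg_carrier, of R] by (simp only: map_dg)
        then have e: "pj N m h * map_mat \<iota> s = map_mat \<iota> s * dg N R" by (simp add: mP)
        have ms: "map_mat \<iota> s \<in> carrier_mat N N" "map_mat \<iota> s \<in> carrier (GL N)" using sm map_GL[OF sm] s by auto
        show ?thesis by (rule pj_card[OF h(1) ms(2) e R(1)]) (simp add: N_def)
      qed
      note cm = clan_matching[OF c(1,2) this]
      let ?x = "((\<lambda>i. (i, p i)) ` Op, R - p ` Op)"
      have Mx: "M ?x = cmat" unfolding M_def fst_conv snd_conv by (rule cm(2))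
      define b where "b = g0 * t * minv g0"
      have bG: "b \<in> carrier (GL N)" unfolding b_def by (intro mult_GL g0 tri_GL c(3) minv_GL)
      have "map_mat \<iota> b \<in> ?B"
        unfolding Bform using bG cj_cj_minv(1)[OF g0(1) tm] c(3) by (auto simp: b_def)
      moreover have "P * b = b * (g0 * M ?x * minv g0)"
        unfolding b_def Mx by (rule conjugate_intertwine[OF g0(1) Pc P1c tm cmat_carrier P0 c(4)])
      then have "pj N m h * map_mat \<iota> b = map_mat \<iota> b * pj N m (r ?x)"
        unfolding pr[OF cm(1)] mP[symmetric]
        using map_mult[OF Pc GL_carrier_mat[OF bG]]
          map_mult[OF GL_carrier_mat[OF bG] sq_mult[OF sq_mult[OF g0(2) Mc[OF cm(1)]] gm]] by simp
      ultimately show ?thesis using cm(1) by blast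
    qed
    show "x = x'" if x: "b \<in> ?B" "x \<in> ?D" "x' \<in> ?D" "b * pj N m (r x) = pj N m (r x') * b" for b x x'
    proof -
      obtain b0 where b0: "b0 \<in> carrier (GL N)" "cj g0 b0 \<in> tri N" "b = map_mat \<iota> b0" using x(1) Bform by auto
      note bm = GL_carrier_mat[OF b0(1)]
      have gm: "minv g0 \<in> carrier_mat N N" by (rule minv_carrier_mat[OF g0(2)])
      note MM = Mc[OF x(2)] Mc[OF x(3)]
      have Q: "g0 * M x * minv g0 \<in> carrier_mat N N" "g0 * M x' * minv g0 \<in> carrier_mat N N" 
        using g0(2) gm MM by (auto intro!: sq_mult)
      have "map_mat \<iota> (b0 * (g0 * M x * minv g0)) = map_mat \<iota> (g0 * M x' * minv g0 * b0)"
        using x(4) unfolding pr[OF x(2)] pr[OF x(3)] b0(3) map_mult[OF bm Q(1)] map_mult[OF Q(2) bm] .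
      then have "b0 * (g0 * M x * minv g0) = g0 * M x' * minv g0 * b0" by (rule mat_hom_inj)
      then have e: "cj g0 b0 * M x = M x' * cj g0 b0" by (rule cj_intertwine[OF g0(1) bm MM])
      obtain E S E' S' where ES: "x = (E, S)" "x' = (E', S')" by (cases x, cases x')
      note c = matching_clan[OF x(2)[unfolded ES]] and c' = matching_clan[OF x(3)[unfolded ES]]
      note u = clan_unique[OF c(2) c'(2) b0(2) e[unfolded ES M_def fst_conv snd_conv]]
      \<comment> \<open>The pairs are recovered from their first components and the partner
        function, which is all that \<open>clan_unique\<close> determines.\<close>
      have graph: "F = (\<lambda>i. (i, partner F i)) ` fst ` F" if "inj_on fst F" for F
        using partner_eq[OF that] by force
      have "E = (\<lambda>i. (i, partner E i)) ` fst ` E" by (rule graph[OF c(1)])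
      also have "\<dots> = (\<lambda>i. (i, partner E' i)) ` fst ` E" using u(2) by (intro image_cong) auto
      also have "\<dots> = E'" unfolding u(1) by (rule graph[OF c'(1), symmetric])
      finally have "E = E'" .
      moreover have "S = S'" using u(3) unfolding c(4) c'(4) .
      ultimately show ?thesis using ES by simp
    qed
  qed
  then show ?thesis unfolding K by simp
qed

end

section \<open>Classification of the orbits for the symplectic group\<close>

section \<open>Self-adjoint idempotents\<close>

text \<open>A vector led by \<open>x\<close> pairs only with coordinates from
  \<open>star N x\<close> upwards; if the other vector is led by exactly this index, a single
  nonzero term remains.\<close>

lemma bil_anti_leads:
  assumes u: "leads (2 * N) u x"
  shows "w \<in> flag (2 * N) (star N x) \<Longrightarrow> bil (anti N) u w = (0 :: 'a::field)"
    and "leads (2 * N) w (star N x) \<Longrightarrow> bil (anti N) u w \<noteq> 0"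
proof -
  have x: "x < 2 * N" and uc: "u \<in> carrier_vec (2 * N)" and u0: "\<And>y. x < y \<Longrightarrow> y < 2 * N \<Longrightarrow> u $ y = 0" and ux: "u $ x \<noteq> 0"
    using u by (auto simp: leads_def)
  have le: "star N x \<le> star N y \<longleftrightarrow> y \<le> x" if "y < 2 * N" for y
    using star_less_iff[OF that x] by linarith
  show "bil (anti N) u w = 0" if w: "w \<in> flag (2 * N) (star N x)"
  proof -
    have wc: "w \<in> carrier_vec (2 * N)" and w0: "\<And>y. star N x \<le> y \<Longrightarrow> y < 2 * N \<Longrightarrow> w $ y = 0"
      using w by (auto simp: flag_def)
    have "u $ y * sg N y * w $ star N y = 0" if y: "y \<in> {..<2 * N}" for y
      using u0[of y] w0[of "star N y"] le[of y] star_less[of y N] y by (cases "y \<le> x") auto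
    then show ?thesis unfolding bil_anti[OF uc wc] by (intro sum.neutral) blast
  qed
  show "bil (anti N) u w \<noteq> 0" if w: "leads (2 * N) w (star N x)"
  proof -
    have wc: "w \<in> carrier_vec (2 * N)" and w0: "\<And>y. star N x < y \<Longrightarrow> y < 2 * N \<Longrightarrow> w $ y = 0" and wx: "w $ star N x \<noteq> 0"
      using w by (auto simp: leads_def)
    have "u $ y * sg N y * w $ star N y = (if y = x then u $ x * sg N x * w $ star N x else 0)" if y: "y < 2 * N" for y
      using u0[of y] w0[of "star N y"] star_less_iff[OF x y] star_less[OF y] y
      by (cases y x rule: linorder_cases) auto
    then have "bil (anti N) u w = (\<Sum>y<2 * N. if y = x then u $ x * sg N x * w $ star N x else 0)"
      unfolding bil_anti[OF uc wc] by (intro sum.cong) auto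
    also have "\<dots> = u $ x * sg N x * w $ star N x" using x by simp
    finally show ?thesis using ux wx by simp
  qed
qed

text \<open>A symplectic involution contains with \<open>(a, j)\<close> also the reflected pair
  \<open>(star N j, star N a)\<close>; the conditions select the pair with the smaller opening and
  exclude \<open>j = star N a\<close>. For positions \<open>a < b\<close> below \<open>N\<close>
  they allow both \<open>j = b\<close> and \<open>j = star N b\<close>.\<close>

definition sp_pairs :: "nat \<Rightarrow> (nat \<times> nat) set" where
  "sp_pairs N = {(a, j). a < j \<and> j < 2 * N \<and> a < star N j}"

definition sp_ends :: "nat \<Rightarrow> nat \<times> nat \<Rightarrow> nat set" where
  "sp_ends N = (\<lambda>(a, j). {a, if j < N then j else star N j})"

definition sp_verts :: "nat \<Rightarrow> (nat \<times> nat) set \<Rightarrow> nat set" where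
  "sp_verts N E = (\<Union>(a, j)\<in>E. {a, j, star N a, star N j})"

lemma sp_pairsD:
  assumes "(a, j) \<in> sp_pairs N"
  shows "a < N" "a < j" "j < 2 * N" "a < star N j" "star N a < 2 * N" "star N j < 2 * N" "j \<noteq> star N a"
proof -
  show *: "a < j" "j < 2 * N" "a < star N j" using assms by (auto simp: sp_pairs_def)
  then show "a < N" by (simp add: star_def)
  show "star N a < 2 * N" "star N j < 2 * N" using * star_less by auto
  show "j \<noteq> star N a" using * by (auto simp: star_def)
qed

lemma sp_ends_verts:
  assumes "x \<in> E"
  shows "sp_ends N x \<subseteq> sp_verts N E"
  using assms by (force simp: sp_ends_def sp_verts_def split: if_splits)

locale anti_idem = symplectic N "anti N :: 'a mat" for N :: nat and P :: "'a::field mat" +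
  assumes P: "P \<in> carrier_mat (2 * N) (2 * N)" and idem: "P * P = P"
    and adj: "v \<in> carrier_vec (2 * N) \<Longrightarrow> w \<in> carrier_vec (2 * N) \<Longrightarrow> bil (anti N) (P *\<^sub>v v) w = bil (anti N) v (P *\<^sub>v w)"
begin

text \<open>A stage is a partial symplectic basis, adapted to the flag, on which \<open>P\<close> acts as on the basis of the model
  idempotent attached to a partial matching.\<close>

definition stage :: "(nat \<Rightarrow> 'a vec) \<Rightarrow> nat set \<Rightarrow> (nat \<times> nat) set \<Rightarrow> nat set \<Rightarrow> bool" where
  "stage f I E S \<longleftrightarrow> psb f I \<and> (\<forall>x\<in>I. leads (2 * N) (f x) x) \<and> E \<subseteq> sp_pairs N \<and> S \<subseteq> {..<N} \<and> S \<subseteq> I \<and> sp_verts N E \<subseteq> I \<and>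
     (\<forall>x\<in>E. \<forall>y\<in>E. x \<noteq> y \<longrightarrow> sp_ends N x \<inter> sp_ends N y = {}) \<and> (\<forall>x\<in>E. sp_ends N x \<inter> S = {}) \<and>
     (\<forall>(a, j)\<in>E. P *\<^sub>v f a = f j \<and> P *\<^sub>v f j = f j \<and> P *\<^sub>v f (star N a) = 0\<^sub>v (2 * N) \<and>
        P *\<^sub>v f (star N j) = f (star N j) + sg N j \<cdot>\<^sub>v f (star N a)) \<and>
     (\<forall>x\<in>I. x \<notin> sp_verts N E \<longrightarrow> P *\<^sub>v f x = (if x \<in> S \<or> star N x \<in> S then f x else 0\<^sub>v (2 * N)))"

definition orth :: "(nat \<Rightarrow> 'a vec) \<Rightarrow> nat set \<Rightarrow> 'a vec \<Rightarrow> bool" where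
  "orth f I w \<longleftrightarrow> w \<in> carrier_vec (2 * N) \<and> (\<forall>x\<in>I. bil (anti N) w (f x) = 0)"

lemma PP: "v \<in> carrier_vec (2 * N) \<Longrightarrow> P *\<^sub>v (P *\<^sub>v v) = P *\<^sub>v v"
  using assoc_mult_mat_vec[OF P P] idem by simp

lemma Pc [simp]: "P *\<^sub>v v \<in> carrier_vec (2 * N)"
  using P by (intro carrier_vecI) simp

text \<open>By self-adjointness and idempotence the value is that of the alternating form on
  \<open>P *\<^sub>v v\<close> twice. This prevents an index from being paired with its
  reflection.\<close>

lemma bil_P_self: "v \<in> carrier_vec (2 * N) \<Longrightarrow> bil (anti N) (P *\<^sub>v v) v = 0"
  using adj[of "P *\<^sub>v v" v] PP[of v] alt[OF Pc[of v]] by simp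

lemma bil_zero_right: "v \<in> carrier_vec (2 * N) \<Longrightarrow> bil (anti N) v (0\<^sub>v (2 * N) :: 'a vec) = 0"
  using bil_minus_right[of v "0\<^sub>v (2 * N)" "0\<^sub>v (2 * N)"] by simp

lemma bil_sym0:
  fixes v w :: "'a vec"
  assumes "v \<in> carrier_vec (2 * N)" "w \<in> carrier_vec (2 * N)" "bil (anti N) v w = 0"
  shows "bil (anti N) w v = 0"
  using skew[OF assms(2,1)] assms(3) by simp

lemma stageD:
  assumes "stage f I E S"
  shows "psb f I" "I \<subseteq> {..<2 * N}" "x \<in> I \<Longrightarrow> star N x \<in> I" "x \<in> I \<Longrightarrow> f x \<in> carrier_vec (2 * N)"
    "x \<in> I \<Longrightarrow> leads (2 * N) (f x) x" "x < 2 * N \<Longrightarrow> x \<notin> I \<Longrightarrow> star N x \<notin> I"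
proof -
  show *: "psb f I" "x \<in> I \<Longrightarrow> leads (2 * N) (f x) x" using assms by (auto simp: stage_def)
  show **: "I \<subseteq> {..<2 * N}" "\<And>x. x \<in> I \<Longrightarrow> star N x \<in> I" "x \<in> I \<Longrightarrow> f x \<in> carrier_vec (2 * N)"
    using *(1) by (auto simp: psb_def)
  show "star N x \<notin> I" if "x < 2 * N" "x \<notin> I" using **(2)[of "star N x"] star_star[OF that(1)] that(2) by auto
qed

text \<open>An unpaired index and its reflection have the same sign, so a single \<open>b\<close>
  serves both and \<open>S\<close> records only the one below \<open>N\<close>.\<close>

lemma stage_fixed:
  assumes st: "stage f I E S" and i: "i < N" "i \<notin> I"
    and f': "psb f' (I \<union> {i, star N i})" "\<And>x. x \<in> I \<Longrightarrow> f' x = f x"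
    and lead: "leads (2 * N) (f' i) i" "leads (2 * N) (f' (star N i)) (star N i)"
    and Pf: "P *\<^sub>v f' i = (if b then f' i else 0\<^sub>v (2 * N))" "P *\<^sub>v f' (star N i) = (if b then f' (star N i) else 0\<^sub>v (2 * N))"
  shows "stage f' (I \<union> {i, star N i}) E (if b then insert i S else S)"
proof -
  have i2: "i < 2 * N" using i by simp
  have ni: "star N i \<notin> I" by (rule stageD(6)[OF st i2 i(2)])
  have vE: "sp_verts N E \<subseteq> I" and SI: "S \<subseteq> I" "S \<subseteq> {..<N}" using st by (auto simp: stage_def)
  have siN: "\<not> star N i < N" using star_less_N[OF i2] i by simp
  have ss: "star N (star N i) = i" by (rule star_star[OF i2])
  have xs: "star N x \<noteq> i" if x: "x \<in> I" for x using stageD(3)[OF st x] i(2) by blast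
  let ?S = "if b then insert i S else S"
  have "P *\<^sub>v f' x = (if x \<in> ?S \<or> star N x \<in> ?S then f' x else 0\<^sub>v (2 * N))"
    if x: "x \<in> I \<union> {i, star N i}" "x \<notin> sp_verts N E" for x
  proof -
    consider "x \<in> I" | "x = i" | "x = star N i" using x by blast
    then show ?thesis
    proof cases
      case 1
      then have "P *\<^sub>v f x = (if x \<in> S \<or> star N x \<in> S then f x else 0\<^sub>v (2 * N))" using st x(2) by (auto simp: stage_def)
      moreover have "x \<noteq> i" using 1 i(2) by blast
      ultimately show ?thesis using 1 xs[OF 1] f'(2)[OF 1] by auto
    next
      case 2
      have "i \<notin> S" "star N i \<notin> S" using SI i(2) ni by auto
      then show ?thesis using 2 Pf(1) by auto
    next
      case 3
      have "star N i \<notin> S" "i \<notin> S" "star N i \<noteq> i" using SI i(2) ni star_neq[OF i2] by auto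
      then show ?thesis using 3 Pf(2) ss by auto
    qed
  qed
  moreover have "P *\<^sub>v f' a = f' j \<and> P *\<^sub>v f' j = f' j \<and> P *\<^sub>v f' (star N a) = 0\<^sub>v (2 * N) \<and>
        P *\<^sub>v f' (star N j) = f' (star N j) + sg N j \<cdot>\<^sub>v f' (star N a)" if aj: "(a, j) \<in> E" for a j
  proof -
    have "a \<in> I" "j \<in> I" "star N a \<in> I" "star N j \<in> I" using vE aj by (auto simp: sp_verts_def)
    then show ?thesis using st aj f'(2) by (auto simp: stage_def)
  qed
  moreover have "sp_ends N x \<inter> ?S = {}" if x: "x \<in> E" for x
  proof -
    have "sp_ends N x \<inter> S = {}" using st x by (auto simp: stage_def)
    then show ?thesis using sp_ends_verts[OF x, of N] vE i(2) by auto
  qed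
  moreover have "leads (2 * N) (f' x) x" if "x \<in> I \<union> {i, star N i}" for x
    using that lead f'(2) stageD(5)[OF st] by auto
  moreover have "E \<subseteq> sp_pairs N" "\<forall>x\<in>E. \<forall>y\<in>E. x \<noteq> y \<longrightarrow> sp_ends N x \<inter> sp_ends N y = {}" using st by (auto simp: stage_def)
  ultimately show ?thesis unfolding stage_def using f'(1) vE SI i(1) by (intro conjI) (auto split: if_splits)
qed

text \<open>A pair comes together with its reflection, hence four new indices at once.\<close>

lemma stage_pair:
  assumes st: "stage f I E S" and ij: "(i, j) \<in> sp_pairs N" "i \<notin> I" "j \<notin> I"
    and f': "psb f' (I \<union> {i, j, star N i, star N j})" "\<And>x. x \<in> I \<Longrightarrow> f' x = f x"
    and lead: "leads (2 * N) (f' i) i" "leads (2 * N) (f' (star N i)) (star N i)"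
      "leads (2 * N) (f' j) j" "leads (2 * N) (f' (star N j)) (star N j)"
    and Pf: "P *\<^sub>v f' i = f' j" "P *\<^sub>v f' j = f' j" "P *\<^sub>v f' (star N i) = 0\<^sub>v (2 * N)"
        "P *\<^sub>v f' (star N j) = f' (star N j) + sg N j \<cdot>\<^sub>v f' (star N i)"
  shows "stage f' (I \<union> {i, j, star N i, star N j}) (insert (i, j) E) S"
proof -
  note ijD = sp_pairsD[OF ij(1)]
  have i2: "i < 2 * N" using ijD by simp
  have n: "star N i \<notin> I" "star N j \<notin> I" using stageD(6)[OF st i2 ij(2)] stageD(6)[OF st ijD(3) ij(3)] .
  have vE: "sp_verts N E \<subseteq> I" and SI: "S \<subseteq> I" "S \<subseteq> {..<N}" using st by (auto simp: stage_def)
  have v': "sp_verts N (insert (i, j) E) = sp_verts N E \<union> {i, j, star N i, star N j}" by (auto simp: sp_verts_def)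
  have e': "sp_ends N (i, j) \<subseteq> {i, j, star N j}" by (auto simp: sp_ends_def)
  have dis: "sp_ends N (i, j) \<inter> I = {}" using e' ij n by auto
  have "P *\<^sub>v f' x = (if x \<in> S \<or> star N x \<in> S then f' x else 0\<^sub>v (2 * N))"
    if x: "x \<in> I \<union> {i, j, star N i, star N j}" "x \<notin> sp_verts N (insert (i, j) E)" for x
  proof -
    have xI: "x \<in> I" "x \<notin> sp_verts N E" using x unfolding v' by auto
    then have "P *\<^sub>v f x = (if x \<in> S \<or> star N x \<in> S then f x else 0\<^sub>v (2 * N))" using st by (auto simp: stage_def)
    then show ?thesis using f'(2)[OF xI(1)] by simp
  qed
  moreover have "P *\<^sub>v f' a = f' c \<and> P *\<^sub>v f' c = f' c \<and> P *\<^sub>v f' (star N a) = 0\<^sub>v (2 * N) \<and>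
        P *\<^sub>v f' (star N c) = f' (star N c) + sg N c \<cdot>\<^sub>v f' (star N a)" if ac: "(a, c) \<in> insert (i, j) E" for a c
  proof (cases "(a, c) = (i, j)")
    case True
    then show ?thesis using Pf by simp
  next
    case False
    then have ac': "(a, c) \<in> E" using ac by blast
    then have "a \<in> I" "c \<in> I" "star N a \<in> I" "star N c \<in> I" using vE by (auto simp: sp_verts_def)
    then show ?thesis using st ac' f'(2) by (auto simp: stage_def)
  qed
  moreover have "sp_ends N x \<inter> S = {}" if x: "x \<in> insert (i, j) E" for x
  proof (cases "x = (i, j)")
    case True
    then show ?thesis using dis SI by blast
  next
    case False
    then show ?thesis using x st by (auto simp: stage_def)
  qed
  moreover have "leads (2 * N) (f' x) x" if "x \<in> I \<union> {i, j, star N i, star N j}" for x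
    using that lead f'(2) stageD(5)[OF st] by auto
  moreover have "insert (i, j) E \<subseteq> sp_pairs N" using st ij(1) by (auto simp: stage_def)
  moreover have "sp_ends N x \<inter> sp_ends N y = {}" if xy: "x \<in> insert (i, j) E" "y \<in> insert (i, j) E" "x \<noteq> y" for x y
  proof -
    have EI: "sp_ends N z \<inter> sp_ends N (i, j) = {}" if "z \<in> E" for z using sp_ends_verts[OF that, of N] vE dis by blast
    consider "x \<in> E" "y \<in> E" | "x = (i, j)" "y \<in> E" | "x \<in> E" "y = (i, j)" using xy by blast
    then show ?thesis
    proof cases
      case 1
      then show ?thesis using st xy(3) by (simp add: stage_def)
    next
      case 2
      then show ?thesis using EI[OF 2(2)] by (simp add: Int_commute)
    next
      case 3
      then show ?thesis using EI[OF 3(1)] by simp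
    qed
  qed
  ultimately show ?thesis unfolding stage_def v' using f'(1) vE SI by (intro conjI) auto
qed

text \<open>The span of a stage is stable under \<open>P\<close>, so by self-adjointness its
  orthogonal is stable too.\<close>

lemma stage_orth_P:
  assumes st: "stage f I E S" and w: "orth f I w"
  shows "orth f I (P *\<^sub>v w)"
  unfolding orth_def
proof (intro conjI ballI)
  have wc: "w \<in> carrier_vec (2 * N)" and w0: "\<And>x. x \<in> I \<Longrightarrow> bil (anti N) w (f x) = 0" using w by (auto simp: orth_def)
  have z: "bil (anti N) w (0\<^sub>v (2 * N)) = 0" by (rule bil_zero_right[OF wc])
  fix x assume x: "x \<in> I"
  note fc = stageD(4)[OF st]
  have "bil (anti N) w (P *\<^sub>v f x) = 0"
  proof (cases "x \<in> sp_verts N E")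
    case True
    then obtain a j where aj: "(a, j) \<in> E" "x \<in> {a, j, star N a, star N j}" by (auto simp: sp_verts_def)
    have vE: "sp_verts N E \<subseteq> I" using st by (simp add: stage_def)
    have I: "a \<in> I" "j \<in> I" "star N a \<in> I" "star N j \<in> I" using vE aj(1) by (auto simp: sp_verts_def)
    have Pf: "P *\<^sub>v f a = f j" "P *\<^sub>v f j = f j" "P *\<^sub>v f (star N a) = 0\<^sub>v (2 * N)"
        "P *\<^sub>v f (star N j) = f (star N j) + sg N j \<cdot>\<^sub>v f (star N a)"
      using st aj(1) by (auto simp: stage_def)
    have "bil (anti N) w (f (star N j) + sg N j \<cdot>\<^sub>v f (star N a)) = 0"
      using bil_add_right[OF wc fc[OF I(4)], of "sg N j \<cdot>\<^sub>v f (star N a)"] bil_smult_right[OF wc fc[OF I(3)]] fc[OF I(3)] w0 I by simp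
    then show ?thesis using aj(2) Pf z w0 I by auto
  next
    case False
    then have "P *\<^sub>v f x = (if x \<in> S \<or> star N x \<in> S then f x else 0\<^sub>v (2 * N))" using st x by (simp add: stage_def)
    then show ?thesis using w0[OF x] z by simp
  qed
  then show "bil (anti N) (P *\<^sub>v w) (f x) = 0" using adj[OF wc fc[OF x]] by simp
qed simp

text \<open>A vector led by an index \<open>l\<close> of the stage pairs nontrivially with
  \<open>f (star N l)\<close>. So all new leading indices lie outside \<open>I\<close>.\<close>

lemma orth_leads:
  assumes st: "stage f I E S" and w: "orth f I w" "leads (2 * N) w l"
  shows "l \<notin> I"
proof
  assume l: "l \<in> I"
  have l2: "l < 2 * N" using w(2) by (simp add: leads_def)
  have "bil (anti N) w (f (star N l)) \<noteq> 0"
    by (rule bil_anti_leads(2)[OF w(2) stageD(5)[OF st stageD(3)[OF st l]]])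
  then show False using w(1) stageD(3)[OF st l] by (simp add: orth_def)
qed

text \<open>Making a unit vector orthogonal to the stage preserves its leading index: for
  \<open>x > k\<close> the coefficient of \<open>f x\<close> is a pairing with a vector led by
  \<open>star N x < star N k\<close>, which is zero.\<close>

lemma pr_unit:
  assumes st: "stage f I E S" and k: "k < 2 * N" "k \<notin> I"
  shows "orth f I (pr f I (unit_vec (2 * N) k))" "leads (2 * N) (pr f I (unit_vec (2 * N) k)) k"
proof -
  let ?e = "unit_vec (2 * N) k :: 'a vec"
  show "orth f I (pr f I ?e)"
    unfolding orth_def using pr_carrier[of ?e f I] pr_orth[OF stageD(1)[OF st], of ?e] by simp
  define g where "g x = (if x < k then f x else 0\<^sub>v (2 * N))" for x
  have eq: "(sg N x * bil (anti N) ?e (f (star N x))) * f x $ l = (sg N x * bil (anti N) ?e (f (star N x))) * g x $ l"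
    if x: "x \<in> I" for x l
  proof (cases "x < k")
    case False
    have x2: "x < 2 * N" using x stageD(2)[OF st] by auto
    have "x \<noteq> k" using x k(2) by blast
    then have "star N x < star N k" using False star_less_iff[OF x2 k(1)] by simp
    then have "f (star N x) \<in> flag (2 * N) (star N k)"
      using leads_flag[OF stageD(5)[OF st stageD(3)[OF st x]]] by simp
    then have "bil (anti N) ?e (f (star N x)) = 0" by (rule bil_anti_leads(1)[OF leads_unit_vec[OF k(1)]])
    then show ?thesis by simp
  qed (simp add: g_def)
  have "g x \<in> flag (2 * N) k" if "x \<in> I" for x
    using stageD(5)[OF st that] leads_flag[of "2 * N" "f x" x k] by (auto simp: g_def flag_def)
  then have "vec (2 * N) (\<lambda>l. \<Sum>x\<in>I. (sg N x * bil (anti N) ?e (f (star N x))) * g x $ l) \<in> flag (2 * N) k"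
    by (rule subsp_lincomb[OF subsp_flag])
  then have "vec (2 * N) (\<lambda>l. \<Sum>x\<in>I. (sg N x * bil (anti N) ?e (f (star N x))) * f x $ l) \<in> flag (2 * N) k"
    by (simp only: eq cong: sum.cong)
  then show "leads (2 * N) (pr f I ?e) k"
    unfolding pr_def by (rule leads_diff_flag(1)[OF leads_unit_vec[OF k(1)]])
qed

lemma stage_step:
  assumes st: "stage f I E S" and ne: "I \<noteq> {..<2 * N}"
  shows "\<exists>f' I' E' S'. stage f' I' E' S' \<and> I \<subset> I'"
proof -
  define i where "i = (LEAST i. i < 2 * N \<and> i \<notin> I)"
  have "\<exists>i. i < 2 * N \<and> i \<notin> I" using ne stageD(2)[OF st] by auto
  then have i: "i < 2 * N" "i \<notin> I" unfolding i_def by (metis (mono_tags, lifting) LeastI_ex)+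
  have imin: "i \<le> l" if "l < 2 * N" "l \<notin> I" for l unfolding i_def using that by (intro Least_le) simp
  have si: "star N i < 2 * N" "star N i \<notin> I" using star_less[OF i(1)] stageD(6)[OF st i] .
  have ss: "star N (star N i) = i" by (rule star_star[OF i(1)])
  have iN: "i < N" using imin[OF si] i(1) unfolding star_def by linarith
  have imax: "l \<le> star N i" if "l < 2 * N" "l \<notin> I" for l
    using imin[OF star_less[OF that(1)] stageD(6)[OF st that]] that(1) i(1) by (simp add: star_def)
  have sgi: "sg N i = (1 :: 'a)" using iN by (simp add: sg_def)
  define v where "v = pr f I (unit_vec (2 * N) i)"
  have v: "orth f I v" "leads (2 * N) v i" unfolding v_def by (rule pr_unit[OF st i])+
  have oc: "w \<in> carrier_vec (2 * N)" if "orth f I w" for w using that by (simp add: orth_def)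
  note vc = oc[OF v(1)]
  have lead_star: "leads (2 * N) w (star N i)" if w: "orth f I w" "bil (anti N) v w \<noteq> 0" for w
  proof -
    have "w \<noteq> 0\<^sub>v (2 * N)" using w(2) bil_zero_right[OF vc] by blast
    then obtain l where l: "leads (2 * N) w l"
      using flag_leads[of w "2 * N" "2 * N"] oc[OF w(1)] by (auto simp: flag_full)
    then have "l \<le> star N i" using imax orth_leads[OF st w(1) l] by (simp add: leads_def)
    moreover have "\<not> l < star N i" using bil_anti_leads(1)[OF v(2), of w] leads_flag[OF l] w(2) by auto
    ultimately show ?thesis using l by simp
  qed
  have osm: "orth f I (c \<cdot>\<^sub>v w)" if "orth f I w" for c w
    using that bil_smult_left[OF _ stageD(4)[OF st], of w _ c] by (simp add: orth_def)
  have odf: "orth f I (w - w')" if "orth f I w" "orth f I w'" for w w'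
    using that bil_minus_left[OF _ _ stageD(4)[OF st], of w w'] by (simp add: orth_def)
  have Psm: "P *\<^sub>v (c \<cdot>\<^sub>v w) = c \<cdot>\<^sub>v (P *\<^sub>v w)" if "w \<in> carrier_vec (2 * N)" for c w
    using that by (rule mult_mat_vec[OF P])
  have Pdf: "P *\<^sub>v (w - w') = P *\<^sub>v w - P *\<^sub>v w'" if "w \<in> carrier_vec (2 * N)" "w' \<in> carrier_vec (2 * N)" for w w'
    using that by (rule mult_minus_distrib_mat_vec[OF P])
  have fixed: ?thesis
    if Pv: "P *\<^sub>v v = (if b then v else 0\<^sub>v (2 * N))" and z: "orth f I z" "bil (anti N) v z \<noteq> 0" "P *\<^sub>v z = (if b then z else 0\<^sub>v (2 * N))" for b z
  proof -
    define y where "y = inverse (bil (anti N) v z) \<cdot>\<^sub>v z"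
    have y: "orth f I y" "bil (anti N) v y = 1" "P *\<^sub>v y = (if b then y else 0\<^sub>v (2 * N))"
      using osm[OF z(1)] bil_smult_right[OF vc oc[OF z(1)]] z Psm[OF oc[OF z(1)]] by (auto simp: y_def)
    let ?f = "f(i := v, star N i := y)"
    have "psb ?f (I \<union> {i, star N i})"
      using psb_extend[OF stageD(1)[OF st] i si(2), of v y] v(1) y(1,2) sgi by (auto simp: orth_def)
    moreover have "?f i = v" "?f (star N i) = y" "\<And>x. x \<in> I \<Longrightarrow> ?f x = f x" using star_neq[OF i(1)] i(2) si(2) by auto
    ultimately have "stage ?f (I \<union> {i, star N i}) E (if b then insert i S else S)"
      using stage_fixed[OF st iN i(2), of ?f b] Pv y v(2) lead_star[OF y(1)] by simp
    then show ?thesis using i(2) by blast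
  qed
  define y where "y = pr f I (unit_vec (2 * N) (star N i))"
  have y: "orth f I y" "leads (2 * N) y (star N i)" unfolding y_def by (rule pr_unit[OF st si])+
  note yc = oc[OF y(1)]
  have vy: "bil (anti N) v y \<noteq> 0" by (rule bil_anti_leads(2)[OF v(2) y(2)])
  define u where "u = P *\<^sub>v v"
  have u: "orth f I u" unfolding u_def by (rule stage_orth_P[OF st v(1)])
  note uc = oc[OF u]
  have Pu: "P *\<^sub>v u = u" unfolding u_def by (rule PP[OF vc])
  consider "u = v" | "u = 0\<^sub>v (2 * N)" | "u \<noteq> v" "u \<noteq> 0\<^sub>v (2 * N)" by blast
  then show ?thesis
  proof cases
    case 1
    have "bil (anti N) v (P *\<^sub>v y) = bil (anti N) v y" using adj[OF vc yc] 1 by (simp add: u_def)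
    then show ?thesis
      using fixed[of True "P *\<^sub>v y"] 1 stage_orth_P[OF st y(1)] vy PP[OF yc] by (simp add: u_def)
  next
    case 2
    have "bil (anti N) v (P *\<^sub>v y) = 0"
      using adj[OF vc yc] 2 yc anti_carrier[of N, where 'a = 'a] by (simp add: u_def bil_def)
    then have "bil (anti N) v (y - P *\<^sub>v y) \<noteq> 0" using bil_minus_right[OF vc yc Pc[of y]] vy by simp
    moreover have "P *\<^sub>v (y - P *\<^sub>v y) = 0\<^sub>v (2 * N)" using Pdf[OF yc Pc] PP[OF yc] by simp
    ultimately show ?thesis
      using fixed[of False "y - P *\<^sub>v y"] 2 odf[OF y(1) stage_orth_P[OF st y(1)]] by (simp add: u_def)
  next
    case 3
    obtain j where j: "leads (2 * N) u j"
      using flag_leads[of u "2 * N" "2 * N"] uc 3 by (auto simp: flag_full)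
    have jI: "j \<notin> I" by (rule orth_leads[OF st u j])
    have j2: "j < 2 * N" using j by (simp add: leads_def)
    have uv: "bil (anti N) u v = 0" unfolding u_def by (rule bil_P_self[OF vc])
    have vu: "bil (anti N) v u = 0" by (rule bil_sym0[OF uc vc uv])
    have sj: "star N j < 2 * N" "star N j \<notin> I" "star N (star N j) = j"
      using star_less[OF j2] stageD(6)[OF st j2 jI] star_star[OF j2] .
    \<comment> \<open>A vector led by \<open>star N i\<close> would pair nontrivially with
      \<open>v\<close>, whereas \<open>v\<close> and its image are orthogonal.\<close>
    have jsi: "j \<noteq> star N i"
    proof
      assume "j = star N i"
      then show False using bil_anti_leads(2)[OF v(2), of u] j vu by simp
    qed
    \<comment> \<open>If the image were led by \<open>i\<close>, it would be a multiple of
      \<open>v\<close>, and idempotence would make it equal to \<open>v\<close>.\<close>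
    have ji: "j \<noteq> i"
    proof
      assume "j = i"
      then obtain c where c: "c \<noteq> 0" "u - c \<cdot>\<^sub>v v \<in> flag (2 * N) i" using leads_cancel[of "2 * N" u i v] j v(2) by blast
      have o: "orth f I (u - c \<cdot>\<^sub>v v)" by (intro odf osm u v)
      have "u - c \<cdot>\<^sub>v v = 0\<^sub>v (2 * N)"
      proof (rule ccontr)
        assume "u - c \<cdot>\<^sub>v v \<noteq> 0\<^sub>v (2 * N)"
        then obtain l where l: "l < i" "leads (2 * N) (u - c \<cdot>\<^sub>v v) l" using flag_leads[OF c(2)] by blast
        then have "i \<le> l" using imin orth_leads[OF st o l(2)] by (simp add: leads_def)
        then show False using l(1) by simp
      qed
      then have "u = c \<cdot>\<^sub>v v" using uc vc by (auto simp: vec_eq_iff)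
      then have "u = c \<cdot>\<^sub>v u" using Pu Psm[OF vc, of c] by (simp add: u_def[symmetric])
      moreover have "c \<cdot>\<^sub>v u = c \<cdot>\<^sub>v v"
      proof -
        have "c \<cdot>\<^sub>v v = c \<cdot>\<^sub>v (c \<cdot>\<^sub>v v)" using \<open>u = c \<cdot>\<^sub>v v\<close> \<open>u = c \<cdot>\<^sub>v u\<close> by simp
        then show ?thesis using \<open>u = c \<cdot>\<^sub>v v\<close> by simp
      qed
      ultimately have "c \<cdot>\<^sub>v u = c \<cdot>\<^sub>v v" by simp
      then have "u = v" using c(1) uc vc by (auto simp: vec_eq_iff)
      then show False using 3 by simp
    qed
    have "i < j" using imin[OF j2 jI] ji by simp
    moreover have sji: "star N j < star N i" using star_less_iff[OF j2 i(1)] calculation by simp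
    moreover have "i < star N j" using imin[OF sj(1,2)] jsi star_eq_iff[OF j2 i(1)] by (metis order_le_imp_less_or_eq star_eq_iff i(1) j2)
    ultimately have ij: "(i, j) \<in> sp_pairs N" using j2 by (simp add: sp_pairs_def)
    \<comment> \<open>The starting point for the partner of \<open>u\<close>; its leading index is
      the reflection of that of \<open>u\<close>.\<close>
    define x0 where "x0 = pr f I (unit_vec (2 * N) (star N j))"
    have x0: "orth f I x0" "leads (2 * N) x0 (star N j)" unfolding x0_def by (rule pr_unit[OF st sj(1,2)])+
    have ux0: "bil (anti N) u x0 \<noteq> 0" by (rule bil_anti_leads(2)[OF j x0(2)])
    define x where "x = (sg N j * inverse (bil (anti N) u x0)) \<cdot>\<^sub>v x0"
    have x: "orth f I x" "leads (2 * N) x (star N j)" "bil (anti N) u x = sg N j"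
      unfolding x_def using osm[OF x0(1)] leads_smult[of "sg N j * inverse (bil (anti N) u x0)"] x0(2) ux0
        bil_smult_right[OF uc oc[OF x0(1)]] by simp_all
    note xc = oc[OF x(1)]
    have vx: "bil (anti N) v x = 0" using bil_anti_leads(1)[OF v(2)] leads_flag[OF x(2)] sji by simp
    \<comment> \<open>Killed by \<open>P\<close> by construction. Its pairing with \<open>v\<close>
      is 1, because moving \<open>P\<close> across the form gives the pairing of \<open>u\<close>
      with \<open>x\<close>, while \<open>x\<close> itself is orthogonal to \<open>v\<close>. So
      \<open>w\<close> is the partner of \<open>v\<close>, and the formula for the image of
      \<open>x\<close> is this definition read backwards.\<close>
    define w where "w = sg N j \<cdot>\<^sub>v (P *\<^sub>v x - x)"
    have dc: "P *\<^sub>v x - x \<in> carrier_vec (2 * N)" using xc by simp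
    have w: "orth f I w" unfolding w_def by (intro osm odf stage_orth_P[OF st] x)
    note wc = oc[OF w]
    have bw: "bil (anti N) z w = sg N j * (bil (anti N) z (P *\<^sub>v x) - bil (anti N) z x)" if "z \<in> carrier_vec (2 * N)" for z
      unfolding w_def using bil_smult_right[OF that dc] bil_minus_right[OF that Pc xc] by simp
    have "bil (anti N) v (P *\<^sub>v x) = sg N j" using adj[OF vc xc] x(3) by (simp add: u_def)
    then have vw: "bil (anti N) v w = 1" unfolding bw[OF vc] by (simp add: vx)
    have uw: "bil (anti N) u w = 0" using bw[OF uc] adj[OF uc xc] Pu by simp
    have "bil (anti N) x (P *\<^sub>v x) = 0" by (rule bil_sym0[OF Pc xc bil_P_self[OF xc]])
    then have xw: "bil (anti N) x w = 0" using bw[OF xc] alt[OF xc] by simp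
    have Pw: "P *\<^sub>v w = 0\<^sub>v (2 * N)" unfolding w_def using Psm[OF dc] Pdf[OF Pc xc] PP[OF xc] minus_cancel_vec[OF Pc[of x]] by (auto intro!: eq_vecI)
    have Px: "P *\<^sub>v x = x + sg N j \<cdot>\<^sub>v w"
      unfolding w_def using xc P by (intro eq_vecI) (simp_all del: index_mult_mat_vec)
    let ?f1 = "f(i := v, star N i := w)" and ?I1 = "I \<union> {i, star N i}"
    let ?f = "?f1(j := u, star N j := x)"
    have p1: "psb ?f1 ?I1"
      using psb_extend[OF stageD(1)[OF st] i si(2), of v w] v(1) w vw sgi by (auto simp: orth_def)
    have sjn: "star N j \<noteq> i" "star N j \<noteq> star N i" "star N i \<noteq> i" "star N j \<noteq> j"
      using sp_pairsD[OF ij] sji star_neq[OF i(1)] star_neq[OF j2] by auto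
    have f1: "?f1 i = v" "?f1 (star N i) = w" "\<And>z. z \<in> I \<Longrightarrow> ?f1 z = f z" using sjn i(2) si(2) by auto
    have o1: "bil (anti N) z (?f1 l) = 0"
      if "orth f I z" "bil (anti N) z v = 0" "bil (anti N) z w = 0" "l \<in> ?I1" for z l
      using that f1 by (auto simp: orth_def)
    have "psb ?f (?I1 \<union> {j, star N j})"
    proof (rule psb_extend[OF p1 j2 _ _ uc _ xc _ x(3)])
      show "j \<notin> ?I1" "star N j \<notin> ?I1" using jI sj ji jsi sjn by auto
      show "bil (anti N) u (?f1 z) = 0" if "z \<in> ?I1" for z by (rule o1[OF u uv uw that])
      show "bil (anti N) x (?f1 z) = 0" if "z \<in> ?I1" for z by (rule o1[OF x(1) bil_sym0[OF vc xc vx] xw that])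
    qed
    moreover have "?I1 \<union> {j, star N j} = I \<union> {i, j, star N i, star N j}" by auto
    ultimately have "psb ?f (I \<union> {i, j, star N i, star N j})" by simp
    moreover have "?f i = v" "?f (star N i) = w" "?f j = u" "?f (star N j) = x" "\<And>z. z \<in> I \<Longrightarrow> ?f z = f z"
      using sjn ji jsi i(2) si(2) jI sj(2) by auto
    ultimately have "stage ?f (I \<union> {i, j, star N i, star N j}) (insert (i, j) E) S"
      using stage_pair[OF st ij i(2) jI, of ?f] v(2) lead_star[OF w] vw j x(2) Pu Pw Px by (simp add: u_def[symmetric])
    then show ?thesis using i(2) by blast
  qed
qed

lemma stage_complete:
  "stage f I E S \<Longrightarrow> \<exists>f E S. stage f {..<2 * N} E S"
proof (induction "card ({..<2 * N} - I)" arbitrary: f I E S rule: less_induct)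
  case less
  show ?case
  proof (cases "I = {..<2 * N}")
    case True
    then show ?thesis using less.prems by blast
  next
    case False
    then obtain f' I' E' S' where s: "stage f' I' E' S'" "I \<subset> I'" using stage_step[OF less.prems] by blast
    have "{..<2 * N} - I' \<subset> {..<2 * N} - I" using s(2) stageD(2)[OF s(1)] by blast
    then have "card ({..<2 * N} - I') < card ({..<2 * N} - I)" by (intro psubset_card_mono) auto
    then show ?thesis using less.hyps s(1) by blast
  qed
qed

lemma complete_stage: "\<exists>f E S. stage f {..<2 * N} E S"
  by (rule stage_complete[of _ "{}" "{}" "{}"]) (auto simp: stage_def psb_def sp_verts_def)

end

section \<open>Symplectic clans\<close>

text \<open>All pairs of the involution on \<open>2 * N\<close> indices. The two ends are exchanged
  in the reflected pair because \<open>star\<close> reverses the order.\<close>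

definition sp_graph :: "nat \<Rightarrow> (nat \<times> nat) set \<Rightarrow> (nat \<times> nat) set" where
  "sp_graph N E = E \<union> (\<lambda>(a, j). (star N j, star N a)) ` E"

text \<open>Chosen to be closed under \<open>star\<close>. In the reflected pair it is therefore the
  opening \<open>star N j\<close> that belongs to it, and not the closing end.\<close>

definition sp_plus :: "nat \<Rightarrow> (nat \<times> nat) set \<Rightarrow> nat set \<Rightarrow> nat set" where
  "sp_plus N E S = snd ` E \<union> star N ` snd ` E \<union> S \<union> star N ` S"

text \<open>The paired indices form quadruples \<open>a, j, star N a, star N j\<close>. They are
  disjoint for different pairs, since folding them below \<open>N\<close> gives the end points of
  disjoint edges. Each quadruple has the two openings \<open>a\<close> and \<open>star N j\<close>,
  and \<open>E\<close> is recovered by keeping the smaller one.\<close>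

lemma sp_matching_clan:
  assumes d: "(E, S) \<in> clan_data N (sp_ends N) (sp_pairs N) m"
  defines "G \<equiv> sp_graph N E" and "R \<equiv> sp_plus N E S" and "Op \<equiv> fst ` sp_graph N E"
  shows "inj_on fst G" "clan (2 * N) (Op) (partner G) R (\<lambda>x. - sg N x :: 'a::field)"
    "x \<in> Op \<Longrightarrow> star N (partner G x) \<in> Op \<and> partner G (star N (partner G x)) = star N x"
    "x < 2 * N \<Longrightarrow> star N x \<in> R \<longleftrightarrow> x \<in> R" "card (R \<inter> {..<N}) = m"
    "(R - Op - partner G ` Op) \<inter> {..<N} = S"
    "E = {(x, partner G x) | x. x \<in> Op \<and> x < star N (partner G x)}"
    "(a, j) \<in> E \<Longrightarrow> partner G a = j \<and> partner G (star N j) = star N a"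
    "(a, j) \<in> E \<Longrightarrow> a \<in> Op \<and> star N j \<in> Op \<and> j \<notin> Op \<and> star N a \<notin> Op"
    "(a, j) \<in> E \<Longrightarrow> j \<in> R \<and> star N j \<in> R \<and> a \<notin> R \<and> star N a \<notin> R"
    "Op \<subseteq> sp_verts N E" "sp_verts N E \<inter> (S \<union> star N ` S) = {}"
proof -
  have EQ: "(a, j) \<in> sp_pairs N" if "(a, j) \<in> E" for a j using d that by (auto simp: clan_data_def)
  have S: "S \<subseteq> {..<N}" "card E + card S = m" using d by (auto simp: clan_data_def)
  have S2: "x < 2 * N" if "x \<in> S" for x using that S by auto
  have dis: "x = y" if "x \<in> E" "y \<in> E" "z \<in> sp_ends N x" "z \<in> sp_ends N y" for x y z
    using d that by (fastforce simp: clan_data_def)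
  have disS: "z \<notin> S" if "x \<in> E" "z \<in> sp_ends N x" for x z using d that by (fastforce simp: clan_data_def)
  \<comment> \<open>Folds the upper half onto the lower one; all four indices of a pair land on the
    end points of its edge.\<close>
  define fo where "fo x = (if x < N then x else star N x)" for x
  note D = sp_pairsD[OF EQ]
  have ss: "star N (star N a) = a" "star N (star N j) = j" if "(a, j) \<in> E" for a j
    using star_star D(1,3)[OF that] by auto
  have neq: "a \<noteq> j" "a \<noteq> star N a" "a \<noteq> star N j" "j \<noteq> star N a" "j \<noteq> star N j" "star N a \<noteq> star N j" if aj: "(a, j) \<in> E" for a j
  proof -
    note Da = D[OF aj]
    have a2: "a < 2 * N" using Da by simp
    show "a \<noteq> j" "a \<noteq> star N j" "j \<noteq> star N a" using Da by auto
    show "a \<noteq> star N a" "j \<noteq> star N j" using star_neq[OF a2] star_neq[OF Da(3)] by auto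
    show "star N a \<noteq> star N j" using star_less_iff[OF Da(3) a2] Da(2) by simp
  qed
  have fo: "fo x \<in> sp_ends N (a, j)" if aj: "(a, j) \<in> E" and x: "x \<in> {a, j, star N a, star N j}" for a j x
  proof -
    note Da = D[OF aj]
    have "\<not> star N a < N" "star N j < N \<longleftrightarrow> \<not> j < N" using star_less_N[of a N] star_less_N[OF Da(3)] Da by auto
    then show ?thesis using x Da(1) ss[OF aj] by (auto simp: sp_ends_def fo_def)
  qed
  have same: "(a, j) = (a', j')"
    if "(a, j) \<in> E" "(a', j') \<in> E" "x \<in> {a, j, star N a, star N j}" "x \<in> {a', j', star N a', star N j'}" for a j a' j' x
    using dis[OF that(1,2) fo[OF that(1,3)] fo[OF that(2,4)]] .
  have noS: "x \<notin> S" "star N x \<notin> S" if aj: "(a, j) \<in> E" and x: "x \<in> {a, j, star N a, star N j}" for a j x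
  proof -
    note Da = D[OF aj]
    have x2: "x < 2 * N" using x Da by auto
    note f = disS[OF aj fo[OF aj x]]
    show "x \<notin> S" using f S(1) by (auto simp: fo_def)
    show "star N x \<notin> S" using f S(1) star_less_N[OF x2] by (auto simp: fo_def split: if_splits)
  qed
  have Gcase: "\<exists>a j. (a, j) \<in> E \<and> (x = a \<and> y = j \<or> x = star N j \<and> y = star N a)" if "(x, y) \<in> G" for x y
    using that by (auto simp: G_def sp_graph_def)
  show inj: "inj_on fst G"
  proof (rule inj_onI)
    fix u u' assume u: "u \<in> G" "u' \<in> G" "fst u = fst u'"
    obtain x y y' where xy: "u = (x, y)" "u' = (x, y')" using u(3) by (cases u, cases u') auto
    obtain a j where aj: "(a, j) \<in> E" "x = a \<and> y = j \<or> x = star N j \<and> y = star N a" using Gcase u(1) xy(1) by blast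
    obtain a' j' where aj': "(a', j') \<in> E" "x = a' \<and> y' = j' \<or> x = star N j' \<and> y' = star N a'" using Gcase u(2) xy(2) by blast
    have "(a, j) = (a', j')" by (rule same[OF aj(1) aj'(1), of x]) (use aj(2) aj'(2) in auto)
    then show "u = u'" using aj aj' neq(3)[OF aj(1)] xy by auto
  qed
  have inG: "(a, j) \<in> G" "(star N j, star N a) \<in> G" if "(a, j) \<in> E" for a j
    unfolding G_def sp_graph_def using that by force+
  have p: "partner G a = j" "partner G (star N j) = star N a" if "(a, j) \<in> E" for a j
    using partner_eq[OF inj inG(1)[OF that]] partner_eq[OF inj inG(2)[OF that]] .
  then show "(a, j) \<in> E \<Longrightarrow> partner G a = j \<and> partner G (star N j) = star N a" by blast
  have Ocase: "\<exists>a j. (a, j) \<in> E \<and> (x = a \<and> partner G x = j \<or> x = star N j \<and> partner G x = star N a)" if x: "x \<in> Op" for x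
  proof -
    obtain y where "(x, y) \<in> G" using x by (auto simp: Op_def G_def)
    then obtain a j where "(a, j) \<in> E" "x = a \<and> y = j \<or> x = star N j \<and> y = star N a" using Gcase by blast
    then show ?thesis using p by blast
  qed
  have O: "a \<in> Op" "star N j \<in> Op" if "(a, j) \<in> E" for a j
    unfolding Op_def G_def[symmetric] using imageI[OF inG(1)[OF that], of fst] imageI[OF inG(2)[OF that], of fst]
    by (simp_all only: fst_conv)
  have notO: "j \<notin> Op" "star N a \<notin> Op" if aj: "(a, j) \<in> E" for a j
  proof -
    have *: False if x: "x \<in> Op" "x = j \<or> x = star N a" for x
    proof -
      obtain a' j' where aj': "(a', j') \<in> E" "x = a' \<or> x = star N j'" using Ocase[OF x(1)] by blast
      have "(a, j) = (a', j')" by (rule same[OF aj aj'(1), of x]) (use x(2) aj'(2) in auto)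
      then show False using aj'(2) x(2) neq[OF aj] by auto
    qed
    show "j \<notin> Op" "star N a \<notin> Op" using * by blast+
  qed
  show "(a, j) \<in> E \<Longrightarrow> a \<in> Op \<and> star N j \<in> Op \<and> j \<notin> Op \<and> star N a \<notin> Op" using O notO by blast
  have Rc: "x \<in> R \<longleftrightarrow> (\<exists>a j. (a, j) \<in> E \<and> (x = j \<or> x = star N j)) \<or> x \<in> S \<or> x \<in> star N ` S" for x
    unfolding R_def sp_plus_def by force
  have inR: "j \<in> R" "star N j \<in> R" if "(a, j) \<in> E" for a j using that unfolding Rc by blast+
  have notR: "x \<notin> R" if aj: "(a, j) \<in> E" and x: "x = a \<or> x = star N a" for a j x
  proof
    assume "x \<in> R"
    moreover have "x \<notin> S" "x \<notin> star N ` S"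
      using noS[OF aj, of x] x star_star S2 by force+
    ultimately obtain a' j' where aj': "(a', j') \<in> E" "x = j' \<or> x = star N j'" unfolding Rc by blast
    have "(a, j) = (a', j')" by (rule same[OF aj aj'(1), of x]) (use x aj'(2) in auto)
    then show False using aj'(2) x neq[OF aj] by auto
  qed
  show "(a, j) \<in> E \<Longrightarrow> j \<in> R \<and> star N j \<in> R \<and> a \<notin> R \<and> star N a \<notin> R" using inR notR by blast
  have R2: "x < 2 * N" if "x \<in> R" for x using that D(3,6) S2 star_less unfolding Rc by auto
  have Rs: "star N x \<in> R" if xR: "x \<in> R" for x
  proof -
    consider a j where "(a, j) \<in> E" "x = j" | a j where "(a, j) \<in> E" "x = star N j" | "x \<in> S" | s where "s \<in> S" "x = star N s"
      using xR unfolding Rc by blast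
    then show ?thesis
    proof cases
      case 1 then show ?thesis using inR(2) by blast
    next
      case 2 then show ?thesis using inR(1) ss(2) by simp
    next
      case 3 then show ?thesis unfolding Rc by blast
    next
      case 4 then show ?thesis using star_star[OF S2] unfolding Rc by simp
    qed
  qed
  show "star N x \<in> R \<longleftrightarrow> x \<in> R" if "x < 2 * N" for x using Rs[of x] Rs[of "star N x"] star_star[OF that] by auto
  show "clan (2 * N) (Op) (partner G) R (\<lambda>x. - sg N x :: 'a)"
  proof
    fix x assume x: "x \<in> Op"
    obtain a j where aj: "(a, j) \<in> E" "x = a \<and> partner G x = j \<or> x = star N j \<and> partner G x = star N a" using Ocase[OF x] by blast
    note Da = D[OF aj(1)]
    have "star N j < star N a" using star_less_iff[OF Da(3), of a] Da by simp
    then show "x < partner G x" "partner G x < 2 * N" using aj(2) Da by auto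
    show "partner G x \<notin> Op" using aj(2) notO[OF aj(1)] by auto
    show "x \<in> R \<longleftrightarrow> partner G x \<notin> R" using aj(2) inR[OF aj(1)] notR[OF aj(1)] by auto
    show "- sg N x \<noteq> (0 :: 'a)" by simp
  next
    show "inj_on (partner G) (Op)"
    proof (rule inj_onI)
      fix x y assume xy: "x \<in> Op" "y \<in> Op" "partner G x = partner G y"
      obtain a j where aj: "(a, j) \<in> E" "x = a \<and> partner G x = j \<or> x = star N j \<and> partner G x = star N a" using Ocase[OF xy(1)] by blast
      obtain a' j' where aj': "(a', j') \<in> E" "y = a' \<and> partner G y = j' \<or> y = star N j' \<and> partner G y = star N a'" using Ocase[OF xy(2)] by blast
      have "(a, j) = (a', j')" by (rule same[OF aj(1) aj'(1), of "partner G x"]) (use aj(2) aj'(2) xy(3) in auto)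
      then show "x = y" using aj(2) aj'(2) xy(3) neq(4)[OF aj(1)] by auto
    qed
    show "R \<subseteq> {..<2 * N}" using R2 by auto
  qed
  show "x \<in> Op \<Longrightarrow> star N (partner G x) \<in> Op \<and> partner G (star N (partner G x)) = star N x"
  proof -
    assume x: "x \<in> Op"
    obtain a j where aj: "(a, j) \<in> E" "x = a \<and> partner G x = j \<or> x = star N j \<and> partner G x = star N a" using Ocase[OF x] by blast
    then show ?thesis using O[OF aj(1)] p[OF aj(1)] ss[OF aj(1)] by auto
  qed
  have "finite ({..<2 * N} \<times> {..<2 * N})" by simp
  moreover have "E \<subseteq> {..<2 * N} \<times> {..<2 * N}" using D(1,3) by fastforce
  ultimately have fin: "finite E" "finite S" using S(1) finite_subset by blast+
  have fojE: "fo (snd x) \<in> sp_ends N x" if "x \<in> E" for x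
    using fo[of "fst x" "snd x" "snd x"] that by simp
  have "R \<inter> {..<N} = (\<lambda>x. fo (snd x)) ` E \<union> S"
  proof (intro equalityI subsetI)
    fix x assume "x \<in> R \<inter> {..<N}"
    then have x: "x \<in> R" "x < N" by auto
    then consider a j where "(a, j) \<in> E" "x = j \<or> x = star N j" | "x \<in> S" | s where "s \<in> S" "x = star N s" unfolding Rc by blast
    then show "x \<in> (\<lambda>x. fo (snd x)) ` E \<union> S"
    proof cases
      case 1
      have "fo j = x" using x(2) 1(2) star_less_N[OF D(3)[OF 1(1)]] by (auto simp: fo_def)
      then show ?thesis using 1(1) by force
    next
      case 3
      then show ?thesis using x(2) S(1) star_less_N[OF S2[OF 3(1)]] by auto
    qed simp
  next
    fix x assume "x \<in> (\<lambda>x. fo (snd x)) ` E \<union> S"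
    then consider a j where "(a, j) \<in> E" "x = fo j" | "x \<in> S" by force
    then show "x \<in> R \<inter> {..<N}"
    proof cases
      case 1
      then show ?thesis using inR[OF 1(1)] star_less_N[OF D(3)[OF 1(1)]] by (auto simp: fo_def)
    next
      case 2
      then show ?thesis using S(1) by (auto simp: Rc)
    qed
  qed
  moreover have "card ((\<lambda>x. fo (snd x)) ` E) = card E"
    by (rule card_image) (use dis fojE in \<open>metis (no_types, lifting) inj_onI\<close>)
  moreover have "(\<lambda>x. fo (snd x)) ` E \<inter> S = {}" using disS fojE by blast
  ultimately show "card (R \<inter> {..<N}) = m" using fin S(2) by (simp add: card_Un_disjoint)
  have vert: "Op \<union> partner G ` Op = sp_verts N E"
  proof (intro equalityI subsetI)
    fix x assume "x \<in> Op \<union> partner G ` Op"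
    then obtain a j where "(a, j) \<in> E" "x \<in> {a, j, star N a, star N j}" using Ocase by blast
    then show "x \<in> sp_verts N E" by (auto simp: sp_verts_def)
  next
    fix x assume "x \<in> sp_verts N E"
    then obtain a j where aj: "(a, j) \<in> E" "x \<in> {a, j, star N a, star N j}" by (auto simp: sp_verts_def)
    then show "x \<in> Op \<union> partner G ` Op"
      using O[OF aj(1)] p[OF aj(1)] image_eqI[of j "partner G" a] image_eqI[of "star N a" "partner G" "star N j"] by auto
  qed
  then show "Op \<subseteq> sp_verts N E" by blast
  show vS: "sp_verts N E \<inter> (S \<union> star N ` S) = {}"
  proof -
    have False if x: "x \<in> sp_verts N E" "x \<in> S \<union> star N ` S" for x
    proof -
      obtain a j where aj: "(a, j) \<in> E" "x \<in> {a, j, star N a, star N j}" using x(1) by (auto simp: sp_verts_def)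
      show False using noS[OF aj] x(2) star_star S2 by auto
    qed
    then show ?thesis by blast
  qed
  have "R - sp_verts N E = S \<union> star N ` S"
  proof (intro equalityI subsetI)
    fix x assume x: "x \<in> R - sp_verts N E"
    have "\<not> (\<exists>a j. (a, j) \<in> E \<and> (x = j \<or> x = star N j))" using x by (auto simp: sp_verts_def)
    moreover have "x \<in> R" using x by blast
    ultimately show "x \<in> S \<union> star N ` S" unfolding Rc by blast
  next
    fix x assume x: "x \<in> S \<union> star N ` S"
    then have "x \<in> R" unfolding Rc by blast
    then show "x \<in> R - sp_verts N E" using x vS by blast
  qed
  then have "R - Op - partner G ` Op = S \<union> star N ` S" unfolding vert[symmetric] by blast
  moreover have "star N s \<notin> {..<N}" if "s \<in> S" for s using star_less_N[OF S2[OF that]] that S(1) by auto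
  ultimately show "(R - Op - partner G ` Op) \<inter> {..<N} = S" using S(1) by blast
  show "E = {(x, partner G x) | x. x \<in> Op \<and> x < star N (partner G x)}"
  proof (intro equalityI subsetI)
    fix u assume u: "u \<in> E"
    obtain a j where aj: "u = (a, j)" by (cases u)
    show "u \<in> {(x, partner G x) | x. x \<in> Op \<and> x < star N (partner G x)}"
      using u O(1)[of a j] p(1)[of a j] D(4)[of a j] unfolding aj by auto
  next
    fix u assume "u \<in> {(x, partner G x) | x. x \<in> Op \<and> x < star N (partner G x)}"
    then obtain x where x: "u = (x, partner G x)" "x \<in> Op" "x < star N (partner G x)" by blast
    obtain a j where aj: "(a, j) \<in> E" "x = a \<and> partner G x = j \<or> x = star N j \<and> partner G x = star N a" using Ocase[OF x(2)] by blast
    then show "u \<in> E" using x ss[OF aj(1)] D(4)[OF aj(1)] by auto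
  qed
qed

text \<open>The coefficients \<open>- sg N x\<close> are chosen so that the two cross terms cancel.
  They are nonzero together, namely when the second index is the reflected opening
  \<open>star N (p k)\<close>.\<close>

lemma sp_cbasis_isom:
  assumes c: "clan (2 * N) Op p R (\<lambda>x. - sg N x :: 'a::field)"
    and sym: "\<And>x. x \<in> Op \<Longrightarrow> star N (p x) \<in> Op \<and> p (star N (p x)) = star N x"
  shows "(clan.cbasis (2 * N) Op p (\<lambda>x. - sg N x :: 'a))\<^sup>T * anti N * clan.cbasis (2 * N) Op p (\<lambda>x. - sg N x) = anti N"
proof -
  interpret clan "2 * N" Op p R "\<lambda>x. - sg N x :: 'a" by (rule c)
  let ?A = "anti N :: 'a mat" and ?e = "\<lambda>k. unit_vec (2 * N) k :: 'a vec"
  define q where "q k = (if k \<in> Op then p k else k)" for k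
  define s where "s k = (if k \<in> Op then - sg N k else (0 :: 'a))" for k
  have q2: "q k < 2 * N" if "k < 2 * N" for k using that Op_p(2) by (simp add: q_def)
  have col: "cbasis *\<^sub>v ?e k = ?e k + s k \<cdot>\<^sub>v ?e (q k)" if k: "k < 2 * N" for k
    unfolding col_eq_mult_unit[OF cbasis_carrier k, symmetric]
    using k Op_p[of k] by (intro eq_vecI) (auto simp: cbasis_def q_def s_def unit_vec_def)
  note be = bil_unit[OF anti_carrier]
  show ?thesis
  proof (rule eq_matI)
    fix k l assume "k < dim_row ?A" "l < dim_col ?A"
    then have kl: "k < 2 * N" "l < 2 * N" by (auto simp: anti_def)
    have M: "cbasis\<^sup>T * ?A * cbasis \<in> carrier_mat (2 * N) (2 * N)"
      using anti_carrier by (intro sq_mult) auto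
    have "(cbasis\<^sup>T * ?A * cbasis) $$ (k, l) = bil (cbasis\<^sup>T * ?A * cbasis) (?e k) (?e l)"
      by (rule bil_unit[OF M kl, symmetric])
    also have "\<dots> = bil ?A (cbasis *\<^sub>v ?e k) (cbasis *\<^sub>v ?e l)"
      by (rule bil_congruence[OF anti_carrier cbasis_carrier]) auto
    also have "\<dots> = ?A $$ (k, l) + s l * ?A $$ (k, q l) + s k * ?A $$ (q k, l) + s k * s l * ?A $$ (q k, q l)"
      unfolding col[OF kl(1)] col[OF kl(2)] be[OF kl, symmetric] be[OF kl(1) q2[OF kl(2)], symmetric]
        be[OF q2[OF kl(1)] kl(2), symmetric] be[OF q2[OF kl(1)] q2[OF kl(2)], symmetric]
      by (simp add: anti.bil_add_left anti.bil_add_right anti.bil_smult_left anti.bil_smult_right algebra_simps)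
    also have "\<dots> = ?A $$ (k, l)"
    proof -
      have sp: "star N (p x) \<in> Op" "p (star N (p x)) = star N x" if "x \<in> Op" for x using sym[OF that] by auto
      have O2: "x < 2 * N" if "x \<in> Op" for x using Op_p[OF that] by simp
      consider "k \<in> Op" "l \<in> Op" | "k \<in> Op" "l \<notin> Op" | "k \<notin> Op" "l \<in> Op" | "k \<notin> Op" "l \<notin> Op" by blast
      then show ?thesis
      proof cases
        case 1
        note kp = Op_p(2)[OF 1(1)] and lp = Op_p(2)[OF 1(2)]
        have a: "p l \<noteq> star N (p k)" using sp(1)[OF 1(1)] Op_p(3)[OF 1(2)] by auto
        have b: "p l = star N k \<longleftrightarrow> l = star N (p k)"
        proof
          assume "p l = star N k"
          then have "p k = star N l" using sp(2)[OF 1(2)] star_star[OF kl(1)] by simp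
          then show "l = star N (p k)" using star_star[OF kl(2)] by simp
        next
          assume "l = star N (p k)"
          then show "p l = star N k" using sp(2)[OF 1(1)] by simp
        qed
        have "sg N (star N (p k)) = - (sg N (p k) :: 'a)" by (rule sg_star[OF kp])
        then show ?thesis
          using 1 a b kl kp lp by (auto simp: s_def q_def anti_index)
      next
        case 2
        have "l \<noteq> star N (p k)" using sp(1)[OF 2(1)] 2(2) by auto
        then show ?thesis using 2 kl Op_p(2)[OF 2(1)] by (simp add: s_def q_def anti_index)
      next
        case 3
        have "p l \<noteq> star N k" using sp(1)[OF 3(2)] 3(1) star_star[OF kl(1)] by auto
        then show ?thesis using 3 kl Op_p(2)[OF 3(2)] by (simp add: s_def q_def anti_index)
      next
        case 4
        then show ?thesis by (simp add: s_def)
      qed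
    qed
    finally show "(cbasis\<^sup>T * ?A * cbasis) $$ (k, l) = ?A $$ (k, l)" .
  qed (auto simp: anti_def cbasis_def)
qed

text \<open>Matches the planes \<open>2 i, 2 i + 1\<close> of the standard form with the planes
  \<open>x, star N x\<close> of the antidiagonal one; \<open>\<rho>\<close> is free and will put the
  indices of the image first.\<close>

lemma sp_pmat:
  assumes \<rho>: "bij_betw \<rho> {..<N} {..<N}"
  defines "\<tau> \<equiv> \<lambda>b. if even b then \<rho> (b div 2) else star N (\<rho> (b div 2))"
  shows "bij_betw \<tau> {..<2 * N} {..<2 * N}" "(pmat (2 * N) \<tau>)\<^sup>T * anti N * pmat (2 * N) \<tau> = (symp_form N :: 'a::field mat)"
proof -
  have r: "\<rho> i < N" "\<rho> i = \<rho> j \<longleftrightarrow> i = j" if "i < N" "j < N" for i j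
    using \<rho> that by (auto simp: bij_betw_def inj_on_def)
  have half: "b div 2 < N" if "b < 2 * N" for b using that by auto
  have hh: "b = c \<longleftrightarrow> b div 2 = c div 2 \<and> (even b \<longleftrightarrow> even c)" for b c :: nat by presburger
  have \<rho>b: "\<rho> (b div 2) < N" "\<rho> (b div 2) < 2 * N" if "b < 2 * N" for b
    using r(1)[OF half[OF that] half[OF that]] by auto
  have t: "\<tau> b < N \<longleftrightarrow> even b" "\<tau> b < 2 * N" if "b < 2 * N" for b
    using \<rho>b[OF that] star_less_N[OF \<rho>b(2)[OF that]] star_less[OF \<rho>b(2)[OF that]] by (auto simp: \<tau>_def)
  have st: "\<tau> c = star N (\<tau> b) \<longleftrightarrow> b div 2 = c div 2 \<and> (even b \<longleftrightarrow> odd c)" if bc: "b < 2 * N" "c < 2 * N" for b c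
  proof -
    note sN = star_less_N[OF \<rho>b(2)[OF bc(1)]] star_less_N[OF \<rho>b(2)[OF bc(2)]]
    note se = star_eq_iff[OF \<rho>b(2)[OF bc(2)] \<rho>b(2)[OF bc(1)]] star_star[OF \<rho>b(2)[OF bc(1)]] star_star[OF \<rho>b(2)[OF bc(2)]]
      r(2)[OF half half, OF bc] r(2)[OF half half, OF bc(2,1)]
    show ?thesis
    proof (cases "even b"; cases "even c")
      assume "even b" "even c"
      then show ?thesis using sN \<rho>b(1)[OF bc(1)] \<rho>b(1)[OF bc(2)] by (auto simp: \<tau>_def)
    next
      assume "even b" "odd c"
      moreover have "star N (\<rho> (c div 2)) = star N (\<rho> (b div 2)) \<longleftrightarrow> \<rho> (c div 2) = \<rho> (b div 2)"
        using se(2,3) by metis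
      ultimately show ?thesis using se(4) by (auto simp: \<tau>_def)
    next
      assume "odd b" "even c"
      then show ?thesis using se by (auto simp: \<tau>_def)
    next
      assume "odd b" "odd c"
      then show ?thesis using sN \<rho>b(1)[OF bc(1)] \<rho>b(1)[OF bc(2)] se(2) by (auto simp: \<tau>_def)
    qed
  qed
  have "inj_on \<tau> {..<2 * N}"
  proof (rule inj_onI)
    fix b c assume bc: "b \<in> {..<2 * N}" "c \<in> {..<2 * N}" "\<tau> b = \<tau> c"
    then have b2: "b < 2 * N" "c < 2 * N" by auto
    have e: "even b \<longleftrightarrow> even c" using t(1)[OF b2(1)] t(1)[OF b2(2)] bc(3) by simp
    have "\<rho> (b div 2) = \<rho> (c div 2)"
      using bc(3) e star_star[OF \<rho>b(2)[OF b2(1)]] star_star[OF \<rho>b(2)[OF b2(2)]] unfolding \<tau>_def by (metis)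
    then show "b = c" using r(2)[OF half half, OF b2] e hh by blast
  qed
  then show bij: "bij_betw \<tau> {..<2 * N} {..<2 * N}"
    using t(2) by (intro bij_betw_imageI endo_inj_surj) auto
  let ?A = "anti N :: 'a mat" and ?p = "pmat (2 * N) \<tau> :: 'a mat"
  show "?p\<^sup>T * ?A * ?p = symp_form N"
  proof (rule eq_matI)
    fix k l assume "k < dim_row (symp_form N :: 'a mat)" "l < dim_col (symp_form N :: 'a mat)"
    then have kl: "k < 2 * N" "l < 2 * N" by (auto simp: symp_form_def)
    have pe: "?p *\<^sub>v unit_vec (2 * N) b = unit_vec (2 * N) (\<tau> b)" if "b < 2 * N" for b
      unfolding col_eq_mult_unit[OF pmat_carrier that, symmetric]
      using that t(2)[OF that] by (intro eq_vecI) (auto simp: pmat_def)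
    have M: "?p\<^sup>T * ?A * ?p \<in> carrier_mat (2 * N) (2 * N)"
      using anti_carrier by (intro sq_mult) auto
    have "(?p\<^sup>T * ?A * ?p) $$ (k, l) = bil (?p\<^sup>T * ?A * ?p) (unit_vec (2 * N) k) (unit_vec (2 * N) l)"
      by (rule bil_unit[OF M kl, symmetric])
    also have "\<dots> = bil ?A (?p *\<^sub>v unit_vec (2 * N) k) (?p *\<^sub>v unit_vec (2 * N) l)"
      by (rule bil_congruence[OF anti_carrier pmat_carrier]) auto
    also have "\<dots> = ?A $$ (\<tau> k, \<tau> l)" unfolding pe[OF kl(1)] pe[OF kl(2)] by (rule bil_unit[OF anti_carrier t(2)[OF kl(1)] t(2)[OF kl(2)]])
    also have "\<dots> = (if k div 2 = l div 2 \<and> (even k \<longleftrightarrow> odd l) then (if even k then 1 else - 1) else 0)"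
      unfolding anti_index[OF t(2)[OF kl(1)] t(2)[OF kl(2)]] st[OF kl] using t(1)[OF kl(1)] by (simp add: sg_def)
    also have "\<dots> = symp_form N $$ (k, l)"
    proof -
      have "even k \<and> l = Suc k \<longleftrightarrow> k div 2 = l div 2 \<and> even k \<and> odd l"
        "even l \<and> k = Suc l \<longleftrightarrow> k div 2 = l div 2 \<and> odd k \<and> even l" by presburger+
      then show ?thesis using kl by (auto simp: symp_form_def)
    qed
    finally show "(?p\<^sup>T * ?A * ?p) $$ (k, l) = symp_form N $$ (k, l)" .
  qed (auto simp: symp_form_def pmat_def)
qed

text \<open>The permutation matrix carries the standard form to the antidiagonal one,
  \<open>cbasis\<close> preserves the latter, and \<open>g\<close> leads back, so the product is
  symplectic.\<close>

lemma sp_representative: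
  assumes d: "(E, S) \<in> clan_data N (sp_ends N) (sp_pairs N) m"
    and g: "g \<in> carrier (GL (2 * N))" "g\<^sup>T * symp_form N * g = (anti N :: 'a::field mat)"
  shows "\<exists>r\<in>carrier (Sp N). pj (2 * N) (2 * m) r =
    g * clan.cmat (2 * N) (fst ` sp_graph N E) (partner (sp_graph N E)) (sp_plus N E S) (\<lambda>x. - sg N x :: 'a) * minv g"
proof -
  note cl = sp_matching_clan[OF d]
  interpret clan "2 * N" "fst ` sp_graph N E" "partner (sp_graph N E)" "sp_plus N E S" "\<lambda>x. - sg N x :: 'a" by (rule cl(2))
  obtain \<rho> where \<rho>: "bij_betw \<rho> {..<N} {..<N}" "\<And>b. b < N \<Longrightarrow> \<rho> b \<in> sp_plus N E S \<inter> {..<N} \<longleftrightarrow> b < m"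
    using sorting_bij[OF _ cl(5)] by (metis inf_le2)
  define \<tau> where "\<tau> b = (if even b then \<rho> (b div 2) else star N (\<rho> (b div 2)))" for b
  note t = sp_pmat[OF \<rho>(1), folded \<tau>_def]
  have tR: "\<tau> b \<in> sp_plus N E S \<longleftrightarrow> b < 2 * m" if b: "b < 2 * N" for b
  proof -
    have h: "b div 2 < N" using b by auto
    then have "\<rho> (b div 2) < N" using \<rho>(1) by (auto simp: bij_betw_def)
    then have "\<tau> b \<in> sp_plus N E S \<longleftrightarrow> \<rho> (b div 2) \<in> sp_plus N E S \<inter> {..<N}"
      using cl(4)[of "\<rho> (b div 2)"] by (auto simp: \<tau>_def)
    also have "\<dots> \<longleftrightarrow> b < 2 * m" using \<rho>(2)[OF h] by auto
    finally show ?thesis .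
  qed
  let ?c = "cbasis * pmat (2 * N) \<tau>"
  have cG: "?c \<in> carrier (GL (2 * N))" by (intro mult_GL cbasis_GL pmat_GL t)
  have "cmat * ?c = cbasis * (dg (2 * N) (sp_plus N E S) * pmat (2 * N) \<tau>)"
    using cmat_cbasis by (simp add: sq_assoc[of _ "2 * N", symmetric] del: assoc_mult_mat)
  also have "\<dots> = ?c * dg (2 * N) {..<2 * m}"
    by (simp add: dg_pmat[OF t(1) tR] sq_assoc[of _ "2 * N"] del: assoc_mult_mat)
  finally have pc: "pj (2 * N) (2 * m) ?c = cmat" by (intro pj_eqI[OF cG cmat_carrier])
  have gm: "g \<in> carrier_mat (2 * N) (2 * N)" using g(1) GL_carrier_mat by blast
  have ci: "cbasis\<^sup>T * anti N * cbasis = anti N" by (rule sp_cbasis_isom[OF cl(2)]) (rule cl(3))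
  have "g * ?c \<in> carrier (Sp N)"
    unfolding carrier_Sp
  proof (rule isomI[OF symp_form_carrier mult_GL[OF g(1) cG]])
    fix v w :: "'a vec" assume vw: "v \<in> carrier_vec (2 * N)" "w \<in> carrier_vec (2 * N)"
    let ?p = "pmat (2 * N) \<tau> :: 'a mat"
    have e: "g * ?c *\<^sub>v u = g *\<^sub>v (cbasis *\<^sub>v (?p *\<^sub>v u))" if "u \<in> carrier_vec (2 * N)" for u
      using gm that by (simp add: assoc_mult_mat_vec[of _ "2 * N" "2 * N" _ "2 * N"] sq_mult del: assoc_mult_mat)
    have pv: "?p *\<^sub>v v \<in> carrier_vec (2 * N)" "?p *\<^sub>v w \<in> carrier_vec (2 * N)" using vw by (auto intro: mult_mat_vec_carrier[OF pmat_carrier])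
    have cv: "cbasis *\<^sub>v (?p *\<^sub>v v) \<in> carrier_vec (2 * N)" "cbasis *\<^sub>v (?p *\<^sub>v w) \<in> carrier_vec (2 * N)"
      using pv by (auto intro: mult_mat_vec_carrier[OF cbasis_carrier])
    have "bil (symp_form N) (g * ?c *\<^sub>v v) (g * ?c *\<^sub>v w) = bil (anti N) (cbasis *\<^sub>v (?p *\<^sub>v v)) (cbasis *\<^sub>v (?p *\<^sub>v w))"
      unfolding e[OF vw(1)] e[OF vw(2)] bil_congruence[OF symp_form_carrier gm cv, symmetric] g(2) ..
    also have "\<dots> = bil (anti N) (?p *\<^sub>v v) (?p *\<^sub>v w)"
      unfolding bil_congruence[OF anti_carrier cbasis_carrier pv, symmetric] ci ..
    also have "\<dots> = bil (symp_form N) v w"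
      unfolding bil_congruence[OF anti_carrier pmat_carrier vw, symmetric] t(2) ..
    finally show "bil (symp_form N) (g * ?c *\<^sub>v v) (g * ?c *\<^sub>v w) = bil (symp_form N) v w" .
  qed
  then show ?thesis using pj_translate[OF g(1) cG, of "2 * m"] pc by auto
qed

lemma card_star_closed:
  assumes R: "R \<subseteq> {..<2 * N}" and c: "\<And>x. x < 2 * N \<Longrightarrow> star N x \<in> R \<longleftrightarrow> x \<in> R"
  shows "card R = 2 * card (R \<inter> {..<N})"
proof -
  have i: "inj_on (star N) (R \<inter> {..<N})"
    by (rule inj_on_inverseI[of _ "star N"]) (simp add: star_star)
  have "R = (R \<inter> {..<N}) \<union> star N ` (R \<inter> {..<N})"
  proof (intro equalityI subsetI)
    fix x assume x: "x \<in> R"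
    then have x2: "x < 2 * N" using R by auto
    show "x \<in> (R \<inter> {..<N}) \<union> star N ` (R \<inter> {..<N})"
    proof (cases "x < N")
      case False
      then have "star N x \<in> R \<inter> {..<N}" using c[OF x2] x star_less_N[OF x2] by simp
      then have "star N (star N x) \<in> star N ` (R \<inter> {..<N})" by (rule imageI)
      then show ?thesis by (simp only: star_star[OF x2] Un_iff simp_thms)
    qed (use x in simp)
  next
    fix x assume "x \<in> (R \<inter> {..<N}) \<union> star N ` (R \<inter> {..<N})"
    then show "x \<in> R"
    proof
      assume "x \<in> star N ` (R \<inter> {..<N})"
      then obtain y where "y \<in> R" "y < N" "x = star N y" by blast
      then show "x \<in> R" using c[of y] by simp
    qed blast
  qed
  moreover have "(R \<inter> {..<N}) \<inter> star N ` (R \<inter> {..<N}) = {}" using star_less_N by fastforce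
  moreover have "finite (R \<inter> {..<N})" by simp
  ultimately have "card R = card (R \<inter> {..<N}) + card (star N ` (R \<inter> {..<N}))"
    using card_Un_disjoint[of "R \<inter> {..<N}" "star N ` (R \<inter> {..<N})"] by simp
  then show ?thesis using card_image[OF i] by simp
qed

text \<open>The two blocks are orthogonal for the form, so the projection onto the first block is
  self-adjoint.\<close>

lemma bil_symp_dg:
  fixes v w :: "'a::field vec"
  assumes v: "v \<in> carrier_vec (2 * (m + n))" "w \<in> carrier_vec (2 * (m + n))"
  shows "bil (symp_form (m + n)) (dg (2 * (m + n)) {..<2 * m} *\<^sub>v v) w =
    bil (symp_form (m + n)) v (dg (2 * (m + n)) {..<2 * m} *\<^sub>v w)"
proof -
  let ?n = "2 * (m + n)" and ?S = "symp_form (m + n) :: 'a mat" and ?D = "dg (2 * (m + n)) {..<2 * m} :: 'a mat"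
  note S = symp_form_carrier[of "m + n", where 'a = 'a]
  have N: "2 * m + 2 * n = ?n" by simp
  have "(i < 2 * m \<longleftrightarrow> j < 2 * m) \<or> ?S $$ (i, j) = 0" if "i < ?n" "j < ?n" for i j
    using that unfolding symp_form_def by (auto; presburger)
  then have SD: "?S * ?D = ?D * ?S" using commute_dg_iff[of ?S "2 * m" "2 * n"] S unfolding N by blast
  have T: "?D\<^sup>T = ?D" by (intro eq_matI) auto
  have Sw: "?S *\<^sub>v w \<in> carrier_vec ?n" using S v(2) by simp
  have "(?D *\<^sub>v v) \<bullet> (?S *\<^sub>v w) = v \<bullet> (?D *\<^sub>v (?S *\<^sub>v w))"
    using transpose_vec_mult_scalar[OF dg_carrier Sw v(1), of "{..<2 * m}"] T by simp
  also have "?D *\<^sub>v (?S *\<^sub>v w) = ?S *\<^sub>v (?D *\<^sub>v w)"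
    using assoc_mult_mat_vec[OF dg_carrier S v(2), of "{..<2 * m}"] assoc_mult_mat_vec[OF S dg_carrier v(2), of "{..<2 * m}"] SD by simp
  finally show ?thesis by (simp add: bil_def)
qed

lemma Sp_orbits:
  fixes g :: "'a::field mat" and m n :: nat
  defines "N \<equiv> m + n"
  assumes g: "g \<in> carrier (GL (2 * N))" "g\<^sup>T * symp_form N * g = anti N"
  shows "\<exists>\<psi>. bij_betw \<psi> (clan_data N (sp_ends N) (sp_pairs N) m)
     (coset_orbits (Sp N) {h \<in> carrier (Sp N). cj g h \<in> tri (2 * N)} (lcosets\<^bsub>Sp N\<^esub> (Sp_Sp m n)))"
proof -
  let ?n = "2 * N" and ?D = "clan_data N (sp_ends N) (sp_pairs N) m"
  let ?H = "carrier (Sp N) :: 'a mat set" and ?B = "{h \<in> carrier (Sp N). cj g h \<in> tri (2 * N)}"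
  let ?K = "{k \<in> ?H. k * dg ?n {..<2 * m} = dg ?n {..<2 * m} * k}"
  have N2: "2 * m + 2 * n = ?n" by (simp add: N_def)
  have K: "Sp_Sp m n = ?K" using Sp_Sp_iff[of _ m n] unfolding N2 by (auto simp: N_def)
  have gm: "g \<in> carrier_mat ?n ?n" "minv g \<in> carrier_mat ?n ?n" using g(1) minv_GL GL_carrier_mat by blast+
  define M where "M x = clan.cmat ?n (fst ` sp_graph N (fst x)) (partner (sp_graph N (fst x))) (sp_plus N (fst x) (snd x)) (\<lambda>x. - sg N x :: 'a)" for x
  have pair: "(fst x, snd x) \<in> ?D" if "x \<in> ?D" for x using that by simp
  have Mc: "M x \<in> carrier_mat ?n ?n" if "x \<in> ?D" for x
    unfolding M_def by (rule clan.cmat_carrier[OF sp_matching_clan(2)[OF pair[OF that]]])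
  have "\<exists>r\<in>?H. pj ?n (2 * m) r = g * M x * minv g" if "x \<in> ?D" for x
    unfolding M_def by (rule sp_representative[OF pair[OF that] g])
  then obtain r where r: "\<And>x. x \<in> ?D \<Longrightarrow> r x \<in> ?H" "\<And>x. x \<in> ?D \<Longrightarrow> pj ?n (2 * m) (r x) = g * M x * minv g"
    using bchoice[of ?D "\<lambda>x r. r \<in> ?H \<and> pj ?n (2 * m) r = g * M x * minv g"] by blast
  have HT: "?B = {h \<in> carrier (GL ?n). cj g h \<in> tri ?n} \<inter> ?H" using Sp_GL by auto
  have "subgroup ?B (GL ?n)"
    unfolding HT using GL.subgroups_Inter_pair[OF _ subgroup_Sp] subgroup_cj_uni[OF g(1), of 0] by (simp add: uni_def)
  then have B: "subgroup ?B ((GL ?n)\<lparr>carrier := ?H\<rparr>)"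
    by (rule GL.subgroup_incl[OF _ subgroup_Sp]) auto
  have "\<exists>\<psi>. bij_betw \<psi> ?D (coset_orbits ((GL ?n)\<lparr>carrier := ?H\<rparr>) ?B (lcosets\<^bsub>(GL ?n)\<lparr>carrier := ?H\<rparr>\<^esub> ?K))"
  proof (rule orbits_via_idempotents(2)[OF subgroup_Sp B order_refl, of ?D r])
    show "r x \<in> ?H" if "x \<in> ?D" for x using r(1)[OF that] .
    then show "r x <#\<^bsub>(GL ?n)\<lparr>carrier := ?H\<rparr>\<^esub> ?K \<in> lcosets\<^bsub>(GL ?n)\<lparr>carrier := ?H\<rparr>\<^esub> ?K" if "x \<in> ?D" for x
      unfolding LCOSETS_def using that by simp blast
    show "\<exists>b\<in>?B. \<exists>x\<in>?D. pj ?n (2 * m) h * b = b * pj ?n (2 * m) (r x)" if h: "h \<in> ?H" for h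
    proof -
      have hG: "h \<in> carrier (GL ?n)" by (rule Sp_GL[OF h])
      have hm: "h \<in> carrier_mat ?n ?n" by (rule GL_carrier_mat[OF hG])
      \<comment> \<open>An isometry from the standard to the antidiagonal form. The idempotent is
        studied in the basis given by \<open>g\<close>, in which the Borel subgroup is
        triangular.\<close>
      define s where "s = minv g * h"
      have s: "s \<in> carrier (GL ?n)" unfolding s_def by (rule mult_GL[OF minv_GL[OF g(1)] hG])
      have sm: "s \<in> carrier_mat ?n ?n" "minv s \<in> carrier_mat ?n ?n" using s minv_GL GL_carrier_mat by blast+
      let ?P = "pj ?n (2 * m) s" and ?E = "dg ?n {..<2 * m} :: 'a mat"
      have Pc: "?P \<in> carrier_mat ?n ?n" by (rule pj_carrier[OF s])
      have gP: "pj ?n (2 * m) h * g = g * ?P"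
        unfolding s_def pj_translate[OF minv_GL[OF g(1)] hG] minv_minv[OF g(1)]
        using minv_cancel(2)[OF g(1), of "pj ?n (2 * m) h * g" ?n] pj_carrier[OF hG, of "2 * m"] gm
        by (simp add: sq_assoc[of _ ?n] sq_mult del: assoc_mult_mat)
      have iso: "bil (anti N) (s *\<^sub>v v) (s *\<^sub>v w) = bil (symp_form N) v w"
        if vw: "v \<in> carrier_vec ?n" "w \<in> carrier_vec ?n" for v w
      proof -
        have gs: "g *\<^sub>v (s *\<^sub>v v) = h *\<^sub>v v" if "v \<in> carrier_vec ?n" for v
          unfolding s_def assoc_mult_mat_vec[OF gm(2) hm that] using minv_cancel_vec(2)[OF g(1)] hm that by simp
        have sv: "s *\<^sub>v v \<in> carrier_vec ?n" "s *\<^sub>v w \<in> carrier_vec ?n" using sm vw by auto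
        show ?thesis
          using bil_congruence[OF symp_form_carrier gm(1) sv] h isomD(3)[OF symp_form_carrier _ vw, of h]
          unfolding g(2) gs[OF vw(1)] gs[OF vw(2)] carrier_Sp by simp
      qed
      \<comment> \<open>Self-adjointness is transported along \<open>s\<close> from the block
        projection and the standard form.\<close>
      have "anti_idem N ?P"
      proof
        show "?P \<in> carrier_mat ?n ?n" "?P * ?P = ?P" by (rule Pc) (rule pj_idem[OF s])
        fix v w :: "'a vec" assume vw: "v \<in> carrier_vec ?n" "w \<in> carrier_vec ?n"
        define v' where "v' = minv s *\<^sub>v v"
        define w' where "w' = minv s *\<^sub>v w"
        have c: "v' \<in> carrier_vec ?n" "w' \<in> carrier_vec ?n" using vw sm by (auto simp: v'_def w'_def)
        have vs: "v = s *\<^sub>v v'" "w = s *\<^sub>v w'" unfolding v'_def w'_def using minv_cancel_vec(2)[OF s] vw by auto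
        have Ps: "?P *\<^sub>v (s *\<^sub>v u) = s *\<^sub>v (?E *\<^sub>v u)" if "u \<in> carrier_vec ?n" for u
          using assoc_mult_mat_vec[OF Pc sm(1) that] assoc_mult_mat_vec[OF sm(1) dg_carrier that, of "{..<2 * m}"] pj_mult[OF s, of "2 * m"] by simp
        have Ec: "?E *\<^sub>v u \<in> carrier_vec ?n" if "u \<in> carrier_vec ?n" for u by (rule mult_mat_vec_carrier[OF dg_carrier that])
        show "bil (anti N) (?P *\<^sub>v v) w = bil (anti N) v (?P *\<^sub>v w)"
          unfolding vs Ps[OF c(1)] Ps[OF c(2)] iso[OF Ec[OF c(1)] c(2)] iso[OF c(1) Ec[OF c(2)]]
          using bil_symp_dg[of v' m n w'] c by (simp add: N_def)
      qed
      then interpret ai: anti_idem N ?P .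
      obtain f E S where st: "ai.stage f {..<?n} E S" using ai.complete_stage by blast
      \<comment> \<open>The number of edges is left open at this point; the rank of
        \<open>?P\<close> determines it once the normal form is known.\<close>
      have d: "(E, S) \<in> clan_data N (sp_ends N) (sp_pairs N) (card E + card S)"
        using st by (simp add: ai.stage_def clan_data_def)
      define Op where "Op = fst ` sp_graph N E"
      note cl = sp_matching_clan[OF d, folded Op_def]
      let ?p = "partner (sp_graph N E)" and ?R = "sp_plus N E S"
      interpret clan ?n Op ?p ?R "\<lambda>x. - sg N x :: 'a" by (rule cl(2))
      have lead: "leads ?n (f x) x" if "x < ?n" for x using ai.stageD(5)[OF st, of x] that by simp
      have fc: "f x \<in> carrier_vec ?n" if "x < ?n" for x using ai.stageD(4)[OF st, of x] that by simp
      define t where "t = mat ?n ?n (\<lambda>(l, i). f i $ l)"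
      have t: "t \<in> tri ?n" unfolding t_def by (rule leads_mat[OF lead])
      note tm = tri_carrier_mat[OF t]
      have tI: "t \<in> isom (anti N)"
        unfolding isom_anti_iff[OF tri_GL[OF t]]
      proof (intro allI impI)
        fix k l assume kl: "k < ?n" "l < ?n"
        have "(\<Sum>x<?n. t $$ (x, k) * sg N x * t $$ (star N x, l)) = bil (anti N) (f k) (f l)"
          unfolding bil_anti[OF fc[OF kl(1)] fc[OF kl(2)]] using kl by (intro sum.cong) (auto simp: t_def star_less)
        also have "\<dots> = anti N $$ (k, l)"
          using ai.stageD(1)[OF st] kl by (simp add: anti.psb_def anti_index)
        finally show "(\<Sum>x<?n. t $$ (x, k) * sg N x * t $$ (star N x, l)) = anti N $$ (k, l)" .
      qed
      have Pf: "?P *\<^sub>v f b = (if b \<in> ?R then f b else 0\<^sub>v ?n) + (if b \<in> Op then (if b \<in> ?R then - sg N b else sg N b) \<cdot>\<^sub>v f (?p b) else 0\<^sub>v ?n)"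
        if b: "b < ?n" for b
      proof (cases "b \<in> sp_verts N E")
        case True
        then obtain a j where aj: "(a, j) \<in> E" "b \<in> {a, j, star N a, star N j}" by (auto simp: sp_verts_def)
        have "(a, j) \<in> sp_pairs N" using d aj(1) by (auto simp: clan_data_def)
        note D = sp_pairsD[OF this]
        have F: "?P *\<^sub>v f a = f j" "?P *\<^sub>v f j = f j" "?P *\<^sub>v f (star N a) = 0\<^sub>v ?n"
            "?P *\<^sub>v f (star N j) = f (star N j) + sg N j \<cdot>\<^sub>v f (star N a)"
          using st aj(1) by (auto simp: ai.stage_def)
        note fs = fc[of a] fc[OF D(3)] fc[OF D(5)] fc[OF D(6)]
        note q = cl(8)[OF aj(1)] cl(9)[OF aj(1)] cl(10)[OF aj(1)]
        have sa: "sg N a = (1 :: 'a)" using D(1) by (simp add: sg_def)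
        consider "b = a" | "b = j" | "b = star N a" | "b = star N j" using aj(2) by blast
        then show ?thesis
        proof cases
          case 1
          then show ?thesis using F(1) q fs sa by (simp del: index_mult_mat_vec)
        next
          case 2
          then show ?thesis using F(2) q fs by simp
        next
          case 3
          then show ?thesis using F(3) q by simp
        next
          case 4
          then show ?thesis using F(4) q sg_star[OF D(3), where 'a = 'a] by simp
        qed
      next
        case False
        have bO: "b \<notin> Op" using False cl(11) by blast
        have ss: "star N (star N b) = b" by (rule star_star[OF b])
        have "b \<in> ?R \<longleftrightarrow> b \<in> S \<or> star N b \<in> S"
        proof
          assume "b \<in> ?R"
          then consider "b \<in> S" | x where "x \<in> S" "b = star N x" | "b \<in> sp_verts N E"
            by (force simp: sp_plus_def sp_verts_def)
          then show "b \<in> S \<or> star N b \<in> S"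
          proof cases
            case 2
            have "x < ?n" using d 2(1) by (auto simp: clan_data_def)
            then show ?thesis using 2 star_star by simp
          qed (use False in auto)
        next
          assume "b \<in> S \<or> star N b \<in> S"
          moreover have "b \<in> star N ` S" if "star N b \<in> S" using imageI[OF that, of "star N"] unfolding ss .
          ultimately show "b \<in> ?R" unfolding sp_plus_def by blast
        qed
        moreover have "?P *\<^sub>v f b = (if b \<in> S \<or> star N b \<in> S then f b else 0\<^sub>v ?n)"
          using st False b by (simp add: ai.stage_def)
        ultimately show ?thesis using bO fc[OF b] by simp
      qed
      have Pt: "?P * t = t * cmat"
        unfolding t_def by (rule intertwines_cmat[OF Pc fc]) (simp_all only: Pf minus_minus)
      have "?P * (t * cbasis) = t * (cmat * cbasis)"
        using Pt Pc tm by (simp add: sq_assoc[of _ ?n, symmetric] del: assoc_mult_mat)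
      also have "\<dots> = t * cbasis * dg ?n ?R"
        unfolding cmat_cbasis using tm by (simp add: sq_assoc[of _ ?n] del: assoc_mult_mat)
      \<comment> \<open>As \<open>?R\<close> is closed under \<open>star\<close>, half of it lies
        below \<open>N\<close>, which gives the number of edges.\<close>
      finally have "card ?R = 2 * m"
        using pj_card[OF s mult_GL[OF tri_GL[OF t] cbasis_GL] _ R(1)] by (simp add: N_def)
      then have "card E + card S = m" using card_star_closed[OF R(1) cl(4)] cl(5) by simp
      then have x: "(E, S) \<in> ?D" using d by simp
      have Mx: "M (E, S) = cmat" by (simp add: M_def Op_def)
      define b where "b = g * t * minv g"
      have bG: "b \<in> carrier (GL ?n)" unfolding b_def by (intro mult_GL g tri_GL t minv_GL)
      have cb: "cj g b = t" unfolding b_def by (rule cj_cj_minv(1)[OF g(1) tm])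
      have "b \<in> ?B"
        using isom_cj[OF symp_form_carrier anti_carrier g bG] cb tI t by (simp add: carrier_Sp)
      moreover have "pj ?n (2 * m) h * b = b * (g * M (E, S) * minv g)"
        unfolding b_def Mx by (rule conjugate_intertwine[OF g(1) pj_carrier[OF hG] Pc tm cmat_carrier gP Pt])
      ultimately show ?thesis using r(2)[OF x] x by force
    qed
    show "x = x'" if x: "b \<in> ?B" "x \<in> ?D" "x' \<in> ?D" "b * pj ?n (2 * m) (r x) = pj ?n (2 * m) (r x') * b" for b x x'
    proof -
      have b: "b \<in> carrier_mat ?n ?n" "cj g b \<in> tri ?n" using x(1) Sp_GL GL_carrier_mat by blast+
      note MM = Mc[OF x(2)] Mc[OF x(3)]
      have e: "cj g b * M x = M x' * cj g b"
        by (rule cj_intertwine[OF g(1) b(1) MM]) (use x(4) in \<open>simp only: r(2)[OF x(2)] r(2)[OF x(3)]\<close>)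
      obtain E S E' S' where ES: "x = (E, S)" "x' = (E', S')" by (cases x, cases x')
      note c = sp_matching_clan[OF x(2)[unfolded ES]] and c' = sp_matching_clan[OF x(3)[unfolded ES]]
      note u = clan_unique[OF c(2) c'(2) b(2) e[unfolded ES M_def fst_conv snd_conv]]
      have gen: "{(x, p x) | x. x \<in> A \<and> x < star N (p x)} = {(x, q x) | x. x \<in> A \<and> x < star N (q x)}"
        if "\<And>x. x \<in> A \<Longrightarrow> p x = q x" for A and p q :: "nat \<Rightarrow> nat"
        using that by auto
      have "E = {(x, partner (sp_graph N E) x) | x. x \<in> fst ` sp_graph N E \<and> x < star N (partner (sp_graph N E) x)}" by (rule c(7))
      also have "\<dots> = {(x, partner (sp_graph N E') x) | x. x \<in> fst ` sp_graph N E \<and> x < star N (partner (sp_graph N E') x)}"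
        by (rule gen) (rule u(2))
      also have "\<dots> = E'" unfolding u(1) by (rule c'(7)[symmetric])
      finally have "E = E'" .
      moreover have "S = S'" using u(3) c(6) c'(6) by metis
      ultimately show ?thesis using ES by simp
    qed
  qed
  then show ?thesis unfolding K Sp_eq[of N, symmetric] .
qed

section \<open>Index data as matchings of the corona graphs, and the conclusion\<close>

lemma matchings_corona_graph:
  "\<exists>\<chi>. bij_betw \<chi> (clan_data N (\<lambda>(i, j). {i, j}) {(i, j). i < j \<and> j < N} m) (matchings (corona_graph N) m)"
proof -
  let ?Q = "{(i, j). i < j \<and> j < N}" and ?enc = "\<lambda>(i, j). Core (Suc i) (Suc j) 0"
  have "?enc ` ?Q = {Core i j c | i j c. 1 \<le> i \<and> i < j \<and> j \<le> N \<and> c < 1}"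
  proof (intro equalityI subsetI)
    fix e assume "e \<in> {Core i j c | i j c. 1 \<le> i \<and> i < j \<and> j \<le> N \<and> c < 1}"
    then obtain i j where ij: "e = Core i j 0" "1 \<le> i" "i < j" "j \<le> N" by auto
    then show "e \<in> ?enc ` ?Q" by (intro image_eqI[of _ _ "(i - 1, j - 1)"]) auto
  qed auto
  moreover have "finite ?Q" by (rule finite_subset[of _ "{..<N} \<times> {..<N}"]) auto
  moreover have "inj_on ?enc ?Q" by (auto simp: inj_on_def)
  ultimately show ?thesis
    unfolding corona_graph_def using clan_data_matchings[of ?Q ?enc N 1 "\<lambda>(i, j). {i, j}" m] by auto
qed

text \<open>The two copies of a core edge distinguish whether the partner \<open>j\<close> lies in
  the lower half or is the reflection of a vertex there. Indices are raised by one because the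
  vertices are numbered from 1.\<close>

lemma matchings_double_corona_graph:
  "\<exists>\<chi>. bij_betw \<chi> (clan_data N (sp_ends N) (sp_pairs N) m) (matchings (double_corona_graph N) m)"
proof -
  let ?enc = "\<lambda>(a, j). Core (Suc a) (Suc (if j < N then j else star N j)) (if j < N then 0 else 1)"
  have img: "?enc ` sp_pairs N = {Core i j c | i j c. 1 \<le> i \<and> i < j \<and> j \<le> N \<and> c < 2}"
  proof (intro equalityI subsetI)
    fix e assume "e \<in> ?enc ` sp_pairs N"
    then obtain a j where aj: "(a, j) \<in> sp_pairs N" "e = ?enc (a, j)" by auto
    note D = sp_pairsD[OF aj(1)]
    show "e \<in> {Core i j c | i j c. 1 \<le> i \<and> i < j \<and> j \<le> N \<and> c < 2}"
      using D star_less_N[OF D(3)] aj(2) by auto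
  next
    fix e assume "e \<in> {Core i j c | i j c. 1 \<le> i \<and> i < j \<and> j \<le> N \<and> c < 2}"
    then obtain i j c where e: "e = Core i j c" "1 \<le> i" "i < j" "j \<le> N" "c < 2" by auto
    define a where "a = i - 1"
    define l where "l = j - 1"
    have al: "a < l" "l < N" "i = Suc a" "j = Suc l" using e by (auto simp: a_def l_def)
    have l2: "l < 2 * N" using al by simp
    have sl: "\<not> star N l < N" "star N (star N l) = l" "star N l < 2 * N"
      using star_less_N[OF l2] al star_star[OF l2] star_less[OF l2] by auto
    have "c = 0 \<or> c = 1" using e(5) by auto
    then show "e \<in> ?enc ` sp_pairs N"
    proof
      assume c: "c = 0"
      show ?thesis using al sl l2 c e(1) by (intro image_eqI[of _ _ "(a, l)"]) (auto simp: sp_pairs_def)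
    next
      assume c: "c = 1"
      show ?thesis using al sl l2 c e(1) by (intro image_eqI[of _ _ "(a, star N l)"]) (auto simp: sp_pairs_def)
    qed
  qed
  have fin: "finite (sp_pairs N)" by (rule finite_subset[of _ "{..<2 * N} \<times> {..<2 * N}"]) (auto simp: sp_pairs_def)
  have inj: "inj_on ?enc (sp_pairs N)"
  proof (rule inj_onI)
    fix x y assume xy: "x \<in> sp_pairs N" "y \<in> sp_pairs N" "?enc x = ?enc y"
    obtain a j b l where e: "x = (a, j)" "y = (b, l)" by (cases x, cases y)
    have j2: "j < 2 * N" "l < 2 * N" using xy by (auto simp: e sp_pairs_def)
    have "?enc (a, j) = ?enc (b, l)" using xy(3) unfolding e .
    then have "a = b" and f: "(if j < N then j else star N j) = (if l < N then l else star N l)"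
      and c: "(if j < N then 0 else 1 :: nat) = (if l < N then 0 else 1)"
      unfolding prod.case corona_edge.inject nat.inject by blast+
    have "j < N \<longleftrightarrow> l < N" using c by presburger
    moreover have "j = l" if s: "star N j = star N l"
    proof -
      have "star N (star N j) = star N (star N l)" by (rule arg_cong[OF s])
      then show ?thesis unfolding star_star[OF j2(1)] star_star[OF j2(2)] .
    qed
    ultimately have "j = l" using f by (cases "j < N"; cases "l < N") simp_all
    then show "x = y" using \<open>a = b\<close> by (simp only: e)
  qed
  have ends: "corona_ends (?enc x) = V ` Suc ` sp_ends N x" for x
    by (cases x) (simp add: sp_ends_def)
  show ?thesis
    unfolding double_corona_graph_def by (rule exI, rule clan_data_matchings[OF fin inj img ends])
qed

lemma bij_betw_common_domain:
  assumes "\<exists>\<psi>. bij_betw \<psi> D A" "\<exists>\<chi>. bij_betw \<chi> D B"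
  shows "\<exists>\<phi>. bij_betw \<phi> A B"
proof -
  obtain \<psi> where p: "bij_betw \<psi> D A" using assms(1) by (rule exE)
  obtain \<chi> where q: "bij_betw \<chi> D B" using assms(2) by (rule exE)
  show ?thesis by (rule exI, rule bij_betw_trans[OF bij_betw_inv_into[OF p] q])
qed

theorem theorem1p1:
  fixes \<iota> :: "'a::field \<Rightarrow> 'b::alg_closed_field" and m n :: nat
  assumes "alg_closure_of \<iota>"
  shows "(\<forall>B. borel_subgroup (m + n) (GL (m + n)) B \<and> defined_over \<iota> (m + n) B \<longrightarrow>
            (\<exists>\<phi>. bij_betw \<phi>
               (coset_orbits (GL (m + n)) (rational_subgroup \<iota> (m + n) B)
                  (GL_quotient_points \<iota> (m + n) (GL_GL m n)))
               (matchings (corona_graph (m + n)) m)))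
       \<and> (CHAR('a) \<noteq> 2 \<longrightarrow>
          (\<forall>B. borel_subgroup (2 * (m + n)) (Sp (m + n)) (B :: 'b mat set) \<longrightarrow>
            (\<exists>\<phi>. bij_betw \<phi>
               (coset_orbits (Sp (m + n)) B (lcosets\<^bsub>Sp (m + n)\<^esub> (Sp_Sp m n)))
               (matchings (double_corona_graph (m + n)) m))))"
proof (intro conjI allI impI)
  interpret field_hom \<iota> using assms by (simp add: alg_closure_of_def)
  interpret field_ext \<iota> ..
  fix B assume B: "borel_subgroup (m + n) (GL (m + n)) B \<and> defined_over \<iota> (m + n) B"
  obtain g where g: "g \<in> carrier (GL (m + n))" "B = {h \<in> carrier (GL (m + n)). cj g h \<in> tri (m + n)}"
    using borel_subgroup_GL B by blast
  obtain g0 where g0: "g0 \<in> carrier (GL (m + n))"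
    "B = {h \<in> carrier (GL (m + n)). cj (map_mat \<iota> g0) h \<in> tri (m + n)}"
    using rational_borel[OF g(1)] B g(2) by metis
  show "\<exists>\<phi>. bij_betw \<phi> (coset_orbits (GL (m + n)) (rational_subgroup \<iota> (m + n) B)
      (GL_quotient_points \<iota> (m + n) (GL_GL m n))) (matchings (corona_graph (m + n)) m)"
    unfolding g0(2) by (rule bij_betw_common_domain[OF GL_orbits[OF g0(1)] matchings_corona_graph])
next
  fix B :: "'b mat set" assume "borel_subgroup (2 * (m + n)) (Sp (m + n)) B"
  then obtain g where g: "g \<in> carrier (GL (2 * (m + n)))" "g\<^sup>T * symp_form (m + n) * g = anti (m + n)"
    "B = {h \<in> carrier (Sp (m + n)). cj g h \<in> tri (2 * (m + n))}"
    by (rule borel_subgroup_Sp)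
  show "\<exists>\<phi>. bij_betw \<phi> (coset_orbits (Sp (m + n)) B (lcosets\<^bsub>Sp (m + n)\<^esub> (Sp_Sp m n)))
      (matchings (double_corona_graph (m + n)) m)"
    unfolding g(3) by (rule bij_betw_common_domain[OF Sp_orbits[OF g(1,2)] matchings_double_corona_graph])
qed

end
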